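(* Let $f:\mathbb{T}^3\to\mathbb{T}^3$ be an absolutely partially hyperbolic diffeomorphism such that $E^s_f\oplus E^u_f$ is integrable, and let $h:\mathbb{T}^3\to\mathbb{T}^3$ be a homeomorphism with $h\circ f = A\circ h$, where $A:\mathbb{T}^3\to\mathbb{T}^3$ is a linear hyperbolic toral automorphism. Then $A$ is partially hyperbolic with a linear splitting such that $W^*_A = h(W^*_f)$ for $* = c, s, u, cs, cu, us$.
   Context: $f$ is absolutely partially hyperbolic if there is a $Tf$-invariant splitting $T\mathbb{T}^3 = E^s_f\oplus E^c_f\oplus E^u_f$ into one-dimensional bundles and constants $\sigma<1<\mu$ with $\|Tf v^s\|<\sigma<\|Tf v^c\|<\mu<\|Tf v^u\|$ for all unit vectors $v^*\in E^*_f$. Such $f$ on $\mathbb{T}^3$ is dynamically coherent, so there are invariant foliations $W^s_f, W^c_f, W^u_f, W^{cs}_f, W^{cu}_f$ tangent respectively to $E^s_f, E^c_f, E^u_f, E^c_f\oplus E^s_f, E^c_f\oplus E^u_f$; $W^{us}_f$ denotes the foliation tangent to $E^u_f\oplus E^s_f$. For $A$ with its linear partially hyperbolic splitting, $W^*_A$ denote the corresponding linear foliations. *)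

theory Defs
  imports "HOL-Analysis.Analysis"
begin

section \<open>The torus T^3 = R^3 / Z^3\<close>

definition torus_rel :: "real^3 \<Rightarrow> real^3 \<Rightarrow> bool" where
  "torus_rel x y \<longleftrightarrow> (\<forall>i. x$i - y$i \<in> \<int>)"

lemma equivp_torus_rel: "equivp torus_rel"
proof (rule equivpI)
  show "reflp torus_rel" by (auto simp: reflp_def torus_rel_def)
  show "symp torus_rel"
    by (auto simp: symp_def torus_rel_def)
       (metis Ints_minus minus_diff_eq)
  show "transp torus_rel"
    unfolding transp_def torus_rel_def
  proof (intro allI impI)
    fix x y z :: "real^3" and i
    assume "\<forall>i. x$i - y$i \<in> \<int>" "\<forall>i. y$i - z$i \<in> \<int>"
    then have "(x$i - y$i) + (y$i - z$i) \<in> \<int>" by (intro Ints_add) auto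
    then show "x$i - z$i \<in> \<int>" by simp
  qed
qed

quotient_type torus = "real^3" / torus_rel
  by (rule equivp_torus_rel)

text \<open>The covering projection R^3 \<rightarrow> T^3.\<close>
definition tproj :: "real^3 \<Rightarrow> torus" where
  "tproj = abs_torus"

definition ivec :: "real^3 \<Rightarrow> bool" where
  "ivec n \<longleftrightarrow> (\<forall>i. n$i \<in> \<int>)"

text \<open>F : R^3 \<rightarrow> R^3 is a lift of f : T^3 \<rightarrow> T^3.\<close>
definition is_lift :: "(real^3 \<Rightarrow> real^3) \<Rightarrow> (torus \<Rightarrow> torus) \<Rightarrow> bool" where
  "is_lift F f \<longleftrightarrow> (\<forall>x. tproj (F x) = f (tproj x))"

definition tcont :: "(torus \<Rightarrow> torus) \<Rightarrow> bool" where
  "tcont f \<longleftrightarrow> (\<exists>F. continuous_on UNIV F \<and> is_lift F f)"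

definition thomeo :: "(torus \<Rightarrow> torus) \<Rightarrow> bool" where
  "thomeo h \<longleftrightarrow> bij h \<and> tcont h \<and> tcont (inv h)"

text \<open>C^1 diffeomorphism of T^3 (via a C^1 lift with invertible derivative).\<close>
definition tC1_diffeo :: "(torus \<Rightarrow> torus) \<Rightarrow> bool" where
  "tC1_diffeo f \<longleftrightarrow> bij f \<and> tcont (inv f) \<and>
     (\<exists>F F'. is_lift F f \<and> (\<forall>x. (F has_derivative blinfun_apply (F' x)) (at x)) \<and>
        continuous_on UNIV F' \<and> (\<forall>x. bij (blinfun_apply (F' x))))"

text \<open>Tangent map Tf at p, identified (T_p T^3 = R^3) with the derivative of a
  continuous lift at a representative of p (independent of the choices).\<close>
definition tderiv :: "(torus \<Rightarrow> torus) \<Rightarrow> torus \<Rightarrow> real^3 \<Rightarrow> real^3" where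
  "tderiv f p = (SOME L. \<exists>F x. is_lift F f \<and> continuous_on UNIV F \<and> tproj x = p \<and>
                   (F has_derivative L) (at x))"

text \<open>Continuous Riemannian metric on T^3 (Gram matrices).\<close>
definition riem_metric :: "(torus \<Rightarrow> real^3^3) \<Rightarrow> bool" where
  "riem_metric G \<longleftrightarrow> continuous_on UNIV (G \<circ> tproj) \<and>
     (\<forall>p. transpose (G p) = G p \<and> (\<forall>v. v \<noteq> 0 \<longrightarrow> v \<bullet> (G p *v v) > 0))"

definition gnorm :: "(torus \<Rightarrow> real^3^3) \<Rightarrow> torus \<Rightarrow> real^3 \<Rightarrow> real" where
  "gnorm G p v = sqrt (v \<bullet> (G p *v v))"

definition ssum :: "(real^3) set \<Rightarrow> (real^3) set \<Rightarrow> (real^3) set" where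
  "ssum A B = {a + b | a b. a \<in> A \<and> b \<in> B}"

text \<open>Absolute partial hyperbolicity of f with splitting Es + Ec + Eu
  (one-dimensional, Tf-invariant), w.r.t. some Riemannian metric.\<close>
definition abs_PH :: "(torus \<Rightarrow> torus) \<Rightarrow> (torus \<Rightarrow> (real^3) set) \<Rightarrow> (torus \<Rightarrow> (real^3) set)
    \<Rightarrow> (torus \<Rightarrow> (real^3) set) \<Rightarrow> bool" where
  "abs_PH f Es Ec Eu \<longleftrightarrow>
    (\<exists>G \<sigma> \<mu>. riem_metric G \<and> \<sigma> < 1 \<and> 1 < \<mu> \<and>
      (\<forall>p. subspace (Es p) \<and> subspace (Ec p) \<and> subspace (Eu p) \<and>
           dim (Es p) = 1 \<and> dim (Ec p) = 1 \<and> dim (Eu p) = 1 \<and>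
           ssum (ssum (Es p) (Ec p)) (Eu p) = UNIV \<and>
           tderiv f p ` Es p = Es (f p) \<and> tderiv f p ` Ec p = Ec (f p) \<and>
           tderiv f p ` Eu p = Eu (f p)) \<and>
      (\<forall>p vs vc vu. vs \<in> Es p \<longrightarrow> vc \<in> Ec p \<longrightarrow> vu \<in> Eu p \<longrightarrow>
          gnorm G p vs = 1 \<longrightarrow> gnorm G p vc = 1 \<longrightarrow> gnorm G p vu = 1 \<longrightarrow>
          gnorm G (f p) (tderiv f p vs) < \<sigma> \<and>
          \<sigma> < gnorm G (f p) (tderiv f p vc) \<and>
          gnorm G (f p) (tderiv f p vc) < \<mu> \<and>
          \<mu> < gnorm G (f p) (tderiv f p vu)))"

text \<open>Linear hyperbolic toral automorphism induced by an integer matrix M with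
  det M = +-1 and no (complex) eigenvalue of modulus 1.\<close>
definition hyp_toral_aut :: "(torus \<Rightarrow> torus) \<Rightarrow> bool" where
  "hyp_toral_aut A \<longleftrightarrow> (\<exists>M :: real^3^3. (\<forall>i j. M$i$j \<in> \<int>) \<and> \<bar>det M\<bar> = 1 \<and>
     (\<forall>z::complex. cmod z = 1 \<longrightarrow>
        det (mat z - (\<chi> i j. complex_of_real (M$i$j)) :: complex^3^3) \<noteq> 0) \<and>
     (\<forall>x. A (tproj x) = tproj (M *v x)))"

section \<open>Foliations of T^3 with C^1 leaves tangent to a distribution\<close>

text \<open>A foliation of T^3 is given by its lift to R^3: W x is the leaf (in R^3)
  through x; it must be Z^3-periodic. Leaves are k-dimensional, where k = DIM('k),
  transversal dimension DIM('t).\<close>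

text \<open>g : ball 0 1 \<subseteq> 'k \<rightarrow> R^3 is a C^1 immersion tangent to E.\<close>
definition tangent_disc :: "(torus \<Rightarrow> (real^3) set) \<Rightarrow> ('k::euclidean_space \<Rightarrow> real^3) \<Rightarrow> bool" where
  "tangent_disc E g \<longleftrightarrow> (\<exists>g'. (\<forall>u\<in>ball 0 1. (g has_derivative blinfun_apply (g' u)) (at u)) \<and>
      continuous_on (ball 0 1) g' \<and>
      (\<forall>u\<in>ball 0 1. inj (blinfun_apply (g' u)) \<and> range (blinfun_apply (g' u)) = E (tproj (g u))))"

text \<open>Foliated chart: a homeomorphism psi from (unit ball in 'k) x (unit ball in 't)
  onto an open set of R^3, whose plaques psi(_, t) are C^1 discs tangent to E,
  each contained in a single leaf.\<close>
definition fol_chart :: "'k::euclidean_space itself \<Rightarrow> 't::euclidean_space itself \<Rightarrow>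
    (torus \<Rightarrow> (real^3) set) \<Rightarrow> (real^3 \<Rightarrow> (real^3) set) \<Rightarrow> ('k \<times> 't \<Rightarrow> real^3) \<Rightarrow> bool" where
  "fol_chart K T E W \<psi> \<longleftrightarrow>
     (let B = (ball (0::'k) 1 \<times> ball (0::'t) 1) in
       inj_on \<psi> B \<and> continuous_on B \<psi> \<and> open (\<psi> ` B) \<and>
       continuous_on (\<psi> ` B) (inv_into B \<psi>) \<and>
       (\<forall>t\<in>ball (0::'t) 1. tangent_disc E (\<lambda>u::'k. \<psi> (u, t)) \<and>
            \<psi> ` (ball (0::'k) 1 \<times> {t}) \<subseteq> W (\<psi> (0, t))))"

definition plaque_rel :: "'k::euclidean_space itself \<Rightarrow> 't::euclidean_space itself \<Rightarrow>
    (torus \<Rightarrow> (real^3) set) \<Rightarrow> (real^3 \<Rightarrow> (real^3) set) \<Rightarrow> ((real^3) \<times> (real^3)) set" where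
  "plaque_rel K T E W = {(a, b). \<exists>\<psi> t. fol_chart K T E W \<psi> \<and> t \<in> ball (0::'t) 1 \<and>
       a \<in> \<psi> ` (ball (0::'k) 1 \<times> {t}) \<and> b \<in> \<psi> ` (ball (0::'k) 1 \<times> {t})}"

definition tangent_foliation :: "'k::euclidean_space itself \<Rightarrow> 't::euclidean_space itself \<Rightarrow>
    (torus \<Rightarrow> (real^3) set) \<Rightarrow> (real^3 \<Rightarrow> (real^3) set) \<Rightarrow> bool" where
  "tangent_foliation K T E W \<longleftrightarrow>
     (\<forall>x. x \<in> W x) \<and> (\<forall>x y. y \<in> W x \<longrightarrow> W y = W x) \<and>
     (\<forall>x n. ivec n \<longrightarrow> W (x + n) = (\<lambda>y. y + n) ` W x) \<and>
     (\<forall>x. \<exists>\<psi>. fol_chart K T E W \<psi> \<and> x \<in> \<psi> ` (ball (0::'k) 1 \<times> ball (0::'t) 1)) \<and>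
     (\<forall>x y. y \<in> W x \<longleftrightarrow> (x, y) \<in> (plaque_rel K T E W)\<^sup>*)"

abbreviation fol1 :: "(torus \<Rightarrow> (real^3) set) \<Rightarrow> (real^3 \<Rightarrow> (real^3) set) \<Rightarrow> bool" where
  "fol1 E W \<equiv> tangent_foliation TYPE(real) TYPE(real^2) E W"

abbreviation fol2 :: "(torus \<Rightarrow> (real^3) set) \<Rightarrow> (real^3 \<Rightarrow> (real^3) set) \<Rightarrow> bool" where
  "fol2 E W \<equiv> tangent_foliation TYPE(real^2) TYPE(real) E W"

text \<open>The leaf in T^3 through p of the foliation with lift W.\<close>
definition tleaf :: "(real^3 \<Rightarrow> (real^3) set) \<Rightarrow> torus \<Rightarrow> torus set" where
  "tleaf W p = tproj ` W (rep_torus p)"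

definition f_invariant :: "(torus \<Rightarrow> torus) \<Rightarrow> (real^3 \<Rightarrow> (real^3) set) \<Rightarrow> bool" where
  "f_invariant f W \<longleftrightarrow> (\<forall>p. f ` tleaf W p = tleaf W (f p))"

text \<open>Linear foliation of R^3 (hence of T^3) by translates of the subspace E.\<close>
definition linfol :: "(real^3) set \<Rightarrow> real^3 \<Rightarrow> (real^3) set" where
  "linfol E x = {x + v | v. v \<in> E}"

end

theory Submission
  imports Defs "HOL-Complex_Analysis.Great_Picard"
begin

text \<open>
  Lift \<open>h\<close> and \<open>f\<close> to homeomorphisms \<open>H\<close> and \<open>F\<close> of \<open>\<real>\<^sup>3\<close> with \<open>H F = M H\<close>. After making the rates of
  expansion uniform, two nearby points with \<open>F\<close>-orbits that stay close and approach each other at rate \<open>\<sigma>\<^sup>n\<close> differ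
  approximately in the direction \<open>E\<^sup>s\<close>, and likewise for \<open>E\<^sup>u\<close> with \<open>F\<^sup>-\<^sup>1\<close> and \<open>1 / \<mu>\<close>.

  One of \<open>M\<close>, \<open>M\<^sup>-\<^sup>1\<close> has a contracted eigenline \<open>\<real> e\<close> and an expanded complementary plane \<open>P\<close>. Say it is \<open>M\<close>.
  Then \<open>H\<close> sends stable leaves into lines parallel to \<open>e\<close> and unstable leaves into planes parallel to \<open>P\<close>.
  Inside the leaves of the integrable bundle \<open>E\<^sup>u \<oplus> E\<^sup>s\<close> this gives a local product structure, so that
  translation by \<open>e\<close> after \<open>H\<close> maps unstable leaves to unstable leaves. Since \<open>\<int>\<^sup>3 + \<real> e\<close> is dense, the
  images of the unstable leaves are translates of one another; the translations preserving them form a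
  closed group with locally just one direction, hence they are parallel lines, spanned by an eigenvector of \<open>M\<close>
  with eigenvalue of modulus at least \<open>\<mu>\<close>. The growth of orbits along the centre leaves then yields the third
  eigenvalue and all remaining leaves, since a leaf of which the image lies in a subspace of its own dimension is
  mapped onto a translate of that subspace by invariance of domain.
\<close>

text \<open>Two features of the hypotheses shape the proof. The splitting is a pointwise object with
  strict inequalities: neither continuity of the bundles nor uniformity of the rates is given. The
  foliation charts supply a substitute, since difference quotients along plaques make each line
  field a pointwise limit of continuous ones, and Baire category turns this into uniformity on
  minimal sets. Secondly, even a continuous line field need not be uniquely integrable. Strong
  leaves are therefore replaced by the dynamical relation \<open>exp_close\<close>, an equivalence
  relation that a cone condition makes locally one-dimensional. The centre direction has no such
  relation and is caught only by its growth in both time directions, through the eigenfunctionals of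
  \<open>M\<close>. A priori \<open>M\<close> may have a complex pair of eigenvalues, so only one
  real eigenline is available at the start; that the complementary plane splits is a conclusion. As
  this eigenline may be contracted by \<open>M\<close> or by its inverse, the middle part is stated
  for a pair of maps whose roles can be exchanged.\<close>

section \<open>The lattice, the torus and the unit cube\<close>

lemma ivec_0 [simp]: "ivec 0"
  by (simp add: ivec_def)

lemma ivec_add: "ivec m \<Longrightarrow> ivec n \<Longrightarrow> ivec (m + n)"
  by (simp add: ivec_def)

lemma ivec_diff: "ivec m \<Longrightarrow> ivec n \<Longrightarrow> ivec (m - n)"
  by (simp add: ivec_def)

lemma ivec_uminus: "ivec m \<Longrightarrow> ivec (- m)"
  by (simp add: ivec_def)

lemma tproj_eq_iff: "tproj x = tproj y \<longleftrightarrow> ivec (x - y)"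
  by (simp add: tproj_def torus.abs_eq_iff torus_rel_def ivec_def)

lemma tproj_rep_torus [simp]: "tproj (rep_torus p) = p"
  by (metis Quotient3_abs_rep Quotient3_torus tproj_def)

lemma tproj_surj: "\<exists>x. tproj x = p"
  using tproj_rep_torus by blast

lemma tproj_add_ivec [simp]: "ivec n \<Longrightarrow> tproj (x + n) = tproj x"
  by (simp add: tproj_eq_iff)

lemma ivec_dist_ge_1:
  assumes "ivec m" "ivec n" "m \<noteq> n"
  shows "1 \<le> dist m n"
proof -
  obtain i where i: "m$i \<noteq> n$i" using assms(3) by (auto simp: vec_eq_iff)
  have "m$i - n$i \<in> \<int>" using assms by (auto simp: ivec_def)
  then have "1 \<le> \<bar>m$i - n$i\<bar>" using i Ints_nonzero_abs_ge1 by fastforce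
  also have "\<dots> \<le> norm (m - n)" using component_le_norm_cart[of "m - n" i] by simp
  finally show ?thesis by (simp add: dist_norm)
qed

text \<open>Distinct lattice points are at distance at least 1, so \<open>g\<close> is locally
  constant, and its domain is connected. Every statement that two lifts differ by a constant lattice
  vector rests on this.\<close>

lemma continuous_ivec_valued_constant:
  assumes "continuous_on UNIV g" "\<And>x::real^3. ivec (g x)"
  shows "\<exists>m. ivec m \<and> (\<forall>x. g x = m)"
proof -
  have "\<exists>T. openin (top_of_set UNIV) T \<and> a \<in> T \<and> (\<forall>x\<in>T. g a = g x)" for a
  proof (intro exI conjI)
    show "openin (top_of_set UNIV) (g -` ball (g a) 1)"
      using open_vimage[OF open_ball assms(1)] by simp
    show "\<forall>x\<in>g -` ball (g a) 1. g a = g x"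
    proof
      fix y assume "y \<in> g -` ball (g a) 1"
      then show "g a = g y" using ivec_dist_ge_1[OF assms(2)[of a] assms(2)[of y]] by force
    qed
  qed simp
  then have "g x = g 0" for x
    by (intro connected_equivalence_relation[of UNIV x 0 "\<lambda>x y. g x = g y"]) (simp_all add: connected_UNIV)
  then show ?thesis using assms(2) by blast
qed

abbreviation ucube :: "(real^3) set" where "ucube \<equiv> cbox 0 1"

lemma translate_into_ucube: "\<exists>n. ivec n \<and> x + n \<in> ucube"
proof (intro exI conjI)
  show "ivec (\<chi> i. - of_int \<lfloor>x$i\<rfloor>)" by (auto simp: ivec_def)
  show "x + (\<chi> i. - of_int \<lfloor>x$i\<rfloor>) \<in> ucube"
    by (auto simp: mem_box_cart) linarith+
qed

section \<open>Periodic and integer-equivariant maps\<close>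

definition periodic :: "(real^3 \<Rightarrow> 'a) \<Rightarrow> bool" where
  "periodic g \<longleftrightarrow> (\<forall>x n. ivec n \<longrightarrow> g (x + n) = g x)"

lemma periodicD: "periodic g \<Longrightarrow> ivec n \<Longrightarrow> g (x + n) = g x"
  by (auto simp: periodic_def)

definition int_equivariant :: "(real^3 \<Rightarrow> real^3) \<Rightarrow> bool" where
  "int_equivariant g \<longleftrightarrow> (\<forall>n. ivec n \<longrightarrow> (\<exists>m. ivec m \<and> (\<forall>x. g (x + n) = g x + m)))"

lemma int_equivariantD:
  "int_equivariant g \<Longrightarrow> ivec n \<Longrightarrow> \<exists>m. ivec m \<and> (\<forall>x. g (x + n) = g x + m)"
  by (auto simp: int_equivariant_def)

lemma int_equivariant_funpow: "int_equivariant g \<Longrightarrow> int_equivariant (g ^^ k)"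
proof (induction k)
  case 0
  then show ?case by (auto simp: int_equivariant_def)
next
  case (Suc k)
  show ?case unfolding int_equivariant_def
  proof (intro allI impI)
    fix n :: "real^3" assume "ivec n"
    then obtain m where m: "ivec m" "\<forall>x. (g ^^ k) (x + n) = (g ^^ k) x + m"
      using Suc int_equivariantD by blast
    obtain m' where "ivec m'" "\<forall>x. g (x + m) = g x + m'"
      using int_equivariantD[OF Suc.prems m(1)] by blast
    then show "\<exists>m. ivec m \<and> (\<forall>x. (g ^^ Suc k) (x + n) = (g ^^ Suc k) x + m)"
      using m by auto
  qed
qed

lemma uniformly_continuous_int_equivariant:
  assumes "continuous_on UNIV g" "int_equivariant g" "0 < e"
  shows "\<exists>d>0. \<forall>x y. norm (x - y) < d \<longrightarrow> norm (g x - g y) < e"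
proof -
  \<comment> \<open>The box is the unit cube with a margin of width 1: after one common lattice
    translation it contains both points as soon as they are less than 1 apart. Hence
    \<open>min d 1\<close> below.\<close>
  have "compact (cbox (- 1) (2::real^3))" by (rule compact_cbox)
  then have "uniformly_continuous_on (cbox (-1) (2::real^3)) g"
    using assms(1) compact_uniformly_continuous continuous_on_subset by blast
  then obtain d where d: "d > 0"
    "\<And>x y. x \<in> cbox (-1) 2 \<Longrightarrow> y \<in> cbox (-1) 2 \<Longrightarrow> dist y x < d \<Longrightarrow> dist (g y) (g x) < e"
    using \<open>0 < e\<close> unfolding uniformly_continuous_on_def by metis
  have "norm (g x - g y) < e" if "norm (x - y) < min d 1" for x y
  proof -
    obtain n where n: "ivec n" "x + n \<in> ucube" using translate_into_ucube by blast
    have "(y + n) \<in> cbox (-1) 2"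
    proof (simp add: mem_box_cart, intro allI conjI)
      fix i
      have "\<bar>(x - y)$i\<bar> < 1" using that component_le_norm_cart[of "x - y" i] by linarith
      then show "- 1 \<le> y$i + n$i" "y$i + n$i \<le> 2"
        using n(2) by (auto simp: mem_box_cart abs_less_iff) (smt (verit))+
    qed
    moreover have "x + n \<in> cbox (-1) 2"
      using n(2) by (auto simp: mem_box_cart) (smt (verit))+
    ultimately have "dist (g (x + n)) (g (y + n)) < e"
      using d(2)[of "y + n" "x + n"] that by (simp add: dist_norm)
    moreover obtain m where "\<forall>x. g (x + n) = g x + m" using int_equivariantD[OF assms(2) n(1)] by blast
    ultimately show ?thesis by (simp add: dist_norm)
  qed
  then show ?thesis using d(1) by (intro exI[of _ "min d 1"]) auto
qed

section \<open>Periodic fields of linear maps\<close>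

text \<open>Bundle maps of the tangent bundle of the torus, seen on the universal cover. Continuity
  is joint in base point and vector, so that derivatives and projections to subbundles are treated
  alike.\<close>

definition lfield :: "(real^3 \<Rightarrow> real^3 \<Rightarrow> real^3) \<Rightarrow> bool" where
  "lfield A \<longleftrightarrow> (\<forall>x. linear (A x)) \<and> continuous_on UNIV (\<lambda>z. A (fst z) (snd z)) \<and> periodic A"

lemma lfield_linear: "lfield A \<Longrightarrow> linear (A x)"
  by (simp add: lfield_def)

lemma lfield_periodic: "lfield A \<Longrightarrow> ivec n \<Longrightarrow> A (x + n) = A x"
  by (simp add: lfield_def periodicD)

lemma lfield_continuous:
  assumes "lfield A" "continuous_on S f" "continuous_on S g"
  shows "continuous_on S (\<lambda>z. A (f z) (g z))"
proof -
  have c: "continuous_on UNIV (\<lambda>z. A (fst z) (snd z))" using assms(1) by (simp add: lfield_def)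
  have "continuous_on S ((\<lambda>z. A (fst z) (snd z)) \<circ> (\<lambda>z. (f z, g z)))"
    by (intro continuous_on_compose continuous_intros assms continuous_on_subset[OF c]) auto
  then show ?thesis by (simp add: o_def)
qed

lemma lfield_uniform:
  assumes A: "lfield A" and "0 < e"
  shows "\<exists>d>0. \<forall>x y v. norm (x - y) < d \<longrightarrow> norm (A x v - A y v) \<le> e * norm v"
proof -
  let ?S = "cbox (-1) (2::real^3) \<times> sphere (0::real^3) 1"
  have "continuous_on ?S (\<lambda>z. A (fst z) (snd z))"
    using A continuous_on_subset unfolding lfield_def by blast
  moreover have "compact ?S" by (intro compact_Times compact_cbox compact_sphere)
  ultimately have "uniformly_continuous_on ?S (\<lambda>z. A (fst z) (snd z))"
    using compact_uniformly_continuous by blast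
  then obtain d where d: "d > 0"
    "\<And>x y. x \<in> ?S \<Longrightarrow> y \<in> ?S \<Longrightarrow> dist y x < d \<Longrightarrow> dist (A (fst y) (snd y)) (A (fst x) (snd x)) < e"
    using \<open>0 < e\<close> unfolding uniformly_continuous_on_def by metis
  have "norm (A x v - A y v) \<le> e * norm v" if "norm (x - y) < min d 1" for x y v
  proof (cases "v = 0")
    case True
    then show ?thesis using lfield_linear[OF A] by (simp add: linear_0)
  next
    case False
    obtain n where n: "ivec n" "x + n \<in> ucube" using translate_into_ucube by blast
    have yn: "(y + n) \<in> cbox (-1) 2"
    proof (simp add: mem_box_cart, intro allI conjI)
      fix i
      have "\<bar>(x - y)$i\<bar> < 1" using that component_le_norm_cart[of "x - y" i] by linarith
      then show "- 1 \<le> y$i + n$i" "y$i + n$i \<le> 2"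
        using n(2) by (auto simp: mem_box_cart abs_less_iff) (smt (verit))+
    qed
    have xn: "x + n \<in> cbox (-1) 2"
      using n(2) by (auto simp: mem_box_cart) (smt (verit))+
    define u where "u = v /\<^sub>R norm v"
    have u: "norm u = 1" "norm v *\<^sub>R u = v" using False by (auto simp: u_def)
    have Av: "A z v = norm v *\<^sub>R A z u" for z
      using linear_cmul[OF lfield_linear[OF A], of z "norm v" u] unfolding u(2) .
    have "dist (A (x + n) u) (A (y + n) u) < e"
      using d(2)[of "(y + n, u)" "(x + n, u)"] xn yn that u by (simp add: dist_Pair_Pair dist_norm)
    then have "norm (A x u - A y u) < e"
      using lfield_periodic[OF A n(1)] by (simp add: dist_norm)
    moreover have "A x v - A y v = norm v *\<^sub>R (A x u - A y u)"
      by (simp add: Av scaleR_right_diff_distrib)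
    ultimately show ?thesis
      by (simp add: mult.commute[of e] mult_left_mono)
  qed
  then show ?thesis using d(1) by (intro exI[of _ "min d 1"]) auto
qed

lemma lfield_bounded:
  assumes A: "lfield A"
  shows "\<exists>C>0. \<forall>x v. norm (A x v) \<le> C * norm v"
proof -
  let ?S = "ucube \<times> sphere (0::real^3) 1"
  have "continuous_on ?S (\<lambda>z. A (fst z) (snd z))"
    using A continuous_on_subset unfolding lfield_def by blast
  moreover have "compact ?S" by (intro compact_Times compact_cbox compact_sphere)
  ultimately have "bounded ((\<lambda>z. A (fst z) (snd z)) ` ?S)"
    using compact_continuous_image compact_imp_bounded by blast
  then obtain C where C: "C > 0" "\<And>z. z \<in> ?S \<Longrightarrow> norm (A (fst z) (snd z)) \<le> C"
    by (auto simp: bounded_pos)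
  have "norm (A x v) \<le> C * norm v" for x v
  proof (cases "v = 0")
    case True
    then show ?thesis using lfield_linear[OF A] by (simp add: linear_0)
  next
    case False
    obtain n where n: "ivec n" "x + n \<in> ucube" using translate_into_ucube by blast
    define u where "u = v /\<^sub>R norm v"
    have u: "norm u = 1" "norm v *\<^sub>R u = v" using False by (auto simp: u_def)
    have Av: "A z v = norm v *\<^sub>R A z u" for z
      using linear_cmul[OF lfield_linear[OF A], of z "norm v" u] unfolding u(2) .
    have "norm (A (x + n) u) \<le> C" using C(2)[of "(x + n, u)"] n u by simp
    moreover have "A (x + n) v = norm v *\<^sub>R A (x + n) u"
      by (rule Av)
    ultimately show ?thesis
      using lfield_periodic[OF A n(1)] by (simp add: mult.commute[of C] mult_left_mono)
  qed
  then show ?thesis using C(1) by blast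
qed

section \<open>Exponential approach of orbits\<close>

text \<open>This replaces membership in a common strong leaf. The constant may depend on the pair,
  which makes the relation transitive; constants valid for all nearby pairs are recovered later from
  \<open>exp_cone\<close>.\<close>

definition exp_close :: "('a::real_normed_vector \<Rightarrow> 'a) \<Rightarrow> real \<Rightarrow> 'a \<Rightarrow> 'a \<Rightarrow> bool" where
  "exp_close G r x y \<longleftrightarrow> (\<exists>C. \<forall>n. norm ((G ^^ n) x - (G ^^ n) y) \<le> C * r ^ n)"

lemma exp_close_refl: "exp_close G r x x"
  unfolding exp_close_def by (rule exI[of _ 0]) auto

lemma exp_close_sym: "exp_close G r x y \<Longrightarrow> exp_close G r y x"
  unfolding exp_close_def by (simp add: norm_minus_commute)

lemma exp_close_trans:
  assumes "exp_close G r x y" "exp_close G r y z"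
  shows "exp_close G r x z"
proof -
  obtain C D where C: "\<And>n. norm ((G ^^ n) x - (G ^^ n) y) \<le> C * r ^ n"
    and D: "\<And>n. norm ((G ^^ n) y - (G ^^ n) z) \<le> D * r ^ n"
    using assms unfolding exp_close_def by metis
  have "norm ((G ^^ n) x - (G ^^ n) z) \<le> (C + D) * r ^ n" for n
    using norm_triangle_ineq[of "(G ^^ n) x - (G ^^ n) y" "(G ^^ n) y - (G ^^ n) z"] C[of n] D[of n]
    by (simp add: algebra_simps)
  then show ?thesis unfolding exp_close_def by blast
qed

lemma exp_close_translate:
  assumes "int_equivariant G" "ivec n"
  shows "exp_close G r (x + n) (y + n) \<longleftrightarrow> exp_close G r x y"
proof -
  have "(G ^^ k) (x + n) - (G ^^ k) (y + n) = (G ^^ k) x - (G ^^ k) y" for k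
  proof -
    obtain m where "\<forall>x. (G ^^ k) (x + n) = (G ^^ k) x + m"
      using int_equivariantD[OF int_equivariant_funpow[OF assms(1)] assms(2)] by blast
    then show ?thesis by simp
  qed
  then show ?thesis by (simp add: exp_close_def)
qed

lemma exp_close_map:
  assumes "exp_close G r x y"
  shows "exp_close G r (G x) (G y)"
proof -
  obtain C where C: "\<And>n. norm ((G ^^ n) x - (G ^^ n) y) \<le> C * r ^ n"
    using assms unfolding exp_close_def by metis
  have "norm ((G ^^ n) (G x) - (G ^^ n) (G y)) \<le> (C * r) * r ^ n" for n
    using C[of "Suc n"] by (simp add: funpow_swap1 mult.assoc)
  then show ?thesis unfolding exp_close_def by blast
qed

lemma exp_close_unmap:
  assumes "exp_close G r (G x) (G y)" "0 < r"
  shows "exp_close G r x y"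
proof -
  obtain C where C: "\<And>n. norm ((G ^^ n) (G x) - (G ^^ n) (G y)) \<le> C * r ^ n"
    using assms unfolding exp_close_def by metis
  \<comment> \<open>Dividing by \<open>r\<close> shifts the index by one; the summand
    \<open>norm (x - y)\<close> serves \<open>n = 0\<close>.\<close>
  have "norm ((G ^^ n) x - (G ^^ n) y) \<le> (\<bar>C\<bar> / r + norm (x - y)) * r ^ n" for n
  proof (cases n)
    case 0
    then show ?thesis using assms(2) by simp
  next
    case (Suc m)
    have "norm ((G ^^ n) x - (G ^^ n) y) \<le> C * r ^ m"
      using C[of m] by (simp add: Suc funpow_swap1)
    also have "\<dots> \<le> \<bar>C\<bar> * r ^ m" using assms(2) by (intro mult_right_mono) auto
    also have "\<dots> = \<bar>C\<bar> / r * r ^ n" using assms(2) by (simp add: Suc)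
    also have "\<dots> \<le> (\<bar>C\<bar> / r + norm (x - y)) * r ^ n"
      using assms(2) by (intro mult_right_mono) auto
    finally show ?thesis .
  qed
  then show ?thesis unfolding exp_close_def by blast
qed

section \<open>Lifts of torus maps\<close>

lemma lift_int_equivariant:
  assumes "continuous_on UNIV F" "is_lift F f"
  shows "int_equivariant F"
  unfolding int_equivariant_def
proof (intro allI impI)
  fix n :: "real^3" assume n: "ivec n"
  have "continuous_on UNIV (\<lambda>x. F (x + n) - F x)"
    by (intro continuous_intros continuous_on_compose2[OF assms(1)]) auto
  moreover have "ivec (F (x + n) - F x)" for x
    using assms(2) n by (metis is_lift_def tproj_add_ivec tproj_eq_iff)
  ultimately obtain m where "ivec m" "\<forall>x. F (x + n) - F x = m"
    using continuous_ivec_valued_constant[of "\<lambda>x. F (x + n) - F x"] by blast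
  then show "\<exists>m. ivec m \<and> (\<forall>x. F (x + n) = F x + m)"
    by (intro exI[of _ m]) (auto simp: algebra_simps)
qed

lemma lifts_differ_by_ivec:
  assumes "continuous_on UNIV F" "is_lift F f" "continuous_on UNIV F1" "is_lift F1 f"
  shows "\<exists>m. ivec m \<and> (\<forall>x. F1 x = F x + m)"
proof -
  have "continuous_on UNIV (\<lambda>x. F1 x - F x)" by (intro continuous_intros assms)
  moreover have "ivec (F1 x - F x)" for x
    using assms by (metis is_lift_def tproj_eq_iff)
  ultimately obtain m where "ivec m" "\<forall>x. F1 x - F x = m"
    using continuous_ivec_valued_constant[of "\<lambda>x. F1 x - F x"] by blast
  then show ?thesis by (intro exI[of _ m]) (auto simp: algebra_simps)
qed

lemma has_derivative_lift_shift:
  fixes F :: "real^3 \<Rightarrow> real^3"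
  assumes "int_equivariant F" "(F has_derivative L) (at x)" "ivec n"
  shows "(F has_derivative L) (at (x + n))"
proof -
  obtain m where m: "\<And>x. F (x + n) = F x + m" using int_equivariantD[OF assms(1,3)] by blast
  have d: "(F has_derivative L) (at ((\<lambda>y. y - n) (x + n)))" using assms(2) by simp
  have "((\<lambda>y. F (y - n)) has_derivative L) (at (x + n))"
    by (rule has_derivative_compose[of "\<lambda>y. y - n" "\<lambda>v. v" "x + n" UNIV F L, OF _ d])
      (auto intro!: derivative_eq_intros)
  then have "((\<lambda>y. F (y - n) + m) has_derivative L) (at (x + n))"
    by (auto intro!: derivative_eq_intros)
  moreover have "F (y - n) + m = F y" for y using m[of "y - n"] by simp
  ultimately show ?thesis by simp
qed

text \<open>\<open>tderiv\<close> chooses among all lifts and representatives. Two lifts differ by a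
  constant and two representatives by a lattice vector; neither affects the derivative, so the
  choice is forced.\<close>

lemma tderiv_eq:
  assumes "continuous_on UNIV F" "is_lift F f" "(F has_derivative L) (at x)"
  shows "tderiv f (tproj x) = L"
  unfolding tderiv_def
proof (rule some_equality)
  show "\<exists>F y. is_lift F f \<and> continuous_on UNIV F \<and> tproj y = tproj x \<and> (F has_derivative L) (at y)"
    using assms by blast
next
  fix L' assume "\<exists>F y. is_lift F f \<and> continuous_on UNIV F \<and> tproj y = tproj x \<and> (F has_derivative L') (at y)"
  then obtain F1 y where F1: "is_lift F1 f" "continuous_on UNIV F1" "tproj y = tproj x"
    "(F1 has_derivative L') (at y)" by blast
  obtain m where m: "\<And>x. F1 x = F x + m" using lifts_differ_by_ivec assms F1 by metis
  have "ivec (x - y)" using F1(3) by (metis tproj_eq_iff)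
  then have "(F1 has_derivative L') (at (y + (x - y)))"
    using has_derivative_lift_shift lift_int_equivariant F1 by blast
  then have "(F1 has_derivative L') (at x)" by simp
  moreover have "(F1 has_derivative L) (at x)"
  proof -
    have "((\<lambda>x. F x + m) has_derivative L) (at x)"
      using assms(3) by (auto intro!: derivative_eq_intros)
    moreover have "F1 = (\<lambda>x. F x + m)" using m by auto
    ultimately show ?thesis by simp
  qed
  ultimately show "L' = L" using has_derivative_unique by blast
qed

text \<open>Independently chosen lifts of \<open>h\<close> and of its inverse compose to a
  translation by a lattice vector. Removing it makes \<open>K\<close> a left inverse of
  \<open>H\<close>; the other composite is then a translation too, and its value at
  \<open>H 0\<close> shows that it is trivial.\<close>

lemma thomeo_lift:
  assumes "thomeo h"
  obtains H K where "continuous_on UNIV H" "is_lift H h" "continuous_on UNIV K" "is_lift K (inv h)"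
    "\<And>x. K (H x) = x" "\<And>x. H (K x) = x"
proof -
  obtain H where H: "continuous_on UNIV H" "is_lift H h"
    using assms unfolding thomeo_def tcont_def by blast
  obtain K0 where K0: "continuous_on UNIV K0" "is_lift K0 (inv h)"
    using assms unfolding thomeo_def tcont_def by blast
  have bij: "bij h" using assms by (simp add: thomeo_def)
  then have inj: "inv h (h p) = p" and sur: "h (inv h p) = p" for p
    by (simp_all add: bij_is_inj bij_is_surj surj_f_inv_f)
  have "continuous_on UNIV (\<lambda>x. K0 (H x) - x)"
    by (intro continuous_intros continuous_on_compose2[OF K0(1)] H) auto
  moreover have "ivec (K0 (H x) - x)" for x
    using K0(2) H(2) inj by (metis is_lift_def tproj_eq_iff)
  ultimately obtain m where m: "ivec m" "\<forall>x. K0 (H x) - x = m"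
    using continuous_ivec_valued_constant[of "\<lambda>x. K0 (H x) - x"] by blast
  define K where "K x = K0 x - m" for x
  have K: "continuous_on UNIV K" unfolding K_def by (intro continuous_intros K0)
  have KH: "K (H x) = x" for x using m(2) by (simp add: K_def algebra_simps)
  have Kl: "is_lift K (inv h)"
    using K0(2) m(1) tproj_add_ivec[OF ivec_uminus[OF m(1)]] by (simp add: is_lift_def K_def)
  have "continuous_on UNIV (\<lambda>x. H (K x) - x)"
    by (intro continuous_intros continuous_on_compose2[OF H(1)] K) auto
  moreover have "ivec (H (K x) - x)" for x
    using Kl H(2) sur by (metis is_lift_def tproj_eq_iff)
  ultimately obtain m' where m': "ivec m'" "\<forall>x. H (K x) - x = m'"
    using continuous_ivec_valued_constant[of "\<lambda>x. H (K x) - x"] by blast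
  have "m' = 0" using m'(2)[rule_format, of "H 0"] KH by simp
  then have "H (K x) = x" for x using m'(2) by simp
  then show thesis using that H K Kl KH by blast
qed

section \<open>Cone estimates for converging orbits\<close>

text \<open>Uniform continuity of the derivative gives one \<open>d\<close> for all base points; the
  mean value inequality is applied on the segment from \<open>x\<close> to \<open>y\<close>.\<close>

lemma uniformly_differentiable:
  fixes G :: "real^3 \<Rightarrow> real^3"
  assumes A: "lfield A" and der: "\<And>x. (G has_derivative A x) (at x)" and "0 < e"
  shows "\<exists>d>0. \<forall>x y. norm (y - x) < d \<longrightarrow> norm (G y - G x - A x (y - x)) \<le> e * norm (y - x)"
proof -
  obtain d where d: "d > 0" "\<And>x y v. norm (x - y) < d \<Longrightarrow> norm (A x v - A y v) \<le> e * norm v"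
    using lfield_uniform[OF A \<open>0 < e\<close>] by blast
  have "norm (G y - G x - A x (y - x)) \<le> e * norm (y - x)" if xy: "norm (y - x) < d" for x y
  proof -
    have "norm (G y - G x - A x (y - x)) \<le> norm (y - x) * e"
    proof (rule differentiable_bound_linearization[where S = "closed_segment x y" and f' = A])
      show "x + t *\<^sub>R (y - x) \<in> closed_segment x y" if "t \<in> {0..1::real}" for t
        using that by (auto simp: closed_segment_def algebra_simps intro!: exI[of _ t])
      show "(G has_derivative A z) (at z within closed_segment x y)" for z
        by (rule has_derivative_at_withinI[OF der])
      show "onorm (A z - A x) \<le> e" if z: "z \<in> closed_segment x y" for z
      proof (rule onorm_le)
        fix v
        have "norm (z - x) < d"
          using segment_bound(1)[OF z] xy by simp
        then show "norm ((A z - A x) v) \<le> e * norm v" using d(2) by simp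
      qed
    qed simp
    then show ?thesis by (simp add: mult.commute)
  qed
  then show ?thesis using d(1) by blast
qed

text \<open>Once \<open>b n > \<eta> a n\<close> holds, it persists and \<open>b\<close> grows by the factor \<open>r' > r\<close> at each step, against \<open>b n \<le> C r\<^sup>n\<close>.\<close>

lemma cone_recurrence:
  fixes a b :: "nat \<Rightarrow> real"
  assumes pos: "\<And>n. 0 \<le> a n" "\<And>n. 0 \<le> b n" and e: "0 \<le> e" "0 < \<eta>" "0 < r" "r < r'"
    and A: "\<alpha> + e * (1 + \<eta>) \<le> r" and B: "r' \<le> \<beta> - e * (1 + 1 / \<eta>)" and "0 \<le> \<alpha>"
    and stepa: "\<And>n. a (Suc n) \<le> \<alpha> * a n + e * (a n + b n)"
    and stepb: "\<And>n. \<beta> * b n - e * (a n + b n) \<le> b (Suc n)"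
    and bound: "\<And>n. b n \<le> C * r ^ n"
  shows "b n \<le> \<eta> * a n" "a n \<le> r ^ n * a 0"
proof -
  have main: "b n \<le> \<eta> * a n" for n
  proof (rule ccontr)
    assume neg: "\<not> b n \<le> \<eta> * a n"
    have persist: "\<eta> * a (n + k) < b (n + k) \<and> r' ^ k * b n \<le> b (n + k)" for k
    proof (induction k)
      case 0
      then show ?case using neg by simp
    next
      case (Suc k)
      let ?m = "n + k"
      have am: "a ?m \<le> b ?m / \<eta>" using Suc e(2) by (simp add: field_simps)
      have bp: "0 < b ?m" using Suc pos(1)[of ?m] e(2)
        by (smt (verit, best) mult_nonneg_nonneg)
      have "\<beta> * b ?m - e * (b ?m / \<eta> + b ?m) \<le> \<beta> * b ?m - e * (a ?m + b ?m)"
        using am e(1) by (simp add: mult_left_mono)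
      then have "(\<beta> - e * (1 + 1 / \<eta>)) * b ?m \<le> b (Suc ?m)"
        using stepb[of ?m] by (simp add: algebra_simps)
      then have b1: "r' * b ?m \<le> b (Suc ?m)"
        using mult_right_mono[OF B pos(2)[of ?m]] by linarith
      have "\<eta> * a (Suc ?m) \<le> \<eta> * ((\<alpha> + e) * a ?m + e * b ?m)"
        using stepa[of ?m] e(2) by (intro mult_left_mono) (auto simp: algebra_simps)
      also have "\<dots> \<le> \<eta> * ((\<alpha> + e) * (b ?m / \<eta>) + e * b ?m)"
        using am e \<open>0 \<le> \<alpha>\<close> by (intro mult_left_mono add_mono) auto
      also have "\<dots> = (\<alpha> + e * (1 + \<eta>)) * b ?m" using e(2) by (simp add: field_simps)
      also have "\<dots> \<le> r * b ?m" using A bp by (intro mult_right_mono) auto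
      also have "\<dots> < r' * b ?m" using e(4) bp by simp
      finally have c: "\<eta> * a (Suc ?m) < b (Suc ?m)" using b1 by linarith
      have "r' ^ Suc k * b n = r' * (r' ^ k * b n)" by simp
      also have "\<dots> \<le> r' * b ?m" using Suc e by (intro mult_left_mono) auto
      also have "\<dots> \<le> b (Suc ?m)" by (rule b1)
      finally show ?case using c by simp
    qed
    have bn: "0 < b n" using neg pos(1)[of n] e(2) by (smt (verit, best) mult_nonneg_nonneg)
    have "(r' / r) ^ k \<le> C * r ^ n / b n" for k
    proof -
      have "r' ^ k * b n \<le> C * r ^ (n + k)" using persist[of k] bound[of "n + k"] by linarith
      then show ?thesis using bn e(3) by (simp add: power_divide power_add field_simps)
    qed
    moreover have "1 < r' / r" using e by simp
    then obtain k where "C * r ^ n / b n < (r' / r) ^ k" using real_arch_pow by blast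
    ultimately show False by (meson not_le)
  qed
  show "b n \<le> \<eta> * a n" by (rule main)
  show "a n \<le> r ^ n * a 0"
  proof (induction n)
    case (Suc n)
    have "a (Suc n) \<le> \<alpha> * a n + e * (a n + \<eta> * a n)"
      using stepa[of n] mult_left_mono[OF main[of n] e(1)] by (simp add: algebra_simps)
    also have "\<dots> = (\<alpha> + e * (1 + \<eta>)) * a n" by (simp add: algebra_simps)
    also have "\<dots> \<le> r * a n" using A pos(1) by (intro mult_right_mono) auto
    also have "\<dots> \<le> r * (r ^ n * a 0)" using Suc e by (intro mult_left_mono) auto
    finally show ?case by simp
  qed simp
qed

text \<open>For nearby orbits, convergence at rate \<open>r\<close> is automatically uniform, and forces the difference
  into an arbitrarily thin cone around the range of \<open>p\<close>.\<close>

definition exp_cone :: "(real^3 \<Rightarrow> real^3) \<Rightarrow> real \<Rightarrow> (real^3 \<Rightarrow> real^3 \<Rightarrow> real^3) \<Rightarrow> bool" where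
  "exp_cone G r p \<longleftrightarrow> (\<forall>\<eta>>0. \<exists>\<epsilon>>0. \<exists>K. \<forall>x y. exp_close G r x y \<longrightarrow>
     (\<forall>n. norm ((G ^^ n) x - (G ^^ n) y) \<le> \<epsilon>) \<longrightarrow>
     (\<forall>n. norm ((G ^^ n) x - (G ^^ n) y) \<le> K * r ^ n) \<and>
     norm ((y - x) - p x (y - x)) \<le> \<eta> * norm (y - x))"

text \<open>Along two nearby orbits, \<open>\<nu>\<close> and \<open>\<omega>\<close> of the
  difference obey the linear rates up to an error proportional to the difference itself. As
  \<open>r\<close> lies strictly between \<open>\<alpha>\<close> and \<open>\<beta>\<close>, there
  is room for this error and \<open>cone_recurrence\<close> applies.\<close>

lemma exp_coneI:
  fixes G :: "real^3 \<Rightarrow> real^3" and \<nu> \<omega> :: "real^3 \<Rightarrow> real^3 \<Rightarrow> real"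
  assumes A: "lfield A" and der: "\<And>x. (G has_derivative A x) (at x)"
    and rates: "0 \<le> \<alpha>" "\<alpha> < r" "r < \<beta>"
    and pos: "\<And>x v. 0 \<le> \<nu> x v" "\<And>x v. 0 \<le> \<omega> x v"
    and tri: "\<And>x v w. \<nu> x (v + w) \<le> \<nu> x v + \<nu> x w" "\<And>x v w. \<omega> x (v + w) \<le> \<omega> x v + \<omega> x w"
    and C: "0 < C" "\<And>x v. \<nu> x v \<le> C * norm v" "\<And>x v. \<omega> x v \<le> C * norm v"
      "\<And>x v. norm v \<le> C * (\<nu> x v + \<omega> x v)" "\<And>x v. norm (v - p x v) \<le> C * \<omega> x v"
    and step\<nu>: "\<And>x v. \<nu> (G x) (A x v) \<le> \<alpha> * \<nu> x v"
    and step\<omega>: "\<And>x v. \<beta> * \<omega> x v \<le> \<omega> (G x) (A x v)"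
  shows "exp_cone G r p"
  unfolding exp_cone_def
proof (intro allI impI)
  fix \<eta> :: real assume "0 < \<eta>"
  \<comment> \<open>The square pays for two changes of norm: from \<open>norm\<close> to
    \<open>\<nu>\<close>, and from \<open>\<omega>\<close> back to \<open>norm\<close>.\<close>
  define h where "h = \<eta> / C\<^sup>2"
  have h: "0 < h" using \<open>0 < \<eta>\<close> C(1) by (simp add: h_def)
  define r' where "r' = (r + \<beta>) / 2"
  have r': "r < r'" "r' < \<beta>" "0 < r" using rates by (auto simp: r'_def)
  \<comment> \<open>The two entries are the largest errors that the contracting and the expanding
    hypothesis of \<open>cone_recurrence\<close> permit, with \<open>r'\<close> halfway between
    \<open>r\<close> and \<open>\<beta>\<close>.\<close>
  define e where "e = min ((r - \<alpha>) / (1 + h)) ((\<beta> - r') / (1 + 1 / h))"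
  have e0: "0 < e" using rates r' h by (simp add: e_def field_simps add_pos_pos)
  have e1: "\<alpha> + e * (1 + h) \<le> r"
  proof -
    have "e * (1 + h) \<le> (r - \<alpha>) / (1 + h) * (1 + h)"
      using h by (intro mult_right_mono) (auto simp: e_def)
    then show ?thesis using h by simp
  qed
  have e2: "r' \<le> \<beta> - e * (1 + 1 / h)"
  proof -
    have p: "0 < 1 + 1 / h" using h by (simp add: add_pos_pos)
    have "e * (1 + 1 / h) \<le> (\<beta> - r') / (1 + 1 / h) * (1 + 1 / h)"
      using p by (intro mult_right_mono) (auto simp: e_def)
    then show ?thesis using p by simp
  qed
  obtain d where d: "d > 0"
    "\<And>x y. norm (y - x) < d \<Longrightarrow> norm (G y - G x - A x (y - x)) \<le> e / C\<^sup>2 * norm (y - x)"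
    using uniformly_differentiable[OF A der, of "e / C\<^sup>2"] e0 C(1) by auto
  show "\<exists>\<epsilon>>0. \<exists>K. \<forall>x y. exp_close G r x y \<longrightarrow>
     (\<forall>n. norm ((G ^^ n) x - (G ^^ n) y) \<le> \<epsilon>) \<longrightarrow>
     (\<forall>n. norm ((G ^^ n) x - (G ^^ n) y) \<le> K * r ^ n) \<and>
     norm ((y - x) - p x (y - x)) \<le> \<eta> * norm (y - x)"
  \<comment> \<open>Half of \<open>d\<close> keeps the distances strictly below \<open>d\<close>.
    The constant collects \<open>norm (V n) \<le> C * (1 + h) * a n\<close> and
    \<open>a 0 \<le> C * d\<close>.\<close>
  proof (rule exI[of _ "d / 2"], intro conjI, use d in simp, rule exI[of _ "C * (1 + h) * (C * d)"],
      intro allI impI conjI)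
    fix x y assume as: "exp_close G r x y" and close: "\<forall>n. norm ((G ^^ n) x - (G ^^ n) y) \<le> d / 2"
    define X where "X n = (G ^^ n) x" for n
    define V where "V n = (G ^^ n) y - (G ^^ n) x" for n
    define a where "a n = \<nu> (X n) (V n)" for n
    define b where "b n = \<omega> (X n) (V n)" for n
    have Vd: "norm (V n) < d" for n
      using close[rule_format, of n] d(1) by (simp add: V_def norm_minus_commute)
    define E where "E n = V (Suc n) - A (X n) (V n)" for n
    have E: "C * norm (E n) \<le> e * (a n + b n)" for n
    proof -
      have "norm (E n) \<le> e / C\<^sup>2 * norm (V n)"
        using d(2)[of "(G ^^ n) y" "(G ^^ n) x"] Vd[of n] by (simp add: E_def V_def X_def)
      also have "\<dots> \<le> e / C\<^sup>2 * (C * (a n + b n))"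
        using C(4)[of "V n" "X n"] e0 by (intro mult_left_mono) (auto simp: a_def b_def)
      finally have "C * norm (E n) \<le> C * (e / C\<^sup>2 * (C * (a n + b n)))"
        using C(1) by (intro mult_left_mono) auto
      also have "\<dots> = e * (a n + b n)" using C(1) by (simp add: power2_eq_square)
      finally show ?thesis .
    qed
    have XS: "X (Suc n) = G (X n)" for n by (simp add: X_def)
    have VS: "V (Suc n) = A (X n) (V n) + E n" for n by (simp add: E_def)
    have sa: "a (Suc n) \<le> \<alpha> * a n + e * (a n + b n)" for n
    proof -
      have "a (Suc n) \<le> \<nu> (G (X n)) (A (X n) (V n)) + \<nu> (G (X n)) (E n)"
        unfolding a_def XS VS by (rule tri)
      also have "\<dots> \<le> \<alpha> * a n + C * norm (E n)"
        unfolding a_def by (intro add_mono step\<nu> C)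
      finally show ?thesis using E[of n] by linarith
    qed
    have sb: "\<beta> * b n - e * (a n + b n) \<le> b (Suc n)" for n
    proof -
      \<comment> \<open>The triangle inequality read backwards: removing the error costs
        \<open>\<omega>\<close> of \<open>- E n\<close>, which the norm bounds.\<close>
      have "\<omega> (G (X n)) (A (X n) (V n)) \<le> \<omega> (G (X n)) (V (Suc n)) + \<omega> (G (X n)) (- E n)"
        using tri(2)[of "G (X n)" "V (Suc n)" "- E n"] by (simp add: E_def)
      also have "\<omega> (G (X n)) (- E n) \<le> C * norm (E n)" using C(3)[of "G (X n)" "- E n"] by simp
      finally show ?thesis using step\<omega>[of "X n" "V n"] E[of n] by (simp add: b_def XS)
    qed
    obtain C0 where C0: "\<And>n. norm ((G ^^ n) x - (G ^^ n) y) \<le> C0 * r ^ n"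
      using as unfolding exp_close_def by metis
    have bb: "b n \<le> (C * C0) * r ^ n" for n
    proof -
      have "b n \<le> C * norm (V n)" unfolding b_def by (rule C)
      also have "\<dots> \<le> C * (C0 * r ^ n)"
        using C0[of n] C(1) by (intro mult_left_mono) (auto simp: V_def norm_minus_commute)
      finally show ?thesis by simp
    qed
    have a0: "0 \<le> a n" and b0: "0 \<le> b n" for n by (simp_all add: a_def b_def pos)
    note rec = cone_recurrence[of a b e h r r' \<alpha> \<beta> "C * C0", OF a0 b0 less_imp_le[OF e0] h r'(3,1) e1 e2 rates(1) sa sb bb]
    have nV: "norm (V n) \<le> C * (1 + h) * a n" for n
    proof -
      have "norm (V n) \<le> C * (a n + b n)" unfolding a_def b_def by (rule C)
      also have "\<dots> \<le> C * (a n + h * a n)" using rec(1)[of n] C(1) by (intro mult_left_mono) auto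
      finally show ?thesis by (simp add: algebra_simps)
    qed
    show "norm ((G ^^ n) x - (G ^^ n) y) \<le> C * (1 + h) * (C * d) * r ^ n" for n
    proof -
      have "a 0 \<le> C * norm (V 0)" unfolding a_def by (rule C)
      also have "\<dots> \<le> C * d" using Vd[of 0] C(1) by (intro mult_left_mono) auto
      finally have a00: "a 0 \<le> C * d" .
      have "norm (V n) \<le> C * (1 + h) * (r ^ n * (C * d))"
        using nV[of n] rec(2)[of n] a00 C(1) h r'(3)
        by (meson add_nonneg_nonneg less_imp_le mult_left_mono mult_nonneg_nonneg order_trans zero_le_one zero_le_power)
      then show ?thesis by (simp add: V_def norm_minus_commute mult_ac)
    qed
    have "norm ((y - x) - p x (y - x)) \<le> C * b 0" using C(5)[of "y - x" x] by (simp add: b_def X_def V_def)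
    also have "\<dots> \<le> C * (h * a 0)" using rec(1)[of 0] C(1) by (intro mult_left_mono) auto
    also have "\<dots> \<le> C * (h * (C * norm (y - x)))"
      using C(1) C(2)[of x "y - x"] h by (intro mult_left_mono) (auto simp: a_def X_def V_def)
    also have "\<dots> = \<eta> * norm (y - x)" using C(1) by (simp add: h_def power2_eq_square)
    finally show "norm ((y - x) - p x (y - x)) \<le> \<eta> * norm (y - x)" .
  qed
qed

section \<open>Derivative cocycles and growth along discs\<close>

fun cocycle :: "('a \<Rightarrow> 'a) \<Rightarrow> ('a \<Rightarrow> 'b \<Rightarrow> 'b) \<Rightarrow> nat \<Rightarrow> 'a \<Rightarrow> 'b \<Rightarrow> 'b" where
  "cocycle G A 0 x v = v"
| "cocycle G A (Suc n) x v = A ((G ^^ n) x) (cocycle G A n x v)"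

text \<open>The recursion appends factors at the end of the orbit; here the first factor is split
  off, as needed when the base point moves to \<open>G x\<close>.\<close>

lemma cocycle_Suc_left: "cocycle G A (Suc n) x v = cocycle G A n (G x) (A x v)"
proof (induction n)
  case (Suc n)
  show ?case
    unfolding cocycle.simps(2)[of G A "Suc n"] Suc by (simp add: funpow_swap1)
qed simp

lemma has_derivative_funpow_cocycle:
  fixes G :: "'a::real_normed_vector \<Rightarrow> 'a"
  assumes "\<And>x. (G has_derivative A x) (at x)"
  shows "((G ^^ n) has_derivative cocycle G A n x) (at x)"
proof (induction n)
  case 0
  have "cocycle G A 0 x = (\<lambda>v. v)" by auto
  then show ?case by (simp add: id_def)
next
  case (Suc n)
  have "((\<lambda>x. G ((G ^^ n) x)) has_derivative (\<lambda>v. A ((G ^^ n) x) (cocycle G A n x v))) (at x)"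
    by (rule has_derivative_compose[OF Suc assms])
  moreover have "cocycle G A (Suc n) x = (\<lambda>v. A ((G ^^ n) x) (cocycle G A n x v))" by auto
  ultimately show ?case by (simp add: o_def)
qed

text \<open>The derivative of an iterate along the disc is the cocycle applied to tangent vectors of
  the disc, all of which lie in \<open>E\<close>. The mean value inequality over the convex
  parameter set turns bounds on vectors into bounds on distances.\<close>

lemma orbit_distance_along_disc:
  fixes G :: "real^3 \<Rightarrow> real^3" and g :: "'k::euclidean_space \<Rightarrow> real^3"
  assumes der: "\<And>x. (G has_derivative A x) (at x)"
    and contr: "\<And>n x v. v \<in> E x \<Longrightarrow> norm (cocycle G A n x v) \<le> K * r ^ n * norm v"
    and S: "compact S" "convex S" "\<And>u. u \<in> S \<Longrightarrow> (g has_derivative blinfun_apply (g' u)) (at u within S)"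
      "continuous_on S g'" "\<And>u. u \<in> S \<Longrightarrow> range (blinfun_apply (g' u)) \<subseteq> E (g u)"
    and K: "0 \<le> K" "0 < r"
  shows "\<exists>C. \<forall>u1\<in>S. \<forall>u2\<in>S. \<forall>n. norm ((G ^^ n) (g u1) - (G ^^ n) (g u2)) \<le> C * r ^ n * norm (u1 - u2)"
proof -
  have "bounded (g' ` S)" using S compact_continuous_image compact_imp_bounded by blast
  then obtain B where B: "B > 0" "\<And>u. u \<in> S \<Longrightarrow> norm (g' u) \<le> B" by (auto simp: bounded_pos)
  have "norm ((G ^^ n) (g u1) - (G ^^ n) (g u2)) \<le> (K * B) * r ^ n * norm (u1 - u2)"
    if u: "u1 \<in> S" "u2 \<in> S" for u1 u2 n
  proof -
    have "norm ((\<lambda>u. (G ^^ n) (g u)) u1 - (\<lambda>u. (G ^^ n) (g u)) u2) \<le> (K * r ^ n * B) * norm (u1 - u2)"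
    proof (rule differentiable_bound[OF S(2) _ _ u])
      fix u assume u: "u \<in> S"
      show "((\<lambda>u. (G ^^ n) (g u)) has_derivative (\<lambda>w. cocycle G A n (g u) (g' u w))) (at u within S)"
        by (rule has_derivative_compose[OF S(3)[OF u] has_derivative_funpow_cocycle[OF der]])
      show "onorm (\<lambda>w. cocycle G A n (g u) (blinfun_apply (g' u) w)) \<le> K * r ^ n * B"
      proof (rule onorm_le)
        fix w
        have "norm (cocycle G A n (g u) (g' u w)) \<le> K * r ^ n * norm (g' u w)"
          using contr S(5)[OF u] by blast
        also have "\<dots> \<le> K * r ^ n * (B * norm w)"
          using order_trans[OF norm_blinfun[of "g' u" w] mult_right_mono[OF B(2)[OF u] norm_ge_zero]] K
          by (intro mult_left_mono) auto
        finally show "norm (cocycle G A n (g u) (blinfun_apply (g' u) w)) \<le> K * r ^ n * B * norm w"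
          by (simp add: mult_ac)
      qed
    qed
    then show ?thesis by (simp add: mult_ac)
  qed
  then show ?thesis by blast
qed

text \<open>Peano's theorem through Tonelli's delayed equations \<open>y'(t) = X (y (t - \<delta>))\<close>, whose Picard
  iteration becomes stationary after finitely many steps.\<close>

lemma tonelli_delay_solution:
  fixes X :: "'a::euclidean_space \<Rightarrow> 'a" and \<delta> T :: real
  assumes X: "continuous_on UNIV X" and "0 < \<delta>" "0 \<le> T"
  shows "\<exists>y. continuous_on {0..T} y \<and> (\<forall>t\<in>{0..T}. y t = x0 + integral {0..t} (\<lambda>s. X (y (max 0 (s - \<delta>)))))"
proof -
  define \<Phi> where "\<Phi> y t = x0 + integral {0..t} (\<lambda>s. X (y (max 0 (s - \<delta>))))" for y t
  define y where "y m = (\<Phi> ^^ m) (\<lambda>t. x0)" for m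
  have yS: "y (Suc m) = \<Phi> (y m)" for m by (simp add: y_def)
  have cont: "continuous_on {0..T} (y m)" for m
  proof (induction m)
    case 0
    then show ?case by (simp add: y_def)
  next
    case (Suc m)
    have "continuous_on {0..T} (\<lambda>s. y m (max 0 (s - \<delta>)))"
      using \<open>0 < \<delta>\<close> by (intro continuous_on_compose2[OF Suc] continuous_intros continuous_on_max) (auto simp: max_def)
    then have "continuous_on {0..T} (\<lambda>s. X (y m (max 0 (s - \<delta>))))"
      by (intro continuous_on_compose2[OF X]) auto
    then have "(\<lambda>s. X (y m (max 0 (s - \<delta>)))) integrable_on {0..T}"
      by (rule integrable_continuous_interval)
    then have "continuous_on {0..T} (\<lambda>t. integral {0..t} (\<lambda>s. X (y m (max 0 (s - \<delta>)))))"
      by (rule indefinite_integral_continuous_1)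
    then show ?case unfolding yS \<Phi>_def by (intro continuous_intros)
  qed
  \<comment> \<open>The delay makes the integrand up to time \<open>(m + 1) \<delta>\<close> depend
    on the iterate up to time \<open>m \<delta>\<close> only, so each iteration settles one more
    interval of length \<open>\<delta>\<close>.\<close>
  have stat: "y (Suc m) t = y m t" if "0 \<le> t" "t \<le> real m * \<delta>" for m t
    using that
  proof (induction m arbitrary: t)
    case 0
    then show ?case by (simp add: yS \<Phi>_def) (simp add: y_def)
  next
    case (Suc m)
    have "integral {0..t} (\<lambda>s. X (y (Suc m) (max 0 (s - \<delta>)))) = integral {0..t} (\<lambda>s. X (y m (max 0 (s - \<delta>))))"
    proof (rule integral_cong)
      fix s assume "s \<in> {0..t}"
      then have "max 0 (s - \<delta>) \<le> real m * \<delta>" using Suc.prems \<open>0 < \<delta>\<close> by (auto simp: algebra_simps)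
      then show "X (y (Suc m) (max 0 (s - \<delta>))) = X (y m (max 0 (s - \<delta>)))" using Suc.IH by simp
    qed
    then show ?case unfolding yS[of "Suc m"] \<Phi>_def by (simp add: yS[of m] \<Phi>_def)
  qed
  obtain m where m: "T < real m * \<delta>" using \<open>0 < \<delta>\<close> ex_less_of_nat_mult by blast
  have "y m t = \<Phi> (y m) t" if "t \<in> {0..T}" for t
    using stat[of t m] m that by (simp add: yS)
  then show ?thesis using cont[of m] unfolding \<Phi>_def by blast
qed

text \<open>The delayed solutions share the Lipschitz constant \<open>B\<close>, so Arzela-Ascoli
  yields a uniformly convergent subsequence, and dominated convergence passes to the limit in the
  integral equation. The fields integrated later are merely continuous, hence existence without
  uniqueness.\<close>

lemma peano:
  fixes X :: "'a::euclidean_space \<Rightarrow> 'a" and T :: real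
  assumes X: "continuous_on UNIV X" and B: "\<And>x. norm (X x) \<le> B" and "0 \<le> T"
  shows "\<exists>c. c 0 = x0 \<and> (\<forall>t\<in>{0..T}. (c has_vector_derivative X (c t)) (at t within {0..T}))"
proof -
  define \<delta> where "\<delta> k = 1 / real (Suc k)" for k
  have \<delta>: "0 < \<delta> k" for k by (simp add: \<delta>_def)
  have "\<forall>k. \<exists>y. continuous_on {0..T} y \<and> (\<forall>t\<in>{0..T}. y t = x0 + integral {0..t} (\<lambda>s. X (y (max 0 (s - \<delta> k)))))"
    using tonelli_delay_solution[OF X \<delta> \<open>0 \<le> T\<close>] by blast
  then obtain y where yc: "\<And>k. continuous_on {0..T} (y k)"
    and y: "\<And>k t. t \<in> {0..T} \<Longrightarrow> y k t = x0 + integral {0..t} (\<lambda>s. X (y k (max 0 (s - \<delta> k))))"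
    by metis
  have B0: "0 \<le> B" using B[of 0] norm_ge_zero order_trans by blast
  have ci: "continuous_on {0..T} (\<lambda>s. X (y k (max 0 (s - \<delta> k))))" for k
  proof -
    have "continuous_on {0..T} (\<lambda>s. y k (max 0 (s - \<delta> k)))"
      using \<delta>[of k] by (intro continuous_on_compose2[OF yc] continuous_intros continuous_on_max) (auto simp: max_def)
    then show ?thesis by (intro continuous_on_compose2[OF X]) auto
  qed
  have int: "(\<lambda>s. X (y k (max 0 (s - \<delta> k)))) integrable_on {0..t}" if "t \<in> {0..T}" for k t
    using that by (intro integrable_continuous_interval continuous_on_subset[OF ci]) auto
  have dy: "(y k has_vector_derivative X (y k (max 0 (t - \<delta> k)))) (at t within {0..T})" if "t \<in> {0..T}" for k t
  proof -
    have "((\<lambda>t. x0 + integral {0..t} (\<lambda>s. X (y k (max 0 (s - \<delta> k))))) has_vector_derivative X (y k (max 0 (t - \<delta> k)))) (at t within {0..T})"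
      using integral_has_vector_derivative[OF ci that] by (auto intro!: derivative_eq_intros)
    then show ?thesis
      by (rule has_vector_derivative_transform[OF that, rotated]) (simp add: y)
  qed
  have lip: "norm (y k s - y k t) \<le> B * \<bar>s - t\<bar>" if "s \<in> {0..T}" "t \<in> {0..T}" for k s t
  proof -
    have "norm (y k s - y k t) \<le> B * norm (s - t)"
    proof (rule differentiable_bound[OF _ _ _ that(1) that(2)])
      show "convex {0..T}" by simp
      fix u assume "u \<in> {0..T}"
      show "(y k has_derivative (\<lambda>h. h *\<^sub>R X (y k (max 0 (u - \<delta> k))))) (at u within {0..T})"
        using dy[OF \<open>u \<in> {0..T}\<close>] by (simp add: has_vector_derivative_def)
      show "onorm (\<lambda>h. h *\<^sub>R X (y k (max 0 (u - \<delta> k)))) \<le> B"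
        by (rule onorm_le) (simp add: B mult.commute[of B] mult_left_mono)
    qed
    then show ?thesis by simp
  qed
  have y0: "y k 0 = x0" for k using y[of 0 k] \<open>0 \<le> T\<close> by simp
  obtain g \<kappa> where g: "continuous_on {0..T} g" "strict_mono (\<kappa>::nat\<Rightarrow>nat)"
    "\<And>e. 0 < e \<Longrightarrow> \<exists>N. \<forall>n x. n \<ge> N \<and> x \<in> {0..T} \<longrightarrow> norm (y (\<kappa> n) x - g x) < e"
  proof (rule Arzela_Ascoli[of "{0..T}" y "norm x0 + B * T"])
    fix n t assume "t \<in> {0..T}"
    then show "norm (y n t) \<le> norm x0 + B * T"
      using lip[of t 0 n] y0[of n] norm_triangle_ineq2[of "y n t" x0] B0 mult_left_mono[of t T B] by auto
  next
    fix x e :: real assume x: "x \<in> {0..T}" "0 < e"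
    show "\<exists>d. 0 < d \<and> (\<forall>n z. z \<in> {0..T} \<and> norm (x - z) < d \<longrightarrow> norm (y n x - y n z) < e)"
    proof (intro exI[of _ "e / (B + 1)"] conjI allI impI)
      show "0 < e / (B + 1)" using x B0 by simp
      fix n z assume z: "z \<in> {0..T} \<and> norm (x - z) < e / (B + 1)"
      have "norm (y n x - y n z) \<le> B * \<bar>x - z\<bar>" using lip x z by blast
      also have "\<dots> \<le> (B + 1) * \<bar>x - z\<bar>" by (intro mult_right_mono) auto
      also have "\<dots> < e" using z B0 by (simp add: field_simps)
      finally show "norm (y n x - y n z) < e" .
    qed
  qed auto
  have conv: "(\<lambda>n. y (\<kappa> n) t) \<longlonglongrightarrow> g t" if "t \<in> {0..T}" for t
    unfolding LIMSEQ_iff using g(3) that by blast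
  have \<delta>0: "(\<lambda>n. \<delta> (\<kappa> n)) \<longlonglongrightarrow> 0"
    using LIMSEQ_subseq_LIMSEQ[OF LIMSEQ_inverse_real_of_nat g(2)] by (simp add: \<delta>_def o_def inverse_eq_divide)
  have conv': "(\<lambda>n. X (y (\<kappa> n) (max 0 (s - \<delta> (\<kappa> n))))) \<longlonglongrightarrow> X (g s)" if s: "s \<in> {0..T}" for s
  proof -
    \<comment> \<open>The argument is displaced by at most the delay, also where
      \<open>max 0\<close> cuts it off, and the common Lipschitz constant makes this
      harmless.\<close>
    have "(\<lambda>n. y (\<kappa> n) (max 0 (s - \<delta> (\<kappa> n))) - y (\<kappa> n) s) \<longlonglongrightarrow> 0"
    proof (rule Lim_null_comparison)
      show "\<forall>\<^sub>F n in sequentially. norm (y (\<kappa> n) (max 0 (s - \<delta> (\<kappa> n))) - y (\<kappa> n) s) \<le> B * \<delta> (\<kappa> n)"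
      proof (rule always_eventually, rule allI)
        fix n
        have "norm (y (\<kappa> n) (max 0 (s - \<delta> (\<kappa> n))) - y (\<kappa> n) s) \<le> B * \<bar>max 0 (s - \<delta> (\<kappa> n)) - s\<bar>"
          using s \<delta>[of "\<kappa> n"] by (intro lip) auto
        also have "\<dots> \<le> B * \<delta> (\<kappa> n)" using s \<delta>[of "\<kappa> n"] B0 by (intro mult_left_mono) auto
        finally show "norm (y (\<kappa> n) (max 0 (s - \<delta> (\<kappa> n))) - y (\<kappa> n) s) \<le> B * \<delta> (\<kappa> n)" .
      qed
      show "(\<lambda>n. B * \<delta> (\<kappa> n)) \<longlonglongrightarrow> 0" using tendsto_mult_left[OF \<delta>0, of B] by simp
    qed
    from tendsto_add[OF this conv[OF s]]
    have "(\<lambda>n. y (\<kappa> n) (max 0 (s - \<delta> (\<kappa> n)))) \<longlonglongrightarrow> g s" by simp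
    moreover have "isCont X (g s)" using X by (simp add: continuous_on_eq_continuous_at)
    ultimately show ?thesis by (rule isCont_tendsto_compose[rotated])
  qed
  have gi: "g t = x0 + integral {0..t} (\<lambda>s. X (g s))" if t: "t \<in> {0..T}" for t
  proof -
    have "(\<lambda>n. integral {0..t} (\<lambda>s. X (y (\<kappa> n) (max 0 (s - \<delta> (\<kappa> n)))))) \<longlonglongrightarrow> integral {0..t} (\<lambda>s. X (g s))"
    proof (rule dominated_convergence(2)[where h = "\<lambda>_. B"])
      show "(\<lambda>_. B) integrable_on {0..t}" by (rule integrable_const_ivl)
    qed (use t int B conv' in auto)
    then have "(\<lambda>n. x0 + integral {0..t} (\<lambda>s. X (y (\<kappa> n) (max 0 (s - \<delta> (\<kappa> n)))))) \<longlonglongrightarrow> x0 + integral {0..t} (\<lambda>s. X (g s))"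
      by (intro tendsto_intros)
    moreover have "x0 + integral {0..t} (\<lambda>s. X (y (\<kappa> n) (max 0 (s - \<delta> (\<kappa> n))))) = y (\<kappa> n) t" for n
      using y[OF t, of "\<kappa> n"] by simp
    ultimately show ?thesis using LIMSEQ_unique conv[OF t] by auto
  qed
  have cg: "continuous_on {0..T} (\<lambda>s. X (g s))" by (intro continuous_on_compose2[OF X] g) auto
  have "(g has_vector_derivative X (g t)) (at t within {0..T})" if t: "t \<in> {0..T}" for t
  proof -
    have "((\<lambda>t. x0 + integral {0..t} (\<lambda>s. X (g s))) has_vector_derivative X (g t)) (at t within {0..T})"
      using integral_has_vector_derivative[OF cg t] by (auto intro!: derivative_eq_intros)
    then show ?thesis
      by (rule has_vector_derivative_transform[OF t, rotated]) (simp add: gi[symmetric])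
  qed
  moreover have "g 0 = x0" using gi[of 0] \<open>0 \<le> T\<close> by simp
  ultimately show ?thesis by blast
qed

section \<open>Spectral splitting of three by three matrices\<close>

text \<open>\<open>S n\<close> is a quadratic form in two consecutive terms, multiplied by
  \<open>p\<close> at each step. The discriminant condition makes it positive definite, so it
  controls \<open>norm (w n)\<close>. A complex pair of roots of modulus \<open>sqrt p\<close> is
  thus treated without complex numbers.\<close>

lemma complex_recurrence_tendsto_0:
  fixes w :: "nat \<Rightarrow> 'a::real_inner"
  assumes rec: "\<And>n. w (Suc (Suc n)) = s *\<^sub>R w (Suc n) - p *\<^sub>R w n" and "s\<^sup>2 < 4 * p" "p < 1"
  shows "w \<longlonglongrightarrow> 0"
proof -
  have p: "0 < p" using assms(2) zero_le_power2[of s] by linarith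
  define S where "S n = (w (Suc n)) \<bullet> (w (Suc n)) - s * (w (Suc n) \<bullet> w n) + p * (w n \<bullet> w n)" for n
  have "S (Suc n) = p * S n" for n
    by (simp add: S_def rec inner_simps inner_commute algebra_simps)
  then have S: "S n = p ^ n * S 0" for n
    by (induction n) auto
  define c where "c = p - s\<^sup>2 / 4"
  have c: "0 < c" using assms(2) by (simp add: c_def)
  have cS: "c * (norm (w n))\<^sup>2 \<le> S n" for n
  proof -
    have "S n = (w (Suc n) - (s / 2) *\<^sub>R w n) \<bullet> (w (Suc n) - (s / 2) *\<^sub>R w n) + c * (w n \<bullet> w n)"
      by (simp add: S_def c_def inner_simps inner_commute power2_eq_square algebra_simps)
    then show ?thesis using inner_ge_zero[of "w (Suc n) - (s / 2) *\<^sub>R w n"]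
      by (simp add: power2_norm_eq_inner)
  qed
  then have b: "(norm (w n))\<^sup>2 \<le> p ^ n * (S 0 / c)" for n
  proof -
    have "c * (norm (w n))\<^sup>2 \<le> p ^ n * S 0" using cS[of n] S[of n] by linarith
    then show ?thesis using c by (simp add: field_simps)
  qed
  have "(\<lambda>n. p ^ n * (S 0 / c)) \<longlonglongrightarrow> 0"
    using tendsto_mult_left_zero[OF LIMSEQ_power_zero[of p], of "S 0 / c"] p assms(3) by simp
  then have "(\<lambda>n. (norm (w n))\<^sup>2) \<longlonglongrightarrow> 0"
    by (rule Lim_null_comparison[rotated]) (use b in auto)
  then have "(\<lambda>n. sqrt ((norm (w n))\<^sup>2)) \<longlonglongrightarrow> sqrt 0" by (rule tendsto_real_sqrt)
  then show ?thesis by (simp add: tendsto_norm_zero_iff)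
qed

text \<open>Splitting off one root leaves \<open>u\<close>, a geometric sequence with ratio
  \<open>b\<close>. The bound carries a factor \<open>n\<close>, so a double root is covered;
  \<open>\<rho>\<close> is kept positive because it is divided by.\<close>

lemma real_recurrence_tendsto_0:
  fixes w :: "nat \<Rightarrow> 'a::real_normed_vector"
  assumes rec: "\<And>n. w (Suc (Suc n)) = (a + b) *\<^sub>R w (Suc n) - (a * b) *\<^sub>R w n" and "\<bar>a\<bar> < 1" "\<bar>b\<bar> < 1"
  shows "w \<longlonglongrightarrow> 0"
proof -
  define \<rho> where "\<rho> = max (1/2) (max \<bar>a\<bar> \<bar>b\<bar>)"
  have \<rho>: "0 < \<rho>" "\<rho> < 1" "\<bar>a\<bar> \<le> \<rho>" "\<bar>b\<bar> \<le> \<rho>" using assms by (auto simp: \<rho>_def)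
  define u where "u n = w (Suc n) - a *\<^sub>R w n" for n
  have "u (Suc n) = b *\<^sub>R u n" for n by (simp add: u_def rec algebra_simps)
  then have u: "u n = b ^ n *\<^sub>R u 0" for n by (induction n) auto
  have "norm (w n) * \<rho> \<le> \<rho> ^ n * (\<rho> * norm (w 0) + n * norm (u 0))" for n
  proof (induction n)
    case (Suc n)
    have "w (Suc n) = a *\<^sub>R w n + b ^ n *\<^sub>R u 0" using u[of n] by (simp add: u_def algebra_simps)
    then have "norm (w (Suc n)) \<le> \<bar>a\<bar> * norm (w n) + \<bar>b\<bar> ^ n * norm (u 0)"
      by (metis norm_scaleR norm_triangle_ineq power_abs)
    also have "\<dots> \<le> \<rho> * norm (w n) + \<rho> ^ n * norm (u 0)"
      using \<rho> by (intro add_mono mult_right_mono power_mono) auto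
    finally have "norm (w (Suc n)) * \<rho> \<le> (\<rho> * norm (w n) + \<rho> ^ n * norm (u 0)) * \<rho>"
      using \<rho> by (intro mult_right_mono) auto
    also have "\<dots> = \<rho> * (norm (w n) * \<rho>) + \<rho> ^ Suc n * norm (u 0)" by (simp add: algebra_simps)
    also have "\<dots> \<le> \<rho> * (\<rho> ^ n * (\<rho> * norm (w 0) + n * norm (u 0))) + \<rho> ^ Suc n * norm (u 0)"
      using Suc \<rho> by (intro add_mono mult_left_mono) auto
    finally show ?case by (simp add: algebra_simps)
  qed (simp add: mult.commute)
  then have b: "norm (w n) \<le> \<rho> ^ n * norm (w 0) + (n * \<rho> ^ n) * (norm (u 0) / \<rho>)" for n
    using \<rho> by (simp add: field_simps)
  have "(\<lambda>n. \<rho> ^ n * norm (w 0) + (n * \<rho> ^ n) * (norm (u 0) / \<rho>)) \<longlonglongrightarrow> 0 * norm (w 0) + 0 * (norm (u 0) / \<rho>)"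
    using \<rho> by (intro tendsto_intros LIMSEQ_power_zero powser_times_n_limit_0) auto
  then show ?thesis
    by (intro Lim_null_comparison[of w]) (use b in auto)
qed

lemma cubic_real_root: "\<exists>x::real. x ^ 3 - t * x\<^sup>2 + m * x - d = 0"
proof -
  \<comment> \<open>From this size on the cubic term outweighs the others, so the polynomial changes
    sign between \<open>-R\<close> and \<open>R\<close>.\<close>
  define R where "R = 1 + \<bar>t\<bar> + \<bar>m\<bar> + \<bar>d\<bar>"
  have R: "1 \<le> R" by (simp add: R_def)
  have RR: "R \<le> R\<^sup>2" "1 \<le> R\<^sup>2" using R self_le_power[of R 2] by auto
  have a: "\<bar>m\<bar> * R \<le> \<bar>m\<bar> * R\<^sup>2" "\<bar>d\<bar> \<le> \<bar>d\<bar> * R\<^sup>2" "\<bar>t * R\<^sup>2\<bar> = \<bar>t\<bar> * R\<^sup>2" "\<bar>m * R\<bar> = \<bar>m\<bar> * R"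
    using RR R mult_left_mono[OF RR(2), of "\<bar>d\<bar>"] by (auto simp: abs_mult intro!: mult_mono)
  have R3: "R ^ 3 = R\<^sup>2 + \<bar>t\<bar> * R\<^sup>2 + \<bar>m\<bar> * R\<^sup>2 + \<bar>d\<bar> * R\<^sup>2"
  proof -
    have "R ^ 3 = R * R\<^sup>2" by (simp add: power3_eq_cube power2_eq_square)
    also have "\<dots> = (1 + \<bar>t\<bar> + \<bar>m\<bar> + \<bar>d\<bar>) * R\<^sup>2" by (simp only: R_def)
    finally show ?thesis by (simp add: algebra_simps)
  qed
  let ?p = "\<lambda>x. x ^ 3 - t * x\<^sup>2 + m * x - d"
  have "(- R) ^ 3 = - (R ^ 3)" by simp
  then have "?p (-R) \<le> 0" "0 \<le> ?p R"
    unfolding power2_minus R3 using a RR by (simp_all only: R3) linarith+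
  moreover have "continuous_on {-R..R} ?p" by (intro continuous_intros)
  ultimately show ?thesis using IVT'[of ?p "-R" 0 R] R by auto
qed

text \<open>The expression in \<open>simple\<close> is the derivative of the characteristic
  polynomial at \<open>\<kappa>\<close>, which is also the trace of the adjugate of
  \<open>\<kappa> - M\<close>. A nonzero trace provides a nonzero diagonal entry: the column through
  it is the eigenvector, the row through it the eigenfunctional.\<close>

lemma rank_one_spectral:
  fixes M :: "real^3^3"
  defines "t \<equiv> M$1$1 + M$2$2 + M$3$3"
    and "m \<equiv> M$1$1 * M$2$2 - M$1$2 * M$2$1 + (M$1$1 * M$3$3 - M$1$3 * M$3$1) + (M$2$2 * M$3$3 - M$2$3 * M$3$2)"
  assumes root: "\<kappa> ^ 3 - t * \<kappa>\<^sup>2 + m * \<kappa> - det M = 0"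
    and simple: "\<kappa>\<^sup>2 - (t - \<kappa>) * \<kappa> + (\<kappa>\<^sup>2 - t * \<kappa> + m) \<noteq> 0"
  shows "\<exists>e \<phi>. e \<noteq> 0 \<and> M *v e = \<kappa> *\<^sub>R e \<and> (\<forall>w. \<phi> \<bullet> (M *v w) = \<kappa> * (\<phi> \<bullet> w)) \<and> \<phi> \<bullet> e \<noteq> 0 \<and>
     (\<forall>w. \<phi> \<bullet> w = 0 \<longrightarrow> M *v (M *v w) = (t - \<kappa>) *\<^sub>R (M *v w) - (\<kappa>\<^sup>2 - t * \<kappa> + m) *\<^sub>R w)"
proof -
  \<comment> \<open>\<open>Q = adj (\<kappa> - M) = q M\<close>, of rank one because \<open>\<kappa>\<close> is a simple root\<close>
  define Q :: "real^3^3" where "Q = vector [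
    vector [(\<kappa> - M$2$2) * (\<kappa> - M$3$3) - M$2$3 * M$3$2, M$1$2 * (\<kappa> - M$3$3) + M$1$3 * M$3$2, M$1$2 * M$2$3 + M$1$3 * (\<kappa> - M$2$2)],
    vector [M$2$1 * (\<kappa> - M$3$3) + M$2$3 * M$3$1, (\<kappa> - M$1$1) * (\<kappa> - M$3$3) - M$1$3 * M$3$1, M$2$3 * (\<kappa> - M$1$1) + M$2$1 * M$1$3],
    vector [M$3$1 * (\<kappa> - M$2$2) + M$2$1 * M$3$2, M$3$2 * (\<kappa> - M$1$1) + M$1$2 * M$3$1, (\<kappa> - M$1$1) * (\<kappa> - M$2$2) - M$1$2 * M$2$1]]"
  obtain a b c d e f g h i where M: "M$1$1 = a" "M$1$2 = b" "M$1$3 = c" "M$2$1 = d" "M$2$2 = e" "M$2$3 = f"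
    "M$3$1 = g" "M$3$2 = h" "M$3$3 = i" by blast
  have det: "(\<kappa> - a) * ((\<kappa> - e) * (\<kappa> - i) - f * h) - b * (d * (\<kappa> - i) + f * g) - c * (d * h + (\<kappa> - e) * g) = 0"
    using root unfolding t_def m_def det_3 M by (simp add: power3_eq_cube power2_eq_square algebra_simps)
  have Q: "Q$1$1 = (\<kappa> - e) * (\<kappa> - i) - f * h" "Q$1$2 = b * (\<kappa> - i) + c * h" "Q$1$3 = b * f + c * (\<kappa> - e)"
    "Q$2$1 = d * (\<kappa> - i) + f * g" "Q$2$2 = (\<kappa> - a) * (\<kappa> - i) - c * g" "Q$2$3 = f * (\<kappa> - a) + d * c"
    "Q$3$1 = g * (\<kappa> - e) + d * h" "Q$3$2 = h * (\<kappa> - a) + b * g" "Q$3$3 = (\<kappa> - a) * (\<kappa> - e) - b * d"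
    by (simp_all add: Q_def M)
  have tr: "Q$1$1 + Q$2$2 + Q$3$3 = \<kappa>\<^sup>2 - (t - \<kappa>) * \<kappa> + (\<kappa>\<^sup>2 - t * \<kappa> + m)"
    unfolding Q t_def m_def M by (simp add: power2_eq_square algebra_simps)
  then obtain k where k: "Q$k$k \<noteq> 0" using simple by (metis add_0_right)
  \<comment> \<open>Up to sign, a two by two minor of the adjugate is an entry of
    \<open>\<kappa> - M\<close> times its determinant, hence zero.\<close>
  have rank1: "Q$i$j * Q$k$k = Q$i$k * Q$k$j" for i j k
  proof -
    have "\<forall>i j k. Q$i$j * Q$k$k = Q$i$k * Q$k$j"
      unfolding forall_3 Q by (intro conjI) ((rule mult.commute refl) | (simp add: algebra_simps; fail) | (insert det, algebra))+
    then show ?thesis by blast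
  qed
  have MQ: "(\<Sum>l\<in>UNIV. M$i$l * Q$l$j) = \<kappa> * Q$i$j" for i j
  proof -
    have "\<forall>i j. (\<Sum>l\<in>UNIV. M$i$l * Q$l$j) = \<kappa> * Q$i$j"
      unfolding forall_3 sum_3 Q M by (intro conjI) ((rule mult.commute refl) | (simp add: algebra_simps; fail) | (insert det, algebra))+
    then show ?thesis by blast
  qed
  have QM: "(\<Sum>l\<in>UNIV. Q$i$l * M$l$j) = \<kappa> * Q$i$j" for i j
  proof -
    have "\<forall>i j. (\<Sum>l\<in>UNIV. Q$i$l * M$l$j) = \<kappa> * Q$i$j"
      unfolding forall_3 sum_3 Q M by (intro conjI) ((rule mult.commute refl) | (simp add: algebra_simps; fail) | (insert det, algebra))+
    then show ?thesis by blast
  qed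
  have qM: "M *v (M *v w) = (t - \<kappa>) *\<^sub>R (M *v w) - (\<kappa>\<^sup>2 - t * \<kappa> + m) *\<^sub>R w + Q *v w" for w
    unfolding t_def m_def
    by (simp add: vec_eq_iff forall_3 matrix_vector_mult_def sum_3 Q M power2_eq_square algebra_simps)
  define v where "v = (\<chi> i. Q$i$k)"
  define \<phi> where "\<phi> = Q$k"
  show ?thesis
  proof (rule exI[of _ v], rule exI[of _ \<phi>], intro conjI allI impI)
    show "v \<noteq> 0" using k by (auto simp: v_def vec_eq_iff)
    show "M *v v = \<kappa> *\<^sub>R v" by (simp add: vec_eq_iff v_def matrix_vector_mult_def MQ)
    show "\<phi> \<bullet> (M *v w) = \<kappa> * (\<phi> \<bullet> w)" for w
    proof -
      have "\<phi> \<bullet> (M *v w) = (\<Sum>j\<in>UNIV. (\<Sum>l\<in>UNIV. Q$k$l * M$l$j) * w$j)"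
        unfolding \<phi>_def inner_vec_def matrix_vector_mult_def
        by (simp add: sum_distrib_left sum_distrib_right mult_ac) (rule sum.swap)
      also have "\<dots> = \<kappa> * (\<phi> \<bullet> w)"
        by (simp only: QM) (simp add: \<phi>_def inner_vec_def sum_distrib_left mult_ac)
      finally show ?thesis .
    qed
    have "\<phi> \<bullet> v = (\<Sum>j\<in>UNIV. Q$k$k * Q$j$j)"
      unfolding \<phi>_def v_def inner_vec_def
    proof (intro sum.cong refl)
      show "Q$k$j \<bullet> (\<chi> i. Q$i$k)$j = Q$k$k * Q$j$j" for j
        using rank1[of j j k] by (simp add: mult.commute)
    qed
    also have "\<dots> = Q$k$k * (Q$1$1 + Q$2$2 + Q$3$3)" by (simp add: sum_3 algebra_simps)
    finally show "\<phi> \<bullet> v \<noteq> 0" using k simple tr by simp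
    show "M *v (M *v w) = (t - \<kappa>) *\<^sub>R (M *v w) - (\<kappa>\<^sup>2 - t * \<kappa> + m) *\<^sub>R w" if w: "\<phi> \<bullet> w = 0" for w
    proof -
      \<comment> \<open>All rows of \<open>Q\<close> are multiples of row \<open>k\<close>, so
        \<open>Q\<close> vanishes wherever \<open>\<phi>\<close> does, and only the quadratic
        relation for \<open>M\<close> is left.\<close>
      have "Q$k$k * (Q *v w)$i = Q$i$k * (\<phi> \<bullet> w)" for i
        unfolding matrix_vector_mult_def \<phi>_def inner_vec_def sum_distrib_left vec_lambda_beta
      proof (intro sum.cong refl)
        fix j
        have "(Q$i$j * Q$k$k) * w$j = (Q$i$k * Q$k$j) * w$j" by (simp only: rank1[of i j k])
        then show "Q$k$k * (Q$i$j * w$j) = Q$i$k * (Q$k$j \<bullet> w$j)" by (simp add: mult_ac)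
      qed
      then have "Q *v w = 0" using w k by (simp add: vec_eq_iff)
      then show ?thesis using qM[of w] by simp
    qed
  qed
qed


text \<open>\<open>e\<close> spans the contracted line of \<open>M\<close>; the complementary plane \<open>\<phi>\<^sup>\<bottom>\<close> is contracted by \<open>Mi\<close>.\<close>

definition hyp_split :: "(real^3 \<Rightarrow> real^3) \<Rightarrow> (real^3 \<Rightarrow> real^3) \<Rightarrow> real^3 \<Rightarrow> real \<Rightarrow> real^3 \<Rightarrow> bool" where
  "hyp_split M Mi e \<kappa> \<phi> \<longleftrightarrow> e \<noteq> 0 \<and> M e = \<kappa> *\<^sub>R e \<and> \<kappa> \<noteq> 0 \<and> \<bar>\<kappa>\<bar> < 1 \<and> (\<forall>w. \<phi> \<bullet> M w = \<kappa> * (\<phi> \<bullet> w)) \<and>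
     \<phi> \<bullet> e \<noteq> 0 \<and> (\<exists>B>0. \<forall>n w. \<phi> \<bullet> w = 0 \<longrightarrow> norm ((Mi ^^ n) w) \<le> B * norm w) \<and>
     (\<forall>w. \<phi> \<bullet> w = 0 \<longrightarrow> (\<lambda>n. (Mi ^^ n) w) \<longlonglongrightarrow> 0)"

lemma linear_funpow: "linear (f :: 'a::real_vector \<Rightarrow> 'a) \<Longrightarrow> linear (f ^^ n)"
  by (induction n) (auto intro: linear_compose simp: linear_id[unfolded id_def] id_def)

text \<open>On the kernel of \<open>\<phi>\<close> the map \<open>M\<close> satisfies a quadratic
  equation with roots outside the unit circle, so backward orbits satisfy the linear recurrence with
  the reciprocal roots, which lie inside.\<close>

lemma hyp_splitI:
  fixes M Mi :: "real^3 \<Rightarrow> real^3"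
  assumes lin: "linear Mi" and inv: "\<And>w. M (Mi w) = w"
    and e: "e \<noteq> 0" "M e = \<kappa> *\<^sub>R e" "\<kappa> \<noteq> 0" "\<bar>\<kappa>\<bar> < 1" "\<And>w. \<phi> \<bullet> M w = \<kappa> * (\<phi> \<bullet> w)" "\<phi> \<bullet> e \<noteq> 0"
    and q: "\<And>w. \<phi> \<bullet> w = 0 \<Longrightarrow> M (M w) = s *\<^sub>R M w - \<delta> *\<^sub>R w" and "\<delta> \<noteq> 0"
    and roots: "(s\<^sup>2 < 4 * \<delta> \<and> 1 < \<delta>) \<or> (\<exists>a b. s = a + b \<and> \<delta> = a * b \<and> 1 < \<bar>a\<bar> \<and> 1 < \<bar>b\<bar>)"
  shows "hyp_split M Mi e \<kappa> \<phi>"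
proof -
  have P: "\<phi> \<bullet> (Mi ^^ n) w = 0" if "\<phi> \<bullet> w = 0" for n w
  proof (induction n)
    case (Suc n)
    have "\<kappa> * (\<phi> \<bullet> Mi ((Mi ^^ n) w)) = \<phi> \<bullet> (Mi ^^ n) w" using e(5)[of "Mi ((Mi ^^ n) w)"] by (simp add: inv)
    then show ?case using Suc e(3) by simp
  qed (use that in simp)
  have rec: "(Mi ^^ Suc (Suc n)) w = (s / \<delta>) *\<^sub>R (Mi ^^ Suc n) w - (1 / \<delta>) *\<^sub>R (Mi ^^ n) w"
    if "\<phi> \<bullet> w = 0" for n w
  proof -
    have "(Mi ^^ n) w = s *\<^sub>R (Mi ^^ Suc n) w - \<delta> *\<^sub>R (Mi ^^ Suc (Suc n)) w"
      using q[OF P[OF that, of "Suc (Suc n)"]] by (simp add: inv)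
    then have "\<delta> *\<^sub>R (Mi ^^ Suc (Suc n)) w = s *\<^sub>R (Mi ^^ Suc n) w - (Mi ^^ n) w" by (simp add: algebra_simps)
    then have "(1 / \<delta>) *\<^sub>R (\<delta> *\<^sub>R (Mi ^^ Suc (Suc n)) w) = (1 / \<delta>) *\<^sub>R (s *\<^sub>R (Mi ^^ Suc n) w - (Mi ^^ n) w)" by simp
    then show ?thesis using \<open>\<delta> \<noteq> 0\<close> by (simp add: scaleR_diff_right)
  qed
  have lim: "(\<lambda>n. (Mi ^^ n) w) \<longlonglongrightarrow> 0" if w: "\<phi> \<bullet> w = 0" for w
    using roots
  proof
    assume a: "s\<^sup>2 < 4 * \<delta> \<and> 1 < \<delta>"
    show ?thesis
    proof (rule complex_recurrence_tendsto_0[of "\<lambda>n. (Mi ^^ n) w" "s / \<delta>" "1 / \<delta>"])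
      show "(Mi ^^ Suc (Suc n)) w = (s / \<delta>) *\<^sub>R (Mi ^^ Suc n) w - (1 / \<delta>) *\<^sub>R (Mi ^^ n) w" for n
        by (rule rec[OF w])
      show "(s / \<delta>)\<^sup>2 < 4 * (1 / \<delta>)" using a by (simp add: power_divide power2_eq_square field_simps)
    qed (use a in simp)
  next
    assume "\<exists>a b. s = a + b \<and> \<delta> = a * b \<and> 1 < \<bar>a\<bar> \<and> 1 < \<bar>b\<bar>"
    then obtain a b where ab: "s = a + b" "\<delta> = a * b" "1 < \<bar>a\<bar>" "1 < \<bar>b\<bar>" by blast
    then have n0: "a \<noteq> 0" "b \<noteq> 0" by auto
    show ?thesis
    proof (rule real_recurrence_tendsto_0[of "\<lambda>n. (Mi ^^ n) w" "1 / a" "1 / b"])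
      show "(Mi ^^ Suc (Suc n)) w = (1 / a + 1 / b) *\<^sub>R (Mi ^^ Suc n) w - (1 / a * (1 / b)) *\<^sub>R (Mi ^^ n) w" for n
      proof -
        have "s / \<delta> = 1 / a + 1 / b" "1 / \<delta> = 1 / a * (1 / b)" using n0 by (simp_all add: ab field_simps)
        then show ?thesis using rec[OF w, of n] by simp
      qed
    qed (use ab in \<open>simp_all add: abs_divide\<close>)
  qed
  \<comment> \<open>Convergence is known vector by vector. The basis vectors, projected to the plane
    along \<open>e\<close>, are finitely many, and their bounds add up to a uniform
    constant.\<close>
  define \<pi> where "\<pi> w = w - ((\<phi> \<bullet> w) / (\<phi> \<bullet> e)) *\<^sub>R e" for w
  have \<pi>0: "\<phi> \<bullet> \<pi> w = 0" for w using e(6) by (simp add: \<pi>_def inner_simps)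
  have lin\<pi>: "linear \<pi>"
    unfolding \<pi>_def by (rule linearI) (simp_all add: inner_simps algebra_simps add_divide_distrib)
  have "\<forall>b::real^3. \<exists>B>0. \<forall>n. norm ((Mi ^^ n) (\<pi> b)) \<le> B"
    using convergent_imp_bounded[OF lim[OF \<pi>0]] by (force simp: bounded_pos)
  then obtain B where B: "\<And>b::real^3. 0 < B b" "\<And>b n. norm ((Mi ^^ n) (\<pi> b)) \<le> B b" by metis
  define C where "C = (\<Sum>b\<in>Basis. B b)"
  have C: "0 < C" unfolding C_def by (rule sum_pos) (auto simp: B)
  have "norm ((Mi ^^ n) w) \<le> C * norm w" if w: "\<phi> \<bullet> w = 0" for n w
  proof -
    have l: "linear (\<lambda>w. (Mi ^^ n) (\<pi> w))"
      using linear_compose[OF lin\<pi> linear_funpow[OF lin]] by (simp add: o_def)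
    have "(Mi ^^ n) w = (Mi ^^ n) (\<pi> w)" using w by (simp add: \<pi>_def)
    also have "\<dots> = (Mi ^^ n) (\<pi> (\<Sum>b\<in>Basis. (w \<bullet> b) *\<^sub>R b))" by (simp add: euclidean_representation)
    also have "\<dots> = (\<Sum>b\<in>Basis. (w \<bullet> b) *\<^sub>R (Mi ^^ n) (\<pi> b))"
      by (simp add: linear_sum[OF l] linear_cmul[OF l])
    also have "norm \<dots> \<le> (\<Sum>b\<in>Basis. norm w * B b)"
    proof (rule sum_norm_le)
      fix b :: "real^3" assume "b \<in> Basis"
      then show "norm ((w \<bullet> b) *\<^sub>R (Mi ^^ n) (\<pi> b)) \<le> norm w * B b"
        using B(2)[of n b] Basis_le_norm[of b w] by (auto intro!: mult_mono)
    qed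
    finally show ?thesis by (simp add: C_def sum_distrib_left mult.commute)
  qed
  then show ?thesis unfolding hyp_split_def using e lim C by blast
qed

text \<open>The moduli of the eigenvalues multiply to 1 and none equals 1: the real values 1 and -1
  are excluded, and a complex pair on the circle would force the real eigenvalue there. So exactly
  one eigenvalue is alone on its side of the circle; it is real, because a complex pair lies on one
  side. If it is inside, \<open>M\<close> splits; if outside, the inverse does.\<close>

lemma hyperbolic_matrix_split:
  fixes M :: "real^3^3"
  assumes det: "\<bar>det M\<bar> = 1" and ev: "det (mat 1 - M) \<noteq> 0" "det (mat (-1) - M) \<noteq> 0"
    and inv: "\<And>w. M *v (Mi w) = w" "\<And>w. Mi (M *v w) = w" and lin: "linear Mi"
  shows "\<exists>e \<kappa> \<phi>. hyp_split ((*v) M) Mi e \<kappa> \<phi> \<or> hyp_split Mi ((*v) M) e \<kappa> \<phi>"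
proof -
  define t where "t = M$1$1 + M$2$2 + M$3$3"
  define m where "m = M$1$1 * M$2$2 - M$1$2 * M$2$1 + (M$1$1 * M$3$3 - M$1$3 * M$3$1) + (M$2$2 * M$3$3 - M$2$3 * M$3$2)"
  define d where "d = det M"
  have "det (mat 1 - M) = 1 - t + m - d"
    unfolding det_3 t_def m_def d_def by (simp add: mat_def algebra_simps)
  then have p1: "1 - t + m - d \<noteq> 0" using ev(1) by simp
  have "det (mat (-1) - M) = - 1 - t - m - d"
    unfolding det_3 t_def m_def d_def by (simp add: mat_def algebra_simps)
  then have p2: "- 1 - t - m - d \<noteq> 0" using ev(2) by simp
  have spec: "\<exists>e \<phi>. e \<noteq> 0 \<and> M *v e = \<kappa> *\<^sub>R e \<and> (\<forall>w. \<phi> \<bullet> (M *v w) = \<kappa> * (\<phi> \<bullet> w)) \<and> \<phi> \<bullet> e \<noteq> 0 \<and>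
     (\<forall>w. \<phi> \<bullet> w = 0 \<longrightarrow> M *v (M *v w) = s *\<^sub>R (M *v w) - \<delta> *\<^sub>R w)"
    if "\<And>x. x ^ 3 - t * x\<^sup>2 + m * x - d = (x - \<kappa>) * (x\<^sup>2 - s * x + \<delta>)" "\<kappa>\<^sup>2 - s * \<kappa> + \<delta> \<noteq> 0" for \<kappa> s \<delta>
  proof -
    \<comment> \<open>The coefficients of the quadratic factor are recovered from the values of the
      identity at 0, 1 and -1.\<close>
    have c: "d = \<kappa> * \<delta>" using that(1)[of 0] by simp
    have "1 - t + m - d = (1 - \<kappa>) * (1 - s + \<delta>)" using that(1)[of 1] by simp
    moreover have "- 1 - t - m - d = (- 1 - \<kappa>) * (1 + s + \<delta>)" using that(1)[of "-1"] by simp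
    ultimately have s: "s = t - \<kappa>" and "\<delta> + \<kappa> * s = m"
      using c by (auto simp: algebra_simps)
    then have \<delta>: "\<delta> = \<kappa>\<^sup>2 - t * \<kappa> + m" by (auto simp: algebra_simps power2_eq_square)
    show ?thesis
      using rank_one_spectral[of \<kappa> M] that(1)[of \<kappa>] that(2)
      unfolding s \<delta> t_def m_def d_def by simp
  qed
  have fwd: "\<exists>e \<phi>. hyp_split ((*v) M) Mi e \<kappa> \<phi>"
    if "\<And>x. x ^ 3 - t * x\<^sup>2 + m * x - d = (x - \<kappa>) * (x\<^sup>2 - s * x + \<delta>)" "\<bar>\<kappa>\<bar> < 1" "\<kappa>\<^sup>2 - s * \<kappa> + \<delta> \<noteq> 0"
      "(s\<^sup>2 < 4 * \<delta> \<and> 1 < \<delta>) \<or> (\<exists>a b. s = a + b \<and> \<delta> = a * b \<and> 1 < \<bar>a\<bar> \<and> 1 < \<bar>b\<bar>)" for \<kappa> s \<delta>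
  proof -
    have c: "d = \<kappa> * \<delta>" using that(1)[of 0] by simp
    then have "\<kappa> \<noteq> 0" "\<delta> \<noteq> 0" using det by (auto simp: d_def)
    note n0 = this and lt = that(2) and rt = that(4) and sp = spec[OF that(1,3)]
    obtain e \<phi> where e: "e \<noteq> 0" "M *v e = \<kappa> *\<^sub>R e" "\<And>w. \<phi> \<bullet> (M *v w) = \<kappa> * (\<phi> \<bullet> w)" "\<phi> \<bullet> e \<noteq> 0"
      "\<And>w. \<phi> \<bullet> w = 0 \<Longrightarrow> M *v (M *v w) = s *\<^sub>R (M *v w) - \<delta> *\<^sub>R w"
      using sp by blast
    have "hyp_split ((*v) M) Mi e \<kappa> \<phi>"
      by (rule hyp_splitI[OF lin inv(1) e(1,2) n0(1) lt e(3,4,5) n0(2) rt])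
    then show ?thesis by blast
  qed
  \<comment> \<open>For the inverse the quadratic on the plane has coefficients
    \<open>s / \<delta>\<close> and \<open>1 / \<delta>\<close>, and its roots are the
    reciprocals.\<close>
  have bwd: "\<exists>e \<kappa> \<phi>. hyp_split Mi ((*v) M) e \<kappa> \<phi>"
    if "\<And>x. x ^ 3 - t * x\<^sup>2 + m * x - d = (x - \<kappa>) * (x\<^sup>2 - s * x + \<delta>)" "1 < \<bar>\<kappa>\<bar>" "\<kappa>\<^sup>2 - s * \<kappa> + \<delta> \<noteq> 0"
      "(s\<^sup>2 < 4 * \<delta> \<and> \<delta> < 1) \<or> (\<exists>a b. s = a + b \<and> \<delta> = a * b \<and> \<bar>a\<bar> < 1 \<and> \<bar>b\<bar> < 1)" for \<kappa> s \<delta>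
  proof -
    have c: "d = \<kappa> * \<delta>" using that(1)[of 0] by simp
    then have n0: "\<kappa> \<noteq> 0" "\<delta> \<noteq> 0" using det by (auto simp: d_def)
    note sp = spec[OF that(1,3)]
    obtain e \<phi> where e: "e \<noteq> 0" "M *v e = \<kappa> *\<^sub>R e" "\<And>w. \<phi> \<bullet> (M *v w) = \<kappa> * (\<phi> \<bullet> w)" "\<phi> \<bullet> e \<noteq> 0"
      "\<And>w. \<phi> \<bullet> w = 0 \<Longrightarrow> M *v (M *v w) = s *\<^sub>R (M *v w) - \<delta> *\<^sub>R w"
      using sp by blast
    have "hyp_split Mi ((*v) M) e (1 / \<kappa>) \<phi>"
    proof (rule hyp_splitI[where s = "s / \<delta>" and \<delta> = "1 / \<delta>"])
      show "linear ((*v) M)" by simp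
      show "Mi (M *v w) = w" for w by (rule inv)
      have "Mi (\<kappa> *\<^sub>R e) = e" using inv(2)[of e] unfolding e(2) .
      then have "(1 / \<kappa>) *\<^sub>R (\<kappa> *\<^sub>R Mi e) = (1 / \<kappa>) *\<^sub>R e" by (simp add: linear_cmul[OF lin])
      then show "Mi e = (1 / \<kappa>) *\<^sub>R e" using n0 by simp
      show phi: "\<phi> \<bullet> Mi w = 1 / \<kappa> * (\<phi> \<bullet> w)" for w using e(3)[of "Mi w"] n0 by (simp add: inv)
      show "1 / \<kappa> \<noteq> 0" "\<bar>1 / \<kappa>\<bar> < 1" "1 / \<delta> \<noteq> 0" using n0 that(2) by (simp_all add: abs_divide)
      show "Mi (Mi w) = (s / \<delta>) *\<^sub>R Mi w - (1 / \<delta>) *\<^sub>R w" if w: "\<phi> \<bullet> w = 0" for w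
      proof -
        have "w = s *\<^sub>R Mi w - \<delta> *\<^sub>R Mi (Mi w)" using e(5)[of "Mi (Mi w)"] w by (simp add: inv phi)
        then have "\<delta> *\<^sub>R Mi (Mi w) = s *\<^sub>R Mi w - w" by (simp add: algebra_simps)
        then have "(1 / \<delta>) *\<^sub>R (\<delta> *\<^sub>R Mi (Mi w)) = (1 / \<delta>) *\<^sub>R (s *\<^sub>R Mi w - w)" by simp
        then show ?thesis using n0 by (simp add: scaleR_diff_right)
      qed
      show "(s / \<delta>)\<^sup>2 < 4 * (1 / \<delta>) \<and> 1 < 1 / \<delta> \<or> (\<exists>a b. s / \<delta> = a + b \<and> 1 / \<delta> = a * b \<and> 1 < \<bar>a\<bar> \<and> 1 < \<bar>b\<bar>)"
        using that(4)
      proof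
        assume a: "s\<^sup>2 < 4 * \<delta> \<and> \<delta> < 1"
        then have "0 < \<delta>" using zero_le_power2[of s] by linarith
        then show ?thesis using a by (simp add: power_divide power2_eq_square field_simps)
      next
        assume "\<exists>a b. s = a + b \<and> \<delta> = a * b \<and> \<bar>a\<bar> < 1 \<and> \<bar>b\<bar> < 1"
        then obtain a b where ab: "s = a + b" "\<delta> = a * b" "\<bar>a\<bar> < 1" "\<bar>b\<bar> < 1" by blast
        then have "a \<noteq> 0" "b \<noteq> 0" using n0 by auto
        then have "s / \<delta> = 1 / a + 1 / b" "1 / \<delta> = 1 / a * (1 / b)" "1 < \<bar>1 / a\<bar>" "1 < \<bar>1 / b\<bar>"
          using ab by (simp_all add: field_simps abs_divide)
        then show ?thesis by blast
      qed
    qed (use e in auto)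
    then show ?thesis by blast
  qed
  obtain \<kappa> where \<kappa>: "\<kappa> ^ 3 - t * \<kappa>\<^sup>2 + m * \<kappa> - d = 0" using cubic_real_root by blast
  define s where "s = t - \<kappa>"
  define \<delta> where "\<delta> = \<kappa>\<^sup>2 - t * \<kappa> + m"
  have c: "d = \<kappa> * \<delta>" using \<kappa> by (simp add: \<delta>_def power2_eq_square power3_eq_cube algebra_simps)
  have fac: "x ^ 3 - t * x\<^sup>2 + m * x - d = (x - \<kappa>) * (x\<^sup>2 - s * x + \<delta>)" for x
    unfolding c by (simp add: s_def \<delta>_def power2_eq_square power3_eq_cube algebra_simps)
  have n1: "(1 - \<kappa>) * (1 - s + \<delta>) \<noteq> 0" using fac[of 1] p1 by simp
  have n2: "(- 1 - \<kappa>) * (1 + s + \<delta>) \<noteq> 0" using fac[of "-1"] p2 by simp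
  have d1: "\<bar>\<kappa>\<bar> * \<bar>\<delta>\<bar> = 1" using c det by (simp add: d_def abs_mult)
  have k1: "\<bar>\<kappa>\<bar> \<noteq> 1" using n1 n2 by (auto simp: abs_if split: if_splits)
  show ?thesis
  proof (cases "s\<^sup>2 < 4 * \<delta>")
    case True
    have "0 < (\<kappa> - s / 2)\<^sup>2 + (\<delta> - s\<^sup>2 / 4)" using True zero_le_power2[of "\<kappa> - s / 2"] by linarith
    then have ne: "\<kappa>\<^sup>2 - s * \<kappa> + \<delta> \<noteq> 0" by (simp add: power2_eq_square algebra_simps)
    have d0: "0 < \<delta>" using True zero_le_power2[of s] by linarith
    show ?thesis
    proof (cases "\<bar>\<kappa>\<bar> < 1")
      case lt: True
      have "1 < \<delta>"
      proof (rule ccontr)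
        assume "\<not> 1 < \<delta>"
        then have "\<bar>\<kappa>\<bar> * \<bar>\<delta>\<bar> \<le> \<bar>\<kappa>\<bar> * 1" using d0 by (intro mult_left_mono) auto
        then show False using d1 lt by simp
      qed
      then show ?thesis using fwd[OF fac lt ne] True by blast
    next
      case False
      then have gt: "1 < \<bar>\<kappa>\<bar>" using k1 by simp
      have "\<delta> < 1"
      proof (rule ccontr)
        assume "\<not> \<delta> < 1"
        then have "\<bar>\<kappa>\<bar> * 1 \<le> \<bar>\<kappa>\<bar> * \<bar>\<delta>\<bar>" by (intro mult_left_mono) auto
        then show False using d1 gt by simp
      qed
      then show ?thesis using bwd[OF fac gt ne] True by blast
    qed
  next
    case False
    define r where "r = sqrt (s\<^sup>2 / 4 - \<delta>)"
    define a where "a = s / 2 + r"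
    define b where "b = s / 2 - r"
    have r2: "r * r = s\<^sup>2 / 4 - \<delta>" using False by (simp add: r_def)
    have ab: "s = a + b" "\<delta> = a * b" using r2 by (auto simp: a_def b_def algebra_simps power2_eq_square)
    have fac3: "x ^ 3 - t * x\<^sup>2 + m * x - d = (x - \<kappa>) * ((x - a) * (x - b))" for x
      unfolding fac ab by (simp add: power2_eq_square algebra_simps)
    have prod: "\<bar>\<kappa>\<bar> * (\<bar>a\<bar> * \<bar>b\<bar>) = 1" using d1 by (simp add: ab abs_mult)
    have a1: "\<bar>a\<bar> \<noteq> 1" "\<bar>b\<bar> \<noteq> 1" using n1 n2 fac3[of 1] fac3[of "-1"] p1 p2 by (auto simp: abs_if split: if_splits)
    have F: ?thesis if "\<bar>x\<bar> < 1" "1 < \<bar>y\<bar>" "1 < \<bar>z\<bar>"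
      "\<And>u. u ^ 3 - t * u\<^sup>2 + m * u - d = (u - x) * ((u - y) * (u - z))" for x y z
    proof -
      have "u ^ 3 - t * u\<^sup>2 + m * u - d = (u - x) * (u\<^sup>2 - (y + z) * u + y * z)" for u
        unfolding that(4) by (simp add: power2_eq_square algebra_simps)
      moreover have "x\<^sup>2 - (y + z) * x + y * z = (x - y) * (x - z)" by (simp add: power2_eq_square algebra_simps)
      then have "x\<^sup>2 - (y + z) * x + y * z \<noteq> 0" using that by auto
      ultimately show ?thesis using fwd[of x "y + z" "y * z"] that by blast
    qed
    have G: ?thesis if "1 < \<bar>x\<bar>" "\<bar>y\<bar> < 1" "\<bar>z\<bar> < 1"
      "\<And>u. u ^ 3 - t * u\<^sup>2 + m * u - d = (u - x) * ((u - y) * (u - z))" for x y z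
    proof -
      have "u ^ 3 - t * u\<^sup>2 + m * u - d = (u - x) * (u\<^sup>2 - (y + z) * u + y * z)" for u
        unfolding that(4) by (simp add: power2_eq_square algebra_simps)
      moreover have "x\<^sup>2 - (y + z) * x + y * z = (x - y) * (x - z)" by (simp add: power2_eq_square algebra_simps)
      then have "x\<^sup>2 - (y + z) * x + y * z \<noteq> 0" using that by auto
      ultimately show ?thesis using bwd[of x "y + z" "y * z"] that by blast
    qed
    have perm1: "u ^ 3 - t * u\<^sup>2 + m * u - d = (u - a) * ((u - \<kappa>) * (u - b))" for u
      unfolding fac3 by (simp add: mult_ac)
    have perm2: "u ^ 3 - t * u\<^sup>2 + m * u - d = (u - b) * ((u - \<kappa>) * (u - a))" for u
      unfolding fac3 by (simp add: mult_ac)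
    \<comment> \<open>Moduli with product 1 cannot all lie on one side. Each of the six remaining
      patterns has one isolated root, which \<open>perm1\<close> and \<open>perm2\<close> bring to
      the front.\<close>
    have small: False if "\<bar>\<kappa>\<bar> < 1" "\<bar>a\<bar> < 1" "\<bar>b\<bar> < 1"
    proof -
      have "\<bar>a\<bar> * \<bar>b\<bar> \<le> 1" using that by (simp add: mult_le_one)
      then have "\<bar>\<kappa>\<bar> * (\<bar>a\<bar> * \<bar>b\<bar>) \<le> \<bar>\<kappa>\<bar> * 1" by (intro mult_left_mono) auto
      then show False using that prod by simp
    qed
    have big: False if "1 < \<bar>\<kappa>\<bar>" "1 < \<bar>a\<bar>" "1 < \<bar>b\<bar>"
    proof -
      have "1 * 1 \<le> \<bar>a\<bar> * \<bar>b\<bar>" using that by (intro mult_mono) auto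
      then have "\<bar>\<kappa>\<bar> * 1 \<le> \<bar>\<kappa>\<bar> * (\<bar>a\<bar> * \<bar>b\<bar>)" by (intro mult_left_mono) auto
      then show False using that prod by simp
    qed
    have "\<bar>\<kappa>\<bar> < 1 \<or> 1 < \<bar>\<kappa>\<bar>" "\<bar>a\<bar> < 1 \<or> 1 < \<bar>a\<bar>" "\<bar>b\<bar> < 1 \<or> 1 < \<bar>b\<bar>"
      using k1 a1 by linarith+
    then consider "\<bar>\<kappa>\<bar> < 1" "\<bar>a\<bar> < 1" "\<bar>b\<bar> < 1" | "1 < \<bar>\<kappa>\<bar>" "1 < \<bar>a\<bar>" "1 < \<bar>b\<bar>"
      | "\<bar>\<kappa>\<bar> < 1" "1 < \<bar>a\<bar>" "1 < \<bar>b\<bar>" | "\<bar>a\<bar> < 1" "1 < \<bar>\<kappa>\<bar>" "1 < \<bar>b\<bar>" | "\<bar>b\<bar> < 1" "1 < \<bar>\<kappa>\<bar>" "1 < \<bar>a\<bar>"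
      | "1 < \<bar>\<kappa>\<bar>" "\<bar>a\<bar> < 1" "\<bar>b\<bar> < 1" | "1 < \<bar>a\<bar>" "\<bar>\<kappa>\<bar> < 1" "\<bar>b\<bar> < 1" | "1 < \<bar>b\<bar>" "\<bar>\<kappa>\<bar> < 1" "\<bar>a\<bar> < 1"
      by blast
    then show ?thesis
    proof cases
      case 1 then show ?thesis using small by blast
    next
      case 2 then show ?thesis using big by blast
    next
      case 3 then show ?thesis using F fac3 by blast
    next
      case 4 then show ?thesis using F perm1 by blast
    next
      case 5 then show ?thesis using F perm2 by blast
    next
      case 6 then show ?thesis using G fac3 by blast
    next
      case 7 then show ?thesis using G perm1 by blast
    next
      case 8 then show ?thesis using G perm2 by blast
    qed
  qed
qed

section \<open>Minimal sets and Baire category\<close>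

text \<open>Closed forward invariant subsets of the torus, encoded by their preimages in
  \<open>real^3\<close>. Compactness is recovered by cutting with \<open>ucube\<close>, which meets
  every lattice orbit.\<close>

definition invariant_closed :: "(real^3 \<Rightarrow> real^3) \<Rightarrow> (real^3) set \<Rightarrow> bool" where
  "invariant_closed F K \<longleftrightarrow> closed K \<and> K \<noteq> {} \<and> (\<forall>x\<in>K. F x \<in> K) \<and> (\<forall>x\<in>K. \<forall>n. ivec n \<longrightarrow> x + n \<in> K)"

definition minimal_set :: "(real^3 \<Rightarrow> real^3) \<Rightarrow> (real^3) set \<Rightarrow> bool" where
  "minimal_set F K \<longleftrightarrow> invariant_closed F K \<and> (\<forall>K'\<subseteq>K. invariant_closed F K' \<longrightarrow> K' = K)"

lemma invariant_closed_funpow: "invariant_closed F K \<Longrightarrow> x \<in> K \<Longrightarrow> (F ^^ n) x \<in> K"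
  by (induction n) (auto simp: invariant_closed_def)

text \<open>Zorn's lemma is applied to complements, so that unions of chains become intersections.
  Compactness of the parts in \<open>ucube\<close> keeps these intersections nonempty.\<close>

lemma minimal_set_exists:
  assumes "invariant_closed F K0"
  shows "\<exists>K\<subseteq>K0. minimal_set F K"
proof -
  let ?A = "{- K |K. invariant_closed F K \<and> K \<subseteq> K0}"
  have "\<exists>M\<in>?A. \<forall>X\<in>?A. M \<subseteq> X \<longrightarrow> X = M"
  proof (rule subset_Zorn_nonempty)
    show "?A \<noteq> {}" using assms by blast
    fix \<C> assume ne: "\<C> \<noteq> {}" and ch: "subset.chain ?A \<C>"
    have sub: "\<C> \<subseteq> ?A" and cmp: "\<And>X Y. X \<in> \<C> \<Longrightarrow> Y \<in> \<C> \<Longrightarrow> X \<subseteq> Y \<or> Y \<subseteq> X"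
      using ch by (auto simp: subset_chain_def)
    have inv: "invariant_closed F (- X)" "- X \<subseteq> K0" if "X \<in> \<C>" for X using sub that by auto
    define J where "J = (\<Inter>X\<in>\<C>. - X)"
    have "\<Inter>((\<lambda>X. - X \<inter> ucube) ` \<C>) \<noteq> {}"
    proof (rule compact_chain)
      fix S assume "S \<in> (\<lambda>X. - X \<inter> ucube) ` \<C>"
      then show "compact S" using inv by (auto simp: invariant_closed_def intro!: closed_Int_compact)
    next
      show "{} \<notin> (\<lambda>X. - X \<inter> ucube) ` \<C>"
      proof
        assume "{} \<in> (\<lambda>X. - X \<inter> ucube) ` \<C>"
        then obtain X where X: "X \<in> \<C>" "- X \<inter> ucube = {}" by auto
        obtain x where "x \<in> - X" using inv(1)[OF X(1)] by (auto simp: invariant_closed_def)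
        moreover obtain n where "ivec n" "x + n \<in> ucube" using translate_into_ucube by blast
        ultimately have "x + n \<in> - X \<inter> ucube" using inv(1)[OF X(1)] by (auto simp: invariant_closed_def)
        then show False using X by blast
      qed
    next
      fix S T assume "S \<in> (\<lambda>X. - X \<inter> ucube) ` \<C> \<and> T \<in> (\<lambda>X. - X \<inter> ucube) ` \<C>"
      then obtain X Y where "X \<in> \<C>" "Y \<in> \<C>" "S = - X \<inter> ucube" "T = - Y \<inter> ucube" by auto
      then show "S \<subseteq> T \<or> T \<subseteq> S" using cmp[of X Y] by auto
    qed
    then have "J \<noteq> {}" using ne by (auto simp: J_def)
    moreover have "closed J" unfolding J_def using inv by (intro closed_INT) (auto simp: invariant_closed_def)
    moreover have "\<forall>x\<in>J. F x \<in> J" "\<forall>x\<in>J. \<forall>n. ivec n \<longrightarrow> x + n \<in> J"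
      using inv(1) unfolding J_def invariant_closed_def by blast+
    ultimately have "invariant_closed F J" by (simp add: invariant_closed_def)
    moreover have "J \<subseteq> K0" using ne inv(2) by (auto simp: J_def)
    moreover have "\<Union>\<C> = - J" by (auto simp: J_def)
    ultimately show "\<Union>\<C> \<in> ?A" by blast
  qed
  then obtain K where K: "invariant_closed F K" "K \<subseteq> K0" "\<forall>X\<in>?A. - K \<subseteq> X \<longrightarrow> X = - K" by blast
  have "K' = K" if "K' \<subseteq> K" "invariant_closed F K'" for K'
  proof -
    have "- K' \<in> ?A" using that K(2) by blast
    then have "- K' = - K" using K(3) that(1) by blast
    then show ?thesis by blast
  qed
  then show ?thesis using K unfolding minimal_set_def by blast
qed

text \<open>The points of \<open>K\<close> whose forward orbit never enters the lattice translates
  of \<open>U\<close> would form a proper invariant closed subset, so there are none. A finite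
  subcover inside \<open>ucube\<close> bounds the waiting time.\<close>

lemma minimal_set_visits:
  assumes K: "minimal_set F K" and F: "continuous_on UNIV F" "int_equivariant F" and U: "open U" "U \<inter> K \<noteq> {}"
  shows "\<exists>m. \<forall>x\<in>K. \<exists>j\<le>m. \<exists>n. ivec n \<and> (F ^^ j) x + n \<in> U"
proof -
  have iK: "invariant_closed F K" using K by (simp add: minimal_set_def)
  define U' where "U' = (\<Union>n\<in>{n. ivec n}. (\<lambda>x. x + n) -` U)"
  have U': "open U'" unfolding U'_def
    by (intro open_UN ballI open_vimage U continuous_intros)
  have U'p: "x + n \<in> U' \<longleftrightarrow> x \<in> U'" if n: "ivec n" for x n
  proof
    assume "x + n \<in> U'"
    then obtain m where "ivec m" "x + n + m \<in> U" by (auto simp: U'_def)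
    then show "x \<in> U'" using ivec_add[OF n, of m] by (auto simp: U'_def add.assoc)
  next
    assume "x \<in> U'"
    then obtain m where "ivec m" "x + m \<in> U" by (auto simp: U'_def)
    then show "x + n \<in> U'" using ivec_diff[of m n] n by (auto simp: U'_def intro!: exI[of _ "m - n"])
  qed
  have cF: "continuous_on UNIV (F ^^ j)" for j
  proof (induction j)
    case (Suc j)
    then show ?case using F(1) by (simp add: continuous_on_compose2 o_def)
  qed (simp add: id_def continuous_on_id)
  define V where "V j = (F ^^ j) -` U'" for j
  have V: "open (V j)" for j unfolding V_def by (intro open_vimage U' cF)
  have Vp: "x + n \<in> V j \<longleftrightarrow> x \<in> V j" if n: "ivec n" for x n j
  proof -
    obtain m where "ivec m" "(F ^^ j) (x + n) = (F ^^ j) x + m"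
      using int_equivariantD[OF int_equivariant_funpow[OF F(2), of j] n] by blast
    then show ?thesis by (simp add: V_def U'p)
  qed
  have cov: "K \<subseteq> (\<Union>j. V j)"
  proof (rule ccontr)
    assume neg: "\<not> K \<subseteq> (\<Union>j. V j)"
    define K' where "K' = K - (\<Union>j. V j)"
    have "closed K'" unfolding K'_def using iK V by (intro closed_Diff open_UN) (auto simp: invariant_closed_def)
    moreover have "F x \<in> K'" if "x \<in> K'" for x
    proof -
      have "F x \<in> K" using that iK by (auto simp: K'_def invariant_closed_def)
      moreover have "F x \<notin> V j" for j using that by (auto simp: K'_def V_def funpow_swap1 dest: spec[of _ "Suc j"])
      ultimately show ?thesis by (simp add: K'_def)
    qed
    moreover have "x + n \<in> K'" if "x \<in> K'" "ivec n" for x n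
      using that iK Vp by (auto simp: K'_def invariant_closed_def)
    ultimately have "invariant_closed F K'" using neg by (auto simp: invariant_closed_def K'_def)
    then have "K' = K" using K by (auto simp: minimal_set_def K'_def)
    moreover obtain x where "x \<in> U" "x \<in> K" using U by blast
    then have "x \<in> V 0" by (auto simp: V_def U'_def intro!: exI[of _ 0])
    ultimately show False using \<open>x \<in> K\<close> by (auto simp: K'_def)
  qed
  have "compact (K \<inter> ucube)" using iK by (intro closed_Int_compact) (auto simp: invariant_closed_def)
  then obtain J where J: "finite J" "K \<inter> ucube \<subseteq> (\<Union>j\<in>J. V j)"
    using compactE_image[of "K \<inter> ucube" UNIV V] V cov by (metis UNIV_I le_infI1 subset_UNIV)
  have "\<exists>j\<le>Max (insert 0 J). \<exists>n. ivec n \<and> (F ^^ j) x + n \<in> U" if x: "x \<in> K" for x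
  proof -
    obtain n where n: "ivec n" "x + n \<in> ucube" using translate_into_ucube by blast
    then have "x + n \<in> K \<inter> ucube" using x iK by (auto simp: invariant_closed_def)
    then obtain j where j: "j \<in> J" "x + n \<in> V j" using J by blast
    then have "x \<in> V j" using Vp n by blast
    moreover have "j \<le> Max (insert 0 J)" using J j by simp
    ultimately show ?thesis by (auto simp: V_def U'_def)
  qed
  then show ?thesis by blast
qed

text \<open>A function of the first Baire class that is below 1 on a minimal set is bounded away from 1 on
  some relatively open part of it, and every orbit segment of a fixed length meets that part.\<close>

lemma uniform_product_on_minimal_set:
  fixes \<phi> :: "real^3 \<Rightarrow> real"
  assumes K: "minimal_set F K" and F: "continuous_on UNIV F" "int_equivariant F"
    and \<phi>: "\<And>x. 0 < \<phi> x" "\<And>x. \<phi> x < 1" "periodic \<phi>"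
    and baire1: "\<And>x. \<exists>W d. open W \<and> x \<in> W \<and> (\<forall>n. continuous_on W (d n)) \<and> (\<forall>y\<in>W. (\<lambda>n::nat. d n y) \<longlonglongrightarrow> \<phi> y)"
  shows "\<exists>L \<eta>. 0 < L \<and> \<eta> < 1 \<and> (\<forall>x\<in>K. (\<Prod>j<L. \<phi> ((F ^^ j) x)) \<le> \<eta>)"
proof -
  have iK: "invariant_closed F K" using K by (simp add: minimal_set_def)
  then obtain x0 where x0: "x0 \<in> K" by (auto simp: invariant_closed_def)
  obtain Q d where Q: "open Q" "x0 \<in> Q" "\<And>n. continuous_on Q (d n)" "\<And>y. y \<in> Q \<Longrightarrow> (\<lambda>n::nat. d n y) \<longlonglongrightarrow> \<phi> y"
    using baire1[of x0] by blast
  obtain r where r: "0 < r" "cball x0 r \<subseteq> Q" using Q open_contains_cball by blast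
  define S where "S = closure (K \<inter> ball x0 r)"
  have SK: "S \<subseteq> K" unfolding S_def using iK by (intro closure_minimal) (auto simp: invariant_closed_def)
  have SQ: "S \<subseteq> cball x0 r" unfolding S_def by (intro closure_minimal) auto
  define c where "c N = 1 - 1 / real (Suc N)" for N
  \<comment> \<open>One index serves as the start of the tail and as the threshold, since
    \<open>c N\<close> increases to 1. The sets are closed in \<open>S\<close> even if
    \<open>\<phi>\<close> is discontinuous, and they cover \<open>S\<close> because
    \<open>\<phi> < 1\<close>.\<close>
  define C where "C N = {y \<in> S. \<forall>n\<ge>N. d n y \<le> c N}" for N
  have clC: "closedin (top_of_set S) (C N)" for N
  proof -
    have "C N = (\<Inter>n\<in>{N..}. {y \<in> S. d n y \<le> c N})" by (auto simp: C_def)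
    moreover have "closedin (top_of_set S) {y \<in> S. d n y \<le> c N}" for n
    proof -
      have "continuous_on S (d n)" using Q(3) r SQ continuous_on_subset by blast
      then have "closedin (top_of_set S) (S \<inter> d n -` {..c N})"
        by (intro continuous_closedin_preimage) auto
      moreover have "S \<inter> d n -` {..c N} = {y \<in> S. d n y \<le> c N}" by auto
      ultimately show ?thesis by simp
    qed
    ultimately show ?thesis by (auto intro!: closedin_INT)
  qed
  have cov: "S \<subseteq> (\<Union>N. C N)"
  proof
    fix y assume y: "y \<in> S"
    then have lim: "(\<lambda>n. d n y) \<longlonglongrightarrow> \<phi> y" using Q(4) r SQ by blast
    have "(\<lambda>N. 1 - inverse (real (Suc N))) \<longlonglongrightarrow> 1 - 0" by (intro tendsto_intros LIMSEQ_inverse_real_of_nat)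
    then have "c \<longlonglongrightarrow> 1" by (simp add: c_def[abs_def] inverse_eq_divide)
    then have "\<forall>\<^sub>F N in sequentially. (\<phi> y + 1) / 2 < c N" using \<phi>(2)[of y] by (intro order_tendstoD) auto
    moreover have "\<forall>\<^sub>F n in sequentially. d n y < (\<phi> y + 1) / 2" using lim \<phi>(2)[of y] by (intro order_tendstoD) auto
    ultimately have "\<forall>\<^sub>F n in sequentially. (\<phi> y + 1) / 2 < c n \<and> d n y < (\<phi> y + 1) / 2"
      by (rule eventually_conj)
    then obtain N where N: "\<And>n. n \<ge> N \<Longrightarrow> (\<phi> y + 1) / 2 < c n \<and> d n y < (\<phi> y + 1) / 2"
      by (auto simp: eventually_sequentially)
    have "d n y \<le> c N" if "n \<ge> N" for n using N[OF that] N[of N] by linarith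
    then have "y \<in> C N" using y by (simp add: C_def)
    then show "y \<in> (\<Union>N. C N)" by blast
  qed
  \<comment> \<open>Baire in dual form: were all complements dense in \<open>S\<close>, so would be
    their intersection, which is empty. Some \<open>C N\<close> therefore has interior relative to
    \<open>S\<close>.\<close>
  have "\<exists>N. \<not> S \<subseteq> closure (S - C N)"
  proof (rule ccontr)
    assume "\<nexists>N. \<not> S \<subseteq> closure (S - C N)"
    then have dense: "S \<subseteq> closure (S - C N)" for N by blast
    have "S \<subseteq> closure (\<Inter>(range (\<lambda>N. S - C N)))"
    proof (rule Baire)
      show "closed S" by (simp add: S_def)
      show "countable (range (\<lambda>N. S - C N))" by simp
      fix T assume "T \<in> range (\<lambda>N. S - C N)"
      then show "openin (top_of_set S) T \<and> S \<subseteq> closure T"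
        using dense clC by (auto simp: closedin_def)
    qed
    moreover have "\<Inter>(range (\<lambda>N. S - C N)) = {}" using cov by auto
    ultimately have "S = {}" by (simp only: closure_empty subset_empty)
    moreover have "x0 \<in> S" unfolding S_def using x0 r(1) closure_subset[of "K \<inter> ball x0 r"] by auto
    ultimately show False by blast
  qed
  then obtain N y where y: "y \<in> S" "y \<notin> closure (S - C N)" by blast
  define U where "U = - closure (S - C N) \<inter> ball x0 r"
  have U: "open U" unfolding U_def by (intro open_Int open_Compl) auto
  have "- closure (S - C N) \<inter> (K \<inter> ball x0 r) \<noteq> {}"
    using y open_Int_closure_eq_empty[of "- closure (S - C N)" "K \<inter> ball x0 r"] by (auto simp: S_def)
  then have UK: "U \<inter> K \<noteq> {}" by (auto simp: U_def)
  have small: "\<phi> z \<le> c N" if "z \<in> U" "z \<in> K" for z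
  proof -
    have zS: "z \<in> S" using that closure_subset[of "K \<inter> ball x0 r"] by (auto simp: U_def S_def)
    then have "z \<in> C N" using that(1) closure_subset[of "S - C N"] by (auto simp: U_def)
    then have "\<forall>n\<ge>N. d n z \<le> c N" by (simp add: C_def)
    moreover have "(\<lambda>n. d n z) \<longlonglongrightarrow> \<phi> z" using Q(4) r SQ zS by blast
    ultimately show ?thesis by (meson LIMSEQ_le_const2)
  qed
  obtain m where m: "\<And>x. x \<in> K \<Longrightarrow> \<exists>j\<le>m. \<exists>n. ivec n \<and> (F ^^ j) x + n \<in> U"
    using minimal_set_visits[OF K F U UK] by blast
  have "(\<Prod>j<Suc m. \<phi> ((F ^^ j) x)) \<le> c N" if x: "x \<in> K" for x
  proof -
    obtain j n where j: "j \<le> m" "ivec n" "(F ^^ j) x + n \<in> U" using m[OF x] by blast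
    have "(F ^^ j) x + n \<in> K" using iK invariant_closed_funpow[OF iK x] j by (auto simp: invariant_closed_def)
    then have le: "\<phi> ((F ^^ j) x) \<le> c N" using small j periodicD[OF \<phi>(3) j(2)] by metis
    have "(\<Prod>j<Suc m. \<phi> ((F ^^ j) x)) = \<phi> ((F ^^ j) x) * (\<Prod>i\<in>{..<Suc m} - {j}. \<phi> ((F ^^ i) x))"
      using j(1) by (intro prod.remove) auto
    also have "\<dots> \<le> \<phi> ((F ^^ j) x) * 1"
      using \<phi> less_imp_le by (intro mult_left_mono prod_le_1) (auto intro: less_imp_le)
    finally show ?thesis using le by simp
  qed
  moreover have "c N < 1" by (simp add: c_def)
  ultimately show ?thesis by blast
qed

text \<open>A block of length \<open>L\<close> shrinks the product by \<open>h\<close>, so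
  \<open>q\<close> is the \<open>L\<close>-th root of \<open>h\<close>; the factor
  \<open>1 / h\<close> absorbs an incomplete last block. Taking the maximum with \<open>1/2\<close>
  keeps \<open>h\<close> positive.\<close>

lemma product_exponential_bound:
  fixes \<phi> :: "'a \<Rightarrow> real"
  assumes inv: "\<And>x. x \<in> S \<Longrightarrow> F x \<in> S" and \<phi>: "\<And>x. x \<in> S \<Longrightarrow> 0 < \<phi> x" "\<And>x. x \<in> S \<Longrightarrow> \<phi> x \<le> 1"
    and L: "0 < L" "\<eta> < 1" "\<And>x. x \<in> S \<Longrightarrow> (\<Prod>j<L. \<phi> ((F ^^ j) x)) \<le> \<eta>"
  shows "\<exists>C q. 0 < C \<and> 0 < q \<and> q < 1 \<and> (\<forall>x\<in>S. \<forall>n. (\<Prod>j<n. \<phi> ((F ^^ j) x)) \<le> C * q ^ n)"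
proof -
  define h where "h = max \<eta> (1/2)"
  have h: "0 < h" "h < 1" using L by (auto simp: h_def)
  define q where "q = root L h"
  have q: "0 < q" "q < 1" "q ^ L = h"
    using h L by (simp_all add: q_def real_root_pow_pos2)
  have invn: "(F ^^ n) x \<in> S" if "x \<in> S" for x n using that by (induction n) (auto simp: inv)
  define P where "P n x = (\<Prod>j<n. \<phi> ((F ^^ j) x))" for n x
  have P1: "P n x \<le> 1" "0 < P n x" if "x \<in> S" for n x
  proof -
    show "P n x \<le> 1" unfolding P_def
      by (rule prod_le_1) (use \<phi> invn[OF that] less_imp_le in blast)
    show "0 < P n x" unfolding P_def
      by (rule prod_pos) (use \<phi> invn[OF that] in blast)
  qed
  have PL: "P (n + L) x \<le> h * P n x" if x: "x \<in> S" for n x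
  proof -
    have "P (n + L) x = P n x * P L ((F ^^ n) x)"
    proof (induction L)
      case (Suc k)
      then show ?case by (simp add: P_def funpow_add add.commute[of n])
    qed (simp add: P_def)
    moreover have "P L ((F ^^ n) x) \<le> h" using L(3)[OF invn[OF x]] by (simp add: P_def h_def le_max_iff_disj)
    ultimately show ?thesis using P1[OF x, of n] by (simp add: mult.commute mult_left_mono)
  qed
  have "h * P n x \<le> q ^ n" if x: "x \<in> S" for n x
  proof (induction n rule: less_induct)
    case (less n)
    show ?case
    proof (cases "n < L")
      case True
      have "h * P n x \<le> h * 1" using P1[OF x] h by (intro mult_left_mono) auto
      also have "\<dots> = q ^ L" using q by simp
      also have "\<dots> \<le> q ^ n" using q True by (intro power_decreasing) auto
      finally show ?thesis .
    next
      case False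
      define m where "m = n - L"
      have n: "n = m + L" "m < n" using False L by (auto simp: m_def)
      have "h * P n x \<le> h * (h * P m x)" using PL[OF x, of m] h n by (intro mult_left_mono) auto
      also have "\<dots> \<le> h * q ^ m" using less[OF n(2)] h by (intro mult_left_mono) auto
      also have "\<dots> = q ^ n" unfolding n(1) using q by (simp add: power_add)
      finally show ?thesis .
    qed
  qed
  then have "\<forall>x\<in>S. \<forall>n. P n x \<le> (1 / h) * q ^ n" using h by (simp add: field_simps)
  then show ?thesis unfolding P_def using h q by (intro exI[of _ "1 / h"] exI[of _ q]) auto
qed

lemma lfield_cocycle:
  assumes A: "lfield A" and F: "continuous_on UNIV F" "int_equivariant F"
  shows "lfield (cocycle F A n)"
  unfolding lfield_def
proof (induction n)
  case 0
  have "cocycle F A 0 = (\<lambda>x v. v)" by (intro ext) simp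
  then show ?case by (auto simp: periodic_def linear_id[unfolded id_def] intro!: continuous_intros)
next
  case (Suc n)
  have cF: "continuous_on UNIV (F ^^ n)"
  proof (induction n)
    case (Suc j)
    then show ?case using F(1) by (simp add: continuous_on_compose2 o_def)
  qed (simp add: id_def continuous_on_id)
  have "linear (cocycle F A (Suc n) x)" for x
    using Suc linear_compose[of "cocycle F A n x" "A ((F ^^ n) x)"] lfield_linear[OF A]
    by (simp add: o_def cocycle.simps[abs_def] fun_eq_iff)
  moreover have "continuous_on UNIV (\<lambda>z. cocycle F A (Suc n) (fst z) (snd z))"
    unfolding cocycle.simps
    using Suc by (intro lfield_continuous[OF A] continuous_on_compose2[OF cF] continuous_intros) auto
  moreover have "periodic (cocycle F A (Suc n))"
    unfolding periodic_def
  proof (intro allI impI)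
    fix x m :: "real^3" assume m: "ivec m"
    obtain m' where "ivec m'" "(F ^^ n) (x + m) = (F ^^ n) x + m'"
      using int_equivariantD[OF int_equivariant_funpow[OF F(2), of n] m] by blast
    then show "cocycle F A (Suc n) (x + m) = cocycle F A (Suc n) x"
      using Suc m lfield_periodic[OF A] by (intro ext) (simp add: periodic_def)
  qed
  ultimately show ?case by blast
qed

text \<open>Divide by \<open>d ^ n\<close> and let \<open>n\<close> grow. Three terms suit a vector
  compared with its components in a threefold splitting; surplus terms are given coefficient
  0.\<close>

lemma exp_sum_dominates:
  fixes c :: real
  assumes "\<And>n. c * d ^ n \<le> C1 * t1 ^ n + C2 * t2 ^ n + C3 * t3 ^ n"
    and "0 \<le> t1" "t1 < d" "0 \<le> t2" "t2 < d" "0 \<le> t3" "t3 < d"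
  shows "c \<le> 0"
proof -
  have d: "0 < d" using assms by linarith
  have "(\<lambda>n. C1 * (t1 / d) ^ n + C2 * (t2 / d) ^ n + C3 * (t3 / d) ^ n) \<longlonglongrightarrow> C1 * 0 + C2 * 0 + C3 * 0"
    using assms d by (intro tendsto_intros LIMSEQ_power_zero) auto
  moreover have "c \<le> C1 * (t1 / d) ^ n + C2 * (t2 / d) ^ n + C3 * (t3 / d) ^ n" for n
  proof -
    have "C1 * (t1 / d) ^ n + C2 * (t2 / d) ^ n + C3 * (t3 / d) ^ n = (C1 * t1 ^ n + C2 * t2 ^ n + C3 * t3 ^ n) / d ^ n"
      by (simp add: power_divide add_divide_distrib)
    then show ?thesis using assms(1)[of n] d by (simp add: pos_le_divide_eq)
  qed
  ultimately show ?thesis by (metis (no_types, lifting) LIMSEQ_le_const mult_zero_right add_0)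
qed

text \<open>Locally the line field is of first Baire class: a pointwise limit of continuous vector
  fields without zeros. This much follows from charts whose plaques are differentiable, with no
  continuity of the tangent lines across plaques.\<close>

definition line_approx :: "(real^3 \<Rightarrow> (real^3) set) \<Rightarrow> bool" where
  "line_approx E \<longleftrightarrow> (\<forall>x. \<exists>W d D. open W \<and> x \<in> W \<and> (\<forall>n::nat. continuous_on W (d n)) \<and>
     (\<forall>y\<in>W. (\<lambda>n. d n y) \<longlonglongrightarrow> D y \<and> D y \<in> E y \<and> D y \<noteq> 0 \<and> (\<forall>n. d n y \<noteq> 0)))"

section \<open>Uniform rates and continuity of the splitting\<close>

text \<open>The situation lifted to \<open>real^3\<close>, with \<open>N\<close> the lifted norm of
  the metric. Rates are strict but pointwise, as on the torus; how \<open>\<sigma>\<close> and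
  \<open>\<mu>\<close> compare with 1 enters later.\<close>

locale ph =
  fixes F Fi :: "real^3 \<Rightarrow> real^3" and A Ai :: "real^3 \<Rightarrow> real^3 \<Rightarrow> real^3" and N :: "real^3 \<Rightarrow> real^3 \<Rightarrow> real"
    and Es Ec Eu :: "real^3 \<Rightarrow> (real^3) set" and \<sigma> \<mu> :: real
  assumes FFi: "\<And>x. F (Fi x) = x" and FiF: "\<And>x. Fi (F x) = x"
    and F_eq: "int_equivariant F" and Fi_eq: "int_equivariant Fi"
    and A_lf: "lfield A" and Ai_lf: "lfield Ai"
    and F_der: "\<And>x. (F has_derivative A x) (at x)" and Fi_der: "\<And>x. (Fi has_derivative Ai x) (at x)"
    and AiA: "\<And>x v. Ai (F x) (A x v) = v" and AAi: "\<And>x v. A x (Ai (F x) v) = v"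
    and N_cont: "continuous_on UNIV (\<lambda>z. N (fst z) (snd z))" and N_per: "periodic N"
    and N_scale: "\<And>x t v. N x (t *\<^sub>R v) = \<bar>t\<bar> * N x v" and N_pos: "\<And>x v. v \<noteq> 0 \<Longrightarrow> 0 < N x v"
    and sub: "\<And>x. subspace (Es x)" "\<And>x. subspace (Ec x)" "\<And>x. subspace (Eu x)"
    and dim1: "\<And>x. dim (Es x) = 1" "\<And>x. dim (Ec x) = 1" "\<And>x. dim (Eu x) = 1"
    and decomp: "\<And>x v. \<exists>a\<in>Es x. \<exists>b\<in>Ec x. \<exists>c\<in>Eu x. v = a + b + c"
    and inv: "\<And>x. A x ` Es x = Es (F x)" "\<And>x. A x ` Ec x = Ec (F x)" "\<And>x. A x ` Eu x = Eu (F x)"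
    and per: "periodic Es" "periodic Ec" "periodic Eu"
    and rate_s: "\<And>x v. v \<in> Es x \<Longrightarrow> v \<noteq> 0 \<Longrightarrow> N (F x) (A x v) < \<sigma> * N x v"
    and rate_c: "\<And>x v. v \<in> Ec x \<Longrightarrow> v \<noteq> 0 \<Longrightarrow> \<sigma> * N x v < N (F x) (A x v)"
      "\<And>x v. v \<in> Ec x \<Longrightarrow> v \<noteq> 0 \<Longrightarrow> N (F x) (A x v) < \<mu> * N x v"
    and rate_u: "\<And>x v. v \<in> Eu x \<Longrightarrow> v \<noteq> 0 \<Longrightarrow> \<mu> * N x v < N (F x) (A x v)"
    and \<sigma>\<mu>: "0 < \<sigma>" "\<sigma> < \<mu>"
    and approx: "line_approx Es" "line_approx Ec" "line_approx Eu"
begin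

abbreviation "D \<equiv> cocycle F A"

lemma F_cont: "continuous_on UNIV F"
  by (intro continuous_at_imp_continuous_on ballI has_derivative_continuous[OF F_der])

lemma Fi_cont: "continuous_on UNIV Fi"
  by (intro continuous_at_imp_continuous_on ballI has_derivative_continuous[OF Fi_der])

lemma F_pow_cont: "continuous_on UNIV (F ^^ n)"
proof (induction n)
  case (Suc j)
  then show ?case using F_cont by (simp add: continuous_on_compose2 o_def)
qed (simp add: id_def continuous_on_id)

lemma D_lf: "lfield (D n)"
  by (rule lfield_cocycle[OF A_lf F_cont F_eq])

lemmas A_lin = lfield_linear[OF A_lf] and D_lin = lfield_linear[OF D_lf]

lemma A_nz: "v \<noteq> 0 \<Longrightarrow> A x v \<noteq> 0"
  using AiA[of x v] lfield_linear[OF Ai_lf, of "F x"] linear_0 by metis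

lemma D_nz: "v \<noteq> 0 \<Longrightarrow> D n x v \<noteq> 0"
  by (induction n) (auto simp: A_nz)

lemma N_0 [simp]: "N x 0 = 0"
  using N_scale[of x 0 0] by simp

lemma N_nonneg: "0 \<le> N x v"
  using N_pos[of v x] by (cases "v = 0") auto

lemma N_continuous:
  assumes "continuous_on S f" "continuous_on S g"
  shows "continuous_on S (\<lambda>z. N (f z) (g z))"
proof -
  have "continuous_on S ((\<lambda>z. N (fst z) (snd z)) \<circ> (\<lambda>z. (f z, g z)))"
    by (intro continuous_on_compose continuous_intros assms continuous_on_subset[OF N_cont]) auto
  then show ?thesis by (simp add: o_def)
qed

lemma N_bounds: "\<exists>k K. 0 < k \<and> 0 < K \<and> (\<forall>x v. k * norm v \<le> N x v \<and> N x v \<le> K * norm v)"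
proof -
  let ?S = "ucube \<times> sphere (0::real^3) 1"
  let ?f = "\<lambda>z. N (fst z) (snd z)"
  have cS: "compact ?S" by (intro compact_Times compact_cbox compact_sphere)
  have ne: "?S \<noteq> {}"
  proof -
    have "(0, axis 1 1) \<in> ?S" by (auto simp: mem_box_cart norm_axis_1)
    then show ?thesis by blast
  qed
  have c: "continuous_on ?S ?f" using N_cont continuous_on_subset by blast
  obtain z1 where z1: "z1 \<in> ?S" "\<And>z. z \<in> ?S \<Longrightarrow> ?f z1 \<le> ?f z"
    using continuous_attains_inf[OF cS ne c] by blast
  obtain z2 where z2: "z2 \<in> ?S" "\<And>z. z \<in> ?S \<Longrightarrow> ?f z \<le> ?f z2"
    using continuous_attains_sup[OF cS ne c] by blast
  have b: "?f z1 * norm v \<le> N x v \<and> N x v \<le> ?f z2 * norm v" for x v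
  proof (cases "v = 0")
    case False
    obtain n where n: "ivec n" "x + n \<in> ucube" using translate_into_ucube by blast
    define u where "u = v /\<^sub>R norm v"
    have u: "norm u = 1" "norm v *\<^sub>R u = v" using False by (auto simp: u_def)
    have "(x + n, u) \<in> ?S" using n u by simp
    then have "?f z1 \<le> N (x + n) u" "N (x + n) u \<le> ?f z2"
      using z1(2)[of "(x + n, u)"] z2(2)[of "(x + n, u)"] by auto
    moreover have "N x v = norm v * N (x + n) u"
      using N_scale[of x "norm v" u] u(2) periodicD[OF N_per n(1)] by simp
    ultimately show ?thesis by (simp add: mult.commute mult_left_mono)
  qed simp
  have "snd z1 \<noteq> 0" "snd z2 \<noteq> 0" using z1(1) z2(1) by auto
  then have "0 < ?f z1" "0 < ?f z2" by (auto intro: N_pos)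
  then show ?thesis using b by blast
qed

section \<open>From pointwise to uniform rates\<close>

text \<open>One step measured against \<open>\<theta>\<close>. The quotient is inverted in
  \<open>p_lo\<close>, so that upper and lower rate bounds alike read \<open>p < 1\<close>. Both are
  homogeneous of degree 0 in the vector, hence depend on its line alone.\<close>

definition p_up :: "real \<Rightarrow> real^3 \<Rightarrow> real^3 \<Rightarrow> real" where
  "p_up \<theta> x v = N (F x) (A x v) / (\<theta> * N x v)"

definition p_lo :: "real \<Rightarrow> real^3 \<Rightarrow> real^3 \<Rightarrow> real" where
  "p_lo \<theta> x v = (\<theta> * N x v) / N (F x) (A x v)"

definition rate_fn :: "real \<Rightarrow> (real^3 \<Rightarrow> real^3 \<Rightarrow> real) \<Rightarrow> bool" where
  "rate_fn \<theta> p \<longleftrightarrow> p = p_up \<theta> \<or> p = p_lo \<theta>"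

lemma rate_fn_pos: "rate_fn \<theta> p \<Longrightarrow> 0 < \<theta> \<Longrightarrow> v \<noteq> 0 \<Longrightarrow> 0 < p x v"
  by (auto simp: rate_fn_def p_up_def p_lo_def N_pos A_nz)

lemma rate_fn_hom: "rate_fn \<theta> p \<Longrightarrow> t \<noteq> 0 \<Longrightarrow> p x (t *\<^sub>R v) = p x v"
  by (auto simp: rate_fn_def p_up_def p_lo_def N_scale linear_cmul[OF A_lin])

lemma rate_fn_periodic:
  assumes "rate_fn \<theta> p" "ivec n"
  shows "p (x + n) v = p x v"
proof -
  obtain m where "ivec m" "F (x + n) = F x + m" using int_equivariantD[OF F_eq assms(2)] by blast
  then show ?thesis using assms
    by (auto simp: rate_fn_def p_up_def p_lo_def periodicD[OF N_per] lfield_periodic[OF A_lf])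
qed

lemma rate_fn_continuous:
  assumes "rate_fn \<theta> p" "0 < \<theta>" "continuous_on S f" "continuous_on S g" "\<And>z. z \<in> S \<Longrightarrow> g z \<noteq> 0"
  shows "continuous_on S (\<lambda>z. p (f z) (g z))"
proof -
  have "continuous_on S (\<lambda>z. N (F (f z)) (A (f z) (g z)))"
    using assms by (intro N_continuous lfield_continuous[OF A_lf] continuous_on_compose2[OF F_cont]) auto
  moreover have "continuous_on S (\<lambda>z. N (f z) (g z))" using assms by (intro N_continuous)
  moreover have "N (F (f z)) (A (f z) (g z)) \<noteq> 0" "N (f z) (g z) \<noteq> 0" if "z \<in> S" for z
    using N_pos[of "g z" "f z"] N_pos[OF A_nz[of "g z" "f z"], of "F (f z)"] assms(5)[OF that] by auto
  ultimately show ?thesis using assms(1,2)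
    by (auto simp: rate_fn_def p_up_def p_lo_def intro!: continuous_intros)
qed

lemma rate_prod_up:
  assumes "v \<noteq> 0" "0 < \<theta>"
  shows "N ((F ^^ n) x) (D n x v) = (\<Prod>j<n. p_up \<theta> ((F ^^ j) x) (D j x v)) * \<theta> ^ n * N x v"
proof (induction n)
  case (Suc n)
  have "N ((F ^^ n) x) (D n x v) > 0" using D_nz N_pos assms by blast
  then have "N ((F ^^ Suc n) x) (D (Suc n) x v) = p_up \<theta> ((F ^^ n) x) (D n x v) * \<theta> * N ((F ^^ n) x) (D n x v)"
    using assms by (simp add: p_up_def)
  then show ?case by (simp add: Suc mult_ac)
qed simp

lemma rate_prod_lo:
  assumes "v \<noteq> 0" "0 < \<theta>"
  shows "\<theta> ^ n * N x v = (\<Prod>j<n. p_lo \<theta> ((F ^^ j) x) (D j x v)) * N ((F ^^ n) x) (D n x v)"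
proof (induction n)
  case (Suc n)
  have p: "N ((F ^^ Suc n) x) (D (Suc n) x v) > 0" using D_nz N_pos assms by blast
  then have "p_lo \<theta> ((F ^^ n) x) (D n x v) * N ((F ^^ Suc n) x) (D (Suc n) x v) = \<theta> * N ((F ^^ n) x) (D n x v)"
    using assms by (simp add: p_lo_def)
  then have "(\<Prod>j<Suc n. p_lo \<theta> ((F ^^ j) x) (D j x v)) * N ((F ^^ Suc n) x) (D (Suc n) x v)
     = (\<Prod>j<n. p_lo \<theta> ((F ^^ j) x) (D j x v)) * (\<theta> * N ((F ^^ n) x) (D n x v))"
    by (simp only: prod.lessThan_Suc mult.assoc)
  also have "\<dots> = \<theta> * (\<theta> ^ n * N x v)" unfolding Suc by (simp only: mult_ac)
  finally show ?case by simp
qed simp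

definition line :: "(real^3 \<Rightarrow> (real^3) set) \<Rightarrow> bool" where
  "line E \<longleftrightarrow> E = Es \<or> E = Ec \<or> E = Eu"

lemma lineD:
  assumes "line E"
  shows "subspace (E x)" "dim (E x) = 1" "A x ` E x = E (F x)" "periodic E" "line_approx E"
  by (use assms in \<open>unfold line_def, elim disjE; simp add: sub dim1 inv per approx\<close>)+

lemma line_ex: "line E \<Longrightarrow> \<exists>v\<in>E x. v \<noteq> 0"
  using lineD(2)[of E x] dim_eq_0[of "E x"] by (metis subsetI singletonI zero_neq_one)

lemma line_multiple:
  assumes "line E" "v \<in> E x" "w \<in> E x" "v \<noteq> 0"
  shows "\<exists>t. w = t *\<^sub>R v"
proof -
  have "span {v} = E x"
    using lineD(1,2)[OF assms(1), of x] assms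
    by (intro subspace_dim_equal) (auto simp: span_minimal dim_singleton)
  then show ?thesis using assms(3) by (auto simp: span_singleton)
qed

lemma D_line: "line E \<Longrightarrow> v \<in> E x \<Longrightarrow> D n x v \<in> E ((F ^^ n) x)"
  by (induction n) (use lineD(3)[of E] in auto)

lemma rate_fn_line:
  assumes "rate_fn \<theta> p" "line E" "v \<in> E x" "w \<in> E x" "v \<noteq> 0" "w \<noteq> 0"
  shows "p x v = p x w"
proof -
  obtain t where "w = t *\<^sub>R v" using line_multiple assms by blast
  moreover have "t \<noteq> 0" using calculation assms(6) by auto
  ultimately show ?thesis using rate_fn_hom[OF assms(1)] by simp
qed

text \<open>A choice of direction without any continuity. The rates evaluated on it have degree 0
  and so do not depend on the choice.\<close>

definition dir :: "(real^3 \<Rightarrow> (real^3) set) \<Rightarrow> real^3 \<Rightarrow> real^3" where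
  "dir E x = (SOME v. v \<in> E x \<and> v \<noteq> 0)"

lemma dir: "line E \<Longrightarrow> dir E x \<in> E x \<and> dir E x \<noteq> 0"
  unfolding dir_def by (rule someI_ex) (use line_ex in blast)

text \<open>The common form of all four rate inequalities, so that the passage to uniform rates is
  made only once.\<close>

definition subordinate :: "real \<Rightarrow> (real^3 \<Rightarrow> real^3 \<Rightarrow> real) \<Rightarrow> (real^3 \<Rightarrow> (real^3) set) \<Rightarrow> bool" where
  "subordinate \<theta> p E \<longleftrightarrow> 0 < \<theta> \<and> rate_fn \<theta> p \<and> line E \<and> (\<forall>x v. v \<in> E x \<longrightarrow> v \<noteq> 0 \<longrightarrow> p x v < 1)"

lemma subordinates:
  "subordinate \<sigma> (p_up \<sigma>) Es" "subordinate \<sigma> (p_lo \<sigma>) Ec" "subordinate \<mu> (p_up \<mu>) Ec" "subordinate \<mu> (p_lo \<mu>) Eu"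
proof -
  have "0 < \<mu>" using \<sigma>\<mu> by linarith
  then show "subordinate \<sigma> (p_up \<sigma>) Es" "subordinate \<sigma> (p_lo \<sigma>) Ec" "subordinate \<mu> (p_up \<mu>) Ec" "subordinate \<mu> (p_lo \<mu>) Eu"
    using \<sigma>\<mu>(1) rate_s rate_c rate_u
    by (auto simp: subordinate_def rate_fn_def line_def p_up_def p_lo_def N_pos A_nz)
qed

lemma subordinate_periodic:
  assumes "subordinate \<theta> p E"
  shows "periodic (\<lambda>x. p x (dir E x))"
proof -
  have E: "line E" "rate_fn \<theta> p" using assms by (auto simp: subordinate_def)
  show ?thesis unfolding periodic_def
  proof (intro allI impI)
    fix x n :: "real^3" assume n: "ivec n"
    have "dir E (x + n) = dir E x" unfolding dir_def using periodicD[OF lineD(4)[OF E(1)] n] by simp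
    then show "p (x + n) (dir E (x + n)) = p x (dir E x)" using rate_fn_periodic[OF E(2) n] by simp
  qed
qed

text \<open>Without continuity of the bundles a rate along a bundle is only a limit of continuous functions,
  namely of its values on the difference quotients of the charts.\<close>

lemma subordinate_baire:
  assumes s: "subordinate \<theta> p E"
  shows "\<exists>W d. open W \<and> x \<in> W \<and> (\<forall>n. continuous_on W (d n)) \<and> (\<forall>y\<in>W. (\<lambda>n::nat. d n y) \<longlonglongrightarrow> p y (dir E y))"
proof -
  have E: "line E" "rate_fn \<theta> p" "0 < \<theta>" using s by (auto simp: subordinate_def)
  obtain W d D' where W: "open W" "x \<in> W" "\<And>n::nat. continuous_on W (d n)"
    "\<And>y. y \<in> W \<Longrightarrow> (\<lambda>n. d n y) \<longlonglongrightarrow> D' y" "\<And>y. y \<in> W \<Longrightarrow> D' y \<in> E y \<and> D' y \<noteq> 0"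
    "\<And>y n. y \<in> W \<Longrightarrow> d n y \<noteq> 0"
    using lineD(5)[OF E(1)] unfolding line_approx_def by metis
  have "continuous_on W (\<lambda>y. p y (d n y))" for n
    using W by (intro rate_fn_continuous[OF E(2,3)] continuous_intros) auto
  moreover have "(\<lambda>n. p y (d n y)) \<longlonglongrightarrow> p y (dir E y)" if y: "y \<in> W" for y
  proof -
    have "continuous_on (- {0}) (\<lambda>v. p y v)"
      by (intro rate_fn_continuous[OF E(2,3)] continuous_intros) auto
    then have "isCont (\<lambda>v. p y v) (D' y)"
      using W(5)[OF y] by (simp add: continuous_on_eq_continuous_at open_Compl)
    then have "(\<lambda>n. p y (d n y)) \<longlonglongrightarrow> p y (D' y)"
      using W(4)[OF y] isCont_tendsto_compose by blast
    then show ?thesis using rate_fn_line[OF E(2,1)] W(5)[OF y] dir[OF E(1)] by metis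
  qed
  ultimately show ?thesis using W(1,2)
    by (intro exI[of _ W] exI[of _ "\<lambda>n y. p y (d n y)"] conjI) auto
qed

definition uniform_on :: "(real^3) set \<Rightarrow> (real^3 \<Rightarrow> real^3 \<Rightarrow> real) \<Rightarrow> (real^3 \<Rightarrow> (real^3) set) \<Rightarrow> bool" where
  "uniform_on S p E \<longleftrightarrow> (\<exists>C q. 0 < C \<and> 0 < q \<and> q < 1 \<and>
     (\<forall>x\<in>S. \<forall>v\<in>E x. v \<noteq> 0 \<longrightarrow> (\<forall>n. (\<Prod>j<n. p ((F ^^ j) x) (D j x v)) \<le> C * q ^ n)))"

text \<open>On a line bundle a rate depends only on the base point. The product along a vector's
  orbit is thus the product of one function along the orbit of \<open>x\<close>, to which
  \<open>product_exponential_bound\<close> applies.\<close>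

lemma uniform_onI:
  assumes s: "subordinate \<theta> p E" and S: "\<And>x. x \<in> S \<Longrightarrow> F x \<in> S"
    and L: "0 < L" "\<eta> < 1" "\<And>x. x \<in> S \<Longrightarrow> (\<Prod>j<L. p ((F ^^ j) x) (dir E ((F ^^ j) x))) \<le> \<eta>"
  shows "uniform_on S p E"
proof -
  have E: "line E" "rate_fn \<theta> p" "0 < \<theta>" "\<And>x v. v \<in> E x \<Longrightarrow> v \<noteq> 0 \<Longrightarrow> p x v < 1"
    using s by (auto simp: subordinate_def)
  have "\<exists>C q. 0 < C \<and> 0 < q \<and> q < 1 \<and> (\<forall>x\<in>S. \<forall>n. (\<Prod>j<n. p ((F ^^ j) x) (dir E ((F ^^ j) x))) \<le> C * q ^ n)"
  proof (rule product_exponential_bound[of S F "\<lambda>x. p x (dir E x)" L \<eta>, OF S _ _ L])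
    show "0 < p x (dir E x)" "p x (dir E x) \<le> 1" for x
      using rate_fn_pos[OF E(2,3), of "dir E x" x] E(4)[of "dir E x" x] dir[OF E(1), of x] by simp_all
  qed
  then obtain C q where C: "0 < C" "0 < q" "q < 1" "\<And>x n. x \<in> S \<Longrightarrow> (\<Prod>j<n. p ((F ^^ j) x) (dir E ((F ^^ j) x))) \<le> C * q ^ n"
    by blast
  have "p ((F ^^ j) x) (D j x v) = p ((F ^^ j) x) (dir E ((F ^^ j) x))" if "v \<in> E x" "v \<noteq> 0" for x v j
    using rate_fn_line[OF E(2,1) D_line[OF E(1) that(1)]] dir[OF E(1)] D_nz[OF that(2)] by blast
  then show ?thesis unfolding uniform_on_def using C by (intro exI[of _ C] exI[of _ q]) auto
qed

lemma uniform_on_minimal: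
  assumes s: "subordinate \<theta> p E" and K: "minimal_set F K"
  shows "uniform_on K p E"
proof -
  have E: "line E" "rate_fn \<theta> p" "0 < \<theta>" "\<And>x v. v \<in> E x \<Longrightarrow> v \<noteq> 0 \<Longrightarrow> p x v < 1"
    using s by (auto simp: subordinate_def)
  have "\<exists>L \<eta>. 0 < L \<and> \<eta> < 1 \<and> (\<forall>x\<in>K. (\<Prod>j<L. p ((F ^^ j) x) (dir E ((F ^^ j) x))) \<le> \<eta>)"
  proof (rule uniform_product_on_minimal_set[OF K F_cont F_eq _ _ subordinate_periodic[OF s] subordinate_baire[OF s]])
    show "0 < p x (dir E x)" "p x (dir E x) < 1" for x
      using rate_fn_pos[OF E(2,3), of "dir E x" x] E(4)[of "dir E x" x] dir[OF E(1), of x] by simp_all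
  qed
  then obtain L \<eta> where "0 < L" "\<eta> < 1" "\<And>x. x \<in> K \<Longrightarrow> (\<Prod>j<L. p ((F ^^ j) x) (dir E ((F ^^ j) x))) \<le> \<eta>"
    by blast
  then show ?thesis using K by (intro uniform_onI[OF s]) (auto simp: minimal_set_def invariant_closed_def)
qed

text \<open>The strict gaps \<open>a < \<sigma> < b\<close> and \<open>c < \<mu> < d\<close> are the
  gain over the pointwise inequalities: exponentials with these bases can be compared.\<close>

definition rates_on :: "(real^3) set \<Rightarrow> bool" where
  "rates_on S \<longleftrightarrow> (\<exists>C a b c d. 0 < C \<and> 0 < a \<and> a < \<sigma> \<and> \<sigma> < b \<and> 0 < c \<and> c < \<mu> \<and> \<mu> < d \<and> (\<forall>x\<in>S. \<forall>n.
     (\<forall>v\<in>Es x. norm (D n x v) \<le> C * a ^ n * norm v) \<and>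
     (\<forall>v\<in>Ec x. norm (D n x v) \<le> C * c ^ n * norm v) \<and>
     (\<forall>v\<in>Ec x. b ^ n * norm v \<le> C * norm (D n x v)) \<and>
     (\<forall>v\<in>Eu x. d ^ n * norm v \<le> C * norm (D n x v))))"

text \<open>The factor \<open>q ^ n\<close> moves into the base, giving \<open>q * \<theta>\<close>
  in upper and \<open>\<theta> / q\<close> in lower bounds; the comparison of \<open>N\<close> with
  the Euclidean norm goes into the constant.\<close>

lemma rates_onI:
  assumes "uniform_on S (p_up \<sigma>) Es" "uniform_on S (p_lo \<sigma>) Ec" "uniform_on S (p_up \<mu>) Ec" "uniform_on S (p_lo \<mu>) Eu"
  shows "rates_on S"
proof -
  have \<mu>0: "0 < \<mu>" using \<sigma>\<mu> by linarith
  obtain k K where k: "0 < k" "0 < K" "\<And>x v. k * norm v \<le> N x v" "\<And>x v. N x v \<le> K * norm v"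
    using N_bounds by blast
  have up: "\<exists>C a. 0 < C \<and> 0 < a \<and> a < \<theta> \<and> (\<forall>x\<in>S. \<forall>n. \<forall>v\<in>E x. norm (D n x v) \<le> C * a ^ n * norm v)"
    if u: "uniform_on S (p_up \<theta>) E" and \<theta>: "0 < \<theta>" for E \<theta>
  proof -
    obtain C q where C: "0 < C" "0 < q" "q < 1"
      "\<And>x v n. x \<in> S \<Longrightarrow> v \<in> E x \<Longrightarrow> v \<noteq> 0 \<Longrightarrow> (\<Prod>j<n. p_up \<theta> ((F ^^ j) x) (D j x v)) \<le> C * q ^ n"
      using u unfolding uniform_on_def by blast
    have "norm (D n x v) \<le> (C * K / k) * (q * \<theta>) ^ n * norm v" if x: "x \<in> S" "v \<in> E x" for x v n
    proof (cases "v = 0")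
      case True
      then show ?thesis by (simp add: linear_0[OF D_lin])
    next
      case False
      have "k * norm (D n x v) \<le> N ((F ^^ n) x) (D n x v)" by (rule k)
      also have "\<dots> = (\<Prod>j<n. p_up \<theta> ((F ^^ j) x) (D j x v)) * (\<theta> ^ n * N x v)"
        unfolding rate_prod_up[OF False \<theta>, of n x] by simp
      also have "\<dots> \<le> (C * q ^ n) * (\<theta> ^ n * (K * norm v))"
        using C(1,2) \<theta> k N_nonneg by (intro mult_mono C(4)[OF x False]) auto
      finally show ?thesis using k(1) by (simp add: field_simps power_mult_distrib)
    qed
    moreover have "q * \<theta> < \<theta>" "0 < q * \<theta>" "0 < C * K / k" using C \<theta> k by auto
    ultimately show ?thesis by blast
  qed
  have lo: "\<exists>C b. 0 < C \<and> \<theta> < b \<and> (\<forall>x\<in>S. \<forall>n. \<forall>v\<in>E x. b ^ n * norm v \<le> C * norm (D n x v))"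
    if u: "uniform_on S (p_lo \<theta>) E" and \<theta>: "0 < \<theta>" for E \<theta>
  proof -
    obtain C q where C: "0 < C" "0 < q" "q < 1"
      "\<And>x v n. x \<in> S \<Longrightarrow> v \<in> E x \<Longrightarrow> v \<noteq> 0 \<Longrightarrow> (\<Prod>j<n. p_lo \<theta> ((F ^^ j) x) (D j x v)) \<le> C * q ^ n"
      using u unfolding uniform_on_def by blast
    have "(\<theta> / q) ^ n * norm v \<le> (C * K / k) * norm (D n x v)" if x: "x \<in> S" "v \<in> E x" for x v n
    proof (cases "v = 0")
      case True
      then show ?thesis by (simp add: linear_0[OF D_lin])
    next
      case False
      have "\<theta> ^ n * (k * norm v) \<le> \<theta> ^ n * N x v" using \<theta> k by (intro mult_left_mono) auto
      also have "\<dots> = (\<Prod>j<n. p_lo \<theta> ((F ^^ j) x) (D j x v)) * N ((F ^^ n) x) (D n x v)"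
        by (rule rate_prod_lo[OF False \<theta>])
      also have "\<dots> \<le> (C * q ^ n) * (K * norm (D n x v))"
        using C(1,2) \<theta> k N_nonneg by (intro mult_mono C(4)[OF x False]) auto
      finally show ?thesis using k(1) C(2) by (simp add: field_simps power_divide)
    qed
    moreover have "\<theta> < \<theta> / q" "0 < C * K / k" using C \<theta> k by (auto simp: field_simps)
    ultimately show ?thesis by blast
  qed
  obtain C1 a where 1: "0 < C1" "0 < a" "a < \<sigma>" "\<And>x n v. x \<in> S \<Longrightarrow> v \<in> Es x \<Longrightarrow> norm (D n x v) \<le> C1 * a ^ n * norm v"
    using up[OF assms(1) \<sigma>\<mu>(1)] by blast
  obtain C2 b where 2: "0 < C2" "\<sigma> < b" "\<And>x n v. x \<in> S \<Longrightarrow> v \<in> Ec x \<Longrightarrow> b ^ n * norm v \<le> C2 * norm (D n x v)"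
    using lo[OF assms(2) \<sigma>\<mu>(1)] by blast
  obtain C3 c where 3: "0 < C3" "0 < c" "c < \<mu>" "\<And>x n v. x \<in> S \<Longrightarrow> v \<in> Ec x \<Longrightarrow> norm (D n x v) \<le> C3 * c ^ n * norm v"
    using up[OF assms(3) \<mu>0] by blast
  obtain C4 d where 4: "0 < C4" "\<mu> < d" "\<And>x n v. x \<in> S \<Longrightarrow> v \<in> Eu x \<Longrightarrow> d ^ n * norm v \<le> C4 * norm (D n x v)"
    using lo[OF assms(4) \<mu>0] by blast
  define C where "C = C1 + C2 + C3 + C4"
  have Cle: "C1 \<le> C" "C2 \<le> C" "C3 \<le> C" "C4 \<le> C" "0 < C" using 1 2 3 4 by (auto simp: C_def)
  have "norm (D n x v) \<le> C * a ^ n * norm v" if "x \<in> S" "v \<in> Es x" for x n v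
  proof -
    have "C1 * a ^ n * norm v \<le> C * a ^ n * norm v" using Cle(1) 1(2) by (intro mult_right_mono) auto
    then show ?thesis using 1(4)[OF that, of n] by linarith
  qed
  moreover have "b ^ n * norm v \<le> C * norm (D n x v)" if "x \<in> S" "v \<in> Ec x" for x n v
    using 2(3)[OF that, of n] mult_right_mono[OF Cle(2) norm_ge_zero[of "D n x v"]] by linarith
  moreover have "norm (D n x v) \<le> C * c ^ n * norm v" if "x \<in> S" "v \<in> Ec x" for x n v
  proof -
    have "C3 * c ^ n * norm v \<le> C * c ^ n * norm v" using Cle(3) 3(2) by (intro mult_right_mono) auto
    then show ?thesis using 3(4)[OF that, of n] by linarith
  qed
  moreover have "d ^ n * norm v \<le> C * norm (D n x v)" if "x \<in> S" "v \<in> Eu x" for x n v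
    using 4(3)[OF that, of n] mult_right_mono[OF Cle(4) norm_ge_zero[of "D n x v"]] by linarith
  ultimately show ?thesis unfolding rates_on_def using 1(2,3) 2(2) 3(2,3) 4(2) Cle(5) by blast
qed


definition rates_at :: "real \<Rightarrow> real \<Rightarrow> real \<Rightarrow> real \<Rightarrow> real \<Rightarrow> real^3 \<Rightarrow> bool" where
  "rates_at C a b c d x \<longleftrightarrow> 0 < C \<and> 0 < a \<and> a < \<sigma> \<and> \<sigma> < b \<and> 0 < c \<and> c < \<mu> \<and> \<mu> < d \<and> (\<forall>n.
     (\<forall>v\<in>Es x. norm (D n x v) \<le> C * a ^ n * norm v) \<and>
     (\<forall>v\<in>Ec x. norm (D n x v) \<le> C * c ^ n * norm v) \<and>
     (\<forall>v\<in>Ec x. b ^ n * norm v \<le> C * norm (D n x v)) \<and>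
     (\<forall>v\<in>Eu x. d ^ n * norm v \<le> C * norm (D n x v)))"

lemma rates_onD: "rates_on S \<Longrightarrow> \<exists>C a b c d. \<forall>x\<in>S. rates_at C a b c d x"
proof -
  assume "rates_on S"
  then obtain C a b c d where "0 < C" "0 < a" "a < \<sigma>" "\<sigma> < b" "0 < c" "c < \<mu>" "\<mu> < d"
    "\<forall>x\<in>S. \<forall>n. (\<forall>v\<in>Es x. norm (D n x v) \<le> C * a ^ n * norm v) \<and>
     (\<forall>v\<in>Ec x. norm (D n x v) \<le> C * c ^ n * norm v) \<and>
     (\<forall>v\<in>Ec x. b ^ n * norm v \<le> C * norm (D n x v)) \<and>
     (\<forall>v\<in>Eu x. d ^ n * norm v \<le> C * norm (D n x v))"
    unfolding rates_on_def by blast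
  then have "\<forall>x\<in>S. rates_at C a b c d x" unfolding rates_at_def by simp
  then show ?thesis by blast
qed

lemma rates_atD:
  assumes "rates_at C a b c d x"
  shows "0 < C" "0 < a" "a < \<sigma>" "\<sigma> < b" "0 < c" "c < \<mu>" "\<mu> < d"
    "\<And>v n. v \<in> Es x \<Longrightarrow> norm (D n x v) \<le> C * a ^ n * norm v"
    "\<And>v n. v \<in> Ec x \<Longrightarrow> norm (D n x v) \<le> C * c ^ n * norm v"
    "\<And>v n. v \<in> Ec x \<Longrightarrow> b ^ n * norm v \<le> C * norm (D n x v)"
    "\<And>v n. v \<in> Eu x \<Longrightarrow> d ^ n * norm v \<le> C * norm (D n x v)"
  using assms unfolding rates_at_def by blast+

text \<open>A component in \<open>Eu\<close> grows at least like \<open>d ^ n\<close>, faster than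
  the whole vector and the other components, so it vanishes. Once it is gone, comparison with
  \<open>b ^ n\<close> removes the centre component.\<close>

lemma dominated_forward:
  assumes R: "rates_at C a b c d x" and v: "s \<in> Es x" "w \<in> Ec x" "u \<in> Eu x"
    and B: "\<And>n. norm (D n x (s + w + u)) \<le> B * t ^ n" "0 \<le> t" "t < d"
  shows "u = 0" "t < b \<Longrightarrow> w = 0"
proof -
  note r = rates_atD[OF R]
  have D: "D n x (s + w + u) = D n x s + D n x w + D n x u" for n
    by (simp add: linear_add[OF D_lin])
  have "norm u * d ^ n \<le> (C * B) * t ^ n + (C * (C * norm s)) * a ^ n + (C * (C * norm w)) * c ^ n" for n
  proof -
    have "D n x u = D n x (s + w + u) - D n x s - D n x w" using D[of n] by simp
    then have "norm (D n x u) \<le> norm (D n x (s + w + u)) + norm (D n x s) + norm (D n x w)"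
      by (smt (verit) norm_triangle_ineq4)
    also have "\<dots> \<le> B * t ^ n + C * a ^ n * norm s + C * c ^ n * norm w"
      using B(1)[of n] r(8)[OF v(1), of n] r(9)[OF v(2), of n] by linarith
    finally have "C * norm (D n x u) \<le> C * (B * t ^ n + C * a ^ n * norm s + C * c ^ n * norm w)"
      using r(1) by (intro mult_left_mono) auto
    then show ?thesis using r(11)[OF v(3), of n] by (simp add: algebra_simps)
  qed
  from exp_sum_dominates[OF this] show u: "u = 0" using r(2-7) \<sigma>\<mu> B(2,3) by simp
  show "w = 0" if tb: "t < b"
  proof -
    have "norm w * b ^ n \<le> (C * B) * t ^ n + (C * (C * norm s)) * a ^ n + 0 * a ^ n" for n
    proof -
      have "D n x w = D n x (s + w + u) - D n x s" using D[of n] u by (simp add: linear_0[OF D_lin])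
      then have "norm (D n x w) \<le> norm (D n x (s + w + u)) + norm (D n x s)"
        by (metis norm_triangle_ineq4)
      also have "\<dots> \<le> B * t ^ n + C * a ^ n * norm s"
        using B(1)[of n] r(8)[OF v(1), of n] by linarith
      finally have "C * norm (D n x w) \<le> C * (B * t ^ n + C * a ^ n * norm s)"
        using r(1) by (intro mult_left_mono) auto
      then show ?thesis using r(10)[OF v(2), of n] by (simp add: algebra_simps)
    qed
    from exp_sum_dominates[OF this] show ?thesis using r(2-7) \<sigma>\<mu> B(2) tb by simp
  qed
qed

text \<open>The definition of absolute partial hyperbolicity only gives strict inequalities at each point, so the
  rates have to be made uniform. A vector growing exactly like \<open>\<theta>\<^sup>n\<close>, with \<open>\<theta>\<close> either \<open>\<sigma>\<close> or \<open>\<mu>\<close>, would give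
  such vectors over a minimal set, where uniformity already holds by Baire category.\<close>

lemma no_neutral_vector:
  assumes \<theta>: "\<theta> = \<sigma> \<or> \<theta> = \<mu>" and v0: "v0 \<noteq> 0"
  shows "\<exists>n. N ((F ^^ n) x0) (D n x0 v0) \<noteq> \<theta> ^ n * N x0 v0"
proof (rule ccontr)
  assume "\<not> ?thesis"
  then have neu: "N ((F ^^ n) x0) (D n x0 v0) = \<theta> ^ n * N x0 v0" for n by blast
  have \<theta>0: "0 < \<theta>" using \<theta> \<sigma>\<mu> by auto
  obtain k K where k: "0 < k" "0 < K" "\<And>x v. k * norm v \<le> N x v" "\<And>x v. N x v \<le> K * norm v"
    using N_bounds by blast
  \<comment> \<open>Exact neutrality is a closed condition on pairs, and the case
    \<open>n = 0\<close> confines the vectors to a compact ball. The base points therefore form a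
    closed set, although the bundles are not yet known to be closed.\<close>
  define T where "T = {z. \<forall>n. N ((F ^^ n) (snd z)) (D n (snd z) (fst z)) = \<theta> ^ n}"
  define Z where "Z = {x. \<exists>v. v \<in> cball 0 (1 / k) \<and> (v, x) \<in> T}"
  have clT: "closed T"
    unfolding T_def
    by (intro closed_Collect_all closed_Collect_eq N_continuous lfield_continuous[OF D_lf]
        continuous_on_compose2[OF F_pow_cont] continuous_intros) auto
  have Z_iff: "x \<in> Z \<longleftrightarrow> (\<exists>v. (v, x) \<in> T)" for x
  proof -
    have "norm v \<le> 1 / k" if "(v, x) \<in> T" for v
    proof -
      have "N x v = 1" using that by (auto simp: T_def dest: spec[of _ 0])
      then show ?thesis using k(3)[of v x] k(1) by (simp add: field_simps)
    qed
    then show ?thesis by (auto simp: Z_def)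
  qed
  have "closed Z" unfolding Z_def by (rule closed_compact_projection[OF compact_cball clT])
  moreover have "Z \<noteq> {}"
  proof -
    have "((1 / N x0 v0) *\<^sub>R v0, x0) \<in> T"
      using N_pos[OF v0, of x0] neu by (auto simp: T_def N_scale linear_cmul[OF D_lin])
    then show ?thesis using Z_iff by blast
  qed
  moreover have "F x \<in> Z" if x: "x \<in> Z" for x
  proof -
    obtain v where v: "(v, x) \<in> T" using x Z_iff by blast
    have "N ((F ^^ n) (F x)) (D n (F x) ((1 / \<theta>) *\<^sub>R A x v)) = \<theta> ^ n" for n
    proof -
      have "\<And>m. N ((F ^^ m) x) (D m x v) = \<theta> ^ m" using v by (simp add: T_def)
      then have "N ((F ^^ Suc n) x) (D (Suc n) x v) = \<theta> ^ Suc n" .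
      then have "N ((F ^^ n) (F x)) (D n (F x) (A x v)) = \<theta> * \<theta> ^ n"
        by (simp only: cocycle_Suc_left funpow_Suc_right o_apply power_Suc)
      then show ?thesis using \<theta>0 by (simp add: N_scale linear_cmul[OF D_lin])
    qed
    then have "((1 / \<theta>) *\<^sub>R A x v, F x) \<in> T" by (simp add: T_def)
    then show ?thesis using Z_iff by blast
  qed
  moreover have "x + m \<in> Z" if x: "x \<in> Z" and m: "ivec m" for x m
  proof -
    obtain v where v: "(v, x) \<in> T" using x Z_iff by blast
    have "N ((F ^^ n) (x + m)) (D n (x + m) v) = N ((F ^^ n) x) (D n x v)" for n
    proof -
      obtain m' where "ivec m'" "(F ^^ n) (x + m) = (F ^^ n) x + m'"
        using int_equivariantD[OF int_equivariant_funpow[OF F_eq, of n] m] by blast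
      then show ?thesis by (simp add: periodicD[OF N_per] lfield_periodic[OF D_lf m])
    qed
    then have "(v, x + m) \<in> T" using v by (simp add: T_def)
    then show ?thesis using Z_iff by blast
  qed
  ultimately have "invariant_closed F Z" by (simp add: invariant_closed_def)
  then obtain M where M: "M \<subseteq> Z" "minimal_set F M" using minimal_set_exists by blast
  obtain x where x: "x \<in> M" using M(2) by (auto simp: minimal_set_def invariant_closed_def)
  obtain C a b c d where R: "rates_at C a b c d x"
    using rates_onD[OF rates_onI[OF uniform_on_minimal[OF subordinates(1) M(2)] uniform_on_minimal[OF subordinates(2) M(2)]
      uniform_on_minimal[OF subordinates(3) M(2)] uniform_on_minimal[OF subordinates(4) M(2)]]] x by blast
  note r = rates_atD[OF R]
  obtain v where v: "(v, x) \<in> T" using x M(1) Z_iff by blast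
  obtain s w u where sp: "s \<in> Es x" "w \<in> Ec x" "u \<in> Eu x" "v = s + w + u" using decomp by blast
  have Nn: "N ((F ^^ n) x) (D n x v) = \<theta> ^ n" for n using v by (auto simp: T_def)
  have B: "norm (D n x (s + w + u)) \<le> (1 / k) * \<theta> ^ n" for n
    using k(3)[of "D n x v" "(F ^^ n) x"] Nn[of n] k(1) by (simp add: sp(4) field_simps)
  \<comment> \<open>Over the minimal set the rates are uniform. Once the components that grow too
    fast are removed, the vector grows strictly slower than \<open>\<theta> ^ n\<close>, against
    neutrality.\<close>
  have u: "u = 0" using dominated_forward(1)[OF R sp(1-3) B] \<theta> r \<sigma>\<mu> \<theta>0 by auto
  show False
  proof (cases "\<theta> = \<sigma>")
    case True
    have w: "w = 0" using dominated_forward(2)[OF R sp(1-3) B] True r \<sigma>\<mu> by auto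
    have "1 * \<sigma> ^ n \<le> (K * (C * norm s)) * a ^ n + 0 * a ^ n + 0 * a ^ n" for n
    proof -
      have "\<sigma> ^ n \<le> K * norm (D n x s)" using Nn[of n] k(4)[of "(F ^^ n) x" "D n x v"] True by (simp add: sp(4) u w)
      also have "\<dots> \<le> K * (C * a ^ n * norm s)" using k(2) by (intro mult_left_mono r(8) sp) auto
      finally show ?thesis by (simp add: mult_ac)
    qed
    from exp_sum_dominates[OF this] show False using r by simp
  next
    case False
    then have \<theta>\<mu>: "\<theta> = \<mu>" using \<theta> by simp
    have "1 * \<mu> ^ n \<le> (K * (C * norm s)) * a ^ n + (K * (C * norm w)) * c ^ n + 0 * a ^ n" for n
    proof -
      have "\<mu> ^ n \<le> K * norm (D n x (s + w))" using Nn[of n] k(4)[of "(F ^^ n) x" "D n x v"] \<theta>\<mu> by (simp add: sp(4) u)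
      also have "\<dots> \<le> K * (norm (D n x s) + norm (D n x w))"
        using k(2) by (intro mult_left_mono) (auto simp: linear_add[OF D_lin] norm_triangle_ineq)
      also have "\<dots> \<le> K * (C * a ^ n * norm s + C * c ^ n * norm w)"
        using k(2) by (intro mult_left_mono add_mono r(8) r(9) sp) auto
      finally show ?thesis by (simp add: algebra_simps)
    qed
    from exp_sum_dominates[OF this] show False using r \<sigma>\<mu> by simp
  qed
qed

text \<open>If no number of steps brought the product of rates below 1 everywhere, nested compact
  sets would contain a vector whose products all equal 1, that is, a neutral vector. The maximum of
  \<open>P L\<close> is then the uniform bound.\<close>

lemma uniform_global:
  assumes s: "subordinate \<theta> p E" and \<theta>: "\<theta> = \<sigma> \<or> \<theta> = \<mu>"
  shows "uniform_on UNIV p E"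
proof -
  have E: "line E" "rate_fn \<theta> p" "0 < \<theta>" "\<And>x v. v \<in> E x \<Longrightarrow> v \<noteq> 0 \<Longrightarrow> p x v < 1"
    using s by (auto simp: subordinate_def)
  obtain k K where k: "0 < k" "0 < K" "\<And>x v. k * norm v \<le> N x v" "\<And>x v. N x v \<le> K * norm v"
    using N_bounds by blast
  define Q0 where "Q0 = (ucube \<times> cball (0::real^3) (1 / k)) \<inter> {z. N (fst z) (snd z) = 1}"
  have cQ0: "compact Q0" unfolding Q0_def
    by (intro compact_Int_closed compact_Times compact_cbox compact_cball closed_Collect_eq N_cont continuous_intros)
  have nz: "snd z \<noteq> 0" if "z \<in> Q0" for z using that by (auto simp: Q0_def)
  define f where "f j z = p ((F ^^ j) (fst z)) (D j (fst z) (snd z))" for j z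
  have cf: "continuous_on Q0 (f j)" for j
    unfolding f_def using nz D_nz
    by (intro rate_fn_continuous[OF E(2,3)] continuous_on_compose2[OF F_pow_cont] lfield_continuous[OF D_lf] continuous_intros) auto
  define P where "P j z = (\<Prod>i<j. f i z)" for j z
  have cP: "continuous_on Q0 (P j)" for j unfolding P_def by (intro continuous_on_prod cf)
  \<comment> \<open>The unit vectors of \<open>E\<close> need not form a closed set.
    \<open>Q\<close> is a compact substitute that contains those over \<open>ucube\<close>: all unit
    vectors whose one-step rates along the orbit never exceed 1.\<close>
  define Q where "Q = Q0 \<inter> (\<Inter>j. {z \<in> Q0. f j z \<le> 1})"
  have clf: "closed {z \<in> Q0. g z \<le> h z}" if "continuous_on Q0 g" "continuous_on Q0 h" for g h :: "_ \<Rightarrow> real"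
    using that compact_imp_closed[OF cQ0] by (intro continuous_on_closed_Collect_le) auto
  have cQ: "compact Q" unfolding Q_def
    by (intro compact_Int_closed cQ0 closed_INT ballI clf cf continuous_intros)
  have fpos: "0 < f j z" if "z \<in> Q0" for j z
    unfolding f_def using nz[OF that] D_nz by (intro rate_fn_pos[OF E(2,3)]) auto
  have Pdec: "P (Suc j) z \<le> P j z" "P j z \<le> 1" "0 < P j z" if z: "z \<in> Q" for j z
  proof -
    have zz: "z \<in> Q0" "\<And>j. f j z \<le> 1" using z by (auto simp: Q_def)
    show pos: "0 < P j z" unfolding P_def using fpos[OF zz(1)] by (intro prod_pos) auto
    show "P (Suc j) z \<le> P j z" using zz(2)[of j] pos by (simp add: P_def mult_left_le)
    show "P j z \<le> 1" unfolding P_def using zz fpos[OF zz(1)] less_imp_le by (intro prod_le_1) blast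
  qed
  have inQ: "(x, v) \<in> Q" if "x \<in> ucube" "v \<in> E x" "N x v = 1" for x v
  proof -
    have v0: "v \<noteq> 0" using that(3) by auto
    have "norm v \<le> 1 / k" using k(3)[of v x] k(1) that(3) by (simp add: field_simps)
    then have "(x, v) \<in> Q0" using that by (simp add: Q0_def)
    moreover have "f j (x, v) \<le> 1" for j
      unfolding f_def using E(4)[OF D_line[OF E(1) that(2)] D_nz[OF v0]] by (simp add: less_imp_le)
    ultimately show ?thesis by (simp add: Q_def)
  qed
  have Qne: "Q \<noteq> {}"
  proof -
    have "(0, (1 / N 0 (dir E 0)) *\<^sub>R dir E 0) \<in> Q"
    proof (rule inQ)
      show "(1 / N 0 (dir E 0)) *\<^sub>R dir E 0 \<in> E 0"
        using dir[OF E(1)] lineD(1)[OF E(1)] subspace_scale by blast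
      show "N 0 ((1 / N 0 (dir E 0)) *\<^sub>R dir E 0) = 1"
        using dir[OF E(1), of 0] N_pos[of "dir E 0" 0] by (simp add: N_scale)
    qed (simp add: mem_box_cart)
    then show ?thesis by blast
  qed
  have "\<exists>L. \<forall>z\<in>Q. P L z < 1"
  proof (rule ccontr)
    assume neg: "\<not> ?thesis"
    define B where "B j = Q \<inter> {z \<in> Q0. 1 \<le> P j z}" for j
    have "\<Inter>(range B) \<noteq> {}"
    proof (rule compact_nest)
      show "compact (B j)" for j unfolding B_def
        by (intro compact_Int_closed cQ clf cP continuous_intros)
      show "B j \<noteq> {}" for j using neg by (force simp: B_def Q_def not_less)
      have "B (Suc j) \<subseteq> B j" for j
      proof
        fix z assume z: "z \<in> B (Suc j)"
        then have "z \<in> Q" "1 \<le> P (Suc j) z" "z \<in> Q0" by (auto simp: B_def)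
        then show "z \<in> B j" using Pdec(1)[of z j] by (simp add: B_def)
      qed
      then show "B n \<subseteq> B m" if "m \<le> n" for m n using lift_Suc_antimono_le[of B] that by blast
    qed
    then obtain z where z: "\<And>j. z \<in> B j" by blast
    then have zQ: "z \<in> Q" by (auto simp: B_def)
    have P1: "P j z = 1" for j using z[of j] Pdec(2)[OF zQ, of j] by (auto simp: B_def)
    obtain x v where xv: "z = (x, v)" by (cases z)
    have v: "v \<noteq> 0" "N x v = 1" using zQ nz[of z] by (auto simp: Q_def Q0_def xv)
    have "N ((F ^^ n) x) (D n x v) = \<theta> ^ n * N x v" for n
      using E(2) P1[of n] rate_prod_up[OF v(1) E(3), of n x] rate_prod_lo[OF v(1) E(3), of n x]
      by (auto simp: rate_fn_def P_def f_def xv)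
    then show False using no_neutral_vector[OF \<theta> v(1), of x] by blast
  qed
  then obtain L where L: "\<And>z. z \<in> Q \<Longrightarrow> P L z < 1" by blast
  have L0: "0 < L"
  proof (rule ccontr)
    assume "\<not> 0 < L"
    then show False using L Qne by (force simp: P_def)
  qed
  have "continuous_on Q (P L)" using cP continuous_on_subset[of Q0 "P L" Q] by (auto simp: Q_def)
  then obtain zm where zm: "zm \<in> Q" "\<And>z. z \<in> Q \<Longrightarrow> P L z \<le> P L zm"
    using continuous_attains_sup[OF cQ Qne] by blast
  show ?thesis
  proof (rule uniform_onI[OF s _ L0 L[OF zm(1)]])
    fix x :: "real^3"
    obtain n where n: "ivec n" "x + n \<in> ucube" using translate_into_ucube by blast
    define v where "v = (1 / N x (dir E x)) *\<^sub>R dir E x"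
    have N1: "0 < N x (dir E x)" using dir[OF E(1)] N_pos by blast
    have v: "v \<in> E x" "N x v = 1" using dir[OF E(1), of x] lineD(1)[OF E(1)] subspace_scale N1
      by (auto simp: v_def N_scale)
    have v0: "v \<noteq> 0" using v by auto
    have "(x + n, v) \<in> Q" using n v periodicD[OF lineD(4)[OF E(1)] n(1)] periodicD[OF N_per n(1)] by (intro inQ) auto
    then have "P L (x + n, v) \<le> P L zm" by (rule zm(2))
    moreover have "f j (x + n, v) = p ((F ^^ j) x) (dir E ((F ^^ j) x))" for j
    proof -
      obtain m where "ivec m" "(F ^^ j) (x + n) = (F ^^ j) x + m"
        using int_equivariantD[OF int_equivariant_funpow[OF F_eq, of j] n(1)] by blast
      then have "f j (x + n, v) = p ((F ^^ j) x) (D j x v)"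
        by (simp add: f_def rate_fn_periodic[OF E(2)] lfield_periodic[OF D_lf n(1)])
      also have "\<dots> = p ((F ^^ j) x) (dir E ((F ^^ j) x))"
        using rate_fn_line[OF E(2,1) D_line[OF E(1) v(1)]] dir[OF E(1)] D_nz[OF v0] by blast
      finally show ?thesis .
    qed
    ultimately show "(\<Prod>j<L. p ((F ^^ j) x) (dir E ((F ^^ j) x))) \<le> P L zm" by (simp add: P_def)
  qed simp
qed

lemma rates_global: "\<exists>C a b c d. \<forall>x. rates_at C a b c d x"
  using rates_onD[OF rates_onI[OF uniform_global[OF subordinates(1)] uniform_global[OF subordinates(2)]
      uniform_global[OF subordinates(3)] uniform_global[OF subordinates(4)]]] by simp

section \<open>Backward rates and continuity of the splitting\<close>

abbreviation "Di \<equiv> cocycle Fi Ai"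

lemma Di_lf: "lfield (Di n)"
  by (rule lfield_cocycle[OF Ai_lf Fi_cont Fi_eq])

lemmas Di_lin = lfield_linear[OF Di_lf]

lemma D_Di: "D n ((Fi ^^ n) x) (Di n x v) = v"
proof (induction n)
  case (Suc n)
  have "D (Suc n) ((Fi ^^ Suc n) x) (Di (Suc n) x v)
    = D n (F (Fi ((Fi ^^ n) x))) (A (Fi ((Fi ^^ n) x)) (Ai ((Fi ^^ n) x) (Di n x v)))"
    unfolding cocycle_Suc_left[of F A] by simp
  also have "\<dots> = v" using Suc AAi[of "Fi ((Fi ^^ n) x)"] by (simp add: FFi)
  finally show ?case .
qed simp

lemma Di_line:
  assumes "line E" "v \<in> E x"
  shows "Di n x v \<in> E ((Fi ^^ n) x)"
proof (induction n)
  case (Suc n)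
  let ?y = "(Fi ^^ n) x"
  obtain w where w: "w \<in> E (Fi ?y)" "Di n x v = A (Fi ?y) w"
    using Suc lineD(3)[OF assms(1), of "Fi ?y"] by (auto simp: FFi)
  have "Ai ?y (Di n x v) = w" using AiA[of "Fi ?y" w] by (simp add: w(2) FFi)
  then show ?case using w(1) by simp
qed (use assms in simp)

lemma line_cases: "line Es" "line Ec" "line Eu"
  by (auto simp: line_def)

text \<open>Each forward estimate is applied at the point reached backwards,
  \<open>(Fi ^^ n) x\<close>, to the vector \<open>Di n x v\<close>.\<close>

lemma backward_rates:
  assumes R: "\<And>x. rates_at C a b c d x"
  shows "v \<in> Es x \<Longrightarrow> (1 / a) ^ n * norm v \<le> C * norm (Di n x v)"
    "v \<in> Ec x \<Longrightarrow> (1 / c) ^ n * norm v \<le> C * norm (Di n x v)"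
    "v \<in> Ec x \<Longrightarrow> norm (Di n x v) \<le> C * (1 / b) ^ n * norm v"
    "v \<in> Eu x \<Longrightarrow> norm (Di n x v) \<le> C * (1 / d) ^ n * norm v"
proof -
  note r = rates_atD[OF R]
  have bd: "0 < b" "0 < d" using r \<sigma>\<mu> by (meson less_trans)+
  show "(1 / a) ^ n * norm v \<le> C * norm (Di n x v)" if "v \<in> Es x"
    using r(8)[OF Di_line[OF line_cases(1) that], of n n] r(2) by (simp add: D_Di power_divide field_simps)
  show "(1 / c) ^ n * norm v \<le> C * norm (Di n x v)" if "v \<in> Ec x"
    using r(9)[OF Di_line[OF line_cases(2) that], of n n] r(5) by (simp add: D_Di power_divide field_simps)
  show "norm (Di n x v) \<le> C * (1 / b) ^ n * norm v" if "v \<in> Ec x"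
    using r(10)[OF Di_line[OF line_cases(2) that], of n n] bd by (simp add: D_Di power_divide field_simps)
  show "norm (Di n x v) \<le> C * (1 / d) ^ n * norm v" if "v \<in> Eu x"
    using r(11)[OF Di_line[OF line_cases(3) that], of n n] bd by (simp add: D_Di power_divide field_simps)
qed

lemma dominated_backward:
  assumes R: "\<And>x. rates_at C a b c d x" and v: "s \<in> Es x" "w \<in> Ec x" "u \<in> Eu x"
    and B: "\<And>n. norm (Di n x (s + w + u)) \<le> B * t ^ n" "0 \<le> t" "t < 1 / a"
  shows "s = 0" "t < 1 / c \<Longrightarrow> w = 0"
proof -
  note r = rates_atD[OF R] and q = backward_rates[OF R]
  have pos: "0 < b" "0 < d" "1 / b < 1 / a" "1 / d < 1 / a" "1 / d < 1 / c"
    using r(2-7) \<sigma>\<mu> by (auto intro!: divide_strict_left_mono)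
  have D: "Di n x (s + w + u) = Di n x s + Di n x w + Di n x u" for n
    by (simp add: linear_add[OF Di_lin])
  have "norm s * (1 / a) ^ n \<le> (C * B) * t ^ n + (C * (C * norm w)) * (1 / b) ^ n + (C * (C * norm u)) * (1 / d) ^ n" for n
  proof -
    have "Di n x s = Di n x (s + w + u) - Di n x w - Di n x u" using D[of n] by simp
    then have "norm (Di n x s) \<le> norm (Di n x (s + w + u)) + norm (Di n x w) + norm (Di n x u)"
      by (smt (verit) norm_triangle_ineq4)
    also have "\<dots> \<le> B * t ^ n + C * (1 / b) ^ n * norm w + C * (1 / d) ^ n * norm u"
      using B(1)[of n] q(3)[OF v(2), of n] q(4)[OF v(3), of n] by linarith
    finally have "C * norm (Di n x s) \<le> C * (B * t ^ n + C * (1 / b) ^ n * norm w + C * (1 / d) ^ n * norm u)"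
      using r(1) by (intro mult_left_mono) auto
    then show ?thesis using q(1)[OF v(1), of n] by (simp add: algebra_simps)
  qed
  from exp_sum_dominates[OF this] show s: "s = 0" using pos B(2,3) by simp
  show "w = 0" if tc: "t < 1 / c"
  proof -
    have "norm w * (1 / c) ^ n \<le> (C * B) * t ^ n + (C * (C * norm u)) * (1 / d) ^ n + 0 * (1 / d) ^ n" for n
    proof -
      have "Di n x w = Di n x (s + w + u) - Di n x u" using D[of n] s by (simp add: linear_0[OF Di_lin])
      then have "norm (Di n x w) \<le> norm (Di n x (s + w + u)) + norm (Di n x u)"
        by (metis norm_triangle_ineq4)
      also have "\<dots> \<le> B * t ^ n + C * (1 / d) ^ n * norm u"
        using B(1)[of n] q(4)[OF v(3), of n] by linarith
      finally have "C * norm (Di n x w) \<le> C * (B * t ^ n + C * (1 / d) ^ n * norm u)"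
        using r(1) by (intro mult_left_mono) auto
      then show ?thesis using q(2)[OF v(2), of n] by (simp add: algebra_simps)
    qed
    from exp_sum_dominates[OF this] show ?thesis using pos B(2) tc by simp
  qed
qed

text \<open>With uniform constants each bundle is described by growth bounds for all times, which
  are closed conditions; the centre bundle needs both time directions. By domination a vector
  obeying the bounds has no other components.\<close>

lemma bundles_closed:
  "closed {z. snd z \<in> Es (fst z)}" "closed {z. snd z \<in> Ec (fst z)}" "closed {z. snd z \<in> Eu (fst z)}"
proof -
  obtain C a b c d where R: "\<And>x. rates_at C a b c d x" using rates_global by blast
  note r = rates_atD[OF R] and q = backward_rates[OF R]
  have pos: "0 < b" "0 < d" "a < b" "a < d" "c < d" "1 / b < 1 / a" "1 / d < 1 / a" "1 / d < 1 / c"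
    using r(2-7) \<sigma>\<mu> by (auto intro!: divide_strict_left_mono)
  have s: "v \<in> Es x \<longleftrightarrow> (\<forall>n. norm (D n x v) \<le> C * a ^ n * norm v)" for x v
  proof
    assume h: "\<forall>n. norm (D n x v) \<le> C * a ^ n * norm v"
    obtain s w u where sp: "s \<in> Es x" "w \<in> Ec x" "u \<in> Eu x" "v = s + w + u" using decomp by blast
    have B: "norm (D n x (s + w + u)) \<le> (C * norm v) * a ^ n" for n using h sp(4) by (simp add: mult_ac)
    have "u = 0" "w = 0" using dominated_forward[OF R sp(1-3) B] r(2) pos by auto
    then show "v \<in> Es x" using sp by simp
  qed (use r in blast)
  have u: "v \<in> Eu x \<longleftrightarrow> (\<forall>n. norm (Di n x v) \<le> C * (1 / d) ^ n * norm v)" for x v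
  proof
    assume h: "\<forall>n. norm (Di n x v) \<le> C * (1 / d) ^ n * norm v"
    obtain s w u where sp: "s \<in> Es x" "w \<in> Ec x" "u \<in> Eu x" "v = s + w + u" using decomp by blast
    have B: "norm (Di n x (s + w + u)) \<le> (C * norm v) * (1 / d) ^ n" for n using h sp(4) by (simp add: mult_ac)
    have "s = 0" "w = 0" using dominated_backward[OF R sp(1-3) B] pos by auto
    then show "v \<in> Eu x" using sp by simp
  qed (use q in blast)
  have c: "v \<in> Ec x \<longleftrightarrow> (\<forall>n. norm (D n x v) \<le> C * c ^ n * norm v) \<and> (\<forall>n. norm (Di n x v) \<le> C * (1 / b) ^ n * norm v)" for x v
  proof
    assume h: "(\<forall>n. norm (D n x v) \<le> C * c ^ n * norm v) \<and> (\<forall>n. norm (Di n x v) \<le> C * (1 / b) ^ n * norm v)"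
    obtain s w u where sp: "s \<in> Es x" "w \<in> Ec x" "u \<in> Eu x" "v = s + w + u" using decomp by blast
    have B: "norm (D n x (s + w + u)) \<le> (C * norm v) * c ^ n" for n using h sp(4) by (simp add: mult_ac)
    have B': "norm (Di n x (s + w + u)) \<le> (C * norm v) * (1 / b) ^ n" for n using h sp(4) by (simp add: mult_ac)
    have "u = 0" using dominated_forward(1)[OF R sp(1-3) B] r(5) pos by auto
    moreover have "s = 0" using dominated_backward(1)[OF R sp(1-3) B'] pos by auto
    ultimately show "v \<in> Ec x" using sp by simp
  qed (use q r in blast)
  show "closed {z. snd z \<in> Es (fst z)}" unfolding s
    by (intro closed_Collect_all closed_Collect_le lfield_continuous[OF D_lf] continuous_intros)
  show "closed {z. snd z \<in> Ec (fst z)}" unfolding c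
    by (intro closed_Collect_all closed_Collect_conj closed_Collect_le lfield_continuous[OF D_lf] lfield_continuous[OF Di_lf] continuous_intros)
  show "closed {z. snd z \<in> Eu (fst z)}" unfolding u
    by (intro closed_Collect_all closed_Collect_le lfield_continuous[OF Di_lf] continuous_intros)
qed

lemma decomp_zero:
  assumes "s \<in> Es x" "w \<in> Ec x" "u \<in> Eu x" "s + w + u = 0"
  shows "s = 0" "w = 0" "u = 0"
proof -
  obtain C a b c d where R: "\<And>x. rates_at C a b c d x" using rates_global by blast
  note r = rates_atD[OF R[of x]]
  have "norm (D n x (s + w + u)) \<le> 0 * 0 ^ n" for n using assms(4) by (simp add: linear_0[OF D_lin])
  from dominated_forward[OF R assms(1-3) this] r \<sigma>\<mu> show "w = 0" "u = 0" by auto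
  then show "s = 0" using assms(4) by simp
qed


lemma decomp_unique:
  assumes "s \<in> Es x" "w \<in> Ec x" "u \<in> Eu x" "s' \<in> Es x" "w' \<in> Ec x" "u' \<in> Eu x" "s + w + u = s' + w' + u'"
  shows "s = s'" "w = w'" "u = u'"
proof -
  have "(s - s') + (w - w') + (u - u') = 0" using assms(7) by (simp add: algebra_simps)
  moreover have "s - s' \<in> Es x" "w - w' \<in> Ec x" "u - u' \<in> Eu x"
    using assms sub subspace_diff by blast+
  ultimately show "s = s'" "w = w'" "u = u'" using decomp_zero[of "s - s'" x "w - w'" "u - u'"] by simp_all
qed

definition ps :: "real^3 \<Rightarrow> real^3 \<Rightarrow> real^3" where
  "ps x v = (SOME s. s \<in> Es x \<and> (\<exists>w\<in>Ec x. \<exists>u\<in>Eu x. v = s + w + u))"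

definition pc :: "real^3 \<Rightarrow> real^3 \<Rightarrow> real^3" where
  "pc x v = (SOME w. w \<in> Ec x \<and> (\<exists>u\<in>Eu x. v = ps x v + w + u))"

definition pu :: "real^3 \<Rightarrow> real^3 \<Rightarrow> real^3" where
  "pu x v = v - ps x v - pc x v"

lemma proj: "ps x v \<in> Es x" "pc x v \<in> Ec x" "pu x v \<in> Eu x" "ps x v + pc x v + pu x v = v"
proof -
  have s: "ps x v \<in> Es x \<and> (\<exists>w\<in>Ec x. \<exists>u\<in>Eu x. v = ps x v + w + u)"
    unfolding ps_def by (rule someI_ex) (use decomp in blast)
  then have "\<exists>w. w \<in> Ec x \<and> (\<exists>u\<in>Eu x. v = ps x v + w + u)" by blast
  then have c: "pc x v \<in> Ec x \<and> (\<exists>u\<in>Eu x. v = ps x v + pc x v + u)"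
    unfolding pc_def by (rule someI_ex)
  then obtain u where "u \<in> Eu x" "v = ps x v + pc x v + u" by blast
  then have "pu x v = u" by (simp add: pu_def algebra_simps)
  then show "ps x v \<in> Es x" "pc x v \<in> Ec x" "pu x v \<in> Eu x" "ps x v + pc x v + pu x v = v"
    using s c \<open>u \<in> Eu x\<close> by (auto simp: pu_def)
qed

lemma proj_eq:
  assumes "s \<in> Es x" "w \<in> Ec x" "u \<in> Eu x"
  shows "ps x (s + w + u) = s" "pc x (s + w + u) = w" "pu x (s + w + u) = u"
  using decomp_unique[OF proj(1-3) assms proj(4)] by auto

lemma proj_linear: "linear (ps x)" "linear (pc x)" "linear (pu x)"
proof -
  have a: "ps x (v + v') = ps x v + ps x v'" "pc x (v + v') = pc x v + pc x v'" "pu x (v + v') = pu x v + pu x v'" for v v'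
  proof -
    have e: "v + v' = (ps x v + ps x v') + (pc x v + pc x v') + (pu x v + pu x v')"
    proof -
      have "(ps x v + pc x v + pu x v) + (ps x v' + pc x v' + pu x v')
        = (ps x v + ps x v') + (pc x v + pc x v') + (pu x v + pu x v')" by (simp add: algebra_simps)
      then show ?thesis unfolding proj(4) .
    qed
    have m: "ps x v + ps x v' \<in> Es x" "pc x v + pc x v' \<in> Ec x" "pu x v + pu x v' \<in> Eu x"
      using proj sub subspace_add by blast+
    show "ps x (v + v') = ps x v + ps x v'" "pc x (v + v') = pc x v + pc x v'" "pu x (v + v') = pu x v + pu x v'"
      using proj_eq[OF m] unfolding e[symmetric] by auto
  qed
  have b: "ps x (t *\<^sub>R v) = t *\<^sub>R ps x v" "pc x (t *\<^sub>R v) = t *\<^sub>R pc x v" "pu x (t *\<^sub>R v) = t *\<^sub>R pu x v" for t v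
  proof -
    have e: "t *\<^sub>R v = t *\<^sub>R ps x v + t *\<^sub>R pc x v + t *\<^sub>R pu x v"
      using proj(4)[of x v] by (simp flip: scaleR_right_distrib)
    have m: "t *\<^sub>R ps x v \<in> Es x" "t *\<^sub>R pc x v \<in> Ec x" "t *\<^sub>R pu x v \<in> Eu x"
      using proj sub subspace_scale by blast+
    show "ps x (t *\<^sub>R v) = t *\<^sub>R ps x v" "pc x (t *\<^sub>R v) = t *\<^sub>R pc x v" "pu x (t *\<^sub>R v) = t *\<^sub>R pu x v"
      using proj_eq[OF m] unfolding e[symmetric] by auto
  qed
  show "linear (ps x)" "linear (pc x)" "linear (pu x)" using a b by (auto intro: linearI)
qed

lemma proj_equivariant:
  "ps (F x) (A x v) = A x (ps x v)" "pc (F x) (A x v) = A x (pc x v)" "pu (F x) (A x v) = A x (pu x v)"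
proof -
  have e: "A x v = A x (ps x v) + A x (pc x v) + A x (pu x v)"
    using proj(4)[of x v] by (simp flip: linear_add[OF A_lin])
  have m: "A x (ps x v) \<in> Es (F x)" "A x (pc x v) \<in> Ec (F x)" "A x (pu x v) \<in> Eu (F x)"
    using proj inv by blast+
  show "ps (F x) (A x v) = A x (ps x v)" "pc (F x) (A x v) = A x (pc x v)" "pu (F x) (A x v) = A x (pu x v)"
    using proj_eq[OF m] unfolding e[symmetric] by auto
qed

lemma proj_periodic: "periodic ps" "periodic pc" "periodic pu"
proof -
  have "ps (x + n) v = ps x v \<and> pc (x + n) v = pc x v \<and> pu (x + n) v = pu x v" if n: "ivec n" for x n v
  proof -
    have m: "ps (x + n) v \<in> Es x" "pc (x + n) v \<in> Ec x" "pu (x + n) v \<in> Eu x"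
      using proj[of "x + n" v] per periodicD n by metis+
    show ?thesis using proj_eq[OF m] proj(4)[of "x + n" v] by simp
  qed
  then show "periodic ps" "periodic pc" "periodic pu" by (auto simp: periodic_def)
qed

text \<open>Over the compact set of normalised triples from the closed bundles, the norm of the sum
  attains a minimum, which is positive by uniqueness of the decomposition.\<close>

lemma proj_bounded: "\<exists>M>0. \<forall>x v. norm (ps x v) \<le> M * norm v \<and> norm (pc x v) \<le> M * norm v"
proof -
  define S where "S = (ucube \<times> sphere (0::(real^3) \<times> (real^3) \<times> (real^3)) 1) \<inter>
    {z. fst (snd z) \<in> Es (fst z) \<and> fst (snd (snd z)) \<in> Ec (fst z) \<and> snd (snd (snd z)) \<in> Eu (fst z)}"
  have cl: "closed {z::(real^3) \<times> (real^3) \<times> (real^3) \<times> (real^3). g z \<in> E (fst z)}"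
    if "closed {z. snd z \<in> E (fst z)}" "continuous_on UNIV g" for E :: "real^3 \<Rightarrow> (real^3) set" and g
  proof -
    have eq: "{z. g z \<in> E (fst z)} = (\<lambda>z. (fst z, g z)) -` {z. snd z \<in> E (fst z)}" by auto
    show ?thesis unfolding eq by (rule closed_vimage[OF that(1)]) (intro continuous_intros that(2))
  qed
  have cS: "compact S" unfolding S_def
    by (intro compact_Int_closed compact_Times compact_cbox compact_sphere closed_Collect_conj cl bundles_closed continuous_intros)
  define f where "f z = norm (fst (snd z) + fst (snd (snd z)) + snd (snd (snd z)))" for z :: "(real^3) \<times> (real^3) \<times> (real^3) \<times> (real^3)"
  have cf: "continuous_on S f" unfolding f_def by (intro continuous_intros)
  have ne: "S \<noteq> {}"
  proof -
    have d: "dir Es 0 \<in> Es 0" "dir Es 0 \<noteq> 0" using dir line_cases by auto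
    have "(0, (1 / norm (dir Es 0)) *\<^sub>R dir Es 0, 0, 0) \<in> S"
      using d sub by (auto simp: S_def mem_box_cart norm_Pair subspace_0 subspace_scale)
    then show ?thesis by blast
  qed
  obtain z0 where z0: "z0 \<in> S" "\<And>z. z \<in> S \<Longrightarrow> f z0 \<le> f z"
    using continuous_attains_inf[OF cS ne cf] by blast
  have f0: "0 < f z0"
  proof (rule ccontr)
    assume "\<not> 0 < f z0"
    then have e: "fst (snd z0) + fst (snd (snd z0)) + snd (snd (snd z0)) = 0" by (simp add: f_def)
    have m: "fst (snd z0) \<in> Es (fst z0)" "fst (snd (snd z0)) \<in> Ec (fst z0)" "snd (snd (snd z0)) \<in> Eu (fst z0)"
      "norm (snd z0) = 1" using z0(1) by (auto simp: S_def)
    from decomp_zero[OF m(1-3) e] have "snd z0 = 0" by (simp add: prod_eq_iff)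
    then show False using m(4) by simp
  qed
  have "norm (ps x v) \<le> (1 / f z0) * norm v \<and> norm (pc x v) \<le> (1 / f z0) * norm v" for x v
  proof -
    define t where "t = norm (ps x v, pc x v, pu x v)"
    have le: "norm (ps x v) \<le> t" "norm (pc x v) \<le> t"
      using norm_fst_le[of "ps x v" "(pc x v, pu x v)"] norm_snd_le[of "(pc x v, pu x v)" "ps x v"] norm_fst_le[of "pc x v" "pu x v"]
      unfolding t_def by linarith+
    have "f z0 * t \<le> norm v"
    proof (cases "t = 0")
      case False
      then have t: "0 < t" by (simp add: t_def)
      obtain n where n: "ivec n" "x + n \<in> ucube" using translate_into_ucube by blast
      have per': "Es (x + n) = Es x" "Ec (x + n) = Ec x" "Eu (x + n) = Eu x" using per periodicD n by metis+
      have "(x + n, (1 / t) *\<^sub>R (ps x v, pc x v, pu x v)) \<in> S"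
        using n t proj sub per' unfolding S_def
        by (simp add: subspace_scale) (simp add: t_def[symmetric] flip: scaleR_Pair)
      from z0(2)[OF this] have "f z0 \<le> norm ((1 / t) *\<^sub>R v)"
        using proj(4)[of x v] by (simp add: f_def flip: scaleR_right_distrib)
      then show ?thesis using t by (simp add: field_simps)
    qed simp
    then have "t \<le> (1 / f z0) * norm v" using f0 by (simp add: field_simps)
    then show ?thesis using le by linarith
  qed
  then show ?thesis using f0 by (intro exI[of _ "1 / f z0"]) auto
qed

text \<open>A map into a compact set is continuous if its graph is closed. Closed bundles make the
  graph closed, and the restriction to \<open>norm (snd z) \<le> R\<close> makes the target
  compact.\<close>

lemma proj_lfield: "lfield ps" "lfield pc" "lfield pu"
proof -
  obtain M where M: "M > 0" "\<And>x v. norm (ps x v) \<le> M * norm v" "\<And>x v. norm (pc x v) \<le> M * norm v"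
    using proj_bounded by blast
  define f where "f z = (ps (fst z) (snd z), pc (fst z) (snd z))" for z
  have cR: "continuous_on {z. norm (snd z) \<le> R} f" for R
  proof (rule continuous_from_closed_graph)
    show "compact (cball (0::real^3) (M * R) \<times> cball (0::real^3) (M * R))" by (intro compact_Times compact_cball)
    show "f \<in> {z. norm (snd z) \<le> R} \<rightarrow> cball 0 (M * R) \<times> cball 0 (M * R)"
    proof
      fix z :: "(real^3) \<times> (real^3)" assume "z \<in> {z. norm (snd z) \<le> R}"
      then have "M * norm (snd z) \<le> M * R" using M(1) by simp
      then show "f z \<in> cball 0 (M * R) \<times> cball 0 (M * R)"
        using M(2)[of "fst z" "snd z"] M(3)[of "fst z" "snd z"] by (simp add: f_def)
    qed
    have eq: "(\<lambda>z. (z, f z)) ` {z. norm (snd z) \<le> R} = {y. norm (snd (fst y)) \<le> R} \<inter>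
      {y. fst (snd y) \<in> Es (fst (fst y))} \<inter> {y. snd (snd y) \<in> Ec (fst (fst y))} \<inter>
      {y. snd (fst y) - fst (snd y) - snd (snd y) \<in> Eu (fst (fst y))}" (is "?L = ?R")
    proof
      show "?L \<subseteq> ?R" using proj by (auto simp: f_def pu_def[symmetric])
      show "?R \<subseteq> ?L"
      proof
        fix y assume y: "y \<in> ?R"
        have "f (fst y) = snd y"
          using proj_eq(1,2)[of "fst (snd y)" "fst (fst y)" "snd (snd y)" "snd (fst y) - fst (snd y) - snd (snd y)"] y
          by (auto simp: f_def prod_eq_iff)
        then have "y = (fst y, f (fst y))" by (metis prod.collapse)
        then show "y \<in> ?L" using y by (intro image_eqI[of _ _ "fst y"]) auto
      qed
    qed
    have cl: "closed {y::((real^3) \<times> (real^3)) \<times> (real^3) \<times> (real^3). g y \<in> E (fst (fst y))}"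
      if "closed {z. snd z \<in> E (fst z)}" "continuous_on UNIV g" for E :: "real^3 \<Rightarrow> (real^3) set" and g
    proof -
      have eq: "{y. g y \<in> E (fst (fst y))} = (\<lambda>y. (fst (fst y), g y)) -` {z. snd z \<in> E (fst z)}" by auto
      show ?thesis unfolding eq by (rule closed_vimage[OF that(1)]) (intro continuous_intros that(2))
    qed
    show "closed ((\<lambda>z. (z, f z)) ` {z. norm (snd z) \<le> R})"
      unfolding eq by (intro closed_Int cl bundles_closed closed_Collect_le continuous_intros)
  qed
  have "isCont f z" for z
  proof -
    let ?S = "{y::(real^3) \<times> (real^3). norm (snd y) < norm (snd z) + 1}"
    have c: "continuous_on ?S f"
      by (rule continuous_on_subset[OF cR[of "norm (snd z) + 1"]]) (auto intro: less_imp_le)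
    have o: "open ?S" by (intro open_Collect_less continuous_intros)
    show ?thesis using iffD1[OF continuous_on_eq_continuous_at[OF o] c] by (rule bspec) simp
  qed
  then have cf: "continuous_on UNIV f" by (simp add: continuous_at_imp_continuous_on)
  have c1: "continuous_on UNIV (\<lambda>z. ps (fst z) (snd z))"
    using continuous_on_fst[OF cf] by (simp add: f_def)
  have c2: "continuous_on UNIV (\<lambda>z. pc (fst z) (snd z))"
    using continuous_on_snd[OF cf] by (simp add: f_def)
  have c3: "continuous_on UNIV (\<lambda>z. pu (fst z) (snd z))"
    unfolding pu_def by (intro continuous_intros c1 c2)
  show "lfield ps" "lfield pc" "lfield pu"
    using proj_linear proj_periodic c1 c2 c3 by (auto simp: lfield_def)
qed

section \<open>Adapted seminorms and the two cones\<close>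

text \<open>A Lyapunov norm: the weighted sum of the norms of the first \<open>L\<close> iterates.
  The map shifts the sum by one index, and the identity keeps exactly the two end terms, whose
  balance is decided by the choice of \<open>L\<close>.\<close>

lemma adapted_seminorm:
  assumes p: "lfield p" "\<And>x v. p (F x) (A x v) = A x (p x v)" and "0 < \<alpha>" "0 < L"
  shows "\<exists>\<nu> M. 0 < M \<and> (\<forall>x v. norm (p x v) \<le> \<nu> x v \<and> \<nu> x v \<le> M * norm v) \<and>
    (\<forall>x v w. \<nu> x (v + w) \<le> \<nu> x v + \<nu> x w) \<and>
    (\<forall>x v. \<nu> (F x) (A x v) = \<alpha> * (\<nu> x v + (1 / \<alpha>) ^ L * norm (D L x (p x v)) - norm (p x v)))"
proof -
  define g where "g j x v = (1 / \<alpha>) ^ j * norm (D j x (p x v))" for j x v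
  define \<nu> where "\<nu> x v = (\<Sum>j<L. g j x v)" for x v
  have gpos: "0 \<le> g j x v" for j x v using \<open>0 < \<alpha>\<close> by (simp add: g_def)
  obtain Mp where Mp: "Mp > 0" "\<And>x v. norm (p x v) \<le> Mp * norm v" using lfield_bounded[OF p(1)] by blast
  have "\<forall>j. \<exists>B>0. \<forall>x v. norm (D j x v) \<le> B * norm v" using lfield_bounded[OF D_lf] by blast
  then obtain B where B: "\<And>j. B j > 0" "\<And>j x v. norm (D j x v) \<le> B j * norm v" by metis
  define M where "M = (\<Sum>j<L. (1 / \<alpha>) ^ j * (B j * Mp))"
  have "0 < M" unfolding M_def using \<open>0 < \<alpha>\<close> \<open>0 < L\<close> B Mp by (intro sum_pos) auto
  moreover have "norm (p x v) \<le> \<nu> x v" for x v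
  proof -
    have "g 0 x v \<le> \<nu> x v" unfolding \<nu>_def using gpos \<open>0 < L\<close> by (intro member_le_sum) auto
    then show ?thesis by (simp add: g_def)
  qed
  moreover have "\<nu> x v \<le> M * norm v" for x v
    unfolding \<nu>_def M_def sum_distrib_right
  proof (rule sum_mono)
    fix j
    have "norm (D j x (p x v)) \<le> B j * (Mp * norm v)"
      using B(2)[of j x "p x v"] Mp(2)[of x v] B(1)[of j] by (meson less_imp_le mult_left_mono order_trans)
    then have "g j x v \<le> (1 / \<alpha>) ^ j * (B j * (Mp * norm v))" unfolding g_def
      using \<open>0 < \<alpha>\<close> by (intro mult_left_mono) auto
    then show "g j x v \<le> (1 / \<alpha>) ^ j * (B j * Mp) * norm v" by (simp only: mult.assoc)
  qed
  moreover have "\<nu> x (v + w) \<le> \<nu> x v + \<nu> x w" for x v w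
    unfolding \<nu>_def sum.distrib[symmetric]
  proof (rule sum_mono)
    fix j
    have "norm (D j x (p x (v + w))) \<le> norm (D j x (p x v)) + norm (D j x (p x w))"
      by (simp add: linear_add[OF lfield_linear[OF p(1)]] linear_add[OF D_lin] norm_triangle_ineq)
    then show "g j x (v + w) \<le> g j x v + g j x w"
      unfolding g_def distrib_left[symmetric] using \<open>0 < \<alpha>\<close> by (intro mult_left_mono) auto
  qed
  moreover have "\<nu> (F x) (A x v) = \<alpha> * (\<nu> x v + (1 / \<alpha>) ^ L * norm (D L x (p x v)) - norm (p x v))" for x v
  proof -
    have s: "g j (F x) (A x v) = \<alpha> * g (Suc j) x v" for j
      unfolding g_def p(2) cocycle_Suc_left[symmetric] using \<open>0 < \<alpha>\<close> by (simp del: cocycle.simps)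
    have "\<nu> (F x) (A x v) = \<alpha> * (\<Sum>j<L. g (Suc j) x v)" by (simp add: \<nu>_def s sum_distrib_left)
    also have "(\<Sum>j<L. g (Suc j) x v) = \<nu> x v + g L x v - g 0 x v"
      using sum.lessThan_Suc_shift[of "\<lambda>j. g j x v" L] by (simp add: \<nu>_def)
    finally show ?thesis by (simp add: g_def)
  qed
  ultimately show ?thesis by blast
qed

text \<open>Once \<open>C * (a / \<alpha>) ^ L \<le> 1\<close>, the new end term is at most the lost
  one, so a single step contracts by \<open>\<alpha>\<close> without a constant in front.\<close>

lemma adapted_upper:
  assumes p: "lfield p" "\<And>x v. p (F x) (A x v) = A x (p x v)" and a: "0 < a" "a < \<alpha>" "0 < C"
    and up: "\<And>x v n. norm (D n x (p x v)) \<le> C * a ^ n * norm (p x v)"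
  shows "\<exists>\<nu> M. 0 < M \<and> (\<forall>x v. norm (p x v) \<le> \<nu> x v \<and> \<nu> x v \<le> M * norm v) \<and>
    (\<forall>x v w. \<nu> x (v + w) \<le> \<nu> x v + \<nu> x w) \<and> (\<forall>x v. \<nu> (F x) (A x v) \<le> \<alpha> * \<nu> x v)"
proof -
  have "(a / \<alpha>) < 1" using a by simp
  then obtain n where n: "(a / \<alpha>) ^ n < 1 / C" using real_arch_pow_inv[of "1 / C" "a / \<alpha>"] a by auto
  define L where "L = Suc n"
  have "(a / \<alpha>) ^ L \<le> (a / \<alpha>) ^ n" unfolding L_def using a by (intro power_decreasing) auto
  then have "(a / \<alpha>) ^ L \<le> 1 / C" using n by linarith
  then have "C * (a / \<alpha>) ^ L \<le> C * (1 / C)" using a by (intro mult_left_mono) auto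
  then have L: "0 < L" "C * (a / \<alpha>) ^ L \<le> 1" using a by (auto simp: L_def)
  obtain \<nu> M where \<nu>: "0 < M" "\<And>x v. norm (p x v) \<le> \<nu> x v" "\<And>x v. \<nu> x v \<le> M * norm v"
    "\<And>x v w. \<nu> x (v + w) \<le> \<nu> x v + \<nu> x w"
    "\<And>x v. \<nu> (F x) (A x v) = \<alpha> * (\<nu> x v + (1 / \<alpha>) ^ L * norm (D L x (p x v)) - norm (p x v))"
    using adapted_seminorm[OF p less_trans[OF a(1,2)] L(1)] by blast
  have "\<nu> (F x) (A x v) \<le> \<alpha> * \<nu> x v" for x v
  proof -
    have "(1 / \<alpha>) ^ L * norm (D L x (p x v)) \<le> (1 / \<alpha>) ^ L * (C * a ^ L * norm (p x v))"
      using a by (intro mult_left_mono up) auto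
    also have "\<dots> = (C * (a / \<alpha>) ^ L) * norm (p x v)" by (simp add: power_divide)
    also have "\<dots> \<le> 1 * norm (p x v)" using L by (intro mult_right_mono) auto
    finally show ?thesis unfolding \<nu>(5) using a by (intro mult_left_mono) auto
  qed
  then show ?thesis using \<nu> by blast
qed

text \<open>The same identity with \<open>L\<close> so large that the new end term outweighs the
  lost one, so a single step expands at least by \<open>\<beta>\<close>.\<close>

lemma adapted_lower:
  assumes p: "lfield p" "\<And>x v. p (F x) (A x v) = A x (p x v)" and a: "0 < \<beta>" "\<beta> < b" "0 < C"
    and lo: "\<And>x v n. b ^ n * norm (p x v) \<le> C * norm (D n x (p x v))"
  shows "\<exists>\<nu> M. 0 < M \<and> (\<forall>x v. norm (p x v) \<le> \<nu> x v \<and> \<nu> x v \<le> M * norm v) \<and>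
    (\<forall>x v w. \<nu> x (v + w) \<le> \<nu> x v + \<nu> x w) \<and> (\<forall>x v. \<beta> * \<nu> x v \<le> \<nu> (F x) (A x v))"
proof -
  have "1 < b / \<beta>" using a by simp
  then obtain n where n: "C < (b / \<beta>) ^ n" using real_arch_pow by blast
  define L where "L = Suc n"
  have "(b / \<beta>) ^ n \<le> (b / \<beta>) ^ L" unfolding L_def using a by (intro power_increasing) auto
  then have L: "0 < L" "C \<le> (b / \<beta>) ^ L" using n by (auto simp: L_def)
  obtain \<nu> M where \<nu>: "0 < M" "\<And>x v. norm (p x v) \<le> \<nu> x v" "\<And>x v. \<nu> x v \<le> M * norm v"
    "\<And>x v w. \<nu> x (v + w) \<le> \<nu> x v + \<nu> x w"
    "\<And>x v. \<nu> (F x) (A x v) = \<beta> * (\<nu> x v + (1 / \<beta>) ^ L * norm (D L x (p x v)) - norm (p x v))"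
    using adapted_seminorm[OF p a(1) L(1)] by blast
  have "\<beta> * \<nu> x v \<le> \<nu> (F x) (A x v)" for x v
  proof -
    have "C * norm (p x v) \<le> (b / \<beta>) ^ L * norm (p x v)" using L by (intro mult_right_mono) auto
    also have "\<dots> = (1 / \<beta>) ^ L * (b ^ L * norm (p x v))" by (simp add: power_divide)
    also have "\<dots> \<le> (1 / \<beta>) ^ L * (C * norm (D L x (p x v)))"
      using a by (intro mult_left_mono lo) auto
    also have "\<dots> = C * ((1 / \<beta>) ^ L * norm (D L x (p x v)))" by simp
    finally have "norm (p x v) \<le> (1 / \<beta>) ^ L * norm (D L x (p x v))" using a(3) by (simp only: mult_le_cancel_left_pos)
    then show ?thesis unfolding \<nu>(5) using a by (intro mult_left_mono) auto
  qed
  then show ?thesis using \<nu> by blast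
qed

lemma norm_sum3: "norm v \<le> norm (ps x v) + norm (pc x v) + norm (pu x v)"
  using norm_triangle_ineq[of "ps x v + pc x v" "pu x v"] norm_triangle_ineq[of "ps x v" "pc x v"]
  unfolding proj(4) by linarith

lemma stable_cone: "exp_cone F \<sigma> ps"
proof -
  obtain C a b c d where R: "\<And>x. rates_at C a b c d x" using rates_global by blast
  note r = rates_atD[OF R]
  \<comment> \<open>These rates lie strictly inside the gaps around \<open>\<sigma>\<close>: the
    seminorms need room towards \<open>a\<close>, \<open>b\<close> and \<open>d\<close>, and
    \<open>exp_coneI\<close> needs room towards \<open>\<sigma>\<close>.\<close>
  define \<alpha> where "\<alpha> = (a + \<sigma>) / 2"
  define \<beta> where "\<beta> = (\<sigma> + min b d) / 2"
  have ab: "a < \<alpha>" "\<alpha> < \<sigma>" "\<sigma> < \<beta>" "\<beta> < b" "\<beta> < d" "0 < \<alpha>" "0 < \<beta>"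
    using r(2-7) \<sigma>\<mu> by (auto simp: \<alpha>_def \<beta>_def min_def)
  obtain \<nu> M1 where \<nu>: "0 < M1" "\<And>x v. norm (ps x v) \<le> \<nu> x v" "\<And>x v. \<nu> x v \<le> M1 * norm v"
    "\<And>x v w. \<nu> x (v + w) \<le> \<nu> x v + \<nu> x w" "\<And>x v. \<nu> (F x) (A x v) \<le> \<alpha> * \<nu> x v"
    using adapted_upper[OF proj_lfield(1) proj_equivariant(1) r(2) ab(1) r(1) r(8)[OF proj(1)]] by blast
  obtain \<omega>1 M2 where w1: "0 < M2" "\<And>x v. norm (pc x v) \<le> \<omega>1 x v" "\<And>x v. \<omega>1 x v \<le> M2 * norm v"
    "\<And>x v w. \<omega>1 x (v + w) \<le> \<omega>1 x v + \<omega>1 x w" "\<And>x v. \<beta> * \<omega>1 x v \<le> \<omega>1 (F x) (A x v)"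
    using adapted_lower[OF proj_lfield(2) proj_equivariant(2) ab(7) ab(4) r(1) r(10)[OF proj(2)]] by blast
  obtain \<omega>2 M3 where w2: "0 < M3" "\<And>x v. norm (pu x v) \<le> \<omega>2 x v" "\<And>x v. \<omega>2 x v \<le> M3 * norm v"
    "\<And>x v w. \<omega>2 x (v + w) \<le> \<omega>2 x v + \<omega>2 x w" "\<And>x v. \<beta> * \<omega>2 x v \<le> \<omega>2 (F x) (A x v)"
    using adapted_lower[OF proj_lfield(3) proj_equivariant(3) ab(7) ab(5) r(1) r(11)[OF proj(3)]] by blast
  define K where "K = 1 + M1 + M2 + M3"
  have K: "M1 \<le> K" "M2 + M3 \<le> K" "1 \<le> K" "0 < K" using \<nu>(1) w1(1) w2(1) by (auto simp: K_def)
  have pos: "0 \<le> \<nu> x v" "0 \<le> \<omega>1 x v" "0 \<le> \<omega>2 x v" for x v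
    using \<nu>(2)[where x=x and v=v] w1(2)[where x=x and v=v] w2(2)[where x=x and v=v] norm_ge_zero order_trans by blast+
  then have pos2: "0 \<le> \<omega>1 x v + \<omega>2 x v" "0 \<le> \<nu> x v + (\<omega>1 x v + \<omega>2 x v)" for x v
    by (simp_all add: add_nonneg_nonneg)
  show ?thesis
  proof (rule exp_coneI[OF A_lf F_der less_imp_le[OF ab(6)] ab(2,3), where \<nu> = \<nu> and \<omega> = "\<lambda>x v. \<omega>1 x v + \<omega>2 x v" and C = K])
    fix x v w
    show "0 \<le> \<nu> x v" "0 \<le> \<omega>1 x v + \<omega>2 x v" using pos by (simp_all add: add_nonneg_nonneg)
    show "\<nu> x (v + w) \<le> \<nu> x v + \<nu> x w" by (rule \<nu>)
    show "\<omega>1 x (v + w) + \<omega>2 x (v + w) \<le> \<omega>1 x v + \<omega>2 x v + (\<omega>1 x w + \<omega>2 x w)" using w1(4)[of x v w] w2(4)[of x v w] by linarith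
    show "0 < K" by (rule K)
    show "\<nu> x v \<le> K * norm v" using \<nu>(3)[of x v] mult_right_mono[OF K(1) norm_ge_zero[of v]] by linarith
    show "\<omega>1 x v + \<omega>2 x v \<le> K * norm v"
      using w1(3)[of x v] w2(3)[of x v] mult_right_mono[OF K(2) norm_ge_zero[of v]] by (simp add: algebra_simps)
    have le: "norm v \<le> \<nu> x v + (\<omega>1 x v + \<omega>2 x v)" using norm_sum3[of v x] \<nu>(2)[of x v] w1(2)[of x v] w2(2)[of x v] by linarith
    then show "norm v \<le> K * (\<nu> x v + (\<omega>1 x v + \<omega>2 x v))"
      using mult_right_mono[OF K(3) pos2(2)[of x v]] unfolding mult_1_left by (rule order_trans)
    have "v - ps x v = pc x v + pu x v" using proj(4)[of x v] by (simp add: algebra_simps)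
    then have "norm (v - ps x v) \<le> \<omega>1 x v + \<omega>2 x v"
      using norm_triangle_ineq[of "pc x v" "pu x v"] w1(2)[of x v] w2(2)[of x v] by simp
    then show "norm (v - ps x v) \<le> K * (\<omega>1 x v + \<omega>2 x v)"
      using mult_right_mono[OF K(3) pos2(1)[of x v]] unfolding mult_1_left by (rule order_trans)
    show "\<nu> (F x) (A x v) \<le> \<alpha> * \<nu> x v" by (rule \<nu>)
    show "\<beta> * (\<omega>1 x v + \<omega>2 x v) \<le> \<omega>1 (F x) (A x v) + \<omega>2 (F x) (A x v)" using w1(5)[of x v] w2(5)[of x v] by (simp add: algebra_simps)
  qed
qed

lemma AAi': "A (Fi x) (Ai x v) = v"
  using AAi[of "Fi x" v] by (simp add: FFi)

text \<open>For the inverse, the unstable component contracts and the stable and centre components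
  expand. The seminorms are those adapted to \<open>F\<close>, read at \<open>Fi x\<close>, so the
  reciprocals of their rates appear.\<close>

lemma unstable_cone: "exp_cone Fi (1 / \<mu>) pu"
proof -
  obtain C a b c d where R: "\<And>x. rates_at C a b c d x" using rates_global by blast
  note r = rates_atD[OF R]
  define \<alpha> where "\<alpha> = (\<mu> + max a c) / 2"
  define \<beta> where "\<beta> = (\<mu> + d) / 2"
  have ab: "a < \<alpha>" "c < \<alpha>" "\<alpha> < \<mu>" "\<mu> < \<beta>" "\<beta> < d" "0 < \<alpha>" "0 < \<beta>"
    using r(2-7) \<sigma>\<mu> by (auto simp: \<alpha>_def \<beta>_def max_def)
  obtain \<nu> M1 where \<nu>: "0 < M1" "\<And>x v. norm (pu x v) \<le> \<nu> x v" "\<And>x v. \<nu> x v \<le> M1 * norm v"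
    "\<And>x v w. \<nu> x (v + w) \<le> \<nu> x v + \<nu> x w" "\<And>x v. \<beta> * \<nu> x v \<le> \<nu> (F x) (A x v)"
    using adapted_lower[OF proj_lfield(3) proj_equivariant(3) ab(7) ab(5) r(1) r(11)[OF proj(3)]] by blast
  obtain \<omega>1 M2 where w1: "0 < M2" "\<And>x v. norm (ps x v) \<le> \<omega>1 x v" "\<And>x v. \<omega>1 x v \<le> M2 * norm v"
    "\<And>x v w. \<omega>1 x (v + w) \<le> \<omega>1 x v + \<omega>1 x w" "\<And>x v. \<omega>1 (F x) (A x v) \<le> \<alpha> * \<omega>1 x v"
    using adapted_upper[OF proj_lfield(1) proj_equivariant(1) r(2) ab(1) r(1) r(8)[OF proj(1)]] by blast
  obtain \<omega>2 M3 where w2: "0 < M3" "\<And>x v. norm (pc x v) \<le> \<omega>2 x v" "\<And>x v. \<omega>2 x v \<le> M3 * norm v"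
    "\<And>x v w. \<omega>2 x (v + w) \<le> \<omega>2 x v + \<omega>2 x w" "\<And>x v. \<omega>2 (F x) (A x v) \<le> \<alpha> * \<omega>2 x v"
    using adapted_upper[OF proj_lfield(2) proj_equivariant(2) r(5) ab(2) r(1) r(9)[OF proj(2)]] by blast
  define K where "K = 1 + M1 + M2 + M3"
  have K: "M1 \<le> K" "M2 + M3 \<le> K" "1 \<le> K" "0 < K" using \<nu>(1) w1(1) w2(1) by (auto simp: K_def)
  have pos: "0 \<le> \<nu> x v" "0 \<le> \<omega>1 x v" "0 \<le> \<omega>2 x v" for x v
    using \<nu>(2)[where x=x and v=v] w1(2)[where x=x and v=v] w2(2)[where x=x and v=v] norm_ge_zero order_trans by blast+
  have o: "0 \<le> 1 / \<beta>" "1 / \<beta> < 1 / \<mu>" "1 / \<mu> < 1 / \<alpha>"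
    using ab \<sigma>\<mu> by (auto intro!: divide_strict_left_mono)
  have pos2: "0 \<le> \<omega>1 x v + \<omega>2 x v" "0 \<le> \<nu> x v + (\<omega>1 x v + \<omega>2 x v)" for x v
    using pos by (simp_all add: add_nonneg_nonneg)
  show ?thesis
  proof (rule exp_coneI[OF Ai_lf Fi_der o, where \<nu> = \<nu> and \<omega> = "\<lambda>x v. \<omega>1 x v + \<omega>2 x v" and C = K])
    fix x v w
    show "0 \<le> \<nu> x v" "0 \<le> \<omega>1 x v + \<omega>2 x v" using pos by (simp_all add: add_nonneg_nonneg)
    show "\<nu> x (v + w) \<le> \<nu> x v + \<nu> x w" by (rule \<nu>)
    show "\<omega>1 x (v + w) + \<omega>2 x (v + w) \<le> \<omega>1 x v + \<omega>2 x v + (\<omega>1 x w + \<omega>2 x w)" using w1(4)[of x v w] w2(4)[of x v w] by linarith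
    show "0 < K" by (rule K)
    show "\<nu> x v \<le> K * norm v" using \<nu>(3)[of x v] mult_right_mono[OF K(1) norm_ge_zero[of v]] by linarith
    show "\<omega>1 x v + \<omega>2 x v \<le> K * norm v"
      using w1(3)[of x v] w2(3)[of x v] mult_right_mono[OF K(2) norm_ge_zero[of v]] by (simp add: algebra_simps)
    have le: "norm v \<le> \<nu> x v + (\<omega>1 x v + \<omega>2 x v)" using norm_sum3[of v x] \<nu>(2)[of x v] w1(2)[of x v] w2(2)[of x v] by linarith
    then show "norm v \<le> K * (\<nu> x v + (\<omega>1 x v + \<omega>2 x v))"
      using mult_right_mono[OF K(3) pos2(2)[of x v]] unfolding mult_1_left by (rule order_trans)
    have "v - pu x v = ps x v + pc x v" using proj(4)[of x v] by (simp add: algebra_simps)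
    then have "norm (v - pu x v) \<le> \<omega>1 x v + \<omega>2 x v"
      using norm_triangle_ineq[of "ps x v" "pc x v"] w1(2)[of x v] w2(2)[of x v] by simp
    then show "norm (v - pu x v) \<le> K * (\<omega>1 x v + \<omega>2 x v)"
      using mult_right_mono[OF K(3) pos2(1)[of x v]] unfolding mult_1_left by (rule order_trans)
    show "\<nu> (Fi x) (Ai x v) \<le> 1 / \<beta> * \<nu> x v"
      using \<nu>(5)[of "Fi x" "Ai x v"] ab(7) by (simp add: AAi' FFi field_simps)
    show "1 / \<alpha> * (\<omega>1 x v + \<omega>2 x v) \<le> \<omega>1 (Fi x) (Ai x v) + \<omega>2 (Fi x) (Ai x v)"
      using w1(5)[of "Fi x" "Ai x v"] w2(5)[of "Fi x" "Ai x v"] ab(6) by (simp add: AAi' FFi field_simps)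
  qed
qed

text \<open>The summary of rates used from here on. \<open>b\<close> and \<open>c\<close> also serve
  the plane bundles, so they are taken as the smaller of two expansion rates and the larger of two
  growth rates.\<close>

lemma bundle_growth:
  "\<exists>K b c. 0 < K \<and> \<sigma> < b \<and> 0 < c \<and> c < \<mu> \<and>
    (\<forall>x v n. v \<in> Es x \<longrightarrow> norm (D n x v) \<le> K * \<sigma> ^ n * norm v) \<and>
    (\<forall>x v n. v \<in> Eu x \<longrightarrow> norm (Di n x v) \<le> K * (1 / \<mu>) ^ n * norm v) \<and>
    (\<forall>x v n. v \<in> Ec x \<longrightarrow> norm (D n x v) \<le> K * c ^ n * norm v) \<and>
    (\<forall>x v n. v \<in> Ec x \<longrightarrow> norm (Di n x v) \<le> K * (1 / b) ^ n * norm v) \<and>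
    (\<forall>x v n. v \<in> ssum (Ec x) (Es x) \<longrightarrow> norm (D n x v) \<le> K * c ^ n * norm v) \<and>
    (\<forall>x v n. v \<in> ssum (Ec x) (Eu x) \<longrightarrow> norm (Di n x v) \<le> K * (1 / b) ^ n * norm v)"
proof -
  obtain C a b c d where R: "\<And>x. rates_at C a b c d x" using rates_global by blast
  note r = rates_atD[OF R] and q = backward_rates[OF R]
  obtain M where M: "M > 0" "\<And>x v. norm (ps x v) \<le> M * norm v" "\<And>x v. norm (pc x v) \<le> M * norm v"
    using proj_bounded by blast
  obtain M' where M': "M' > 0" "\<And>x v. norm (pu x v) \<le> M' * norm v"
    using lfield_bounded[OF proj_lfield(3)] by blast
  define c' where "c' = max a c"
  define b' where "b' = min b d"
  define K where "K = C + C * (M + M) + C * (M + M')"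
  have K: "C \<le> K" "C * (M + M) \<le> K" "C * (M + M') \<le> K" "0 < K"
    using r(1) M(1) M'(1) mult_pos_pos[of C "M + M"] mult_pos_pos[of C "M + M'"] unfolding K_def by linarith+
  have cb: "\<sigma> < b'" "0 < c'" "c' < \<mu>" "0 < b'" "a \<le> c'" "c \<le> c'" "1 / b \<le> 1 / b'" "1 / d \<le> 1 / b'" "0 < b" "0 < d" "1 / d \<le> 1 / \<mu>"
    using r(2-7) \<sigma>\<mu> by (auto simp: c'_def b'_def min_def max_def intro!: divide_left_mono)
  have up: "norm w \<le> K * t' ^ n * norm v" if "norm w \<le> C * t ^ n * norm v" "0 \<le> t" "t \<le> t'" for w v :: "real^3" and t t' n
  proof -
    have "C * t ^ n \<le> K * t' ^ n" using K r(1) that by (intro mult_mono power_mono) auto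
    then have "C * t ^ n * norm v \<le> K * t' ^ n * norm v" by (intro mult_right_mono) auto
    then show ?thesis using that(1) by linarith
  qed
  have cs: "norm (D n x v) \<le> K * c' ^ n * norm v" if v: "v \<in> ssum (Ec x) (Es x)" for x v n
  proof -
    obtain w s where ws: "w \<in> Ec x" "s \<in> Es x" "v = w + s" using v by (auto simp: ssum_def)
    have e: "ps x v = s" "pc x v = w" using proj_eq[OF ws(2,1) subspace_0[OF sub(3)]] ws(3) by (auto simp: add.commute)
    have "norm (D n x v) \<le> norm (D n x w) + norm (D n x s)"
      by (simp add: ws(3) linear_add[OF D_lin] norm_triangle_ineq)
    also have "\<dots> \<le> C * c ^ n * norm w + C * a ^ n * norm s" by (intro add_mono r ws)
    also have "\<dots> \<le> C * c' ^ n * (M * norm v) + C * c' ^ n * (M * norm v)"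
      using M(2)[of x v] M(3)[of x v] r(1,2,5) cb unfolding e
      by (intro add_mono mult_mono power_mono) (auto intro: mult_nonneg_nonneg)
    also have "\<dots> = (C * (M + M)) * (c' ^ n * norm v)" by (simp add: algebra_simps)
    also have "\<dots> \<le> K * (c' ^ n * norm v)" using K(2) cb by (intro mult_right_mono) auto
    finally show ?thesis by (simp add: mult.assoc)
  qed
  have cu: "norm (Di n x v) \<le> K * (1 / b') ^ n * norm v" if v: "v \<in> ssum (Ec x) (Eu x)" for x v n
  proof -
    obtain w u where wu: "w \<in> Ec x" "u \<in> Eu x" "v = w + u" using v by (auto simp: ssum_def)
    have e: "pu x v = u" "pc x v = w" using proj_eq[OF subspace_0[OF sub(1)] wu(1,2)] wu(3) by auto
    have "norm (Di n x v) \<le> norm (Di n x w) + norm (Di n x u)"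
      by (simp add: wu(3) linear_add[OF Di_lin] norm_triangle_ineq)
    also have "\<dots> \<le> C * (1 / b) ^ n * norm w + C * (1 / d) ^ n * norm u" by (intro add_mono q wu)
    also have "\<dots> \<le> C * (1 / b') ^ n * (M * norm v) + C * (1 / b') ^ n * (M' * norm v)"
      using M'(2)[of x v] M(3)[of x v] r(1) cb unfolding e
      by (intro add_mono mult_mono power_mono) (auto intro: mult_nonneg_nonneg)
    also have "\<dots> = (C * (M + M')) * ((1 / b') ^ n * norm v)" by (simp add: algebra_simps)
    also have "\<dots> \<le> K * ((1 / b') ^ n * norm v)" using K(3) cb by (intro mult_right_mono) auto
    finally show ?thesis by (simp add: mult.assoc)
  qed
  have 1: "norm (D n x v) \<le> K * \<sigma> ^ n * norm v" if "v \<in> Es x" for x v n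
    using up[OF r(8)[OF that, of n]] r(2,3) by simp
  have 2: "norm (Di n x v) \<le> K * (1 / \<mu>) ^ n * norm v" if "v \<in> Eu x" for x v n
    using up[OF q(4)[OF that, of n]] cb by simp
  have 3: "norm (D n x v) \<le> K * c' ^ n * norm v" if "v \<in> Ec x" for x v n
    using up[OF r(9)[OF that, of n]] r(5) cb by simp
  have 4: "norm (Di n x v) \<le> K * (1 / b') ^ n * norm v" if "v \<in> Ec x" for x v n
    using up[OF q(3)[OF that, of n]] cb by simp
  show ?thesis
    using K(4) cb(1-3) 1 2 3 4 cs cu by (intro exI[of _ K] exI[of _ b'] exI[of _ c']) blast
qed

end

section \<open>Curves in plaques\<close>

abbreviation chart_dom :: "((real^2) \<times> real) set" where
  "chart_dom \<equiv> ball 0 1 \<times> ball 0 1"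

text \<open>The tangent plane only has to contain the range of \<open>p\<close>: one chart of the
  foliation tangent to \<open>Eu\<close> and \<open>Es\<close> is used for \<open>ps\<close> as well
  as for \<open>pu\<close>.\<close>

definition plaque_chart :: "((real^2) \<times> real \<Rightarrow> real^3) \<Rightarrow> (real^3 \<Rightarrow> real^3 \<Rightarrow> real^3) \<Rightarrow> bool" where
  "plaque_chart \<psi> p \<longleftrightarrow> inj_on \<psi> chart_dom \<and> continuous_on chart_dom \<psi> \<and> open (\<psi> ` chart_dom) \<and>
     continuous_on (\<psi> ` chart_dom) (inv_into chart_dom \<psi>) \<and>
     (\<forall>t\<in>ball 0 1. \<exists>g'. (\<forall>u\<in>ball 0 1. ((\<lambda>u. \<psi> (u, t)) has_derivative blinfun_apply (g' u)) (at u)) \<and>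
        continuous_on (ball 0 1) g' \<and>
        (\<forall>u\<in>ball 0 1. inj (blinfun_apply (g' u)) \<and> range (p (\<psi> (u, t))) \<subseteq> range (blinfun_apply (g' u))))"

lemma plaque_chartD:
  assumes "plaque_chart \<psi> p" "t \<in> ball 0 1"
  shows "\<exists>g'. (\<forall>u\<in>ball 0 1. ((\<lambda>u. \<psi> (u, t)) has_derivative blinfun_apply (g' u)) (at u)) \<and>
        continuous_on (ball 0 1) g' \<and>
        (\<forall>u\<in>ball 0 1. inj (blinfun_apply (g' u)) \<and> range (p (\<psi> (u, t))) \<subseteq> range (blinfun_apply (g' u)))"
  using assms unfolding plaque_chart_def by (elim conjE) (rule bspec)

definition line_proj :: "(real^3 \<Rightarrow> real^3 \<Rightarrow> real^3) \<Rightarrow> bool" where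
  "line_proj p \<longleftrightarrow> lfield p \<and> (\<forall>x. \<exists>w. norm w = 1 \<and> p x w = w \<and> (\<forall>v. \<exists>t. p x v = t *\<^sub>R w))"

abbreviation chart_inv :: "((real^2) \<times> real \<Rightarrow> real^3) \<Rightarrow> real^3 \<Rightarrow> (real^2) \<times> real" where
  "chart_inv \<psi> \<equiv> inv_into chart_dom \<psi>"

text \<open>Injectivity bounds \<open>g' u\<close> from below by some \<open>m\<close>; maps within
  \<open>m / 2\<close> of it keep half of this bound, which controls the difference of the
  solutions.\<close>

lemma continuous_solution_of_linear_equations:
  fixes g' :: "'a::metric_space \<Rightarrow> ('k::euclidean_space \<Rightarrow>\<^sub>L 'b::euclidean_space)"
  assumes "continuous_on S g'" "continuous_on S f" "\<And>u. u \<in> S \<Longrightarrow> inj (blinfun_apply (g' u))"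
    and X: "\<And>u. u \<in> S \<Longrightarrow> blinfun_apply (g' u) (X u) = f u"
  shows "continuous_on S X"
  unfolding continuous_on_def
proof
  fix u assume u: "u \<in> S"
  have "linear (blinfun_apply (g' u))" using blinfun.bounded_linear_right bounded_linear.linear by blast
  then obtain m where m: "0 < m" "\<And>\<xi>. m * norm \<xi> \<le> norm (g' u \<xi>)"
    using linear_inj_bounded_below_pos assms(3)[OF u] by blast
  have "((\<lambda>u'. norm (g' u' - g' u)) \<longlongrightarrow> norm (g' u - g' u)) (at u within S)"
    using assms(1) u by (intro tendsto_intros) (auto simp: continuous_on_def)
  then have ev: "\<forall>\<^sub>F u' in at u within S. norm (g' u' - g' u) < m / 2"
    using m(1) by (intro order_tendstoD) auto
  have evS: "\<forall>\<^sub>F u' in at u within S. u' \<in> S" by (simp add: eventually_at_filter)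
  have "\<forall>\<^sub>F u' in at u within S. norm (X u' - X u) \<le> (2 / m) * norm (f u' - g' u' (X u))"
    using ev evS
  proof (rule eventually_elim2)
    fix u' assume n: "norm (g' u' - g' u) < m / 2" and u': "u' \<in> S"
    have "norm (g' u (X u' - X u)) \<le> norm (g' u' (X u' - X u)) + norm ((g' u' - g' u) (X u' - X u))"
      using norm_triangle_ineq4[of "g' u' (X u' - X u)" "(g' u' - g' u) (X u' - X u)"]
      by (simp add: blinfun.diff_left)
    also have "norm ((g' u' - g' u) (X u' - X u)) \<le> m / 2 * norm (X u' - X u)"
      using norm_blinfun[of "g' u' - g' u" "X u' - X u"] mult_right_mono[OF less_imp_le[OF n] norm_ge_zero[of "X u' - X u"]]
      by linarith
    also have "g' u' (X u' - X u) = f u' - g' u' (X u)" using X[OF u'] by (simp add: blinfun.diff_right)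
    finally have "m * norm (X u' - X u) \<le> norm (f u' - g' u' (X u)) + m / 2 * norm (X u' - X u)"
      using m(2)[of "X u' - X u"] by linarith
    then show "norm (X u' - X u) \<le> (2 / m) * norm (f u' - g' u' (X u))" using m(1) by (simp add: field_simps)
  qed
  moreover have "((\<lambda>u'. (2 / m) * norm (f u' - g' u' (X u))) \<longlongrightarrow> (2 / m) * norm (f u - g' u (X u))) (at u within S)"
    using assms(1,2) u by (intro tendsto_intros) (auto simp: continuous_on_def)
  then have "((\<lambda>u'. (2 / m) * norm (f u' - g' u' (X u))) \<longlongrightarrow> 0) (at u within S)" using X[OF u] by simp
  ultimately have "((\<lambda>u'. X u' - X u) \<longlongrightarrow> 0) (at u within S)" by (rule Lim_null_comparison)
  then show "(X \<longlongrightarrow> X u) (at u within S)" by (simp add: LIM_zero_iff)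
qed

lemma chart_inv_openin:
  assumes "continuous_on (\<psi> ` chart_dom) (chart_inv \<psi>)" "open (\<psi> ` chart_dom)" "open U"
  shows "open {x \<in> \<psi> ` chart_dom. chart_inv \<psi> x \<in> U}"
proof -
  have "open (chart_inv \<psi> -` U \<inter> \<psi> ` chart_dom)"
    using continuous_on_open_vimage[OF assms(2)] assms(1,3) by blast
  moreover have "chart_inv \<psi> -` U \<inter> \<psi> ` chart_dom = {x \<in> \<psi> ` chart_dom. chart_inv \<psi> x \<in> U}" by auto
  ultimately show ?thesis by simp
qed

text \<open>A field tangent to the line field is pulled back to the parameters of one plaque and
  integrated there, so the curve stays in its plaque. Its tangents are contracted, hence its points
  are exponentially close, and it keeps advancing along \<open>s\<close> times \<open>w\<close>. The
  length \<open>r\<close> is uniform over \<open>y\<close> near \<open>p0\<close>.\<close>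

lemma plaque_half_curve:
  fixes G :: "real^3 \<Rightarrow> real^3"
  assumes ch: "plaque_chart \<psi> p" and p: "lfield p" and p0: "p0 \<in> \<psi> ` chart_dom"
    and w: "norm w = 1" "p p0 w = w"
    and der: "\<And>x. (G has_derivative A x) (at x)" and "0 < \<rho>"
    and contr: "\<And>x v n. norm (cocycle G A n x (p x v)) \<le> Kc * \<rho> ^ n * norm (p x v)" and "0 \<le> Kc" and "0 < \<epsilon>"
  shows "\<exists>r>0. ball p0 r \<subseteq> \<psi> ` chart_dom \<and> (\<forall>y\<in>ball p0 r. \<forall>s\<in>{1,-1::real}. \<exists>c. c 0 = y \<and> continuous_on {0..r} c \<and>
     (\<forall>a\<in>{0..r}. c a \<in> ball p0 \<epsilon> \<and> c a \<in> \<psi> ` chart_dom \<and> snd (chart_inv \<psi> (c a)) = snd (chart_inv \<psi> y)) \<and>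
     (\<forall>a\<in>{0..r}. \<forall>b\<in>{0..r}. exp_close G \<rho> (c a) (c b)) \<and>
     (\<forall>a b. 0 \<le> a \<longrightarrow> a \<le> b \<longrightarrow> b \<le> r \<longrightarrow> (b - a) / 2 \<le> s * ((c b - c a) \<bullet> w)))"
proof -
  let ?B = "chart_dom"
  have inj: "inj_on \<psi> ?B" and cont: "continuous_on ?B \<psi>" and opn: "open (\<psi> ` ?B)"
    and icont: "continuous_on (\<psi> ` ?B) (chart_inv \<psi>)" using ch by (auto simp: plaque_chart_def)
  obtain u0 t0 where ut0: "p0 = \<psi> (u0, t0)" "norm u0 < 1" "\<bar>t0\<bar> < 1" using p0 by auto
  obtain R1 where R1: "norm u0 < R1" "R1 < 1" using dense ut0 by blast
  obtain R2 where R2: "R1 < R2" "R2 < 1" using dense R1 by blast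
  obtain \<tau> where \<tau>: "\<bar>t0\<bar> < \<tau>" "\<tau> < 1" using dense ut0 by blast
  have R0: "0 < R1" "0 < R2" using R1 R2 norm_ge_zero[of u0] by linarith+
  \<comment> \<open>Starting points lie in \<open>In\<close>, and a curve whose parameter has
    reached radius \<open>R2\<close> lies in \<open>Out\<close>. The distance between these compact
    sets limits the travel time in all plaques at once.\<close>
  define In where "In = \<psi> ` (cball 0 R1 \<times> {-\<tau>..\<tau>})"
  define Out where "Out = \<psi> ` (sphere 0 R2 \<times> {-\<tau>..\<tau>})"
  have sub: "cball 0 R1 \<times> {-\<tau>..\<tau>} \<subseteq> ?B" "sphere 0 R2 \<times> {-\<tau>..\<tau>} \<subseteq> ?B"
    using R1 R2 \<tau> by auto
  have "compact In" "compact Out" unfolding In_def Out_def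
    by (intro compact_continuous_image continuous_on_subset[OF cont] sub compact_Times compact_cball compact_sphere compact_Icc)+
  moreover have "In \<inter> Out = {}"
  proof -
    have "(cball 0 R1 \<times> {-\<tau>..\<tau>}) \<inter> (sphere (0::real^2) R2 \<times> {-\<tau>..\<tau>}) = {}" using R2 by auto
    then show ?thesis unfolding In_def Out_def using inj_on_image_Int[OF inj sub] by (metis image_empty)
  qed
  ultimately obtain \<delta> where \<delta>: "\<delta> > 0" "\<And>x y. x \<in> In \<Longrightarrow> y \<in> Out \<Longrightarrow> \<delta> \<le> dist x y"
    using separate_compact_closed compact_imp_closed by metis
  obtain Mp where Mp: "Mp > 0" "\<And>x v. norm (p x v) \<le> Mp * norm v" using lfield_bounded[OF p] by blast
  have pw: "norm (p x w) \<le> Mp" for x using Mp(2)[of x w] w by simp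
  obtain r3 where r3: "r3 > 0" "\<And>x. norm (p0 - x) < r3 \<Longrightarrow> norm (p p0 w - p x w) \<le> 1/2 * norm w"
    using lfield_uniform[OF p, of "1/2"] by auto
  define r2 where "r2 = min r3 \<epsilon>"
  have r2: "r2 > 0" "\<And>x. norm (p0 - x) < r2 \<Longrightarrow> norm (p p0 w - p x w) \<le> 1/2 * norm w" "r2 \<le> \<epsilon>"
    using r3 \<open>0 < \<epsilon>\<close> by (auto simp: r2_def)
  have op: "open {x \<in> \<psi> ` ?B. chart_inv \<psi> x \<in> ball 0 R1 \<times> ball 0 \<tau>}"
    by (intro chart_inv_openin icont opn open_Times open_ball)
  have "chart_inv \<psi> p0 = (u0, t0)" using ut0 by (auto intro!: inv_into_f_eq[OF inj])
  then have mem: "p0 \<in> {x \<in> \<psi> ` ?B. chart_inv \<psi> x \<in> ball 0 R1 \<times> ball 0 \<tau>}" using p0 R1 \<tau> by simp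
  obtain r1 where r1: "r1 > 0" "ball p0 r1 \<subseteq> {x \<in> \<psi> ` ?B. chart_inv \<psi> x \<in> ball 0 R1 \<times> ball 0 \<tau>}"
    by (rule openE[OF op mem])
  \<comment> \<open>Four demands: the start has parameters within \<open>R1\<close> and
    \<open>\<tau>\<close>, the path is too short to reach \<open>Out\<close>, and start and path
    each spend at most half of \<open>r2\<close>, the range where \<open>p\<close> is nearly
    constant.\<close>
  define r where "r = min (min r1 (r2 / 2)) (min (\<delta> / (2 * Mp)) (r2 / (2 * Mp)))"
  have r: "0 < r" "r \<le> r1" "r \<le> r2 / 2" "Mp * r < \<delta>" "Mp * r \<le> r2 / 2"
  proof -
    show "0 < r" using r1 r2 \<delta> Mp by (simp add: r_def)
    show "r \<le> r1" "r \<le> r2 / 2" by (auto simp: r_def)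
    have "r \<le> \<delta> / (2 * Mp)" "r \<le> r2 / (2 * Mp)" by (auto simp: r_def)
    then have "Mp * r \<le> \<delta> / 2" "Mp * r \<le> r2 / 2" using Mp(1) by (auto simp: field_simps)
    then show "Mp * r < \<delta>" "Mp * r \<le> r2 / 2" using \<delta>(1) by linarith+
  qed
  have main: "\<exists>c. c 0 = y \<and> continuous_on {0..r} c \<and>
     (\<forall>a\<in>{0..r}. c a \<in> ball p0 \<epsilon> \<and> c a \<in> \<psi> ` ?B \<and> snd (chart_inv \<psi> (c a)) = snd (chart_inv \<psi> y)) \<and>
     (\<forall>a\<in>{0..r}. \<forall>b\<in>{0..r}. exp_close G \<rho> (c a) (c b)) \<and>
     (\<forall>a b. 0 \<le> a \<longrightarrow> a \<le> b \<longrightarrow> b \<le> r \<longrightarrow> (b - a) / 2 \<le> s * ((c b - c a) \<bullet> w))"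
    if y: "y \<in> ball p0 r" and s: "s \<in> {1, -1::real}" for y s
  proof -
    have "y \<in> ball p0 r1" using y r by auto
    then have yB: "y \<in> \<psi> ` ?B" "chart_inv \<psi> y \<in> ball 0 R1 \<times> ball 0 \<tau>" using r1(2) by blast+
    define u where "u = fst (chart_inv \<psi> y)"
    define t where "t = snd (chart_inv \<psi> y)"
    have ut: "chart_inv \<psi> y = (u, t)" "y \<in> \<psi> ` ?B" "norm u < R1" "\<bar>t\<bar> < \<tau>"
      using yB by (auto simp: u_def t_def mem_Times_iff)
    have yut: "y = \<psi> (u, t)" using f_inv_into_f[OF ut(2)] ut(1) by simp
    have tb: "t \<in> ball 0 1" using ut(4) \<tau> by simp
    obtain g' where g': "\<And>u. u \<in> ball 0 1 \<Longrightarrow> ((\<lambda>u. \<psi> (u, t)) has_derivative blinfun_apply (g' u)) (at u)"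
      "continuous_on (ball 0 1) g'" "\<And>u. u \<in> ball 0 1 \<Longrightarrow> inj (blinfun_apply (g' u))"
      "\<And>u. u \<in> ball 0 1 \<Longrightarrow> range (p (\<psi> (u, t))) \<subseteq> range (blinfun_apply (g' u))"
      using plaque_chartD[OF ch tb] by blast
    define g where "g u = \<psi> (u, t)" for u
    have gc: "continuous_on (ball 0 1) g" unfolding g_def
      by (rule continuous_on_compose2[OF cont]) (use tb in \<open>auto intro!: continuous_intros\<close>)
    have "\<forall>u\<in>ball 0 1. \<exists>\<xi>. g' u \<xi> = s *\<^sub>R p (g u) w"
    proof
      fix u :: "real^2" assume "u \<in> ball 0 1"
      moreover have "s *\<^sub>R p (g u) w \<in> range (p (g u))"
        by (metis lfield_linear[OF p] linear_cmul rangeI)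
      ultimately show "\<exists>\<xi>. g' u \<xi> = s *\<^sub>R p (g u) w" using g'(4)[of u] unfolding g_def by (metis imageE subsetD)
    qed
    then obtain X where X: "\<And>u. u \<in> ball 0 1 \<Longrightarrow> g' u (X u) = s *\<^sub>R p (g u) w" by metis
    have Xc: "continuous_on (ball 0 1) X"
      by (rule continuous_solution_of_linear_equations[OF g'(2) _ g'(3) X])
        (intro continuous_intros lfield_continuous[OF p] gc)
    \<comment> \<open>Projecting the parameter to the closed ball makes the field global and
      bounded, as \<open>peano\<close> requires; this changes nothing along the solution, which
      stays within radius \<open>R2\<close>.\<close>
    define X' where "X' u = X (closest_point (cball 0 R2) u)" for u
    have cp: "closest_point (cball 0 R2) u \<in> cball 0 R2" for u :: "real^2"
      using R0 by (intro closest_point_in_set) auto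
    have cb: "cball (0::real^2) R2 \<subseteq> ball 0 1" using R2 by auto
    have X'c: "continuous_on UNIV X'" unfolding X'_def
      using R0 cp cb
      by (intro continuous_on_compose2[OF Xc] continuous_on_closest_point convex_cball closed_cball) auto
    have "bounded (X ` cball 0 R2)"
      using cb by (intro compact_imp_bounded compact_continuous_image continuous_on_subset[OF Xc] compact_cball)
    then obtain Bx where Bx: "\<And>z. z \<in> cball 0 R2 \<Longrightarrow> norm (X z) \<le> Bx"
      unfolding bounded_iff by blast
    have "norm (X' z) \<le> Bx" for z unfolding X'_def by (rule Bx[OF cp])
    then obtain \<xi> where \<xi>: "\<xi> 0 = u" "\<And>a. a \<in> {0..r} \<Longrightarrow> (\<xi> has_vector_derivative X' (\<xi> a)) (at a within {0..r})"
      using peano[OF X'c, of Bx r u] r(1) by auto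
    have \<xi>c: "continuous_on {0..r} \<xi>"
      unfolding continuous_on_eq_continuous_within using has_vector_derivative_continuous[OF \<xi>(2)] by blast
    define c where "c a = g (\<xi> a)" for a
    have dc: "(c has_vector_derivative s *\<^sub>R p (c a) w) (at a within {0..b})"
      if "a \<in> {0..b}" "b \<le> r" "norm (\<xi> a) \<le> R2" for a b
    proof -
      have sub: "a \<in> {0..r}" "{0..b} \<subseteq> {0..r}" using that by auto
      have "(\<xi> has_vector_derivative X' (\<xi> a)) (at a within {0..b})"
        by (rule has_vector_derivative_within_subset[OF \<xi>(2)[OF sub(1)] sub(2)])
      then have d1: "(\<xi> has_derivative (\<lambda>h. h *\<^sub>R X' (\<xi> a))) (at a within {0..b})" by (simp add: has_vector_derivative_def)
      have in1: "\<xi> a \<in> ball 0 1" using that(3) R2 by simp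
      have "X' (\<xi> a) = X (\<xi> a)" using that(3) by (simp add: X'_def closest_point_self)
      then have e: "g' (\<xi> a) (X' (\<xi> a)) = s *\<^sub>R p (c a) w" using X[OF in1] by (simp add: c_def)
      have d2: "(g has_derivative blinfun_apply (g' (\<xi> a))) (at (\<xi> a))"
        using g'(1)[OF in1] by (simp add: g_def[abs_def])
      have "((\<lambda>a. g (\<xi> a)) has_derivative (\<lambda>h. g' (\<xi> a) (h *\<^sub>R X' (\<xi> a)))) (at a within {0..b})"
        by (rule has_derivative_compose[OF d1 d2])
      then show ?thesis unfolding has_vector_derivative_def c_def by (simp add: blinfun.scaleR_right e c_def)
    qed
    have sp: "norm (c a - c 0) \<le> Mp * a" if a: "0 \<le> a" "a \<le> r" and b: "\<And>b. b \<in> {0..a} \<Longrightarrow> norm (\<xi> b) \<le> R2" for a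
    proof -
      have "norm (c a - c 0) \<le> Mp * norm (a - 0)"
      proof (rule differentiable_bound[of "{0..a}" c "\<lambda>b h. h *\<^sub>R (s *\<^sub>R p (c b) w)"])
        show "(c has_derivative (\<lambda>h. h *\<^sub>R (s *\<^sub>R p (c b) w))) (at b within {0..a})" if "b \<in> {0..a}" for b
          using dc[of b a] b that a by (simp add: has_vector_derivative_def)
        show "onorm (\<lambda>h. h *\<^sub>R (s *\<^sub>R p (c b) w)) \<le> Mp" for b
        proof (rule onorm_le)
          fix h :: real
          show "norm (h *\<^sub>R (s *\<^sub>R p (c b) w)) \<le> Mp * norm h"
            using pw[of "c b"] s by (auto simp: mult.commute[of Mp] intro!: mult_left_mono)
        qed
      qed (use a in auto)
      then show ?thesis using a by simp
    qed
    \<comment> \<open>At the first time of reaching radius \<open>R2\<close> the curve would be in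
      \<open>Out\<close>; at speed at most \<open>Mp\<close> it has moved less than
      \<open>\<delta>\<close> away from \<open>In\<close>.\<close>
    have stay: "norm (\<xi> a) < R2" if a: "a \<in> {0..r}" for a
    proof (rule ccontr)
      assume "\<not> norm (\<xi> a) < R2"
      then have ge: "R2 \<le> norm (\<xi> a)" by simp
      define Z where "Z = {b \<in> {0..r}. R2 \<le> norm (\<xi> b)}"
      have "closed Z" unfolding Z_def
        by (intro continuous_on_closed_Collect_le continuous_intros \<xi>c closed_real_atLeastAtMost) 
      then have "compact Z" unfolding Z_def
        using compact_Icc[of 0 r] by (metis (no_types, lifting) closed_Int_compact inf.absorb_iff2 inf_commute mem_Collect_eq subsetI)
      moreover have "Z \<noteq> {}" using a ge by (auto simp: Z_def)
      ultimately obtain b where b: "b \<in> Z" "\<And>x. x \<in> Z \<Longrightarrow> b \<le> x" by (meson compact_attains_inf)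
      have br: "0 \<le> b" "b \<le> r" "R2 \<le> norm (\<xi> b)" using b(1) by (auto simp: Z_def)
      have lt: "norm (\<xi> x) < R2" if "0 \<le> x" "x < b" for x
        using b(2)[of x] that br by (force simp: Z_def)
      have "norm (\<xi> 0) < R2" using \<xi>(1) ut(3) R2 by simp
      then have "continuous_on {0..b} (\<lambda>x. norm (\<xi> x))" "norm (\<xi> 0) \<le> R2"
        using br by (auto intro!: continuous_intros continuous_on_subset[OF \<xi>c])
      then obtain x where x: "0 \<le> x" "x \<le> b" "norm (\<xi> x) = R2" using IVT'[of "\<lambda>x. norm (\<xi> x)" 0 R2 b] br by auto
      then have xb: "x = b" using lt by force
      have "norm (c b - c 0) \<le> Mp * b"
      proof (rule sp[OF br(1,2)])
        fix z assume "z \<in> {0..b}"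
        then show "norm (\<xi> z) \<le> R2" using lt[of z] x xb by (cases "z = b") auto
      qed
      also have "\<dots> \<le> Mp * r" using br Mp by simp
      finally have "norm (c b - c 0) < \<delta>" using r by linarith
      moreover have "c 0 \<in> In" unfolding In_def c_def g_def \<xi>(1) using ut(3,4) by (intro imageI) auto
      moreover have "c b \<in> Out" unfolding Out_def c_def g_def using x xb ut(4) by (intro imageI) auto
      ultimately show False using \<delta>(2)[of "c 0" "c b"] by (simp add: dist_norm norm_minus_commute)
    qed
    have dcr: "(c has_vector_derivative s *\<^sub>R p (c a) w) (at a within {0..r})" if "a \<in> {0..r}" for a
      using dc[of a r] stay[OF that] that by simp
    have cc: "continuous_on {0..r} c"
      unfolding continuous_on_eq_continuous_within using has_vector_derivative_continuous[OF dcr] by blast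
    have c0: "c 0 = y" by (simp add: c_def g_def \<xi>(1) yut)
    have lev0: "c a \<in> \<psi> ` ?B \<and> snd (chart_inv \<psi> (c a)) = snd (chart_inv \<psi> y)" if "a \<in> {0..r}" for a
    proof -
      have "(\<xi> a, t) \<in> ?B" using stay[OF that] R2 tb by simp
      then show ?thesis using inv_into_f_f[OF inj, of "(\<xi> a, t)"] ut(1) by (simp add: c_def g_def)
    qed
    have near: "norm (p (c a) w - w) \<le> 1/2" "c a \<in> ball p0 \<epsilon>" if a: "a \<in> {0..r}" for a
    proof -
      have "norm (c a - c 0) \<le> Mp * a" using sp[of a] stay a by (force intro: less_imp_le)
      also have "\<dots> \<le> Mp * r" using a Mp by simp
      finally have "norm (c a - y) \<le> r2 / 2" using r c0 by simp
      moreover have "norm (p0 - y) < r2 / 2" using y r by (simp add: dist_norm)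
      ultimately have "norm (p0 - c a) < r2"
        using norm_triangle_ineq[of "p0 - y" "y - c a"] by (simp add: norm_minus_commute)
      from r2(2)[OF this] r2(3) this show "norm (p (c a) w - w) \<le> 1/2" "c a \<in> ball p0 \<epsilon>"
        using w by (simp_all add: norm_minus_commute dist_norm)
    qed
    have lev: "c a \<in> ball p0 \<epsilon> \<and> c a \<in> \<psi> ` ?B \<and> snd (chart_inv \<psi> (c a)) = snd (chart_inv \<psi> y)"
      if "a \<in> {0..r}" for a using lev0 near(2) that by blast
    \<comment> \<open>Near \<open>p0\<close> the velocity differs from \<open>s\<close> times
      \<open>w\<close> by at most \<open>1/2\<close>, so its component in that direction is at least
      \<open>1/2\<close>.\<close>
    have mono: "(b - a) / 2 \<le> s * ((c b - c a) \<bullet> w)" if ab: "0 \<le> a" "a \<le> b" "b \<le> r" for a b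
    proof -
      have "\<exists>z\<in>{a..b}. (c b \<bullet> w) - (c a \<bullet> w) = (\<lambda>h. (h *\<^sub>R (s *\<^sub>R p (c z) w)) \<bullet> w) (b - a)"
      proof (rule mvt_very_simple[OF ab(2)])
        fix z assume z: "a \<le> z" "z \<le> b"
        have "(c has_derivative (\<lambda>h. h *\<^sub>R (s *\<^sub>R p (c z) w))) (at z within {a..b})"
          using dcr[of z] z ab by (auto simp: has_vector_derivative_def intro: has_derivative_subset)
        then show "((\<lambda>z. c z \<bullet> w) has_derivative (\<lambda>h. (h *\<^sub>R (s *\<^sub>R p (c z) w)) \<bullet> w)) (at z within {a..b})"
          by (rule has_derivative_inner_left)
      qed
      then obtain z where z: "z \<in> {a..b}" "(c b - c a) \<bullet> w = (b - a) * (s * (p (c z) w \<bullet> w))"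
        by (auto simp: inner_diff_left)
      have ss: "s * s = 1" using s by auto
      have "w \<bullet> w = 1" using w by (simp add: norm_eq_1)
      moreover have "\<bar>(p (c z) w - w) \<bullet> w\<bar> \<le> 1/2"
        using Cauchy_Schwarz_ineq2[of "p (c z) w - w" w] near(1)[of z] z ab w by simp
      ultimately have "1/2 \<le> p (c z) w \<bullet> w" unfolding inner_diff_left by linarith
      then have "(b - a) * (1/2) \<le> (b - a) * (p (c z) w \<bullet> w)" using ab by (intro mult_left_mono) auto
      also have "\<dots> = s * ((c b - c a) \<bullet> w)" 
      proof -
        have "s * ((c b - c a) \<bullet> w) = (b - a) * ((s * s) * (p (c z) w \<bullet> w))" by (simp add: z(2))
        then show ?thesis by (simp add: ss)
      qed
      finally show ?thesis by simp
    qed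
    have asy: "\<forall>a\<in>{0..r}. \<forall>b\<in>{0..r}. exp_close G \<rho> (c a) (c b)"
    proof -
      have "\<exists>C. \<forall>u1\<in>{0..r}. \<forall>u2\<in>{0..r}. \<forall>n. norm ((G ^^ n) (c u1) - (G ^^ n) (c u2)) \<le> C * \<rho> ^ n * norm (u1 - u2)"
      proof (rule orbit_distance_along_disc[where A = A and E = "\<lambda>x. range (p x)" and K = Kc
            and g' = "\<lambda>a. blinfun_scaleR_left (s *\<^sub>R p (c a) w)"])
        show "norm (cocycle G A n x v) \<le> Kc * \<rho> ^ n * norm v" if "v \<in> range (p x)" for n x v
          using that contr by auto
        show "(c has_derivative blinfun_apply (blinfun_scaleR_left (s *\<^sub>R p (c a) w))) (at a within {0..r})"
          if "a \<in> {0..r}" for a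
          using dcr[OF that] by (simp add: has_vector_derivative_def)
        show "continuous_on {0..r} (\<lambda>a. blinfun_scaleR_left (s *\<^sub>R p (c a) w))"
          by (intro continuous_intros lfield_continuous[OF p] cc)
        show "range (blinfun_apply (blinfun_scaleR_left (s *\<^sub>R p (c a) w))) \<subseteq> range (p (c a))" for a
        proof
          fix v assume "v \<in> range (blinfun_apply (blinfun_scaleR_left (s *\<^sub>R p (c a) w)))"
          then obtain h where "v = h *\<^sub>R s *\<^sub>R p (c a) w" by auto
          then have "v = p (c a) ((h * s) *\<^sub>R w)" by (simp add: linear_cmul[OF lfield_linear[OF p]])
          then show "v \<in> range (p (c a))" by blast
        qed
      qed (use der \<open>0 \<le> Kc\<close> \<open>0 < \<rho>\<close> in auto)
      then obtain C where C: "\<And>u1 u2 n. u1 \<in> {0..r} \<Longrightarrow> u2 \<in> {0..r} \<Longrightarrow>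
        norm ((G ^^ n) (c u1) - (G ^^ n) (c u2)) \<le> C * \<rho> ^ n * norm (u1 - u2)" by blast
      show ?thesis
      proof (intro ballI)
        fix a b assume "a \<in> {0..r}" "b \<in> {0..r}"
        then have "norm ((G ^^ n) (c a) - (G ^^ n) (c b)) \<le> (C * norm (a - b)) * \<rho> ^ n" for n
          using C[of a b n] by (simp only: mult.assoc mult.commute[of "\<rho> ^ n"])
        then show "exp_close G \<rho> (c a) (c b)" unfolding exp_close_def by blast
      qed
    qed
    show ?thesis using c0 cc lev asy mono by (intro exI[of _ c]) auto
  qed
  have "ball p0 r \<subseteq> ball p0 r1" using r(2) by (rule subset_ball)
  then have "ball p0 r \<subseteq> \<psi> ` ?B" using r1(2) by blast
  then show ?thesis using r(1) main by blast
qed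

text \<open>Two half curves are joined at \<open>y\<close>, and \<open>exp_close\<close> passes
  through \<open>y\<close> by transitivity. The advance along \<open>w\<close> makes the curve
  injective.\<close>

lemma plaque_curve:
  fixes G :: "real^3 \<Rightarrow> real^3"
  assumes ch: "plaque_chart \<psi> p" and p: "lfield p" and p0: "p0 \<in> \<psi> ` chart_dom"
    and w: "norm w = 1" "p p0 w = w"
    and der: "\<And>x. (G has_derivative A x) (at x)" and "0 < \<rho>"
    and contr: "\<And>x v n. norm (cocycle G A n x (p x v)) \<le> Kc * \<rho> ^ n * norm (p x v)" and "0 \<le> Kc" and "0 < \<epsilon>"
  shows "\<exists>r>0. ball p0 r \<subseteq> \<psi> ` chart_dom \<and> (\<forall>y\<in>ball p0 r. \<exists>c. c 0 = y \<and> continuous_on {-r..r} c \<and>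
     (\<forall>a\<in>{-r..r}. c a \<in> ball p0 \<epsilon> \<and> c a \<in> \<psi> ` chart_dom \<and> snd (chart_inv \<psi> (c a)) = snd (chart_inv \<psi> y)) \<and>
     (\<forall>a\<in>{-r..r}. \<forall>b\<in>{-r..r}. exp_close G \<rho> (c a) (c b)) \<and>
     (\<forall>a b. -r \<le> a \<longrightarrow> a \<le> b \<longrightarrow> b \<le> r \<longrightarrow> (b - a) / 2 \<le> (c b - c a) \<bullet> w))"
proof -
  obtain r where r: "0 < r" "ball p0 r \<subseteq> \<psi> ` chart_dom"
    and half: "\<forall>y\<in>ball p0 r. \<forall>s\<in>{1,-1::real}. \<exists>c. c 0 = y \<and> continuous_on {0..r} c \<and>
     (\<forall>a\<in>{0..r}. c a \<in> ball p0 \<epsilon> \<and> c a \<in> \<psi> ` chart_dom \<and> snd (chart_inv \<psi> (c a)) = snd (chart_inv \<psi> y)) \<and>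
     (\<forall>a\<in>{0..r}. \<forall>b\<in>{0..r}. exp_close G \<rho> (c a) (c b)) \<and>
     (\<forall>a b. 0 \<le> a \<longrightarrow> a \<le> b \<longrightarrow> b \<le> r \<longrightarrow> (b - a) / 2 \<le> s * ((c b - c a) \<bullet> w))"
    using plaque_half_curve[OF assms] by (elim exE conjE) (rule that)
  have "\<exists>c. c 0 = y \<and> continuous_on {-r..r} c \<and>
     (\<forall>a\<in>{-r..r}. c a \<in> ball p0 \<epsilon> \<and> c a \<in> \<psi> ` chart_dom \<and> snd (chart_inv \<psi> (c a)) = snd (chart_inv \<psi> y)) \<and>
     (\<forall>a\<in>{-r..r}. \<forall>b\<in>{-r..r}. exp_close G \<rho> (c a) (c b)) \<and>
     (\<forall>a b. -r \<le> a \<longrightarrow> a \<le> b \<longrightarrow> b \<le> r \<longrightarrow> (b - a) / 2 \<le> (c b - c a) \<bullet> w)" if y: "y \<in> ball p0 r" for y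
  proof -
    obtain c1 where c1: "c1 0 = y" "continuous_on {0..r} c1"
     "\<And>a. a \<in> {0..r} \<Longrightarrow> c1 a \<in> ball p0 \<epsilon> \<and> c1 a \<in> \<psi> ` chart_dom \<and> snd (chart_inv \<psi> (c1 a)) = snd (chart_inv \<psi> y)"
     "\<And>a b. a \<in> {0..r} \<Longrightarrow> b \<in> {0..r} \<Longrightarrow> exp_close G \<rho> (c1 a) (c1 b)"
     "\<And>a b. 0 \<le> a \<Longrightarrow> a \<le> b \<Longrightarrow> b \<le> r \<Longrightarrow> (b - a) / 2 \<le> 1 * ((c1 b - c1 a) \<bullet> w)"
      using bspec[OF bspec[OF half y], of "1"] by blast
    obtain c2 where c2: "c2 0 = y" "continuous_on {0..r} c2"
     "\<And>a. a \<in> {0..r} \<Longrightarrow> c2 a \<in> ball p0 \<epsilon> \<and> c2 a \<in> \<psi> ` chart_dom \<and> snd (chart_inv \<psi> (c2 a)) = snd (chart_inv \<psi> y)"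
     "\<And>a b. a \<in> {0..r} \<Longrightarrow> b \<in> {0..r} \<Longrightarrow> exp_close G \<rho> (c2 a) (c2 b)"
     "\<And>a b. 0 \<le> a \<Longrightarrow> a \<le> b \<Longrightarrow> b \<le> r \<Longrightarrow> (b - a) / 2 \<le> (-1) * ((c2 b - c2 a) \<bullet> w)"
      using bspec[OF bspec[OF half y], of "-1"] by blast
    define c where "c a = (if 0 \<le> a then c1 a else c2 (- a))" for a
    have "continuous_on ({0..r} \<union> {-r..0}) c"
      unfolding c_def
    proof (rule continuous_on_If)
      show "continuous_on {0..r} c1" by (rule c1)
      show "continuous_on {-r..0} (\<lambda>a. c2 (- a))"
        by (rule continuous_on_compose2[OF c2(2)]) (auto intro!: continuous_intros)
    qed (use c1(1) c2(1) r(1) in \<open>auto simp: antisym\<close>)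
    moreover have "{0..r} \<union> {-r..0} = {-r..r}" using r(1) by auto
    ultimately have cc: "continuous_on {-r..r} c" by simp
    have ay: "exp_close G \<rho> (c a) y" if "a \<in> {-r..r}" for a
      using c1(4)[of a 0] c2(4)[of "-a" 0] that r(1) by (auto simp: c_def c1(1) c2(1))
    have "exp_close G \<rho> (c a) (c b)" if "a \<in> {-r..r}" "b \<in> {-r..r}" for a b
      using ay that exp_close_trans exp_close_sym by blast
    moreover have "c a \<in> ball p0 \<epsilon> \<and> c a \<in> \<psi> ` chart_dom \<and> snd (chart_inv \<psi> (c a)) = snd (chart_inv \<psi> y)" if "a \<in> {-r..r}" for a
      using c1(3)[of a] c2(3)[of "-a"] that by (auto simp: c_def)
    moreover have "(b - a) / 2 \<le> (c b - c a) \<bullet> w" if ab: "-r \<le> a" "a \<le> b" "b \<le> r" for a b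
    proof -
      consider "0 \<le> a" | "a < 0" "0 \<le> b" | "b < 0" by linarith
      then show ?thesis
      proof cases
        case 1
        then show ?thesis using c1(5)[of a b] ab by (simp add: c_def)
      next
        case 2
        then show ?thesis using c1(5)[of 0 b] c2(5)[of 0 "-a"] ab
          by (simp add: c_def c1(1) c2(1) inner_diff_left field_simps)
      next
        case 3
        then show ?thesis using c2(5)[of "-b" "-a"] ab by (simp add: c_def inner_diff_left field_simps)
      qed
    qed
    moreover have "c 0 = y" by (simp add: c_def c1)
    ultimately show ?thesis using cc by (intro exI[of _ c]) auto
  qed
  then show ?thesis using r by blast
qed

text \<open>What the stable line of a map and the unstable line, taken for the inverse, have in
  common; this allows the two to exchange roles.\<close>

definition contracting_line ::
  "(real^3 \<Rightarrow> real^3) \<Rightarrow> (real^3 \<Rightarrow> real^3 \<Rightarrow> real^3) \<Rightarrow> real \<Rightarrow> (real^3 \<Rightarrow> real^3 \<Rightarrow> real^3) \<Rightarrow> bool" where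
  "contracting_line G A \<rho> p \<longleftrightarrow> (\<forall>x. (G has_derivative A x) (at x)) \<and> 0 < \<rho> \<and> \<rho> < 1 \<and> line_proj p \<and> exp_cone G \<rho> p \<and>
     (\<exists>Kc\<ge>0. \<forall>x v n. norm (cocycle G A n x (p x v)) \<le> Kc * \<rho> ^ n * norm (p x v))"

lemma contracting_lineD:
  assumes "contracting_line G A \<rho> p"
  shows "\<And>x. (G has_derivative A x) (at x)" "0 < \<rho>" "\<rho> < 1" "lfield p" "line_proj p" "exp_cone G \<rho> p"
    "\<exists>Kc\<ge>0. \<forall>x v n. norm (cocycle G A n x (p x v)) \<le> Kc * \<rho> ^ n * norm (p x v)"
  using assms unfolding contracting_line_def line_proj_def by blast+

lemma line_proj_unit: "line_proj p \<Longrightarrow> \<exists>w. norm w = 1 \<and> p x w = w \<and> (\<forall>v. \<exists>t. p x v = t *\<^sub>R w)"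
  by (simp add: line_proj_def)

text \<open>The cone at \<open>x\<close> and the continuity of \<open>p\<close> at \<open>p0\<close>
  cost \<open>1/8\<close> of the norm each, which leaves \<open>3/4\<close> for the multiple of
  \<open>w\<close>. Locally a class of \<open>exp_close\<close> is thus a graph over the direction
  \<open>w\<close>.\<close>

lemma exp_close_transverse:
  assumes p: "contracting_line G A \<rho> p" and w: "norm w = 1" "p p0 w = w" "\<And>v. \<exists>t. p p0 v = t *\<^sub>R w"
    and close: "\<And>\<epsilon>. 0 < \<epsilon> \<Longrightarrow> \<exists>\<delta>>0. \<forall>x y. exp_close G \<rho> x y \<longrightarrow> norm (x - y) < \<delta> \<longrightarrow> (\<forall>n. norm ((G ^^ n) x - (G ^^ n) y) \<le> \<epsilon>)"
  shows "\<exists>r>0. \<forall>x\<in>ball p0 r. \<forall>y\<in>ball p0 r. exp_close G \<rho> x y \<longrightarrow> norm (y - x) / 2 \<le> \<bar>(y - x) \<bullet> w\<bar>"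
proof -
  note P = contracting_lineD[OF p]
  obtain \<epsilon> K where \<epsilon>: "0 < \<epsilon>" and cone: "\<And>x y. exp_close G \<rho> x y \<Longrightarrow> \<forall>n. norm ((G ^^ n) x - (G ^^ n) y) \<le> \<epsilon> \<Longrightarrow>
     norm ((y - x) - p x (y - x)) \<le> 1/8 * norm (y - x)"
    using P(6)[unfolded exp_cone_def, rule_format, of "1/8"] by auto
  obtain \<delta> where \<delta>: "0 < \<delta>" "\<And>x y. exp_close G \<rho> x y \<Longrightarrow> norm (x - y) < \<delta> \<Longrightarrow> \<forall>n. norm ((G ^^ n) x - (G ^^ n) y) \<le> \<epsilon>"
    using close[OF \<epsilon>] by blast
  obtain r0 where r0: "r0 > 0" "\<And>x v. norm (p0 - x) < r0 \<Longrightarrow> norm (p p0 v - p x v) \<le> 1/8 * norm v"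
    using lfield_uniform[OF P(4), of "1/8"] by auto
  show ?thesis
  proof (intro exI[of _ "min r0 (\<delta> / 2)"] conjI ballI impI)
    show "0 < min r0 (\<delta> / 2)" using r0 \<delta> by simp
    fix x y assume xy: "x \<in> ball p0 (min r0 (\<delta> / 2))" "y \<in> ball p0 (min r0 (\<delta> / 2))" "exp_close G \<rho> x y"
    define v where "v = y - x"
    have "norm (x - y) < \<delta>" using xy(1,2) dist_triangle_half_r[of p0 x \<delta> y] by (simp add: dist_norm)
    then have c1: "norm (v - p x v) \<le> 1/8 * norm v" using cone[OF xy(3)] \<delta>(2)[OF xy(3)] by (simp add: v_def)
    have c2: "norm (p p0 v - p x v) \<le> 1/8 * norm v" using r0(2)[of x v] xy(1) by (simp add: dist_norm)
    obtain t where t: "p p0 v = t *\<^sub>R w" using w(3) by blast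
    have d: "norm (v - t *\<^sub>R w) \<le> 1/4 * norm v"
      using norm_triangle_ineq4[of "v - p x v" "p p0 v - p x v"] c1 c2 by (simp add: t)
    have "norm v \<le> norm (v - t *\<^sub>R w) + \<bar>t\<bar>" using norm_triangle_ineq[of "v - t *\<^sub>R w" "t *\<^sub>R w"] w(1) by simp
    then have tt: "3/4 * norm v \<le> \<bar>t\<bar>" using d by linarith
    have "v \<bullet> w = (v - t *\<^sub>R w) \<bullet> w + t" using w(1) by (simp add: inner_diff_left norm_eq_1)
    moreover have "\<bar>(v - t *\<^sub>R w) \<bullet> w\<bar> \<le> 1/4 * norm v"
      using Cauchy_Schwarz_ineq2[of "v - t *\<^sub>R w" w] d w(1) by simp
    ultimately have "norm v / 2 \<le> \<bar>v \<bullet> w\<bar>" using tt by linarith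
    then show "norm (y - x) / 2 \<le> \<bar>(y - x) \<bullet> w\<bar>" by (simp add: v_def)
  qed
qed

section \<open>Strong leaves under the conjugacy\<close>

text \<open>Meant for the diffeomorphism or for its inverse, whichever is conjugate to the linear
  map with an isolated contracted eigenvalue. Stable and unstable refer to the map that plays the
  part of \<open>F\<close>.\<close>

locale us_conj =
  fixes F Fi :: "real^3 \<Rightarrow> real^3" and A Ai :: "real^3 \<Rightarrow> real^3 \<Rightarrow> real^3"
    and H K M Mi :: "real^3 \<Rightarrow> real^3" and ps pu :: "real^3 \<Rightarrow> real^3 \<Rightarrow> real^3"
    and \<sigma> \<rho> :: real and e :: "real^3" and \<kappa> :: real and \<phi> :: "real^3"
  assumes S: "contracting_line F A \<sigma> ps" and U: "contracting_line Fi Ai \<rho> pu"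
    and FFi: "\<And>x. F (Fi x) = x" and FiF: "\<And>x. Fi (F x) = x"
    and F_eq: "int_equivariant F" and Fi_eq: "int_equivariant Fi"
    and HK: "\<And>x. H (K x) = x" and KH: "\<And>x. K (H x) = x"
    and H_cont: "continuous_on UNIV H" and K_cont: "continuous_on UNIV K"
    and H_eq: "int_equivariant H" and K_eq: "int_equivariant K"
    and HF: "\<And>x. H (F x) = M (H x)"
    and M_lin: "linear M" and Mi_lin: "linear Mi"
    and MMi: "\<And>w. M (Mi w) = w" and MiM: "\<And>w. Mi (M w) = w" and Mi_int: "\<And>n. ivec n \<Longrightarrow> ivec (Mi n)"
    and split: "hyp_split M Mi e \<kappa> \<phi>"
    and charts: "\<And>q. \<exists>\<psi>. plaque_chart \<psi> ps \<and> plaque_chart \<psi> pu \<and> q \<in> \<psi> ` chart_dom"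
begin

lemmas splitD = split[unfolded hyp_split_def]

lemma e0: "e \<noteq> 0" and Me: "M e = \<kappa> *\<^sub>R e" and \<kappa>0: "\<kappa> \<noteq> 0" and \<kappa>1: "\<bar>\<kappa>\<bar> < 1"
  and \<phi>M: "\<phi> \<bullet> M w = \<kappa> * (\<phi> \<bullet> w)" and \<phi>e: "\<phi> \<bullet> e \<noteq> 0"
  using splitD by auto

lemma Mi_plane_bounded: "\<exists>B>0. \<forall>n w. \<phi> \<bullet> w = 0 \<longrightarrow> norm ((Mi ^^ n) w) \<le> B * norm w"
  using splitD by blast

lemma Mi_plane_lim: "\<phi> \<bullet> w = 0 \<Longrightarrow> (\<lambda>n. (Mi ^^ n) w) \<longlonglongrightarrow> 0"
  using splitD by blast

lemma HFi: "H (Fi x) = Mi (H x)"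
  by (metis FFi HF MiM)

lemma HF_pow: "H ((F ^^ n) x) = (M ^^ n) (H x)"
  by (induction n) (auto simp: HF)

lemma HFi_pow: "H ((Fi ^^ n) x) = (Mi ^^ n) (H x)"
  by (induction n) (auto simp: HFi)

lemma M_pow_lin: "linear (M ^^ n)" and Mi_pow_lin: "linear (Mi ^^ n)"
  using linear_funpow M_lin Mi_lin by blast+

lemma Me_pow: "(M ^^ n) e = \<kappa> ^ n *\<^sub>R e"
  by (induction n) (auto simp: Me linear_cmul[OF M_lin] mult.commute)

lemma Mie: "Mi e = (1 / \<kappa>) *\<^sub>R e"
proof -
  have "\<kappa> *\<^sub>R Mi e = e" using MiM[of e] by (simp add: Me linear_cmul[OF Mi_lin])
  then have "(1 / \<kappa>) *\<^sub>R (\<kappa> *\<^sub>R Mi e) = (1 / \<kappa>) *\<^sub>R e" by simp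
  then show ?thesis using \<kappa>0 by simp
qed

lemma Mie_pow: "(Mi ^^ n) e = (1 / \<kappa>) ^ n *\<^sub>R e"
  by (induction n) (auto simp: Mie linear_cmul[OF Mi_lin] mult.commute)

lemma Mi_M_pow: "(Mi ^^ n) ((M ^^ n) w) = w"
proof (induction n arbitrary: w)
  case (Suc n)
  have "(Mi ^^ Suc n) ((M ^^ Suc n) w) = (Mi ^^ n) (Mi (M ((M ^^ n) w)))"
    by (simp only: funpow_Suc_right[of n Mi] funpow.simps(2)[of n M] o_apply)
  then show ?case using Suc by (simp add: MiM)
qed simp

lemma \<phi>M_pow: "\<phi> \<bullet> (M ^^ n) w = \<kappa> ^ n * (\<phi> \<bullet> w)"
  by (induction n) (auto simp: \<phi>M)

lemma \<phi>Mi_pow: "\<phi> \<bullet> (Mi ^^ n) w = (1 / \<kappa>) ^ n * (\<phi> \<bullet> w)"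
proof (induction n)
  case (Suc n)
  have "\<kappa> * (\<phi> \<bullet> Mi ((Mi ^^ n) w)) = \<phi> \<bullet> (Mi ^^ n) w" using \<phi>M[of "Mi ((Mi ^^ n) w)"] by (simp add: MMi)
  then show ?case using Suc \<kappa>0 by (simp add: field_simps)
qed simp

lemma H_unif: "0 < \<epsilon> \<Longrightarrow> \<exists>d>0. \<forall>x y. norm (x - y) < d \<longrightarrow> norm (H x - H y) < \<epsilon>"
  by (rule uniformly_continuous_int_equivariant[OF H_cont H_eq])

lemma K_unif: "0 < \<epsilon> \<Longrightarrow> \<exists>d>0. \<forall>x y. norm (x - y) < d \<longrightarrow> norm (K x - K y) < \<epsilon>"
  by (rule uniformly_continuous_int_equivariant[OF K_cont K_eq])

lemma H_inj: "H x = H y \<Longrightarrow> x = y"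
  by (metis KH)

text \<open>\<open>H\<close> is only uniformly continuous, so the rate is lost and convergence to 0
  remains, which is enough for a hyperbolic linear map.\<close>

lemma exp_close_image_tendsto:
  assumes "exp_close G \<tau> x y" "0 < \<tau>" "\<tau> < 1"
  shows "(\<lambda>n. H ((G ^^ n) x) - H ((G ^^ n) y)) \<longlonglongrightarrow> 0"
proof -
  obtain C where C: "\<And>n. norm ((G ^^ n) x - (G ^^ n) y) \<le> C * \<tau> ^ n"
    using assms(1) unfolding exp_close_def by blast
  have "(\<lambda>n. C * \<tau> ^ n) \<longlonglongrightarrow> C * 0" using assms by (intro tendsto_intros LIMSEQ_power_zero) auto
  then have "(\<lambda>n. (G ^^ n) x - (G ^^ n) y) \<longlonglongrightarrow> 0"
    by (intro Lim_null_comparison[OF always_eventually, rule_format, OF C]) simp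
  then have lim: "\<And>d. 0 < d \<Longrightarrow> \<forall>\<^sub>F n in sequentially. norm ((G ^^ n) x - (G ^^ n) y) < d"
    by (auto simp: tendsto_iff)
  show ?thesis unfolding tendsto_iff
  proof (intro allI impI)
    fix \<epsilon> :: real assume "0 < \<epsilon>"
    then obtain d where d: "d > 0" "\<And>x y. norm (x - y) < d \<Longrightarrow> norm (H x - H y) < \<epsilon>" using H_unif by blast
    show "\<forall>\<^sub>F n in sequentially. dist (H ((G ^^ n) x) - H ((G ^^ n) y)) 0 < \<epsilon>"
      by (rule eventually_mono[OF lim[OF d(1)]]) (simp add: d(2))
  qed
qed

text \<open>The iterates of the component in the plane tend to 0, while the inverse iterates are
  bounded there; so this component is 0.\<close>

lemma stable_on_line:
  assumes "exp_close F \<sigma> x y"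
  shows "\<exists>t. H x - H y = t *\<^sub>R e"
proof -
  define w where "w = H x - H y"
  define t where "t = (\<phi> \<bullet> w) / (\<phi> \<bullet> e)"
  define w' where "w' = w - t *\<^sub>R e"
  have 0: "\<phi> \<bullet> w' = 0" using \<phi>e by (simp add: w'_def t_def inner_diff_right)
  obtain B where B: "B > 0" "\<And>n w. \<phi> \<bullet> w = 0 \<Longrightarrow> norm ((Mi ^^ n) w) \<le> B * norm w" using Mi_plane_bounded by blast
  have "(\<lambda>n. (M ^^ n) w) \<longlonglongrightarrow> 0"
    using exp_close_image_tendsto[OF assms] contracting_lineD(2,3)[OF S] by (simp add: w_def HF_pow linear_diff[OF M_pow_lin])
  moreover have "(\<lambda>n. \<kappa> ^ n *\<^sub>R (t *\<^sub>R e)) \<longlonglongrightarrow> 0 *\<^sub>R (t *\<^sub>R e)"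
    using \<kappa>1 by (intro tendsto_intros LIMSEQ_power_zero) auto
  ultimately have "(\<lambda>n. (M ^^ n) w - \<kappa> ^ n *\<^sub>R (t *\<^sub>R e)) \<longlonglongrightarrow> 0 - 0 *\<^sub>R (t *\<^sub>R e)" by (rule tendsto_diff)
  moreover have "(M ^^ n) w' = (M ^^ n) w - \<kappa> ^ n *\<^sub>R (t *\<^sub>R e)" for n
    by (simp add: w'_def linear_diff[OF M_pow_lin] linear_cmul[OF M_pow_lin] Me_pow mult.commute)
  ultimately have "(\<lambda>n. (M ^^ n) w') \<longlonglongrightarrow> 0" by simp
  then have "(\<lambda>n. B * norm ((M ^^ n) w')) \<longlonglongrightarrow> B * norm (0::real^3)" by (intro tendsto_intros)
  moreover have "norm w' \<le> B * norm ((M ^^ n) w')" for n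
    using B(2)[of "(M ^^ n) w'" n] by (simp add: Mi_M_pow \<phi>M_pow 0)
  ultimately have "norm w' \<le> 0" by (metis (no_types, lifting) LIMSEQ_le_const norm_zero mult_zero_right)
  then show ?thesis by (auto simp: w'_def w_def)
qed

text \<open>Backward iteration multiplies the value of \<open>\<phi>\<close> by powers of
  \<open>1 / \<kappa>\<close>, which have modulus at least 1, so a limit 0 forces the value
  0.\<close>

lemma unstable_in_plane:
  assumes "exp_close Fi \<rho> x y"
  shows "\<phi> \<bullet> (H x - H y) = 0"
proof -
  define w where "w = H x - H y"
  have "(\<lambda>n. (Mi ^^ n) w) \<longlonglongrightarrow> 0"
    using exp_close_image_tendsto[OF assms] contracting_lineD(2,3)[OF U] by (simp add: w_def HFi_pow linear_diff[OF Mi_pow_lin])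
  then have "(\<lambda>n. \<bar>\<phi> \<bullet> (Mi ^^ n) w\<bar>) \<longlonglongrightarrow> \<bar>\<phi> \<bullet> 0\<bar>" by (intro tendsto_intros)
  moreover have "\<bar>\<phi> \<bullet> w\<bar> \<le> \<bar>\<phi> \<bullet> (Mi ^^ n) w\<bar>" for n
  proof -
    have "1 \<le> \<bar>(1 / \<kappa>) ^ n\<bar>" using \<kappa>0 \<kappa>1 by (simp add: power_abs abs_divide power_le_one power_one_over)
    then have "1 * \<bar>\<phi> \<bullet> w\<bar> \<le> \<bar>(1 / \<kappa>) ^ n\<bar> * \<bar>\<phi> \<bullet> w\<bar>" by (intro mult_right_mono) auto
    then show ?thesis by (simp add: \<phi>Mi_pow abs_mult)
  qed
  ultimately have "\<bar>\<phi> \<bullet> w\<bar> \<le> 0" by (metis (no_types, lifting) LIMSEQ_le_const inner_zero_right abs_zero)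
  then show ?thesis by (simp add: w_def)
qed

text \<open>In the plane the inverse iterates are bounded, so a small displacement stays small, and
  uniform continuity of \<open>K\<close> carries this back. It is the closeness for all times that
  \<open>exp_cone\<close> asks for.\<close>

lemma unstable_close:
  assumes "0 < \<epsilon>"
  shows "\<exists>\<delta>>0. \<forall>x y. exp_close Fi \<rho> x y \<longrightarrow> norm (H x - H y) < \<delta> \<longrightarrow> (\<forall>n. norm ((Fi ^^ n) x - (Fi ^^ n) y) \<le> \<epsilon>)"
proof -
  obtain B where B: "B > 0" "\<And>n w. \<phi> \<bullet> w = 0 \<Longrightarrow> norm ((Mi ^^ n) w) \<le> B * norm w" using Mi_plane_bounded by blast
  obtain d where d: "d > 0" "\<And>x y. norm (x - y) < d \<Longrightarrow> norm (K x - K y) < \<epsilon>" using K_unif[OF assms] by blast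
  show ?thesis
  proof (intro exI[of _ "d / B"] conjI allI impI)
    show "0 < d / B" using d B by simp
    fix x y n assume xy: "exp_close Fi \<rho> x y" "norm (H x - H y) < d / B"
    have "norm (H ((Fi ^^ n) x) - H ((Fi ^^ n) y)) \<le> B * norm (H x - H y)"
      using B(2)[OF unstable_in_plane[OF xy(1)], of n] by (simp add: HFi_pow linear_diff[OF Mi_pow_lin])
    also have "\<dots> < d" using xy(2) B(1) by (simp add: field_simps)
    finally show "norm ((Fi ^^ n) x - (Fi ^^ n) y) \<le> \<epsilon>" using d(2) by (force simp: KH)
  qed
qed

lemma stable_close:
  assumes "0 < \<epsilon>"
  shows "\<exists>\<delta>>0. \<forall>x y. exp_close F \<sigma> x y \<longrightarrow> norm (H x - H y) < \<delta> \<longrightarrow> (\<forall>n. norm ((F ^^ n) x - (F ^^ n) y) \<le> \<epsilon>)"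
proof -
  obtain d where d: "d > 0" "\<And>x y. norm (x - y) < d \<Longrightarrow> norm (K x - K y) < \<epsilon>" using K_unif[OF assms] by blast
  show ?thesis
  proof (intro exI[of _ d] conjI allI impI)
    show "0 < d" by (rule d)
    fix x y n assume xy: "exp_close F \<sigma> x y" "norm (H x - H y) < d"
    obtain t where t: "H x - H y = t *\<^sub>R e" using stable_on_line[OF xy(1)] by blast
    have "H ((F ^^ n) x) - H ((F ^^ n) y) = (M ^^ n) (t *\<^sub>R e)" by (simp add: HF_pow linear_diff[OF M_pow_lin] flip: t)
    also have "\<dots> = \<kappa> ^ n *\<^sub>R (H x - H y)" by (simp add: linear_cmul[OF M_pow_lin] Me_pow t mult.commute)
    finally have "norm (H ((F ^^ n) x) - H ((F ^^ n) y)) = \<bar>\<kappa>\<bar> ^ n * norm (H x - H y)" by (simp add: power_abs)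
    also have "\<dots> \<le> 1 * norm (H x - H y)" using \<kappa>1 by (intro mult_right_mono power_le_one) auto
    finally have "norm (H ((F ^^ n) x) - H ((F ^^ n) y)) < d" using xy(2) by simp
    then show "norm ((F ^^ n) x - (F ^^ n) y) \<le> \<epsilon>" using d(2) by (force simp: KH)
  qed
qed

lemma close_domain:
  assumes "\<And>\<epsilon>. 0 < \<epsilon> \<Longrightarrow> \<exists>\<delta>>0. \<forall>x y. exp_close G \<tau> x y \<longrightarrow> norm (H x - H y) < \<delta> \<longrightarrow> (\<forall>n. norm ((G ^^ n) x - (G ^^ n) y) \<le> \<epsilon>)"
    and "0 < \<epsilon>"
  shows "\<exists>\<delta>>0. \<forall>x y. exp_close G \<tau> x y \<longrightarrow> norm (x - y) < \<delta> \<longrightarrow> (\<forall>n. norm ((G ^^ n) x - (G ^^ n) y) \<le> \<epsilon>)"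
proof -
  obtain \<delta> where \<delta>: "\<delta> > 0" "\<And>x y. exp_close G \<tau> x y \<Longrightarrow> norm (H x - H y) < \<delta> \<Longrightarrow> \<forall>n. norm ((G ^^ n) x - (G ^^ n) y) \<le> \<epsilon>"
    using assms by blast
  obtain d where "d > 0" "\<And>x y. norm (x - y) < d \<Longrightarrow> norm (H x - H y) < \<delta>" using H_unif[OF \<delta>(1)] by blast
  then show ?thesis using \<delta>(2) by blast
qed

lemma unstable_transverse:
  assumes "norm w = 1" "pu p0 w = w" "\<And>v. \<exists>t. pu p0 v = t *\<^sub>R w"
  shows "\<exists>r>0. \<forall>x\<in>ball p0 r. \<forall>y\<in>ball p0 r. exp_close Fi \<rho> x y \<longrightarrow> norm (y - x) / 2 \<le> \<bar>(y - x) \<bullet> w\<bar>"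
  by (rule exp_close_transverse[OF U assms close_domain[OF unstable_close]])

lemma stable_curve:
  assumes "plaque_chart \<psi> ps" "p0 \<in> \<psi> ` chart_dom" "0 < \<epsilon>"
  shows "\<exists>w r. norm w = 1 \<and> 0 < r \<and> ball p0 r \<subseteq> \<psi> ` chart_dom \<and> (\<forall>y\<in>ball p0 r. \<exists>c. c 0 = y \<and> continuous_on {-r..r} c \<and>
     (\<forall>a\<in>{-r..r}. c a \<in> ball p0 \<epsilon> \<and> c a \<in> \<psi> ` chart_dom \<and> snd (chart_inv \<psi> (c a)) = snd (chart_inv \<psi> y)) \<and>
     (\<forall>a\<in>{-r..r}. \<forall>b\<in>{-r..r}. exp_close F \<sigma> (c a) (c b)) \<and>
     (\<forall>a b. -r \<le> a \<longrightarrow> a \<le> b \<longrightarrow> b \<le> r \<longrightarrow> (b - a) / 2 \<le> (c b - c a) \<bullet> w))"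
proof -
  note s = contracting_lineD[OF S]
  obtain w where w: "norm w = 1" "ps p0 w = w" using line_proj_unit[OF s(5)] by blast
  obtain Kc where Kc: "Kc \<ge> 0" "\<And>x v n. norm (cocycle F A n x (ps x v)) \<le> Kc * \<sigma> ^ n * norm (ps x v)" using s(7) by blast
  show ?thesis using plaque_curve[OF assms(1) s(4) assms(2) w s(1,2) Kc(2,1) assms(3)] w(1) by blast
qed

text \<open>The last clause is a local uniqueness that integration alone does not give: the curve
  meets every nearby value of the coordinate along \<open>w\<close>, and by transversality
  equivalent points with equal coordinate coincide.\<close>

lemma unstable_curve:
  assumes "plaque_chart \<psi> pu" "p0 \<in> \<psi> ` chart_dom" "0 < \<epsilon>"
  shows "\<exists>w r \<delta>. norm w = 1 \<and> 0 < r \<and> 0 < \<delta> \<and> ball p0 r \<subseteq> \<psi> ` chart_dom \<and> (\<forall>y\<in>ball p0 r. \<exists>c. c 0 = y \<and> continuous_on {-r..r} c \<and>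
     (\<forall>a\<in>{-r..r}. c a \<in> ball p0 \<epsilon> \<and> c a \<in> \<psi> ` chart_dom \<and> snd (chart_inv \<psi> (c a)) = snd (chart_inv \<psi> y)) \<and>
     (\<forall>a\<in>{-r..r}. \<forall>b\<in>{-r..r}. exp_close Fi \<rho> (c a) (c b)) \<and>
     (\<forall>a b. -r \<le> a \<longrightarrow> a \<le> b \<longrightarrow> b \<le> r \<longrightarrow> (b - a) / 2 \<le> (c b - c a) \<bullet> w) \<and>
     (\<forall>z\<in>ball p0 \<delta>. norm (z - y) < \<delta> \<longrightarrow> exp_close Fi \<rho> y z \<longrightarrow> (\<exists>a\<in>{-r..r}. c a = z)))"
proof -
  note s = contracting_lineD[OF U]
  obtain w where w: "norm w = 1" "pu p0 w = w" "\<And>v. \<exists>t. pu p0 v = t *\<^sub>R w" using line_proj_unit[OF s(5)] by blast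
  obtain Kc where Kc: "Kc \<ge> 0" "\<And>x v n. norm (cocycle Fi Ai n x (pu x v)) \<le> Kc * \<rho> ^ n * norm (pu x v)" using s(7) by blast
  obtain r' where r': "r' > 0" "\<And>x y. x \<in> ball p0 r' \<Longrightarrow> y \<in> ball p0 r' \<Longrightarrow> exp_close Fi \<rho> x y \<Longrightarrow> norm (y - x) / 2 \<le> \<bar>(y - x) \<bullet> w\<bar>"
    using unstable_transverse[OF w] by blast
  define \<epsilon>' where "\<epsilon>' = min \<epsilon> r'"
  have \<epsilon>': "0 < \<epsilon>'" "\<epsilon>' \<le> \<epsilon>" "\<epsilon>' \<le> r'" using assms(3) r' by (auto simp: \<epsilon>'_def)
  obtain r where r: "0 < r" "ball p0 r \<subseteq> \<psi> ` chart_dom"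
    and ex: "\<forall>y\<in>ball p0 r. \<exists>c. c 0 = y \<and> continuous_on {-r..r} c \<and>
     (\<forall>a\<in>{-r..r}. c a \<in> ball p0 \<epsilon>' \<and> c a \<in> \<psi> ` chart_dom \<and> snd (chart_inv \<psi> (c a)) = snd (chart_inv \<psi> y)) \<and>
     (\<forall>a\<in>{-r..r}. \<forall>b\<in>{-r..r}. exp_close Fi \<rho> (c a) (c b)) \<and>
     (\<forall>a b. -r \<le> a \<longrightarrow> a \<le> b \<longrightarrow> b \<le> r \<longrightarrow> (b - a) / 2 \<le> (c b - c a) \<bullet> w)"
    using plaque_curve[OF assms(1) s(4) assms(2) w(1,2) s(1,2) Kc(2,1) \<epsilon>'(1)] by (elim exE conjE) (rule that)
  \<comment> \<open>The curve advances at least \<open>r / 2\<close> along \<open>w\<close> on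
    either side of \<open>y\<close>, and \<open>r'\<close> is the range of transversality.\<close>
  define \<delta> where "\<delta> = min (r / 2) r'"
  have \<delta>: "0 < \<delta>" "\<delta> \<le> r / 2" "\<delta> \<le> r'" using r r' by (auto simp: \<delta>_def)
  have "\<exists>c. c 0 = y \<and> continuous_on {-r..r} c \<and>
     (\<forall>a\<in>{-r..r}. c a \<in> ball p0 \<epsilon> \<and> c a \<in> \<psi> ` chart_dom \<and> snd (chart_inv \<psi> (c a)) = snd (chart_inv \<psi> y)) \<and>
     (\<forall>a\<in>{-r..r}. \<forall>b\<in>{-r..r}. exp_close Fi \<rho> (c a) (c b)) \<and>
     (\<forall>a b. -r \<le> a \<longrightarrow> a \<le> b \<longrightarrow> b \<le> r \<longrightarrow> (b - a) / 2 \<le> (c b - c a) \<bullet> w) \<and>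
     (\<forall>z\<in>ball p0 \<delta>. norm (z - y) < \<delta> \<longrightarrow> exp_close Fi \<rho> y z \<longrightarrow> (\<exists>a\<in>{-r..r}. c a = z))"
    if y: "y \<in> ball p0 r" for y
  proof -
    obtain c where c: "c 0 = y" "continuous_on {-r..r} c"
     "\<And>a. a \<in> {-r..r} \<Longrightarrow> c a \<in> ball p0 \<epsilon>' \<and> c a \<in> \<psi> ` chart_dom \<and> snd (chart_inv \<psi> (c a)) = snd (chart_inv \<psi> y)"
     "\<And>a b. a \<in> {-r..r} \<Longrightarrow> b \<in> {-r..r} \<Longrightarrow> exp_close Fi \<rho> (c a) (c b)"
     "\<And>a b. -r \<le> a \<Longrightarrow> a \<le> b \<Longrightarrow> b \<le> r \<Longrightarrow> (b - a) / 2 \<le> (c b - c a) \<bullet> w"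
      using bspec[OF ex y] by blast
    have hit: "\<exists>a\<in>{-r..r}. c a = z" if z: "norm (z - y) < r / 2" "exp_close Fi \<rho> y z" "z \<in> ball p0 r'" for z
    proof -
      have f: "continuous_on {-r..r} (\<lambda>a. (c a - z) \<bullet> w)" by (intro continuous_intros c)
      have zy: "\<bar>(y - z) \<bullet> w\<bar> < r / 2" using Cauchy_Schwarz_ineq2[of "y - z" w] w(1) z(1) by (simp add: norm_minus_commute)
      have "(r - 0) / 2 \<le> (c r - y) \<bullet> w" "(0 - (- r)) / 2 \<le> (y - c (- r)) \<bullet> w"
        using c(5)[of 0 r] c(5)[of "-r" 0] r(1) c(1) by auto
      moreover have "(y - z) \<bullet> w < r / 2" "- (r / 2) < (y - z) \<bullet> w"
        using abs_less_iff[THEN iffD1, OF zy] by auto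
      moreover have "(c (- r) - z) \<bullet> w = (y - z) \<bullet> w - (y - c (- r)) \<bullet> w" "(c r - z) \<bullet> w = (y - z) \<bullet> w + (c r - y) \<bullet> w"
        by (simp_all add: inner_diff_left)
      ultimately have "(c (- r) - z) \<bullet> w \<le> 0" "0 \<le> (c r - z) \<bullet> w"
        by simp_all
      then obtain a where a: "a \<in> {-r..r}" "(c a - z) \<bullet> w = 0"
        using IVT'[of "\<lambda>a. (c a - z) \<bullet> w" "-r" 0 r] f r(1) by auto
      have as: "exp_close Fi \<rho> z (c a)" using c(4)[of 0 a] a(1) r(1) z(2) c(1) exp_close_trans exp_close_sym by (metis atLeastAtMost_iff less_imp_le neg_le_0_iff_le)
      have "c a \<in> ball p0 r'" using c(3)[OF a(1)] \<epsilon>'(3) by auto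
      from r'(2)[OF z(3) this as] a(2) have "norm (c a - z) \<le> 0" by simp
      then show ?thesis using a(1) by auto
    qed
    have hit': "\<forall>z\<in>ball p0 \<delta>. norm (z - y) < \<delta> \<longrightarrow> exp_close Fi \<rho> y z \<longrightarrow> (\<exists>a\<in>{-r..r}. c a = z)"
    proof (intro ballI impI)
      fix z assume "z \<in> ball p0 \<delta>" "norm (z - y) < \<delta>" "exp_close Fi \<rho> y z"
      then show "\<exists>a\<in>{-r..r}. c a = z" using hit[of z] \<delta> by simp
    qed
    have "\<forall>a\<in>{-r..r}. c a \<in> ball p0 \<epsilon> \<and> c a \<in> \<psi> ` chart_dom \<and> snd (chart_inv \<psi> (c a)) = snd (chart_inv \<psi> y)"
      using c(3) \<epsilon>'(2) subset_ball[OF \<epsilon>'(2), of p0] by blast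
    then show ?thesis using c(1,2,4,5) hit' by (intro exI[of _ c] conjI) auto
  qed
  then show ?thesis using w(1) r \<delta>(1) by (intro exI[of _ w] exI[of _ r] exI[of _ \<delta>] conjI) auto
qed


text \<open>Along a stable curve the image under \<open>H\<close> moves injectively on the line
  through \<open>H y\<close> in direction \<open>e\<close>, so it covers an interval. The curve ends
  at distance at least \<open>r / 2\<close> from \<open>y\<close>, and uniform continuity of
  \<open>K\<close> then bounds the interval from below independently of \<open>y\<close>.\<close>

lemma stable_segment_in_plaque:
  assumes ch: "plaque_chart \<psi> ps" and p0: "p0 \<in> \<psi> ` chart_dom"
  shows "\<exists>r>0. \<exists>\<delta>>0. ball p0 r \<subseteq> \<psi> ` chart_dom \<and> (\<forall>y\<in>ball p0 r. \<forall>t. \<bar>t\<bar> \<le> \<delta> \<longrightarrow>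
     K (H y + t *\<^sub>R e) \<in> \<psi> ` chart_dom \<and> snd (chart_inv \<psi> (K (H y + t *\<^sub>R e))) = snd (chart_inv \<psi> y) \<and>
     exp_close F \<sigma> y (K (H y + t *\<^sub>R e)))"
proof -
  obtain w r where w: "norm w = 1" and r: "0 < r" "ball p0 r \<subseteq> \<psi> ` chart_dom"
    and ex: "\<forall>y\<in>ball p0 r. \<exists>c. c 0 = y \<and> continuous_on {-r..r} c \<and>
     (\<forall>a\<in>{-r..r}. c a \<in> ball p0 1 \<and> c a \<in> \<psi> ` chart_dom \<and> snd (chart_inv \<psi> (c a)) = snd (chart_inv \<psi> y)) \<and>
     (\<forall>a\<in>{-r..r}. \<forall>b\<in>{-r..r}. exp_close F \<sigma> (c a) (c b)) \<and>
     (\<forall>a b. -r \<le> a \<longrightarrow> a \<le> b \<longrightarrow> b \<le> r \<longrightarrow> (b - a) / 2 \<le> (c b - c a) \<bullet> w)"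
    using stable_curve[OF ch p0 zero_less_one] by (elim exE conjE) (rule that)
  obtain d where d: "d > 0" "\<And>x y. norm (x - y) < d \<Longrightarrow> norm (K x - K y) < r / 2" using K_unif[of "r / 2"] r(1) by auto
  define \<delta> where "\<delta> = d / norm e"
  have \<delta>: "0 < \<delta>" using d e0 by (simp add: \<delta>_def)
  have "K (H y + t *\<^sub>R e) \<in> \<psi> ` chart_dom \<and> snd (chart_inv \<psi> (K (H y + t *\<^sub>R e))) = snd (chart_inv \<psi> y) \<and>
     exp_close F \<sigma> y (K (H y + t *\<^sub>R e))" if y: "y \<in> ball p0 r" and t: "\<bar>t\<bar> \<le> \<delta>" for y t
  proof -
    obtain c where c: "c 0 = y" "continuous_on {-r..r} c"
     "\<And>a. a \<in> {-r..r} \<Longrightarrow> c a \<in> \<psi> ` chart_dom \<and> snd (chart_inv \<psi> (c a)) = snd (chart_inv \<psi> y)"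
     "\<And>a b. a \<in> {-r..r} \<Longrightarrow> b \<in> {-r..r} \<Longrightarrow> exp_close F \<sigma> (c a) (c b)"
     "\<And>a b. -r \<le> a \<Longrightarrow> a \<le> b \<Longrightarrow> b \<le> r \<Longrightarrow> (b - a) / 2 \<le> (c b - c a) \<bullet> w"
      using bspec[OF ex y] by blast
    define f where "f a = (\<phi> \<bullet> (H (c a) - H y)) / (\<phi> \<bullet> e)" for a
    have Hc: "H (c a) = H y + f a *\<^sub>R e" if "a \<in> {-r..r}" for a
    proof -
      have "exp_close F \<sigma> (c a) y" using c(4)[OF that, of 0] r(1) c(1) by auto
      then obtain s where s: "H (c a) - H y = s *\<^sub>R e" using stable_on_line by blast
      then have "f a = s" using \<phi>e by (simp add: f_def)
      then show ?thesis using s by (simp add: algebra_simps)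
    qed
    have fc: "continuous_on {-r..r} f" unfolding f_def using \<phi>e
      by (intro continuous_intros continuous_on_compose2[OF H_cont c(2)]) auto
    have fi: "inj_on f {-r..r}"
    proof (rule inj_onI)
      fix a b assume ab: "a \<in> {-r..r}" "b \<in> {-r..r}" "f a = f b"
      have "H (c a) = H (c b)" unfolding Hc[OF ab(1)] Hc[OF ab(2)] ab(3) ..
      then have ce: "c a = c b" by (rule H_inj)
      have "\<not> a < b" using c(5)[of a b] ab(1,2) unfolding ce by auto
      moreover have "\<not> b < a" using c(5)[of b a] ab(1,2) unfolding ce by auto
      ultimately show "a = b" by simp
    qed
    have f0: "f 0 = 0" by (simp add: f_def c(1))
    have big: "\<delta> \<le> \<bar>f a\<bar>" if a: "a = r \<or> a = - r" for a
    proof (rule ccontr)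
      assume "\<not> \<delta> \<le> \<bar>f a\<bar>"
      then have "\<bar>f a\<bar> * norm e < d" using e0 by (simp add: \<delta>_def field_simps)
      moreover have ar: "a \<in> {-r..r}" using a r(1) by auto
      ultimately have "norm (H (c a) - H y) < d" using Hc[OF ar] by simp
      then have l: "norm (c a - y) < r / 2" using d(2) by (force simp: KH)
      have "\<bar>(c a - y) \<bullet> w\<bar> \<le> norm (c a - y)" using Cauchy_Schwarz_ineq2[of "c a - y" w] w by simp
      moreover have "r / 2 \<le> \<bar>(c a - y) \<bullet> w\<bar>"
        using a c(5)[of 0 r] c(5)[of "-r" 0] r(1) c(1) by (auto simp: inner_diff_left)
      ultimately show False using l by linarith
    qed
    have "(f (- r) < f 0 \<and> f 0 < f r) \<or> (f r < f 0 \<and> f 0 < f (- r))"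
      using continuous_inj_imp_mono[of "-r" 0 r f] fc fi r(1) by auto
    then have "\<exists>a\<in>{-r..r}. f a = t"
    proof
      assume m: "f (- r) < f 0 \<and> f 0 < f r"
      then have "f (- r) \<le> t" "t \<le> f r" using big[of r] big[of "-r"] t f0 by auto
      then show ?thesis using IVT'[of f "-r" t r] fc r(1) by auto
    next
      assume m: "f r < f 0 \<and> f 0 < f (- r)"
      then have "f r \<le> t" "t \<le> f (- r)" using big[of r] big[of "-r"] t f0 by auto
      then show ?thesis using IVT2'[of f r t "-r"] fc r(1) by auto
    qed
    then obtain a where a: "a \<in> {-r..r}" "f a = t" by blast
    have "K (H y + t *\<^sub>R e) = c a" using Hc[OF a(1)] a(2) KH by metis
    then show ?thesis using c(3)[OF a(1)] c(4)[of 0 a] a(1) r(1) c(1) by auto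
  qed
  then show ?thesis using r \<delta> by blast
qed

text \<open>The translates along \<open>e\<close>, seen through \<open>H\<close>, of an unstable curve through \<open>q\<close> form an injective continuous
  image of a planar domain inside the plaque, hence a neighbourhood of \<open>q\<close> by invariance of domain.\<close>

lemma local_product:
  assumes ch: "plaque_chart \<psi> ps" "plaque_chart \<psi> pu" and q: "q \<in> \<psi> ` chart_dom"
  shows "\<exists>W. open W \<and> q \<in> W \<and> W \<subseteq> \<psi> ` chart_dom \<and>
    (\<forall>z\<in>W. snd (chart_inv \<psi> z) = snd (chart_inv \<psi> q) \<longrightarrow> (\<exists>y t. exp_close Fi \<rho> q y \<and> H z - H y = t *\<^sub>R e))"
proof -
  have inj: "inj_on \<psi> chart_dom" and opn: "open (\<psi> ` chart_dom)"
    and icont: "continuous_on (\<psi> ` chart_dom) (chart_inv \<psi>)" using ch by (auto simp: plaque_chart_def)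
  obtain r1 \<delta> where r1: "0 < r1" "0 < \<delta>" "ball q r1 \<subseteq> \<psi> ` chart_dom"
    and seg: "\<And>y t. y \<in> ball q r1 \<Longrightarrow> \<bar>t\<bar> \<le> \<delta> \<Longrightarrow>
     K (H y + t *\<^sub>R e) \<in> \<psi> ` chart_dom \<and> snd (chart_inv \<psi> (K (H y + t *\<^sub>R e))) = snd (chart_inv \<psi> y)"
    using stable_segment_in_plaque[OF ch(1) q] by blast
  obtain w r \<delta>' where w: "norm w = 1" and r: "0 < r" "0 < \<delta>'" "ball q r \<subseteq> \<psi> ` chart_dom"
    and ex: "\<forall>y\<in>ball q r. \<exists>c. c 0 = y \<and> continuous_on {-r..r} c \<and>
     (\<forall>a\<in>{-r..r}. c a \<in> ball q r1 \<and> c a \<in> \<psi> ` chart_dom \<and> snd (chart_inv \<psi> (c a)) = snd (chart_inv \<psi> y)) \<and>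
     (\<forall>a\<in>{-r..r}. \<forall>b\<in>{-r..r}. exp_close Fi \<rho> (c a) (c b)) \<and>
     (\<forall>a b. -r \<le> a \<longrightarrow> a \<le> b \<longrightarrow> b \<le> r \<longrightarrow> (b - a) / 2 \<le> (c b - c a) \<bullet> w) \<and>
     (\<forall>z\<in>ball q \<delta>'. norm (z - y) < \<delta>' \<longrightarrow> exp_close Fi \<rho> y z \<longrightarrow> (\<exists>a\<in>{-r..r}. c a = z))"
    using unstable_curve[OF ch(2) q r1(1)] by (elim exE conjE) (rule that)
  have "q \<in> ball q r" using r by simp
  from bspec[OF ex this] obtain c where c: "c 0 = q" "continuous_on {-r..r} c"
     "\<And>a. a \<in> {-r..r} \<Longrightarrow> c a \<in> ball q r1 \<and> c a \<in> \<psi> ` chart_dom \<and> snd (chart_inv \<psi> (c a)) = snd (chart_inv \<psi> q)"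
     "\<And>a b. a \<in> {-r..r} \<Longrightarrow> b \<in> {-r..r} \<Longrightarrow> exp_close Fi \<rho> (c a) (c b)"
     "\<And>a b. -r \<le> a \<Longrightarrow> a \<le> b \<Longrightarrow> b \<le> r \<Longrightarrow> (b - a) / 2 \<le> (c b - c a) \<bullet> w"
    by blast
  define S where "S = {-r<..<r} \<times> {-\<delta><..<\<delta>}"
  define \<Phi> where "\<Phi> z = K (H (c (fst z)) + snd z *\<^sub>R e)" for z
  have \<Phi>: "\<Phi> z \<in> \<psi> ` chart_dom" "snd (chart_inv \<psi> (\<Phi> z)) = snd (chart_inv \<psi> q)" if "z \<in> S" for z
    using seg[of "c (fst z)" "snd z"] c(3)[of "fst z"] that by (auto simp: S_def \<Phi>_def)
  have \<Phi>c: "continuous_on S \<Phi>" unfolding \<Phi>_def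
    by (intro continuous_on_compose2[OF K_cont] continuous_intros continuous_on_compose2[OF H_cont]
        continuous_on_compose2[OF c(2)]) (auto simp: S_def)
  have \<Phi>i: "inj_on \<Phi> S"
  proof (rule inj_onI)
    fix z z' assume z: "z \<in> S" "z' \<in> S" "\<Phi> z = \<Phi> z'"
    have "H (\<Phi> z) = H (\<Phi> z')" using z(3) by simp
    then have eq: "H (c (fst z)) - H (c (fst z')) = (snd z' - snd z) *\<^sub>R e" by (simp add: \<Phi>_def HK algebra_simps)
    \<comment> \<open>Unstable displacements lie in the plane and \<open>e\<close> is transverse to
      it, so the two parameters separate.\<close>
    have "\<phi> \<bullet> (H (c (fst z)) - H (c (fst z'))) = 0" using z by (intro unstable_in_plane c(4)) (auto simp: S_def)
    then have s: "snd z' = snd z" using \<phi>e by (simp add: eq)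
    have zr: "fst z \<in> {-r<..<r}" "fst z' \<in> {-r<..<r}" using z(1,2) by (auto simp: S_def)
    have "H (c (fst z)) = H (c (fst z'))" using eq s by simp
    then have ce: "c (fst z) = c (fst z')" by (rule H_inj)
    have "\<not> fst z < fst z'" using c(5)[of "fst z" "fst z'"] zr unfolding ce by auto
    moreover have "\<not> fst z' < fst z" using c(5)[of "fst z'" "fst z"] zr unfolding ce by auto
    ultimately have "fst z = fst z'" by simp
    then show "z = z'" using s by (simp add: prod_eq_iff)
  qed
  \<comment> \<open>Within one plaque a point is determined by its planar coordinate, so the map
    becomes one between planes, as invariance of domain requires.\<close>
  define \<Theta> where "\<Theta> z = fst (chart_inv \<psi> (\<Phi> z))" for z
  have eqv: "\<Phi> z = z'" if "z \<in> S" "z' \<in> \<psi> ` chart_dom" "snd (chart_inv \<psi> z') = snd (chart_inv \<psi> q)" "\<Theta> z = fst (chart_inv \<psi> z')" for z z'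
  proof -
    have "chart_inv \<psi> (\<Phi> z) = chart_inv \<psi> z'" using \<Phi>[OF that(1)] that by (simp add: \<Theta>_def prod_eq_iff)
    then show ?thesis using \<Phi>(1)[OF that(1)] that(2) by (metis f_inv_into_f)
  qed
  have "open (\<Theta> ` S)"
  proof (rule invariance_of_domain_gen)
    show "open S" unfolding S_def by (intro open_Times open_greaterThanLessThan)
    show "continuous_on S \<Theta>" unfolding \<Theta>_def
      using \<Phi>(1) by (intro continuous_intros continuous_on_compose2[OF icont \<Phi>c]) auto
    show "inj_on \<Theta> S"
    proof (rule inj_onI)
      fix z z' assume z: "z \<in> S" "z' \<in> S" "\<Theta> z = \<Theta> z'"
      have "\<Phi> z = \<Phi> z'" using eqv[OF z(1) \<Phi>[OF z(2)]] z(3) by (simp add: \<Theta>_def)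
      then show "z = z'" using \<Phi>i z by (auto dest: inj_onD)
    qed
  qed simp
  define W where "W = {x \<in> \<psi> ` chart_dom. chart_inv \<psi> x \<in> \<Theta> ` S \<times> UNIV}"
  have "open W" unfolding W_def by (intro chart_inv_openin icont opn open_Times open_UNIV) fact
  moreover have "q \<in> W"
  proof -
    have "(0, 0) \<in> S" using r r1 by (simp add: S_def)
    moreover have "\<Phi> (0, 0) = q" by (simp add: \<Phi>_def c(1) KH)
    ultimately have "fst (chart_inv \<psi> q) \<in> \<Theta> ` S" by (auto simp: \<Theta>_def intro!: image_eqI[of _ _ "(0,0)"])
    then show ?thesis using q by (simp add: W_def mem_Times_iff)
  qed
  moreover have "\<exists>y t. exp_close Fi \<rho> q y \<and> H z - H y = t *\<^sub>R e" if z: "z \<in> W" "snd (chart_inv \<psi> z) = snd (chart_inv \<psi> q)" for z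
  proof -
    obtain s where s: "s \<in> S" "fst (chart_inv \<psi> z) = \<Theta> s" using z(1) by (auto simp: W_def mem_Times_iff)
    have "\<Phi> s = z" using eqv[OF s(1) _ z(2)] z(1) s(2) by (auto simp: W_def)
    then have "H z = H (c (fst s)) + snd s *\<^sub>R e" by (auto simp: \<Phi>_def HK)
    then have "H z - H (c (fst s)) = snd s *\<^sub>R e" by simp
    moreover have "exp_close Fi \<rho> q (c (fst s))" using c(4)[of 0 "fst s"] s(1) r(1) c(1) by (auto simp: S_def)
    ultimately show ?thesis by blast
  qed
  ultimately show ?thesis by (intro exI[of _ W]) (auto simp: W_def)
qed

text \<open>Shift an unstable curve by \<open>t\<close> times \<open>e\<close>, as seen through
  \<open>H\<close>; the shifted points stay in the same plaque. Near each of them the plaque is a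
  product of the unstable and the \<open>e\<close> direction, and comparing values of
  \<open>\<phi>\<close> leaves no part along \<open>e\<close>. So the shifted curve is unstable
  locally, and by connectedness along its whole length.\<close>

lemma joint_integrability_local:
  "\<exists>r>0. \<forall>p1\<in>ball p0 r. \<forall>p2\<in>ball p0 r. \<forall>t. \<bar>t\<bar> < r \<longrightarrow> exp_close Fi \<rho> p1 p2 \<longrightarrow>
     exp_close Fi \<rho> (K (H p1 + t *\<^sub>R e)) (K (H p2 + t *\<^sub>R e))"
proof -
  obtain \<psi> where ch: "plaque_chart \<psi> ps" "plaque_chart \<psi> pu" and p0: "p0 \<in> \<psi> ` chart_dom" using charts by blast
  obtain r1 \<delta> where r1: "0 < r1" "0 < \<delta>" "ball p0 r1 \<subseteq> \<psi> ` chart_dom"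
    and seg: "\<And>y t. y \<in> ball p0 r1 \<Longrightarrow> \<bar>t\<bar> \<le> \<delta> \<Longrightarrow>
     K (H y + t *\<^sub>R e) \<in> \<psi> ` chart_dom \<and> snd (chart_inv \<psi> (K (H y + t *\<^sub>R e))) = snd (chart_inv \<psi> y)"
    using stable_segment_in_plaque[OF ch(1) p0] by blast
  obtain w r \<delta>' where w: "norm w = 1" and r: "0 < r" "0 < \<delta>'" "ball p0 r \<subseteq> \<psi> ` chart_dom"
    and ex: "\<forall>y\<in>ball p0 r. \<exists>c. c 0 = y \<and> continuous_on {-r..r} c \<and>
     (\<forall>a\<in>{-r..r}. c a \<in> ball p0 r1 \<and> c a \<in> \<psi> ` chart_dom \<and> snd (chart_inv \<psi> (c a)) = snd (chart_inv \<psi> y)) \<and>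
     (\<forall>a\<in>{-r..r}. \<forall>b\<in>{-r..r}. exp_close Fi \<rho> (c a) (c b)) \<and>
     (\<forall>a b. -r \<le> a \<longrightarrow> a \<le> b \<longrightarrow> b \<le> r \<longrightarrow> (b - a) / 2 \<le> (c b - c a) \<bullet> w) \<and>
     (\<forall>z\<in>ball p0 \<delta>'. norm (z - y) < \<delta>' \<longrightarrow> exp_close Fi \<rho> y z \<longrightarrow> (\<exists>a\<in>{-r..r}. c a = z))"
    using unstable_curve[OF ch(2) p0 r1(1)] by (elim exE conjE) (rule that)
  define r0 where "r0 = min (min r \<delta>) (\<delta>' / 2)"
  have r0: "0 < r0" "r0 \<le> r" "r0 \<le> \<delta>" "r0 \<le> \<delta>' / 2" using r r1 by (auto simp: r0_def)
  show ?thesis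
  proof (intro exI[of _ r0] conjI ballI allI impI)
    show "0 < r0" by (rule r0)
    fix p1 p2 t assume p: "p1 \<in> ball p0 r0" "p2 \<in> ball p0 r0" "\<bar>t\<bar> < r0" "exp_close Fi \<rho> p1 p2"
    have "p1 \<in> ball p0 r" using p r0 by auto
    from bspec[OF ex this] obtain c where c: "c 0 = p1" "continuous_on {-r..r} c"
     "\<And>a. a \<in> {-r..r} \<Longrightarrow> c a \<in> ball p0 r1 \<and> c a \<in> \<psi> ` chart_dom \<and> snd (chart_inv \<psi> (c a)) = snd (chart_inv \<psi> p1)"
     "\<And>a b. a \<in> {-r..r} \<Longrightarrow> b \<in> {-r..r} \<Longrightarrow> exp_close Fi \<rho> (c a) (c b)"
     "\<And>z. z \<in> ball p0 \<delta>' \<Longrightarrow> norm (z - p1) < \<delta>' \<Longrightarrow> exp_close Fi \<rho> p1 z \<Longrightarrow> \<exists>a\<in>{-r..r}. c a = z"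
      by blast
    have "dist p1 p2 < \<delta>'" using p(1,2) r0 dist_triangle_half_r[of p0 p1 \<delta>' p2] by simp
    then have "norm (p2 - p1) < \<delta>'" by (simp add: dist_norm norm_minus_commute)
    moreover have "p2 \<in> ball p0 \<delta>'" using p(2) r0 r(2) by simp
    ultimately obtain a2 where a2: "a2 \<in> {-r..r}" "c a2 = p2" using c(5) p(4) by blast
    define q where "q a = K (H (c a) + t *\<^sub>R e)" for a
    have q: "q a \<in> \<psi> ` chart_dom" "snd (chart_inv \<psi> (q a)) = snd (chart_inv \<psi> p1)" if "a \<in> {-r..r}" for a
      using seg[of "c a" t] c(3)[OF that] p(3) r0 by (auto simp: q_def)
    have qc: "continuous_on {-r..r} q" unfolding q_def
      by (intro continuous_on_compose2[OF K_cont] continuous_intros continuous_on_compose2[OF H_cont c(2)]) auto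
    have "exp_close Fi \<rho> (q 0) (q a2)"
    proof (rule connected_equivalence_relation[of "{-r..r}" 0 a2 "\<lambda>a b. exp_close Fi \<rho> (q a) (q b)"])
      fix a assume a: "a \<in> {-r..r}"
      obtain W where W: "open W" "q a \<in> W" "\<And>z. z \<in> W \<Longrightarrow> snd (chart_inv \<psi> z) = snd (chart_inv \<psi> (q a)) \<Longrightarrow> \<exists>y t. exp_close Fi \<rho> (q a) y \<and> H z - H y = t *\<^sub>R e"
        using local_product[OF ch q(1)[OF a]] by blast
      have "openin (top_of_set {-r..r}) ({-r..r} \<inter> q -` W)"
        using continuous_openin_preimage_gen[OF qc W(1)] .
      moreover have "exp_close Fi \<rho> (q a) (q b)" if b: "b \<in> {-r..r} \<inter> q -` W" for b
      proof -
        have bb: "b \<in> {-r..r}" "q b \<in> W" using b by auto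
        obtain y \<tau> where y: "exp_close Fi \<rho> (q a) y" "H (q b) - H y = \<tau> *\<^sub>R e"
          using W(3)[OF bb(2)] q(2)[OF a] q(2)[OF bb(1)] by auto
        \<comment> \<open>The shift cancels in the difference, so \<open>\<phi>\<close> sees only
          the original unstable curve.\<close>
        have "\<phi> \<bullet> (H (q b) - H (q a)) = \<phi> \<bullet> (H (c b) - H (c a))" by (simp add: q_def HK inner_diff_right)
        then have 1: "\<phi> \<bullet> (H (q b) - H (q a)) = 0" using unstable_in_plane[OF c(4)[OF bb(1) a]] by simp
        have 2: "\<phi> \<bullet> (H (q a) - H y) = 0" by (rule unstable_in_plane[OF y(1)])
        have "\<phi> \<bullet> (H (q b) - H y) = 0" using 1 2 by (simp add: inner_diff_right)
        then have "\<tau> = 0" using \<phi>e by (simp add: y(2))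
        then have "q b = y" using y(2) H_inj by simp
        then show ?thesis using y(1) by simp
      qed
      ultimately show "\<exists>T. openin (top_of_set {-r..r}) T \<and> a \<in> T \<and> (\<forall>x\<in>T. exp_close Fi \<rho> (q a) (q x))"
        using a W(2) by (intro exI[of _ "{-r..r} \<inter> q -` W"]) auto
    next
      show "connected {-r..r}" by simp
      show "0 \<in> {-r..r}" using r(1) by simp
      show "a2 \<in> {-r..r}" by (rule a2)
    next
      fix x y assume "exp_close Fi \<rho> (q x) (q y)"
      then show "exp_close Fi \<rho> (q y) (q x)" by (rule exp_close_sym)
    next
      fix x y z assume "exp_close Fi \<rho> (q x) (q y)" "exp_close Fi \<rho> (q y) (q z)"
      then show "exp_close Fi \<rho> (q x) (q z)" by (rule exp_close_trans)
    qed
    then show "exp_close Fi \<rho> (K (H p1 + t *\<^sub>R e)) (K (H p2 + t *\<^sub>R e))" by (simp add: q_def c(1) a2(2))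
  qed
qed

lemma H_K_translate:
  assumes "ivec n"
  shows "\<exists>m. ivec m \<and> (\<forall>x v. K (H (x + n) + v) = K (H x + v) + m)"
proof -
  obtain m where m: "ivec m" "\<And>x. H (x + n) = H x + m" using int_equivariantD[OF H_eq assms] by blast
  obtain m' where m': "ivec m'" "\<And>x. K (x + m) = K x + m'" using int_equivariantD[OF K_eq m(1)] by blast
  have "K (H (x + n) + v) = K (H x + v) + m'" for x v
    unfolding m(2) using m'(2)[of "H x + v"] by (simp add: algebra_simps)
  then show ?thesis using m'(1) by blast
qed

lemma joint_integrability:
  "\<exists>r>0. \<forall>p1 p2 t. norm (p1 - p2) < r \<longrightarrow> \<bar>t\<bar> < r \<longrightarrow> exp_close Fi \<rho> p1 p2 \<longrightarrow>
     exp_close Fi \<rho> (K (H p1 + t *\<^sub>R e)) (K (H p2 + t *\<^sub>R e))"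
proof -
  have "\<forall>p0. \<exists>r>0. \<forall>p1\<in>ball p0 r. \<forall>p2\<in>ball p0 r. \<forall>t. \<bar>t\<bar> < r \<longrightarrow> exp_close Fi \<rho> p1 p2 \<longrightarrow>
     exp_close Fi \<rho> (K (H p1 + t *\<^sub>R e)) (K (H p2 + t *\<^sub>R e))" using joint_integrability_local by blast
  then obtain R where R: "\<And>p0. 0 < R p0" "\<And>p0 p1 p2 t. p1 \<in> ball p0 (R p0) \<Longrightarrow> p2 \<in> ball p0 (R p0) \<Longrightarrow> \<bar>t\<bar> < R p0 \<Longrightarrow>
     exp_close Fi \<rho> p1 p2 \<Longrightarrow> exp_close Fi \<rho> (K (H p1 + t *\<^sub>R e)) (K (H p2 + t *\<^sub>R e))" by metis
  have cpt: "compact ucube" by (rule compact_cbox)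
  \<comment> \<open>Half radii leave room for the second point, as with a Lebesgue number.\<close>
  have cov: "ucube \<subseteq> (\<Union>p\<in>UNIV. ball p (R p / 2))"
  proof
    fix x :: "real^3"
    have "x \<in> ball x (R x / 2)" using R(1)[of x] by simp
    then show "x \<in> (\<Union>p\<in>UNIV. ball p (R p / 2))" by blast
  qed
  obtain D where D: "D \<subseteq> UNIV" "finite D" "ucube \<subseteq> (\<Union>p\<in>D. ball p (R p / 2))"
    by (rule compactE_image[OF cpt _ cov]) (simp_all add: open_ball)
  define r where "r = Min (insert 1 ((\<lambda>p. R p / 2) ` D))"
  have r: "0 < r" unfolding r_def using D(2) R(1) by simp
  have rD: "r \<le> R p / 2" if "p \<in> D" for p unfolding r_def using D(2) that by (intro Min_le) auto
  show ?thesis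
  proof (intro exI[of _ r] conjI allI impI)
    show "0 < r" by (rule r)
    fix p1 p2 t assume p: "norm (p1 - p2) < r" "\<bar>t\<bar> < r" "exp_close Fi \<rho> p1 p2"
    obtain n where n: "ivec n" "p1 + n \<in> ucube" using translate_into_ucube by blast
    obtain p0 where p0: "p0 \<in> D" "p1 + n \<in> ball p0 (R p0 / 2)" using D(3) n(2) by blast
    have a: "p1 + n \<in> ball p0 (R p0)" using p0(2) R(1)[of p0] by simp
    have "dist (p1 + n) (p2 + n) < R p0 / 2" using p(1) rD[OF p0(1)] by (simp add: dist_norm)
    then have b: "p2 + n \<in> ball p0 (R p0)" using p0(2) dist_triangle[of p0 "p2 + n" "p1 + n"] by (simp add: dist_commute)
    have t: "\<bar>t\<bar> < R p0" using p(2) rD[OF p0(1)] R(1)[of p0] by linarith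
    have "exp_close Fi \<rho> (p1 + n) (p2 + n)" using exp_close_translate[OF Fi_eq n(1)] p(3) by blast
    from R(2)[OF a b t this] have "exp_close Fi \<rho> (K (H (p1 + n) + t *\<^sub>R e)) (K (H (p2 + n) + t *\<^sub>R e))" .
    moreover obtain m where "ivec m" "\<And>x v. K (H (x + n) + v) = K (H x + v) + m" using H_K_translate[OF n(1)] by blast
    ultimately show "exp_close Fi \<rho> (K (H p1 + t *\<^sub>R e)) (K (H p2 + t *\<^sub>R e))" using exp_close_translate[OF Fi_eq] by simp
  qed
qed

section \<open>The group of translations preserving the unstable images\<close>

text \<open>Push \<open>z\<close> forward by a high power of \<open>M\<close> and move it into the
  unit cube by a lattice vector. Pulled back, the lattice vector stays integral, the remainder's
  part along \<open>e\<close> goes into \<open>t\<close>, and its part in the plane becomes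
  small.\<close>

lemma lattice_plus_line_dense:
  assumes "0 < \<epsilon>"
  shows "\<exists>n t. ivec n \<and> norm (z - (n + t *\<^sub>R e)) < \<epsilon>"
proof -
  define \<pi> where "\<pi> w = w - ((\<phi> \<bullet> w) / (\<phi> \<bullet> e)) *\<^sub>R e" for w
  have \<pi>0: "\<phi> \<bullet> \<pi> w = 0" for w using \<phi>e by (simp add: \<pi>_def inner_simps)
  have lin\<pi>: "linear \<pi>"
    unfolding \<pi>_def by (rule linearI) (simp_all add: inner_simps algebra_simps add_divide_distrib)
  have "(\<lambda>N. \<Sum>b\<in>Basis. norm ((Mi ^^ N) (\<pi> b))) \<longlonglongrightarrow> (\<Sum>b\<in>(Basis::(real^3) set). norm (0::real^3))"
    by (intro tendsto_intros Mi_plane_lim \<pi>0)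
  then have "(\<lambda>N. \<Sum>b\<in>Basis. norm ((Mi ^^ N) (\<pi> b))) \<longlonglongrightarrow> 0" by simp
  then have "\<forall>\<^sub>F N in sequentially. (\<Sum>b\<in>Basis. norm ((Mi ^^ N) (\<pi> b))) < \<epsilon>"
    using assms by (rule order_tendstoD)
  then obtain N where N: "(\<Sum>b\<in>Basis. norm ((Mi ^^ N) (\<pi> b))) < \<epsilon>"
    by (auto simp: eventually_sequentially)
  obtain m where m: "ivec m" "(M ^^ N) z + m \<in> ucube" using translate_into_ucube by blast
  define f where "f = (M ^^ N) z + m"
  define \<tau> where "\<tau> = (\<phi> \<bullet> f) / (\<phi> \<bullet> e)"
  have fd: "f = \<pi> f + \<tau> *\<^sub>R e" by (simp add: \<pi>_def \<tau>_def)
  have iv: "ivec ((Mi ^^ k) n)" if "ivec n" for k n using that by (induction k) (auto simp: Mi_int)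
  have "z = (Mi ^^ N) (f - m)" by (simp add: f_def Mi_M_pow)
  also have "\<dots> = (Mi ^^ N) (\<pi> f) + \<tau> *\<^sub>R (Mi ^^ N) e - (Mi ^^ N) m"
    by (subst fd) (simp add: linear_diff[OF Mi_pow_lin] linear_add[OF Mi_pow_lin] linear_cmul[OF Mi_pow_lin])
  finally have z: "z - ((Mi ^^ N) (- m) + (\<tau> * (1 / \<kappa>) ^ N) *\<^sub>R e) = (Mi ^^ N) (\<pi> f)"
    by (simp add: Mie_pow linear_neg[OF Mi_pow_lin])
  have l: "linear (\<lambda>w. (Mi ^^ N) (\<pi> w))"
    using linear_compose[OF lin\<pi> Mi_pow_lin] by (simp add: o_def)
  have "(Mi ^^ N) (\<pi> f) = (\<Sum>b\<in>Basis. (f \<bullet> b) *\<^sub>R (Mi ^^ N) (\<pi> b))"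
  proof -
    have "(Mi ^^ N) (\<pi> f) = (Mi ^^ N) (\<pi> (\<Sum>b\<in>Basis. (f \<bullet> b) *\<^sub>R b))" by (simp add: euclidean_representation)
    then show ?thesis by (simp add: linear_sum[OF l] linear_cmul[OF l])
  qed
  also have "norm \<dots> \<le> (\<Sum>b\<in>Basis. norm ((Mi ^^ N) (\<pi> b)))"
  proof (rule sum_norm_le)
    fix b :: "real^3" assume b: "b \<in> Basis"
    have "f \<in> ucube" using m by (simp add: f_def)
    then have "\<bar>f \<bullet> b\<bar> \<le> 1" using b by (auto simp: Basis_vec_def inner_axis mem_box_cart abs_le_iff) (smt (verit))
    then show "norm ((f \<bullet> b) *\<^sub>R (Mi ^^ N) (\<pi> b)) \<le> norm ((Mi ^^ N) (\<pi> b))"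
      using mult_right_mono[of "\<bar>f \<bullet> b\<bar>" 1 "norm ((Mi ^^ N) (\<pi> b))"] by simp
  qed
  finally have "norm (z - ((Mi ^^ N) (- m) + (\<tau> * (1 / \<kappa>) ^ N) *\<^sub>R e)) < \<epsilon>" using N z by simp
  then show ?thesis using iv[OF ivec_uminus[OF m(1)]] by blast
qed


text \<open>For pairs with close images one constant suffices. At small displacement the relation
  thus amounts to a family of closed inequalities.\<close>

lemma uniform_rate:
  assumes p: "contracting_line G B \<tau> p"
    and close: "\<And>\<epsilon>. 0 < \<epsilon> \<Longrightarrow> \<exists>\<delta>>0. \<forall>x y. exp_close G \<tau> x y \<longrightarrow> norm (H x - H y) < \<delta> \<longrightarrow> (\<forall>n. norm ((G ^^ n) x - (G ^^ n) y) \<le> \<epsilon>)"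
  shows "\<exists>\<delta> C. 0 < \<delta> \<and> 0 \<le> C \<and> (\<forall>x y n. exp_close G \<tau> x y \<longrightarrow> norm (H x - H y) < \<delta> \<longrightarrow> norm ((G ^^ n) x - (G ^^ n) y) \<le> C * \<tau> ^ n)"
proof -
  note P = contracting_lineD[OF p]
  obtain \<epsilon> C where \<epsilon>: "0 < \<epsilon>" and C: "\<And>x y. exp_close G \<tau> x y \<Longrightarrow> \<forall>n. norm ((G ^^ n) x - (G ^^ n) y) \<le> \<epsilon> \<Longrightarrow>
     \<forall>n. norm ((G ^^ n) x - (G ^^ n) y) \<le> C * \<tau> ^ n"
    using P(6)[unfolded exp_cone_def, rule_format, OF zero_less_one] by blast
  obtain \<delta> where \<delta>: "\<delta> > 0" "\<And>x y. exp_close G \<tau> x y \<Longrightarrow> norm (H x - H y) < \<delta> \<Longrightarrow> \<forall>n. norm ((G ^^ n) x - (G ^^ n) y) \<le> \<epsilon>"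
    using close[OF \<epsilon>] by blast
  have "norm ((G ^^ n) x - (G ^^ n) y) \<le> \<bar>C\<bar> * \<tau> ^ n" if xy: "exp_close G \<tau> x y" "norm (H x - H y) < \<delta>" for x y n
  proof -
    have "norm ((G ^^ n) x - (G ^^ n) y) \<le> C * \<tau> ^ n" using C[OF xy(1) \<delta>(2)[OF xy]] by blast
    also have "\<dots> \<le> \<bar>C\<bar> * \<tau> ^ n" using P(2) by (intro mult_right_mono) auto
    finally show ?thesis .
  qed
  then show ?thesis using \<delta>(1) by (intro exI[of _ \<delta>] exI[of _ "\<bar>C\<bar>"]) auto
qed

lemma Fi_pow_cont: "continuous_on UNIV (Fi ^^ n)"
proof (induction n)
  case (Suc j)
  have "continuous_on UNIV Fi"
    by (intro continuous_at_imp_continuous_on ballI has_derivative_continuous[OF contracting_lineD(1)[OF U]])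
  then show ?case using Suc by (simp add: continuous_on_compose2 o_def)
qed (simp add: id_def continuous_on_id)

text \<open>The set of \<open>z\<close> with \<open>exp_close Fi \<rho> (K z) (K (z + w))\<close> is closed and invariant under \<open>\<int>\<^sup>3\<close> and, by joint
  integrability, under \<open>\<real> e\<close>; it is everything because \<open>\<int>\<^sup>3 + \<real> e\<close> is dense.\<close>

lemma leaf_translation:
  "\<exists>\<delta>>0. \<forall>z0 w z. norm w < \<delta> \<longrightarrow> exp_close Fi \<rho> (K z0) (K (z0 + w)) \<longrightarrow> exp_close Fi \<rho> (K z) (K (z + w))"
proof -
  obtain \<delta>1 C where \<delta>1: "0 < \<delta>1" "\<And>x y n. exp_close Fi \<rho> x y \<Longrightarrow> norm (H x - H y) < \<delta>1 \<Longrightarrow> norm ((Fi ^^ n) x - (Fi ^^ n) y) \<le> C * \<rho> ^ n"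
    using uniform_rate[OF U unstable_close] by blast
  obtain r where r: "r > 0" "\<And>p1 p2 t. norm (p1 - p2) < r \<Longrightarrow> \<bar>t\<bar> < r \<Longrightarrow> exp_close Fi \<rho> p1 p2 \<Longrightarrow>
     exp_close Fi \<rho> (K (H p1 + t *\<^sub>R e)) (K (H p2 + t *\<^sub>R e))" using joint_integrability by blast
  obtain d where d: "d > 0" "\<And>x y. norm (x - y) < d \<Longrightarrow> norm (K x - K y) < r" using K_unif[OF r(1)] by blast
  show ?thesis
  proof (intro exI[of _ "min \<delta>1 d"] conjI allI impI)
    show "0 < min \<delta>1 d" using \<delta>1 d by simp
    fix z0 w z assume w: "norm w < min \<delta>1 d" and z0: "exp_close Fi \<rho> (K z0) (K (z0 + w))"
    define T where "T = {z. exp_close Fi \<rho> (K z) (K (z + w))}"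
    have "T = {z. \<forall>n. norm ((Fi ^^ n) (K z) - (Fi ^^ n) (K (z + w))) \<le> C * \<rho> ^ n}"
    proof (intro equalityI subsetI CollectI allI)
      fix z n assume "z \<in> T"
      then show "norm ((Fi ^^ n) (K z) - (Fi ^^ n) (K (z + w))) \<le> C * \<rho> ^ n"
        using \<delta>1(2)[of "K z" "K (z + w)" n] w by (simp add: T_def HK)
    next
      fix z assume "z \<in> {z. \<forall>n. norm ((Fi ^^ n) (K z) - (Fi ^^ n) (K (z + w))) \<le> C * \<rho> ^ n}"
      then show "z \<in> T" unfolding T_def exp_close_def by blast
    qed
    moreover have "closed {z. \<forall>n. norm ((Fi ^^ n) (K z) - (Fi ^^ n) (K (z + w))) \<le> C * \<rho> ^ n}"
      by (intro closed_Collect_all closed_Collect_le continuous_intros continuous_on_compose2[OF Fi_pow_cont]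
          continuous_on_compose2[OF K_cont]) auto
    ultimately have cl: "closed T" by simp
    have step: "z + t *\<^sub>R e \<in> T" if "z \<in> T" "\<bar>t\<bar> < r" for z t
    proof -
      have "norm (K z - K (z + w)) < r" using d(2)[of z "z + w"] w by simp
      from r(2)[OF this that(2)] that(1) have "exp_close Fi \<rho> (K (z + t *\<^sub>R e)) (K (z + w + t *\<^sub>R e))" by (simp add: T_def HK)
      then show ?thesis by (simp add: T_def add_ac)
    qed
    \<comment> \<open>Joint integrability allows only steps shorter than \<open>r\<close>; a long
      translation is cut into \<open>n\<close> of them.\<close>
    have line: "z + t *\<^sub>R e \<in> T" if z: "z \<in> T" for z t
    proof -
      obtain n where n: "\<bar>t\<bar> < real n * r" using r(1) ex_less_of_nat_mult by blast
      have n0: "0 < n" using n by (cases n) auto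
      have "z + (real k * (t / n)) *\<^sub>R e \<in> T" for k
      proof (induction k)
        case (Suc k)
        have "\<bar>t / n\<bar> < r" using n n0 by (simp add: field_simps)
        from step[OF Suc this] show ?case by (simp add: algebra_simps add_divide_distrib)
      qed (use z in simp)
      from this[of n] show ?thesis using n0 by simp
    qed
    have per: "z + n \<in> T" if z: "z \<in> T" and n: "ivec n" for z n
    proof -
      obtain m where m: "ivec m" "\<And>x. K (x + n) = K x + m" using int_equivariantD[OF K_eq n] by blast
      have "K (z + n + w) = K (z + w) + m" using m(2)[of "z + w"] by (simp add: add_ac)
      then show ?thesis using z exp_close_translate[OF Fi_eq m(1)] by (simp add: T_def m(2))
    qed
    have z0T: "z0 \<in> T" using z0 by (simp add: T_def)
    have "z \<in> closure T"
      unfolding closure_approachable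
    proof (intro allI impI)
      fix \<epsilon> :: real assume "0 < \<epsilon>"
      then obtain n t where n: "ivec n" "norm ((z - z0) - (n + t *\<^sub>R e)) < \<epsilon>" using lattice_plus_line_dense by blast
      have "z0 + n + t *\<^sub>R e \<in> T" using line[OF per[OF z0T n(1)]] .
      moreover have "dist (z0 + n + t *\<^sub>R e) z < \<epsilon>"
        using n(2) by (simp add: dist_norm norm_minus_commute algebra_simps)
      ultimately show "\<exists>y\<in>T. dist y z < \<epsilon>" by blast
    qed
    then show "exp_close Fi \<rho> (K z) (K (z + w))" using cl by (simp add: T_def)
  qed
qed

text \<open>Demanding the relation at every base point makes this a group at once; by
  \<open>leaf_translation\<close>, a small displacement belongs to it as soon as the relation holds
  at a single base point.\<close>

definition leaf_group :: "(real^3) set" where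
  "leaf_group = {w. \<forall>z. exp_close Fi \<rho> (K z) (K (z + w))}"

lemma leaf_groupD: "w \<in> leaf_group \<Longrightarrow> exp_close Fi \<rho> (K z) (K (z + w))"
  by (simp add: leaf_group_def)

lemma leaf_group_plane: "w \<in> leaf_group \<Longrightarrow> \<phi> \<bullet> w = 0"
  using unstable_in_plane[OF leaf_groupD[of w 0]] by (simp add: HK)

lemma leaf_group_0: "0 \<in> leaf_group"
  by (simp add: leaf_group_def exp_close_refl)

lemma leaf_group_add:
  assumes "v \<in> leaf_group" "w \<in> leaf_group"
  shows "v + w \<in> leaf_group"
proof -
  have "exp_close Fi \<rho> (K z) (K (z + v + w))" for z
    by (rule exp_close_trans[OF leaf_groupD[OF assms(1)] leaf_groupD[OF assms(2)]])
  then show ?thesis by (simp add: leaf_group_def add.assoc)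
qed

lemma leaf_group_minus: "w \<in> leaf_group \<Longrightarrow> - w \<in> leaf_group"
  unfolding leaf_group_def
proof (intro CollectI allI)
  fix z assume "w \<in> {w. \<forall>z. exp_close Fi \<rho> (K z) (K (z + w))}"
  then have "exp_close Fi \<rho> (K (z - w)) (K (z - w + w))" by blast
  then show "exp_close Fi \<rho> (K z) (K (z + - w))" using exp_close_sym by simp
qed

lemma leaf_group_nat: "w \<in> leaf_group \<Longrightarrow> real n *\<^sub>R w \<in> leaf_group"
  by (induction n) (auto simp: leaf_group_0 leaf_group_add scaleR_add_left)

lemma leaf_group_int:
  assumes "w \<in> leaf_group"
  shows "of_int n *\<^sub>R w \<in> leaf_group"
proof (cases "0 \<le> n")
  case True
  then show ?thesis using leaf_group_nat[OF assms, of "nat n"] by simp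
next
  case False
  then show ?thesis using leaf_group_minus[OF leaf_group_nat[OF assms, of "nat (- n)"]] by simp
qed

lemma leaf_group_M:
  assumes "w \<in> leaf_group"
  shows "M w \<in> leaf_group"
  unfolding leaf_group_def
proof (intro CollectI allI)
  fix z
  have FK: "Fi (K x) = K (Mi x)" for x using HFi[of "K x"] KH[of "Fi (K x)"] by (simp add: HK)
  have "exp_close Fi \<rho> (K (Mi z)) (K (Mi z + w))" using assms by (simp add: leaf_group_def)
  then have "exp_close Fi \<rho> (Fi (K z)) (Fi (K (z + M w)))" by (simp add: FK MiM linear_add[OF Mi_lin])
  then show "exp_close Fi \<rho> (K z) (K (z + M w))" by (rule exp_close_unmap) (rule contracting_lineD(2)[OF U])
qed

text \<open>Limits are taken only within small elements, where the rate constant is uniform; longer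
  elements are obtained afterwards as multiples.\<close>

lemma leaf_group_closed:
  "\<exists>\<delta>>0. \<forall>f w. (\<forall>k. f k \<in> leaf_group \<and> norm (f k) < \<delta>) \<longrightarrow> f \<longlonglongrightarrow> w \<longrightarrow> w \<in> leaf_group"
proof -
  obtain \<delta> C where \<delta>: "0 < \<delta>" "\<And>x y n. exp_close Fi \<rho> x y \<Longrightarrow> norm (H x - H y) < \<delta> \<Longrightarrow> norm ((Fi ^^ n) x - (Fi ^^ n) y) \<le> C * \<rho> ^ n"
    using uniform_rate[OF U unstable_close] by blast
  have "w \<in> leaf_group" if f: "\<And>k. f k \<in> leaf_group \<and> norm (f k) < \<delta>" "f \<longlonglongrightarrow> w" for f :: "nat \<Rightarrow> real^3" and w
    unfolding leaf_group_def exp_close_def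
  proof (intro CollectI allI exI[of _ C])
    fix z n
    have "isCont (\<lambda>v. (Fi ^^ n) (K (z + v))) w"
    proof -
      have "continuous_on UNIV (\<lambda>v. (Fi ^^ n) (K (z + v)))"
        by (intro continuous_on_compose2[OF Fi_pow_cont] continuous_on_compose2[OF K_cont] continuous_intros) auto
      then show ?thesis by (simp add: continuous_on_eq_continuous_at)
    qed
    then have "(\<lambda>k. (Fi ^^ n) (K (z + f k))) \<longlonglongrightarrow> (Fi ^^ n) (K (z + w))"
      using f(2) by (rule isCont_tendsto_compose)
    then have "(\<lambda>k. norm ((Fi ^^ n) (K z) - (Fi ^^ n) (K (z + f k)))) \<longlonglongrightarrow> norm ((Fi ^^ n) (K z) - (Fi ^^ n) (K (z + w)))"
      by (intro tendsto_intros)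
    moreover have "norm ((Fi ^^ n) (K z) - (Fi ^^ n) (K (z + f k))) \<le> C * \<rho> ^ n" for k
      using f(1)[of k] \<delta>(2)[of "K z" "K (z + f k)" n] by (simp add: leaf_group_def HK)
    ultimately show "norm ((Fi ^^ n) (K z) - (Fi ^^ n) (K (z + w))) \<le> C * \<rho> ^ n"
      by (meson LIMSEQ_le_const2)
  qed
  then show ?thesis using \<delta>(1) by blast
qed

text \<open>The end of a short unstable curve through \<open>K 0\<close> differs from its centre, so
  its image under \<open>H\<close> is nonzero, and small by continuity.\<close>

lemma leaf_group_small:
  assumes "0 < \<epsilon>"
  shows "\<exists>w\<in>leaf_group. w \<noteq> 0 \<and> norm w < \<epsilon>"
proof -
  obtain \<delta> where \<delta>: "\<delta> > 0" "\<And>z0 w z. norm w < \<delta> \<Longrightarrow> exp_close Fi \<rho> (K z0) (K (z0 + w)) \<Longrightarrow> exp_close Fi \<rho> (K z) (K (z + w))"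
    using leaf_translation by blast
  obtain \<psi> where ch: "plaque_chart \<psi> pu" and p0: "K 0 \<in> \<psi> ` chart_dom" using charts by blast
  obtain d where d: "d > 0" "\<And>x y. norm (x - y) < d \<Longrightarrow> norm (H x - H y) < min \<epsilon> \<delta>" using H_unif[of "min \<epsilon> \<delta>"] assms \<delta>(1) by auto
  obtain w r \<delta>' where w: "norm w = 1" and r: "0 < r" "0 < \<delta>'" "ball (K 0) r \<subseteq> \<psi> ` chart_dom"
    and ex: "\<forall>y\<in>ball (K 0) r. \<exists>c. c 0 = y \<and> continuous_on {-r..r} c \<and>
     (\<forall>a\<in>{-r..r}. c a \<in> ball (K 0) d \<and> c a \<in> \<psi> ` chart_dom \<and> snd (chart_inv \<psi> (c a)) = snd (chart_inv \<psi> y)) \<and>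
     (\<forall>a\<in>{-r..r}. \<forall>b\<in>{-r..r}. exp_close Fi \<rho> (c a) (c b)) \<and>
     (\<forall>a b. -r \<le> a \<longrightarrow> a \<le> b \<longrightarrow> b \<le> r \<longrightarrow> (b - a) / 2 \<le> (c b - c a) \<bullet> w) \<and>
     (\<forall>z\<in>ball (K 0) \<delta>'. norm (z - y) < \<delta>' \<longrightarrow> exp_close Fi \<rho> y z \<longrightarrow> (\<exists>a\<in>{-r..r}. c a = z))"
    using unstable_curve[OF ch p0 d(1)] by (elim exE conjE) (rule that)
  have "K 0 \<in> ball (K 0) r" using r by simp
  from bspec[OF ex this] obtain c where cc: "c 0 = K 0" "continuous_on {-r..r} c"
     "\<forall>a\<in>{-r..r}. c a \<in> ball (K 0) d \<and> c a \<in> \<psi> ` chart_dom \<and> snd (chart_inv \<psi> (c a)) = snd (chart_inv \<psi> (K 0))"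
     "\<forall>a\<in>{-r..r}. \<forall>b\<in>{-r..r}. exp_close Fi \<rho> (c a) (c b)"
     "\<forall>a b. -r \<le> a \<longrightarrow> a \<le> b \<longrightarrow> b \<le> r \<longrightarrow> (b - a) / 2 \<le> (c b - c a) \<bullet> w"
     "\<forall>z\<in>ball (K 0) \<delta>'. norm (z - K 0) < \<delta>' \<longrightarrow> exp_close Fi \<rho> (K 0) z \<longrightarrow> (\<exists>a\<in>{-r..r}. c a = z)"
    by (elim exE conjE) (rule that)
  have c: "c 0 = K 0" "\<And>a. a \<in> {-r..r} \<Longrightarrow> c a \<in> ball (K 0) d"
     "\<And>a b. a \<in> {-r..r} \<Longrightarrow> b \<in> {-r..r} \<Longrightarrow> exp_close Fi \<rho> (c a) (c b)"
     "\<And>a b. -r \<le> a \<Longrightarrow> a \<le> b \<Longrightarrow> b \<le> r \<Longrightarrow> (b - a) / 2 \<le> (c b - c a) \<bullet> w"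
    using cc by blast+
  define v where "v = H (c r)"
  have rr: "r \<in> {-r..r}" "0 \<in> {-r..r}" using r by auto
  have "norm (c r - K 0) < d" using c(2)[OF rr(1)] by (simp add: dist_norm norm_minus_commute)
  then have v: "norm v < min \<epsilon> \<delta>" using d(2)[of "c r" "K 0"] by (simp add: v_def HK)
  have "exp_close Fi \<rho> (K 0) (K (0 + v))" using c(3)[OF rr(2,1)] by (simp add: v_def KH c(1))
  moreover have "norm v < \<delta>" using v by simp
  ultimately have "v \<in> leaf_group" using \<delta>(2)[of v 0] unfolding leaf_group_def by blast
  moreover have "v \<noteq> 0"
  proof
    assume "v = 0"
    then have "c r = c 0" using KH[of "c r"] c(1) by (simp add: v_def)
    then show False using c(4)[of 0 r] r by simp
  qed
  ultimately show ?thesis using v by auto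
qed

text \<open>A nondiscrete closed subgroup contains a line.\<close>

lemma leaf_group_contains_line: "\<exists>\<omega>. norm \<omega> = 1 \<and> (\<forall>t. t *\<^sub>R \<omega> \<in> leaf_group)"
proof -
  obtain \<delta> where \<delta>: "\<delta> > 0" "\<And>f w. (\<And>k. f k \<in> leaf_group \<and> norm (f k) < \<delta>) \<Longrightarrow> f \<longlonglongrightarrow> w \<Longrightarrow> w \<in> leaf_group"
    using leaf_group_closed by blast
  have "\<forall>k. \<exists>w\<in>leaf_group. w \<noteq> 0 \<and> norm w < (\<delta> / 2) * inverse (real (Suc k))"
  proof
    fix k
    have "0 < (\<delta> / 2) * inverse (real (Suc k))" using \<delta>(1) by (intro mult_pos_pos) auto
    then show "\<exists>w\<in>leaf_group. w \<noteq> 0 \<and> norm w < (\<delta> / 2) * inverse (real (Suc k))" by (rule leaf_group_small)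
  qed
  then obtain w where w: "\<And>k. w k \<in> leaf_group" "\<And>k. w k \<noteq> 0" "\<And>k. norm (w k) < (\<delta> / 2) * inverse (real (Suc k))" by metis
  have "(\<lambda>k. (\<delta> / 2) * inverse (real (Suc k))) \<longlonglongrightarrow> (\<delta> / 2) * 0" by (intro tendsto_intros LIMSEQ_inverse_real_of_nat)
  then have lim0: "(\<lambda>k. (\<delta> / 2) * inverse (real (Suc k))) \<longlonglongrightarrow> 0" by (simp only: mult_zero_right)
  have "norm (norm (w k)) \<le> (\<delta> / 2) * inverse (real (Suc k))" for k
    using less_imp_le[OF w(3)[of k]] by (simp only: real_norm_def abs_norm_cancel)
  then have w0: "(\<lambda>k. norm (w k)) \<longlonglongrightarrow> 0"
    by (intro Lim_null_comparison[OF always_eventually lim0] allI)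
  define d where "d k = w k /\<^sub>R norm (w k)" for k
  have dS: "d k \<in> sphere 0 1" for k using w(2)[of k] by (simp add: d_def)
  then obtain \<omega> \<kappa>' where \<omega>: "\<omega> \<in> sphere 0 1" "strict_mono (\<kappa>'::nat\<Rightarrow>nat)" "(d \<circ> \<kappa>') \<longlonglongrightarrow> \<omega>"
    using compact_sphere[of "0::real^3" 1] unfolding compact_def by blast
  have small: "t *\<^sub>R \<omega> \<in> leaf_group" if t: "\<bar>t\<bar> < \<delta> / 2" for t
  proof -
    \<comment> \<open>Integer multiples of short elements, with the coefficient rounded down: the
      length then misses \<open>t\<close> by at most the length of one such element.\<close>
    define m where "m k = \<lfloor>t / norm (w (\<kappa>' k))\<rfloor>" for k
    define f where "f k = of_int (m k) *\<^sub>R w (\<kappa>' k)" for k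
    have nw: "0 < norm (w (\<kappa>' k))" for k using w(2) by simp
    have fd: "f k = (of_int (m k) * norm (w (\<kappa>' k))) *\<^sub>R d (\<kappa>' k)" for k using nw[of k] by (simp add: f_def d_def)
    have mt: "\<bar>of_int (m k) * norm (w (\<kappa>' k)) - t\<bar> \<le> norm (w (\<kappa>' k))" for k
    proof -
      have "of_int (m k) \<le> t / norm (w (\<kappa>' k))" "t / norm (w (\<kappa>' k)) < of_int (m k) + 1" unfolding m_def by linarith+
      then have "of_int (m k) * norm (w (\<kappa>' k)) \<le> t" "t < (of_int (m k) + 1) * norm (w (\<kappa>' k))"
        using nw[of k] by (simp_all add: pos_le_divide_eq pos_divide_less_eq)
      then show ?thesis by (simp add: algebra_simps abs_le_iff)
    qed
    have w0': "(\<lambda>k. norm (w (\<kappa>' k))) \<longlonglongrightarrow> 0" using LIMSEQ_subseq_LIMSEQ[OF w0 \<omega>(2)] by (simp add: o_def)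
    have "(\<lambda>k. of_int (m k) * norm (w (\<kappa>' k)) - t) \<longlonglongrightarrow> 0"
      by (rule Lim_null_comparison[OF _ w0']) (use mt in auto)
    then have "(\<lambda>k. of_int (m k) * norm (w (\<kappa>' k))) \<longlonglongrightarrow> t" by (simp add: LIM_zero_iff)
    moreover have "(\<lambda>k. d (\<kappa>' k)) \<longlonglongrightarrow> \<omega>" using \<omega>(3) by (simp add: o_def)
    ultimately have lim: "f \<longlonglongrightarrow> t *\<^sub>R \<omega>" unfolding fd by (intro tendsto_intros)
    have "norm (f k) < \<delta>" for k
    proof -
      have "norm (f k) = \<bar>of_int (m k) * norm (w (\<kappa>' k))\<bar>" using dS[of "\<kappa>' k"] by (simp add: fd)
      also have "\<dots> \<le> \<bar>t\<bar> + norm (w (\<kappa>' k))" using mt[of k] by linarith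
      also have "norm (w (\<kappa>' k)) < \<delta> / 2 * inverse (real (Suc (\<kappa>' k)))" by (rule w(3))
      also have "\<delta> / 2 * inverse (real (Suc (\<kappa>' k))) \<le> \<delta> / 2 * 1"
        using \<delta>(1) by (intro mult_left_mono) (auto simp: inverse_le_1_iff)
      finally show ?thesis using t by simp
    qed
    moreover have "f k \<in> leaf_group" for k unfolding f_def by (rule leaf_group_int[OF w(1)])
    ultimately show ?thesis using \<delta>(2)[of f] lim by blast
  qed
  have "t *\<^sub>R \<omega> \<in> leaf_group" for t
  proof -
    obtain n where n: "\<bar>t\<bar> < real n * (\<delta> / 2)" using \<delta>(1) ex_less_of_nat_mult[of "\<delta> / 2"] by auto
    have n0: "0 < n" using n by (cases n) auto
    have "\<bar>t / n\<bar> < \<delta> / 2" using n n0 by (simp add: field_simps)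
    from leaf_group_nat[OF small[OF this], of n] show ?thesis using n0 by simp
  qed
  then show ?thesis using \<omega>(1) by (intro exI[of _ \<omega>]) auto
qed

text \<open>The line already realises every small value of the coordinate along \<open>u\<close>,
  and by transversality this coordinate determines a small element. So no small element lies off the
  line.\<close>

lemma leaf_group_small_on_line:
  assumes \<omega>: "norm \<omega> = 1" "\<And>t. t *\<^sub>R \<omega> \<in> leaf_group"
  shows "\<exists>\<delta>>0. \<forall>w\<in>leaf_group. norm w < \<delta> \<longrightarrow> (\<exists>t. w = t *\<^sub>R \<omega>)"
proof -
  define p0 where "p0 = K 0"
  obtain u where u: "norm u = 1" "pu p0 u = u" "\<And>v. \<exists>t. pu p0 v = t *\<^sub>R u"
    using line_proj_unit[OF contracting_lineD(5)[OF U]] by blast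
  obtain r where r: "r > 0" "\<And>x y. x \<in> ball p0 r \<Longrightarrow> y \<in> ball p0 r \<Longrightarrow> exp_close Fi \<rho> x y \<Longrightarrow> norm (y - x) / 2 \<le> \<bar>(y - x) \<bullet> u\<bar>"
    using unstable_transverse[OF u] by blast
  obtain d where d: "d > 0" "\<And>x y. norm (x - y) < d \<Longrightarrow> norm (K x - K y) < r" using K_unif[OF r(1)] by blast
  have inb: "K v \<in> ball p0 r" if "norm v < d" for v
    using d(2)[of 0 v] that by (simp add: p0_def dist_norm)
  have as: "exp_close Fi \<rho> (K v) (K w)" if "v \<in> leaf_group" "w \<in> leaf_group" for v w
  proof -
    have "exp_close Fi \<rho> (K 0) (K (0 + v))" "exp_close Fi \<rho> (K 0) (K (0 + w))" using that leaf_groupD by blast+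
    then show ?thesis using exp_close_trans[OF exp_close_sym] by simp
  qed
  define \<tau> where "\<tau> = d / 2"
  have \<tau>: "0 < \<tau>" "\<tau> < d" using d by (auto simp: \<tau>_def)
  define f where "f t = (K (t *\<^sub>R \<omega>) - p0) \<bullet> u" for t
  have fc: "continuous_on {-\<tau>..\<tau>} f" unfolding f_def
    by (intro continuous_intros continuous_on_compose2[OF K_cont]) auto
  have key: "v = w" if vw: "v \<in> leaf_group" "w \<in> leaf_group" "norm v < d" "norm w < d" "(K v - p0) \<bullet> u = (K w - p0) \<bullet> u" for v w
  proof -
    have "(K w - K v) \<bullet> u = 0" using vw(5) by (simp add: inner_diff_left)
    then have "norm (K w - K v) \<le> 0" using r(2)[OF inb[OF vw(3)] inb[OF vw(4)] as[OF vw(1,2)]] by simp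
    then show ?thesis using HK[of v] HK[of w] by simp
  qed
  have fi: "inj_on f {-\<tau>..\<tau>}"
  proof (rule inj_onI)
    fix a b assume ab: "a \<in> {-\<tau>..\<tau>}" "b \<in> {-\<tau>..\<tau>}" "f a = f b"
    have "a *\<^sub>R \<omega> = b *\<^sub>R \<omega>"
      by (rule key) (use ab \<omega> \<tau> in \<open>auto simp: f_def\<close>)
    then show "a = b" using \<omega>(1) by auto
  qed
  have f0: "f 0 = 0" by (simp add: f_def p0_def)
  have sgn: "(f (- \<tau>) < 0 \<and> 0 < f \<tau>) \<or> (f \<tau> < 0 \<and> 0 < f (- \<tau>))"
    using continuous_inj_imp_mono[of "-\<tau>" 0 \<tau> f] fc fi \<tau>(1) f0 by auto
  define m where "m = min \<bar>f \<tau>\<bar> \<bar>f (- \<tau>)\<bar>"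
  have m: "0 < m" using sgn by (auto simp: m_def)
  have cov: "\<exists>t\<in>{-\<tau>..\<tau>}. f t = s" if s: "\<bar>s\<bar> < m" for s
    using sgn
  proof
    assume a: "f (- \<tau>) < 0 \<and> 0 < f \<tau>"
    then have "f (- \<tau>) \<le> s" "s \<le> f \<tau>" using s by (auto simp: m_def)
    then show ?thesis using IVT'[of f "-\<tau>" s \<tau>] fc \<tau>(1) by auto
  next
    assume a: "f \<tau> < 0 \<and> 0 < f (- \<tau>)"
    then have "f \<tau> \<le> s" "s \<le> f (- \<tau>)" using s by (auto simp: m_def)
    then show ?thesis using IVT2'[of f \<tau> s "-\<tau>"] fc \<tau>(1) by auto
  qed
  obtain d' where d': "d' > 0" "\<And>x y. norm (x - y) < d' \<Longrightarrow> norm (K x - K y) < m" using K_unif[OF m] by blast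
  show ?thesis
  proof (rule exI[of _ "min d d'"], intro conjI ballI impI)
    show "0 < min d d'" using d d' by simp
    fix w assume w: "w \<in> leaf_group" "norm w < min d d'"
    have "norm (K w - p0) < m" using d'(2)[of w 0] w by (simp add: p0_def)
    then have "\<bar>(K w - p0) \<bullet> u\<bar> < m" using Cauchy_Schwarz_ineq2[of "K w - p0" u] u(1) by simp
    then obtain t where t: "t \<in> {-\<tau>..\<tau>}" "f t = (K w - p0) \<bullet> u" using cov by blast
    have "w = t *\<^sub>R \<omega>"
      by (rule key) (use w \<omega> t \<tau> in \<open>auto simp: f_def\<close>)
    then show "\<exists>t. w = t *\<^sub>R \<omega>" by blast
  qed
qed

section \<open>Eigenvalues compared with contraction rates\<close>

text \<open>Cut the segment from 0 to \<open>\<theta> ^ n\<close> times \<open>v\<close> into about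
  \<open>\<bar>\<theta>\<bar> ^ n / b\<close> pieces; \<open>n\<close> iterations of
  \<open>G\<close> bring the ends of each within \<open>C * \<tau> ^ n\<close>. The sum bounds the
  fixed distance between \<open>K 0\<close> and \<open>K v\<close>, so
  \<open>\<bar>\<theta>\<bar> * \<tau>\<close> cannot be below 1.\<close>

lemma rate_along_line:
  assumes p: "contracting_line G B \<tau> p"
    and close: "\<And>\<epsilon>. 0 < \<epsilon> \<Longrightarrow> \<exists>\<delta>>0. \<forall>x y. exp_close G \<tau> x y \<longrightarrow> norm (H x - H y) < \<delta> \<longrightarrow> (\<forall>n. norm ((G ^^ n) x - (G ^^ n) y) \<le> \<epsilon>)"
    and leaf: "\<And>z t. exp_close G \<tau> (K z) (K (z + t *\<^sub>R v))" and "v \<noteq> 0"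
    and orb: "\<And>n. (G ^^ n) (K 0) = K 0" "\<And>n. (G ^^ n) (K (\<theta> ^ n *\<^sub>R v)) = K v"
  shows "1 \<le> \<bar>\<theta>\<bar> * \<tau>"
proof (rule ccontr)
  assume neg: "\<not> 1 \<le> \<bar>\<theta>\<bar> * \<tau>"
  note P = contracting_lineD[OF p]
  obtain \<delta> C where \<delta>: "0 < \<delta>" "0 \<le> C" "\<And>x y n. exp_close G \<tau> x y \<Longrightarrow> norm (H x - H y) < \<delta> \<Longrightarrow> norm ((G ^^ n) x - (G ^^ n) y) \<le> C * \<tau> ^ n"
    using uniform_rate[OF p close] by blast
  \<comment> \<open>Steps of this parameter length move the image by less than
    \<open>\<delta>\<close>, the range of the uniform rate.\<close>
  define b where "b = \<delta> / (2 * norm v)"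
  have b: "0 < b" "b * norm v < \<delta>" using \<delta>(1) \<open>v \<noteq> 0\<close> by (auto simp: b_def)
  have chain: "norm ((G ^^ n) (K 0) - (G ^^ n) (K (t *\<^sub>R v))) \<le> (\<bar>t\<bar> / b + 1) * (C * \<tau> ^ n)" for t n
  proof -
    define N where "N = nat \<lceil>\<bar>t\<bar> / b\<rceil>"
    have N: "\<bar>t\<bar> / b \<le> real N" "real N \<le> \<bar>t\<bar> / b + 1" using b by (auto simp: N_def)
    have step: "norm ((G ^^ n) (K 0) - (G ^^ n) (K ((real k * (t / N)) *\<^sub>R v))) \<le> real k * (C * \<tau> ^ n)" for k
    proof (induction k)
      case (Suc k)
      let ?z = "(real k * (t / N)) *\<^sub>R v"
      have e: "(real (Suc k) * (t / N)) *\<^sub>R v = ?z + (t / N) *\<^sub>R v" by (simp add: algebra_simps add_divide_distrib)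
      have "\<bar>t / N\<bar> \<le> b"
      proof (cases "N = 0")
        case False
        then show ?thesis using N(1) b(1) by (simp add: field_simps)
      qed (use b in simp)
      then have "\<bar>t / N\<bar> * norm v \<le> b * norm v" by (intro mult_right_mono) auto
      then have "norm (H (K ?z) - H (K (?z + (t / N) *\<^sub>R v))) < \<delta>" using b(2) by (simp add: HK)
      from \<delta>(3)[OF leaf this] have "norm ((G ^^ n) (K ?z) - (G ^^ n) (K (?z + (t / N) *\<^sub>R v))) \<le> C * \<tau> ^ n" .
      then have "norm ((G ^^ n) (K 0) - (G ^^ n) (K (?z + (t / N) *\<^sub>R v))) \<le> real k * (C * \<tau> ^ n) + C * \<tau> ^ n"
        using Suc norm_triangle_ineq[of "(G ^^ n) (K 0) - (G ^^ n) (K ?z)" "(G ^^ n) (K ?z) - (G ^^ n) (K (?z + (t / N) *\<^sub>R v))"] by simp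
      then show ?case unfolding e by (simp add: algebra_simps)
    qed simp
    have "(real N * (t / N)) *\<^sub>R v = t *\<^sub>R v"
    proof (cases "N = 0")
      case True
      then have "\<bar>t\<bar> / b \<le> 0" using N(1) by simp
      then have "t = 0" using b(1) by (simp add: divide_le_0_iff)
      then show ?thesis by simp
    qed simp
    then have "norm ((G ^^ n) (K 0) - (G ^^ n) (K (t *\<^sub>R v))) \<le> real N * (C * \<tau> ^ n)" using step[of N] by (simp only:)
    also have "\<dots> \<le> (\<bar>t\<bar> / b + 1) * (C * \<tau> ^ n)" using N(2) \<delta>(2) P(2) by (intro mult_right_mono) auto
    finally show ?thesis .
  qed
  have le: "norm (K 0 - K v) \<le> (C / b) * (\<bar>\<theta>\<bar> * \<tau>) ^ n + C * \<tau> ^ n" for n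
    using chain[of n "\<theta> ^ n"] unfolding orb by (simp add: power_mult_distrib power_abs algebra_simps)
  have "(\<lambda>n. (C / b) * (\<bar>\<theta>\<bar> * \<tau>) ^ n + C * \<tau> ^ n) \<longlonglongrightarrow> (C / b) * 0 + C * 0"
    using neg P(2,3) by (intro tendsto_intros LIMSEQ_power_zero) (auto simp: abs_mult)
  then have "norm (K 0 - K v) \<le> (C / b) * 0 + C * 0" using le by (meson LIMSEQ_le_const)
  then have "K 0 = K v" by simp
  then show False using HK[of 0] HK[of v] \<open>v \<noteq> 0\<close> by simp
qed

text \<open>Plaques provide short segments around every point, so the class is locally constant
  along the line, which is connected.\<close>

lemma stable_leaf_full: "exp_close F \<sigma> (K z) (K (z + t *\<^sub>R e))"
proof -
  have "exp_close F \<sigma> (K (z + 0 *\<^sub>R e)) (K (z + t *\<^sub>R e))"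
  proof (rule connected_equivalence_relation[of UNIV 0 t "\<lambda>a b. exp_close F \<sigma> (K (z + a *\<^sub>R e)) (K (z + b *\<^sub>R e))"])
    fix a :: real
    let ?q = "K (z + a *\<^sub>R e)"
    obtain \<psi> where ch: "plaque_chart \<psi> ps" and q: "?q \<in> \<psi> ` chart_dom" using charts by blast
    obtain r \<delta> where r: "0 < r" "0 < \<delta>" and seg: "\<And>y t. y \<in> ball ?q r \<Longrightarrow> \<bar>t\<bar> \<le> \<delta> \<Longrightarrow> exp_close F \<sigma> y (K (H y + t *\<^sub>R e))"
      using stable_segment_in_plaque[OF ch q] by blast
    have "exp_close F \<sigma> ?q (K (z + b *\<^sub>R e))" if "b \<in> ball a \<delta>" for b
    proof -
      have "z + b *\<^sub>R e = H ?q + (b - a) *\<^sub>R e" by (simp add: HK algebra_simps)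
      then show ?thesis using seg[of ?q "b - a"] r(1) that by (simp add: dist_real_def abs_minus_commute)
    qed
    then show "\<exists>T. openin (top_of_set UNIV) T \<and> a \<in> T \<and> (\<forall>x\<in>T. exp_close F \<sigma> ?q (K (z + x *\<^sub>R e)))"
      using r(2) by (intro exI[of _ "ball a \<delta>"]) auto
  qed (auto intro: exp_close_sym exp_close_trans connected_UNIV)
  then show ?thesis by simp
qed

theorem us_conj_main:
  "\<exists>\<omega> \<theta>. \<omega> \<noteq> 0 \<and> \<phi> \<bullet> \<omega> = 0 \<and> M \<omega> = \<theta> *\<^sub>R \<omega> \<and> 1 / \<rho> \<le> \<bar>\<theta>\<bar> \<and> \<bar>\<kappa>\<bar> \<le> \<sigma> \<and>
    (\<forall>x y. exp_close F \<sigma> x y \<longrightarrow> (\<exists>t. H x - H y = t *\<^sub>R e)) \<and>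
    (\<forall>x y. exp_close Fi \<rho> x y \<longrightarrow> (\<exists>t. H x - H y = t *\<^sub>R \<omega>)) \<and>
    (\<forall>\<psi> t u1 u2. plaque_chart \<psi> ps \<longrightarrow> plaque_chart \<psi> pu \<longrightarrow> t \<in> ball 0 1 \<longrightarrow> u1 \<in> ball 0 1 \<longrightarrow> u2 \<in> ball 0 1 \<longrightarrow>
       (\<exists>a b. H (\<psi> (u1, t)) - H (\<psi> (u2, t)) = a *\<^sub>R e + b *\<^sub>R \<omega>))"
proof -
  obtain \<omega> where \<omega>: "norm \<omega> = 1" "\<And>t. t *\<^sub>R \<omega> \<in> leaf_group" using leaf_group_contains_line by blast
  have \<omega>0: "\<omega> \<noteq> 0" using \<omega>(1) by auto
  have \<omega>G: "\<omega> \<in> leaf_group" using \<omega>(2)[of 1] by simp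
  obtain \<delta>1 where \<delta>1: "\<delta>1 > 0" "\<And>w. w \<in> leaf_group \<Longrightarrow> norm w < \<delta>1 \<Longrightarrow> \<exists>t. w = t *\<^sub>R \<omega>"
    using leaf_group_small_on_line[OF \<omega>] by blast
  obtain \<delta>2 where \<delta>2: "\<delta>2 > 0" "\<And>z0 w z. norm w < \<delta>2 \<Longrightarrow> exp_close Fi \<rho> (K z0) (K (z0 + w)) \<Longrightarrow> exp_close Fi \<rho> (K z) (K (z + w))"
    using leaf_translation by blast
  have "\<exists>\<theta>. M \<omega> = \<theta> *\<^sub>R \<omega>"
  proof -
    \<comment> \<open>\<open>M\<close> may lengthen \<open>\<omega>\<close>, so a multiple is taken
      whose image is still a small element of the group.\<close>
    define s where "s = \<delta>1 / (2 * (norm (M \<omega>) + 1))"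
    have s: "0 < s" "s * norm (M \<omega>) < \<delta>1"
    proof -
      have n: "0 < norm (M \<omega>) + 1" by (simp add: add_nonneg_pos)
      then show "0 < s" using \<delta>1(1) by (simp add: s_def)
      have "\<delta>1 * norm (M \<omega>) < \<delta>1 * (2 * (norm (M \<omega>) + 1))" 
        using \<delta>1(1) add_nonneg_pos[OF norm_ge_zero[of "M \<omega>"], of 2] by (intro mult_strict_left_mono) auto
      then show "s * norm (M \<omega>) < \<delta>1" using n by (simp add: s_def field_simps)
    qed
    have "M (s *\<^sub>R \<omega>) \<in> leaf_group" by (rule leaf_group_M[OF \<omega>(2)])
    moreover have "norm (M (s *\<^sub>R \<omega>)) < \<delta>1" using s by (simp add: linear_cmul[OF M_lin])
    ultimately obtain t where "M (s *\<^sub>R \<omega>) = t *\<^sub>R \<omega>" using \<delta>1(2) by blast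
    then have "(1 / s) *\<^sub>R (s *\<^sub>R M \<omega>) = (1 / s) *\<^sub>R (t *\<^sub>R \<omega>)" by (simp add: linear_cmul[OF M_lin])
    then have "M \<omega> = (t / s) *\<^sub>R \<omega>" using s(1) by simp
    then show ?thesis by blast
  qed
  then obtain \<theta> where \<theta>: "M \<omega> = \<theta> *\<^sub>R \<omega>" by blast
  have \<theta>0: "\<theta> \<noteq> 0"
  proof
    assume "\<theta> = 0"
    then have "Mi (M \<omega>) = 0" using \<theta> linear_0[OF Mi_lin] by simp
    then show False using MiM \<omega>0 by simp
  qed
  have \<theta>pow: "(M ^^ n) \<omega> = \<theta> ^ n *\<^sub>R \<omega>" for n
    by (induction n) (auto simp: \<theta> linear_cmul[OF M_lin] mult.commute)
  \<comment> \<open>Inverse iterates shorten the displacement until it is a small group element,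
    hence on the line; powers of \<open>M\<close>, which preserve the line, lead back.\<close>
  have unst: "\<exists>t. H x - H y = t *\<^sub>R \<omega>" if xy: "exp_close Fi \<rho> x y" for x y
  proof -
    define w where "w = H y - H x"
    have "\<phi> \<bullet> w = 0" using unstable_in_plane[OF exp_close_sym[OF xy]] by (simp add: w_def)
    then have "(\<lambda>n. (Mi ^^ n) w) \<longlonglongrightarrow> 0" by (rule Mi_plane_lim)
    then have "\<forall>\<^sub>F n in sequentially. dist ((Mi ^^ n) w) 0 < min \<delta>1 \<delta>2"
      using \<delta>1(1) \<delta>2(1) unfolding tendsto_iff by (metis min_less_iff_conj)
    then obtain n where n: "norm ((Mi ^^ n) w) < min \<delta>1 \<delta>2" by (auto simp: eventually_sequentially)
    have an: "exp_close Fi \<rho> ((Fi ^^ n) x) ((Fi ^^ n) y)"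
      by (induction n) (auto intro: exp_close_map xy)
    have Kx: "K ((Mi ^^ n) (H x)) = (Fi ^^ n) x" for x using HFi_pow[of n x] KH by metis
    have "(Mi ^^ n) (H x) + (Mi ^^ n) w = (Mi ^^ n) (H y)" by (simp add: w_def linear_diff[OF Mi_pow_lin])
    then have "exp_close Fi \<rho> (K ((Mi ^^ n) (H x))) (K ((Mi ^^ n) (H x) + (Mi ^^ n) w))" using an by (simp add: Kx)
    moreover have "norm ((Mi ^^ n) w) < \<delta>2" using n by simp
    ultimately have "(Mi ^^ n) w \<in> leaf_group" using \<delta>2(2)[of "(Mi ^^ n) w" "(Mi ^^ n) (H x)"] unfolding leaf_group_def by blast
    then obtain t where "(Mi ^^ n) w = t *\<^sub>R \<omega>" using \<delta>1(2) n by auto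
    then have "(M ^^ n) ((Mi ^^ n) w) = (t * \<theta> ^ n) *\<^sub>R \<omega>" by (simp add: linear_cmul[OF M_pow_lin] \<theta>pow)
    moreover have "(M ^^ n) ((Mi ^^ n) w) = w"
    proof -
      have "(M ^^ k) ((Mi ^^ k) v) = v" for k v
      proof (induction k arbitrary: v)
        case (Suc k)
        have "(M ^^ Suc k) ((Mi ^^ Suc k) v) = (M ^^ k) (M (Mi ((Mi ^^ k) v)))"
          by (simp only: funpow_Suc_right[of k M] funpow.simps(2)[of k Mi] o_apply)
        then show ?case using Suc by (simp add: MMi)
      qed simp
      then show ?thesis .
    qed
    ultimately have "H x - H y = (- (t * \<theta> ^ n)) *\<^sub>R \<omega>" by (simp add: w_def algebra_simps)
    then show ?thesis by blast
  qed
  \<comment> \<open>The linear map fixes 0, so the conjugate maps fix \<open>K 0\<close>, the base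
    point for the comparison of rates.\<close>
  have K0: "(Fi ^^ n) (K 0) = K 0" "(F ^^ n) (K 0) = K 0" for n
  proof -
    have "H ((Fi ^^ n) (K 0)) = H (K 0)" "H ((F ^^ n) (K 0)) = H (K 0)"
      by (simp_all add: HFi_pow HF_pow HK linear_0[OF Mi_pow_lin] linear_0[OF M_pow_lin])
    then show "(Fi ^^ n) (K 0) = K 0" "(F ^^ n) (K 0) = K 0" using H_inj by blast+
  qed
  have r1: "1 \<le> \<bar>\<theta>\<bar> * \<rho>"
  proof (rule rate_along_line[OF U unstable_close _ \<omega>0 K0(1)])
    show "exp_close Fi \<rho> (K z) (K (z + t *\<^sub>R \<omega>))" for z t using \<omega>(2)[of t] by (simp add: leaf_group_def)
    show "(Fi ^^ n) (K (\<theta> ^ n *\<^sub>R \<omega>)) = K \<omega>" for n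
    proof (rule H_inj)
      have "(Mi ^^ n) ((M ^^ n) \<omega>) = \<omega>" by (rule Mi_M_pow)
      then show "H ((Fi ^^ n) (K (\<theta> ^ n *\<^sub>R \<omega>))) = H (K \<omega>)" by (simp add: HFi_pow HK \<theta>pow)
    qed
  qed
  have r2: "1 \<le> \<bar>1 / \<kappa>\<bar> * \<sigma>"
  proof (rule rate_along_line[OF S stable_close _ e0 K0(2)])
    show "exp_close F \<sigma> (K z) (K (z + t *\<^sub>R e))" for z t by (rule stable_leaf_full)
    show "(F ^^ n) (K ((1 / \<kappa>) ^ n *\<^sub>R e)) = K e" for n
    proof (rule H_inj)
      show "H ((F ^^ n) (K ((1 / \<kappa>) ^ n *\<^sub>R e))) = H (K e)" using \<kappa>0
        by (simp add: HF_pow HK linear_cmul[OF M_pow_lin] Me_pow power_divide)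
    qed
  qed
  \<comment> \<open>Near a point of the plaque the displacement is one along \<open>e\<close> plus
    an unstable one, now known to lie along \<open>\<omega>\<close>; the plaque is
    connected.\<close>
  have plq: "\<exists>a b. H (\<psi> (u1, t)) - H (\<psi> (u2, t)) = a *\<^sub>R e + b *\<^sub>R \<omega>"
    if ch: "plaque_chart \<psi> ps" "plaque_chart \<psi> pu" and t: "t \<in> ball 0 1" and u: "u1 \<in> ball 0 1" "u2 \<in> ball 0 1" for \<psi> t u1 u2
  proof (rule connected_equivalence_relation[of "ball 0 1" u1 u2 "\<lambda>u1 u2. \<exists>a b. H (\<psi> (u1, t)) - H (\<psi> (u2, t)) = a *\<^sub>R e + b *\<^sub>R \<omega>"])
    fix u :: "real^2" assume u: "u \<in> ball 0 1"
    have inj: "inj_on \<psi> chart_dom" and cont: "continuous_on chart_dom \<psi>" using ch by (auto simp: plaque_chart_def)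
    have q: "\<psi> (u, t) \<in> \<psi> ` chart_dom" using u t by blast
    obtain W where W: "open W" "\<psi> (u, t) \<in> W" "\<And>z. z \<in> W \<Longrightarrow> snd (chart_inv \<psi> z) = snd (chart_inv \<psi> (\<psi> (u, t))) \<Longrightarrow>
      \<exists>y s. exp_close Fi \<rho> (\<psi> (u, t)) y \<and> H z - H y = s *\<^sub>R e" using local_product[OF ch q] by blast
    have c: "continuous_on (ball 0 1) (\<lambda>u. \<psi> (u, t))"
      by (rule continuous_on_compose2[OF cont]) (use t in \<open>auto intro!: continuous_intros\<close>)
    have "\<exists>a b. H (\<psi> (u, t)) - H (\<psi> (u', t)) = a *\<^sub>R e + b *\<^sub>R \<omega>" if u': "u' \<in> ball 0 1 \<inter> (\<lambda>u. \<psi> (u, t)) -` W" for u'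
    proof -
      have "(u', t) \<in> chart_dom" "(u, t) \<in> chart_dom" using u u' t by auto
      then obtain y s where y: "exp_close Fi \<rho> (\<psi> (u, t)) y" "H (\<psi> (u', t)) - H y = s *\<^sub>R e"
        using W(3)[of "\<psi> (u', t)"] u' inv_into_f_f[OF inj] by auto
      obtain b where b: "H (\<psi> (u, t)) - H y = b *\<^sub>R \<omega>" using unst[OF y(1)] by blast
      have "H (\<psi> (u, t)) - H (\<psi> (u', t)) = (- s) *\<^sub>R e + b *\<^sub>R \<omega>"
        using y(2) b by (simp add: algebra_simps)
      then show ?thesis by blast
    qed
    then show "\<exists>T. openin (top_of_set (ball 0 1)) T \<and> u \<in> T \<and>
        (\<forall>x\<in>T. \<exists>a b. H (\<psi> (u, t)) - H (\<psi> (x, t)) = a *\<^sub>R e + b *\<^sub>R \<omega>)"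
      using continuous_openin_preimage_gen[OF c W(1)] u W(2)
      by (intro exI[of _ "ball 0 1 \<inter> (\<lambda>u. \<psi> (u, t)) -` W"]) auto
  next
    fix x y assume "\<exists>a b. H (\<psi> (x, t)) - H (\<psi> (y, t)) = a *\<^sub>R e + b *\<^sub>R \<omega>"
    then obtain a b where "H (\<psi> (x, t)) - H (\<psi> (y, t)) = a *\<^sub>R e + b *\<^sub>R \<omega>" by blast
    then have "H (\<psi> (y, t)) - H (\<psi> (x, t)) = (- a) *\<^sub>R e + (- b) *\<^sub>R \<omega>" by (simp add: algebra_simps)
    then show "\<exists>a b. H (\<psi> (y, t)) - H (\<psi> (x, t)) = a *\<^sub>R e + b *\<^sub>R \<omega>" by blast
  next
    fix x y z assume "\<exists>a b. H (\<psi> (x, t)) - H (\<psi> (y, t)) = a *\<^sub>R e + b *\<^sub>R \<omega>"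
      "\<exists>a b. H (\<psi> (y, t)) - H (\<psi> (z, t)) = a *\<^sub>R e + b *\<^sub>R \<omega>"
    then obtain a b a' b' where "H (\<psi> (x, t)) - H (\<psi> (y, t)) = a *\<^sub>R e + b *\<^sub>R \<omega>"
      "H (\<psi> (y, t)) - H (\<psi> (z, t)) = a' *\<^sub>R e + b' *\<^sub>R \<omega>" by blast
    then have "H (\<psi> (x, t)) - H (\<psi> (z, t)) = (a + a') *\<^sub>R e + (b + b') *\<^sub>R \<omega>" by (simp add: algebra_simps)
    then show "\<exists>a b. H (\<psi> (x, t)) - H (\<psi> (z, t)) = a *\<^sub>R e + b *\<^sub>R \<omega>" by blast
  qed (use u in auto)
  have "1 / \<rho> \<le> \<bar>\<theta>\<bar>" using r1 contracting_lineD(2)[OF U] by (simp add: field_simps)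
  moreover have "\<bar>\<kappa>\<bar> \<le> \<sigma>" using r2 \<kappa>0 by (simp add: abs_divide field_simps)
  ultimately show ?thesis
    using \<omega>0 leaf_group_plane[OF \<omega>G] \<theta> stable_on_line unst plq
    by (intro exI[of _ \<omega>] exI[of _ \<theta>] conjI) (assumption | blast)+
qed

end

section \<open>Transfer to the torus\<close>

text \<open>The approximations are difference quotients along plaques with step \<open>h n\<close>:
  continuous because the chart and its inverse are, nonzero because the chart is injective,
  convergent because each plaque is differentiable.\<close>

lemma line_approx_of_fol1:
  assumes fol: "fol1 E W"
  shows "line_approx (\<lambda>x. E (tproj x))"
  unfolding line_approx_def
proof
  fix x :: "real^3"
  let ?B = "ball (0::real) 1 \<times> ball (0::real^2) 1"
  obtain \<psi> where ch: "fol_chart TYPE(real) TYPE(real^2) E W \<psi>" and x: "x \<in> \<psi> ` ?B"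
    using fol unfolding tangent_foliation_def by blast
  have inj: "inj_on \<psi> ?B" and cont: "continuous_on ?B \<psi>" and opn: "open (\<psi> ` ?B)"
    and icont: "continuous_on (\<psi> ` ?B) (inv_into ?B \<psi>)"
    and disc: "\<And>t. t \<in> ball 0 1 \<Longrightarrow> tangent_disc E (\<lambda>u. \<psi> (u, t))"
    using ch unfolding fol_chart_def Let_def by blast+
  let ?i = "inv_into ?B \<psi>"
  have ix: "?i x \<in> ?B" using x by (rule inv_into_into)
  then have "\<bar>fst (?i x)\<bar> < 1" by (auto simp: mem_Times_iff)
  then obtain s where s: "\<bar>fst (?i x)\<bar> < s" "s < 1" using dense by blast
  \<comment> \<open>The parameter is kept below \<open>s < 1\<close>, so that adding
    \<open>h n \<le> 1 - s\<close> does not leave the chart.\<close>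
  define W' where "W' = ?i -` (ball 0 s \<times> UNIV) \<inter> \<psi> ` ?B"
  have oW: "open W'" unfolding W'_def
    using continuous_on_open_vimage[OF opn, THEN iffD1, OF icont] by (simp add: open_Times)
  have xW: "x \<in> W'" using x s by (simp add: W'_def mem_Times_iff)
  have W'D: "y \<in> \<psi> ` ?B" "\<bar>fst (?i y)\<bar> < s" "snd (?i y) \<in> ball 0 1" "\<psi> (?i y) = y" "?i y \<in> ?B" if "y \<in> W'" for y
  proof -
    show y: "y \<in> \<psi> ` ?B" "\<bar>fst (?i y)\<bar> < s" using that by (auto simp: W'_def mem_Times_iff)
    show "?i y \<in> ?B" "\<psi> (?i y) = y" using inv_into_into[OF y(1)] f_inv_into_f[OF y(1)] by auto
    then show "snd (?i y) \<in> ball 0 1" by (auto simp: mem_Times_iff)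
  qed
  define h where "h n = (1 - s) * inverse (real (Suc n))" for n
  have h: "0 < h n" "h n \<le> 1 - s" for n
  proof -
    show "0 < h n" using s by (simp add: h_def)
    have "(1 - s) * inverse (real (Suc n)) \<le> (1 - s) * 1" using s by (intro mult_left_mono) (auto simp: inverse_le_1_iff)
    then show "h n \<le> 1 - s" by (simp add: h_def)
  qed
  have "h \<longlonglongrightarrow> (1 - s) * 0" unfolding h_def by (intro tendsto_intros LIMSEQ_inverse_real_of_nat)
  then have h0: "h \<longlonglongrightarrow> 0" by simp
  define d where "d n y = (1 / h n) *\<^sub>R (\<psi> (fst (?i y) + h n, snd (?i y)) - y)" for n y
  have inB: "(fst (?i y) + h n, snd (?i y)) \<in> ?B" if "y \<in> W'" for n y
  proof -
    have "\<bar>fst (?i y) + h n\<bar> < 1" using W'D(2)[OF that] h[of n] by linarith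
    then show ?thesis using W'D(3)[OF that] by simp
  qed
  have cd: "continuous_on W' (d n)" for n
    unfolding d_def
  proof -
    have ci: "continuous_on W' ?i" by (rule continuous_on_subset[OF icont]) (auto simp: W'_def)
    have cp: "continuous_on W' (\<lambda>y. (fst (?i y) + h n, snd (?i y)))" by (intro continuous_intros ci)
    have "continuous_on W' (\<lambda>y. \<psi> (fst (?i y) + h n, snd (?i y)))"
      by (rule continuous_on_compose2[OF cont cp]) (use inB in auto)
    then show "continuous_on W' (\<lambda>y. (1 / h n) *\<^sub>R (\<psi> (fst (?i y) + h n, snd (?i y)) - y))"
      by (intro continuous_intros)
  qed
  have nz: "d n y \<noteq> 0" if y: "y \<in> W'" for n y
  proof
    assume "d n y = 0"
    then have "\<psi> (fst (?i y) + h n, snd (?i y)) = \<psi> (?i y)" using h(1)[of n] W'D(4)[OF y] by (simp add: d_def)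
    then have "(fst (?i y) + h n, snd (?i y)) = ?i y" using inj inB[OF y] W'D(5)[OF y] by (meson inj_onD)
    then have "fst (?i y) + h n = fst (?i y)" by (metis fst_conv)
    then show False using h(1)[of n] by simp
  qed
  have "\<exists>D. (\<lambda>n. d n y) \<longlonglongrightarrow> D \<and> D \<in> E (tproj y) \<and> D \<noteq> 0" if y: "y \<in> W'" for y
  proof -
    define u where "u = fst (?i y)"
    define t where "t = snd (?i y)"
    have ub: "u \<in> ball 0 1" using W'D(5)[OF y] by (auto simp: u_def mem_Times_iff)
    have yut: "\<psi> (u, t) = y" using W'D(4)[OF y] by (simp add: u_def t_def)
    obtain g' where g': "\<And>u. u \<in> ball 0 1 \<Longrightarrow> ((\<lambda>u. \<psi> (u, t)) has_derivative blinfun_apply (g' u)) (at u)"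
      "\<And>u. u \<in> ball 0 1 \<Longrightarrow> inj (blinfun_apply (g' u)) \<and> range (blinfun_apply (g' u)) = E (tproj (\<psi> (u, t)))"
      using disc[OF W'D(3)[OF y]] unfolding tangent_disc_def t_def by blast
    let ?D = "blinfun_apply (g' u) 1"
    have "?D \<in> E (tproj y)" using g'(2)[OF ub] yut by auto
    moreover have "?D \<noteq> 0"
    proof
      assume "?D = 0"
      then have "blinfun_apply (g' u) 1 = blinfun_apply (g' u) 0" by (simp add: blinfun.zero_right)
      then have "(1::real) = 0" by (rule injD[OF conjunct1[OF g'(2)[OF ub]]])
      then show False by simp
    qed
    moreover have "(\<lambda>n. d n y) \<longlonglongrightarrow> ?D"
    proof -
      have "(\<lambda>k. norm (\<psi> (u + k, t) - \<psi> (u, t) - blinfun_apply (g' u) k) / norm k) \<midarrow>0\<rightarrow> 0"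
        using g'(1)[OF ub] unfolding has_derivative_at by blast
      moreover have "filterlim h (at 0) sequentially"
      proof (rule filterlim_atI[OF h0])
        show "\<forall>\<^sub>F n in sequentially. h n \<noteq> 0"
          using h(1) by (intro always_eventually allI) (metis less_irrefl)
      qed
      ultimately have l: "(\<lambda>n. norm (\<psi> (u + h n, t) - \<psi> (u, t) - blinfun_apply (g' u) (h n)) / norm (h n)) \<longlonglongrightarrow> 0"
        by (rule filterlim_compose)
      have "norm (d n y - ?D) = norm (\<psi> (u + h n, t) - \<psi> (u, t) - blinfun_apply (g' u) (h n)) / norm (h n)" for n
      proof -
        have "blinfun_apply (g' u) (h n) = h n *\<^sub>R ?D" using blinfun.scaleR_right[of "g' u" "h n" 1] by simp
        then have "d n y - ?D = (1 / h n) *\<^sub>R (\<psi> (u + h n, t) - \<psi> (u, t) - blinfun_apply (g' u) (h n))"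
          using h(1)[of n] by (simp add: d_def u_def[symmetric] t_def[symmetric] yut scaleR_diff_right)
        then show ?thesis using h(1)[of n] by simp
      qed
      then have "(\<lambda>n. norm (d n y - ?D)) \<longlonglongrightarrow> 0" using l by simp
      then show ?thesis using tendsto_norm_zero_iff LIM_zero_iff by blast
    qed
    ultimately show ?thesis by blast
  qed
  then obtain D where "\<And>y. y \<in> W' \<Longrightarrow> (\<lambda>n. d n y) \<longlonglongrightarrow> D y \<and> D y \<in> E (tproj y) \<and> D y \<noteq> 0" by metis
  then show "\<exists>W d D. open W \<and> x \<in> W \<and> (\<forall>n::nat. continuous_on W (d n)) \<and>
     (\<forall>y\<in>W. (\<lambda>n. d n y) \<longlonglongrightarrow> D y \<and> D y \<in> E (tproj y) \<and> D y \<noteq> 0 \<and> (\<forall>n. d n y \<noteq> 0))"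
    using oW xW cd nz by (intro exI[of _ W'] exI[of _ d] exI[of _ D]) auto
qed

text \<open>One inclusion chains plaques together. For the other, images of plaques are open in the
  translate of \<open>V\<close>, so membership in the leaf is locally constant along
  \<open>V\<close>, which is connected.\<close>

lemma leaf_image:
  fixes W :: "real^3 \<Rightarrow> (real^3) set"
  assumes fol: "tangent_foliation TYPE('k::euclidean_space) TYPE('t::euclidean_space) E W"
    and V: "subspace V" "dim V \<le> DIM('k)"
    and HK: "\<And>x. H (K x) = x" "\<And>x. K (H x) = x" "continuous_on UNIV H"
    and plaque: "\<And>\<psi> t u1 u2. fol_chart TYPE('k) TYPE('t) E W \<psi> \<Longrightarrow> t \<in> ball 0 1 \<Longrightarrow> u1 \<in> ball 0 1 \<Longrightarrow> u2 \<in> ball 0 1 \<Longrightarrow>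
      H (\<psi> (u1, t)) - H (\<psi> (u2, t)) \<in> V"
  shows "H ` W x = linfol V (H x)"
proof
  have W: "\<And>x. x \<in> W x" "\<And>x y. y \<in> W x \<Longrightarrow> W y = W x"
    "\<And>x. \<exists>\<psi>. fol_chart TYPE('k) TYPE('t) E W \<psi> \<and> x \<in> \<psi> ` (ball (0::'k) 1 \<times> ball (0::'t) 1)"
    "\<And>x y. y \<in> W x \<longleftrightarrow> (x, y) \<in> (plaque_rel TYPE('k) TYPE('t) E W)\<^sup>*"
    using fol unfolding tangent_foliation_def by blast+
  show "H ` W x \<subseteq> linfol V (H x)"
  proof
    fix z assume "z \<in> H ` W x"
    then obtain y where y: "z = H y" "(x, y) \<in> (plaque_rel TYPE('k) TYPE('t) E W)\<^sup>*" using W(4) by blast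
    from y(2) have "H y - H x \<in> V"
    proof (induction rule: rtrancl_induct)
      case base
      then show ?case using V(1) by (simp add: subspace_0)
    next
      case (step y y')
      from step(2) obtain \<psi> t u1 u2 where p: "fol_chart TYPE('k) TYPE('t) E W \<psi>" "t \<in> ball 0 1"
        "u1 \<in> ball 0 1" "u2 \<in> ball 0 1" "y = \<psi> (u1, t)" "y' = \<psi> (u2, t)"
        unfolding plaque_rel_def by blast
      have "H y' - H y \<in> V" unfolding p(5,6) by (rule plaque[OF p(1,2,4,3)])
      then have "(H y' - H y) + (H y - H x) \<in> V" using step(3) V(1) subspace_add by blast
      then show ?case by simp
    qed
    then show "z \<in> linfol V (H x)" unfolding linfol_def y(1) by (intro CollectI exI[of _ "H y - H x"]) simp
  qed
  show "linfol V (H x) \<subseteq> H ` W x"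
  proof
    fix z assume "z \<in> linfol V (H x)"
    then obtain v where v: "z = H x + v" "v \<in> V" by (auto simp: linfol_def)
    have "K (H x + v) \<in> W (K (H x + 0))"
    proof (rule connected_equivalence_relation[of V 0 v "\<lambda>a b. K (H x + b) \<in> W (K (H x + a))"])
      show "connected V" using V(1) subspace_imp_convex convex_connected by blast
      show "0 \<in> V" "v \<in> V" using v V(1) subspace_0 by auto
      fix a assume a: "a \<in> V"
      define q where "q = K (H x + a)"
      obtain \<psi> where ch: "fol_chart TYPE('k) TYPE('t) E W \<psi>" and q: "q \<in> \<psi> ` (ball (0::'k) 1 \<times> ball (0::'t) 1)"
        using W(3) by blast
      obtain u0 t where ut: "q = \<psi> (u0, t)" "u0 \<in> ball 0 1" "t \<in> ball 0 1" using q by blast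
      have inj: "inj_on \<psi> (ball 0 1 \<times> ball 0 1)" and cont: "continuous_on (ball 0 1 \<times> ball 0 1) \<psi>"
        and leaf: "\<psi> ` (ball (0::'k) 1 \<times> {t}) \<subseteq> W (\<psi> (0, t))"
        using ch ut(3) unfolding fol_chart_def Let_def by blast+
      define f where "f u = H (\<psi> (u, t)) - H x" for u
      have fV: "f u \<in> V" if "u \<in> ball 0 1" for u
      proof -
        have "(H (\<psi> (u, t)) - H (\<psi> (u0, t))) + a \<in> V" using plaque[OF ch ut(3) that ut(2)] a V(1) subspace_add by blast
        moreover have "H (\<psi> (u0, t)) = H x + a" unfolding ut(1)[symmetric] q_def by (rule HK)
        ultimately show ?thesis by (simp add: f_def)
      qed
      have fc: "continuous_on (ball 0 1) f" unfolding f_def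
        by (intro continuous_intros continuous_on_compose2[OF HK(3)] continuous_on_compose2[OF cont])
          (use ut(3) in auto)
      have fi: "inj_on f (ball 0 1)"
      proof (rule inj_onI)
        fix u u' assume u: "u \<in> ball 0 1" "u' \<in> ball 0 1" "f u = f u'"
        have "K (H (\<psi> (u, t))) = K (H (\<psi> (u', t)))" using u(3) by (simp add: f_def)
        then have "\<psi> (u, t) = \<psi> (u', t)" by (simp only: HK)
        then have "(u, t) = (u', t)" using inj_onD[OF inj] u(1,2) ut(3) by blast
        then show "u = u'" by simp
      qed
      have "openin (top_of_set V) (f ` ball 0 1)"
      proof (rule invariance_of_domain_subspaces[of UNIV])
        show "dim V \<le> dim (UNIV::'k set)" using V(2) by simp
      qed (use fV fc fi V(1) in auto)
      moreover have "a \<in> f ` ball 0 1"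
      proof (rule image_eqI[OF _ ut(2)])
        show "a = f u0" unfolding f_def ut(1)[symmetric] q_def by (simp add: HK)
      qed
      moreover have "K (H x + b) \<in> W (K (H x + a))" if b: "b \<in> f ` ball 0 1" for b
      proof -
        obtain u where u: "u \<in> ball 0 1" "b = f u" using b by blast
        have "K (H x + b) = \<psi> (u, t)" by (simp add: u(2) f_def HK)
        then have "K (H x + b) \<in> W (\<psi> (0, t))" using leaf u(1) by auto
        moreover have "q \<in> W (\<psi> (0, t))" using leaf ut by auto
        then have "W q = W (\<psi> (0, t))" by (rule W(2))
        ultimately show ?thesis by (simp add: q_def)
      qed
      ultimately show "\<exists>T. openin (top_of_set V) T \<and> a \<in> T \<and> (\<forall>b\<in>T. K (H x + b) \<in> W (K (H x + a)))"
        by (intro exI[of _ "f ` ball 0 1"]) blast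
    next
      fix a b assume "K (H x + b) \<in> W (K (H x + a))"
      then have "W (K (H x + b)) = W (K (H x + a))" by (rule W(2))
      then show "K (H x + a) \<in> W (K (H x + b))" using W(1) by simp
    next
      fix a b c assume "K (H x + b) \<in> W (K (H x + a))" "K (H x + c) \<in> W (K (H x + b))"
      then show "K (H x + c) \<in> W (K (H x + a))" using W(2) by blast
    qed
    then have "K z \<in> W x" by (simp add: v(1) HK)
    then show "z \<in> H ` W x" using HK(1) by (intro image_eqI[of _ _ "K z"]) simp_all
  qed
qed

section \<open>Coarse growth estimates\<close>

text \<open>Cut the segment into pieces short enough for an increment below 1. So \<open>H\<close>,
  although no more than a homeomorphism, distorts large distances at most linearly and respects
  exponential growth.\<close>

lemma coarse_lipschitz:
  assumes "continuous_on UNIV g" "int_equivariant g"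
  shows "\<exists>C\<ge>0. \<forall>x y. norm (g x - g y) \<le> C * (1 + norm (x - y))"
proof -
  obtain d where d: "d > 0" "\<And>x y. norm (x - y) < d \<Longrightarrow> norm (g x - g y) < 1"
    using uniformly_continuous_int_equivariant[OF assms zero_less_one] by blast
  have "norm (g x - g y) \<le> (1 / d + 2) * (1 + norm (x - y))" for x y
  proof -
    define n where "n = nat \<lceil>norm (x - y) / d\<rceil> + 1"
    have "0 \<le> norm (x - y) / d" using d by simp
    then have n: "norm (x - y) / d < real n" "real n \<le> norm (x - y) / d + 2" "0 < n" unfolding n_def by linarith+
    have "norm (g x - g (x + (real k / n) *\<^sub>R (y - x))) \<le> real k" for k
    proof (induction k)
      case (Suc k)
      let ?z = "x + (real k / n) *\<^sub>R (y - x)"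
      have e: "x + (real (Suc k) / n) *\<^sub>R (y - x) = ?z + (1 / n) *\<^sub>R (y - x)"
        by (simp add: add_divide_distrib scaleR_add_left)
      have "norm (?z - (?z + (1 / n) *\<^sub>R (y - x))) = norm (x - y) / n" by (simp add: norm_minus_commute)
      also have "\<dots> < d" using n d by (simp add: field_simps)
      finally have "norm (g ?z - g (?z + (1 / n) *\<^sub>R (y - x))) < 1" by (rule d)
      then have "norm (g x - g (?z + (1 / n) *\<^sub>R (y - x))) \<le> real k + 1"
        using Suc norm_triangle_ineq[of "g x - g ?z" "g ?z - g (?z + (1 / n) *\<^sub>R (y - x))"] by simp
      then show ?case unfolding e by simp
    qed simp
    from this[of n] have "norm (g x - g y) \<le> real n" using n(3) by simp
    also have "\<dots> \<le> (1 / d) * norm (x - y) + 2" using n(2) by simp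
    also have "\<dots> \<le> (1 / d + 2) * (1 + norm (x - y))" using d(1) by (simp add: algebra_simps)
    finally show ?thesis .
  qed
  then show ?thesis using d(1) by (intro exI[of _ "1 / d + 2"]) auto
qed

text \<open>The open ball of parameters may carry unbounded tangents; the closed segment between the
  two parameters is compact and convex.\<close>

lemma disc_growth:
  fixes g :: "'k::euclidean_space \<Rightarrow> real^3"
  assumes disc: "tangent_disc E g" and der: "\<And>x. (G has_derivative A x) (at x)" and K: "0 \<le> K" "0 < r"
    and contr: "\<And>n x v. v \<in> E (tproj x) \<Longrightarrow> norm (cocycle G A n x v) \<le> K * r ^ n * norm v"
    and u: "u1 \<in> ball 0 1" "u2 \<in> ball 0 1"
  shows "\<exists>C. \<forall>n. norm ((G ^^ n) (g u1) - (G ^^ n) (g u2)) \<le> C * r ^ n"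
proof -
  obtain g' where g': "\<And>u. u \<in> ball 0 1 \<Longrightarrow> (g has_derivative blinfun_apply (g' u)) (at u)"
    "continuous_on (ball 0 1) g'" "\<And>u. u \<in> ball 0 1 \<Longrightarrow> range (blinfun_apply (g' u)) = E (tproj (g u))"
    using disc unfolding tangent_disc_def by blast
  let ?S = "closed_segment u1 u2"
  have S: "?S \<subseteq> ball 0 1" using u by (intro closed_segment_subset convex_ball)
  have "\<exists>C. \<forall>u1\<in>?S. \<forall>u2\<in>?S. \<forall>n. norm ((G ^^ n) (g u1) - (G ^^ n) (g u2)) \<le> C * r ^ n * norm (u1 - u2)"
  proof (rule orbit_distance_along_disc[where A = A and E = "\<lambda>x. E (tproj x)" and K = K and g' = g'])
    show "continuous_on ?S g'" using g'(2) S continuous_on_subset by blast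
    show "(g has_derivative blinfun_apply (g' u)) (at u within ?S)" if "u \<in> ?S" for u
      using g'(1)[of u] S that has_derivative_at_withinI by blast
    show "range (blinfun_apply (g' u)) \<subseteq> E (tproj (g u))" if "u \<in> ?S" for u using g'(3)[of u] S that by blast
  qed (use der contr K in auto)
  then obtain C where C: "\<And>v1 v2 n. v1 \<in> ?S \<Longrightarrow> v2 \<in> ?S \<Longrightarrow> norm ((G ^^ n) (g v1) - (G ^^ n) (g v2)) \<le> C * r ^ n * norm (v1 - v2)" by blast
  have "norm ((G ^^ n) (g u1) - (G ^^ n) (g u2)) \<le> (C * norm (u1 - u2)) * r ^ n" for n
    using C[of u1 u2 n] by (simp add: mult_ac)
  then show ?thesis by blast
qed

section \<open>The linear splitting\<close>

lemma ssum_span: "ssum (span {a}) (span {b}) = span {a, b}"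
proof -
  have "span ({a} \<union> {b}) = {x + y |x y. x \<in> span {a} \<and> y \<in> span {b}}" by (rule span_Un)
  then show ?thesis by (simp add: ssum_def insert_is_Un[of a "{b}"])
qed

text \<open>\<open>M - \<theta>\<close> is not injective, hence not surjective, and any nonzero
  vector orthogonal to its range will do.\<close>

lemma left_eigenvector:
  fixes M :: "real^3 \<Rightarrow> real^3"
  assumes "linear M" "M v = \<theta> *\<^sub>R v" "v \<noteq> 0"
  shows "\<exists>\<phi>. \<phi> \<noteq> 0 \<and> (\<forall>x. \<phi> \<bullet> M x = \<theta> * (\<phi> \<bullet> x))"
proof -
  define T where "T x = M x - \<theta> *\<^sub>R x" for x
  have T: "linear T" unfolding T_def
    by (rule linearI) (simp_all add: linear_add[OF assms(1)] linear_cmul[OF assms(1)] algebra_simps)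
  have "T v = T 0" using assms by (simp add: T_def linear_0)
  then have "\<not> inj T" using assms(3) injD[of T v 0] by blast
  then have "\<not> surj T" using linear_surjective_imp_injective[OF T] by blast
  moreover have "subspace (range T)" using linear_subspace_image[OF T subspace_UNIV] .
  ultimately have "dim (range T) < DIM(real^3)"
    using dim_eq_full[of "range T"] dim_subset_UNIV[of "range T"] by (metis le_neq_implies_less span_eq_iff)
  then obtain \<phi> where \<phi>: "\<phi> \<noteq> 0" "\<And>y. y \<in> span (range T) \<Longrightarrow> orthogonal \<phi> y"
    using orthogonal_to_subspace_exists by blast
  have "\<phi> \<bullet> M x = \<theta> * (\<phi> \<bullet> x)" for x
  proof -
    have "\<phi> \<bullet> T x = 0" using \<phi>(2)[OF span_base[of "T x"]] by (auto simp: orthogonal_def)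
    then show ?thesis by (simp add: T_def inner_diff_right)
  qed
  then show ?thesis using \<phi>(1) by blast
qed

text \<open>In a constant metric that makes the three eigenvectors orthonormal, the rates of
  \<open>A\<close> are the moduli of its eigenvalues.\<close>

lemma abs_PH_linear:
  fixes M :: "real^3^3"
  assumes A: "\<And>x. A (tproj x) = tproj (M *v x)"
    and eig: "M *v es = ls *\<^sub>R es" "M *v ec = lc *\<^sub>R ec" "M *v eu = lu *\<^sub>R eu"
    and nz: "es \<noteq> 0" "ec \<noteq> 0" "eu \<noteq> 0" "ls \<noteq> 0"
    and mod: "\<bar>ls\<bar> < \<bar>lc\<bar>" "\<bar>lc\<bar> < \<bar>lu\<bar>" "\<bar>ls\<bar> < 1" "1 < \<bar>lu\<bar>"
    and a: "a \<bullet> es = 1" "a \<bullet> ec = 0" "a \<bullet> eu = 0"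
    and c: "c \<bullet> es = 0" "c \<bullet> ec = 0" "c \<bullet> eu = 1"
    and dec: "\<And>x. a \<bullet> x = 0 \<Longrightarrow> c \<bullet> x = 0 \<Longrightarrow> x \<in> span {ec}"
  shows "abs_PH A (\<lambda>_. span {es}) (\<lambda>_. span {ec}) (\<lambda>_. span {eu})"
proof -
  \<comment> \<open>Completes \<open>a\<close> and \<open>c\<close> to the basis dual to the
    eigenvectors: from the functional given by \<open>ec\<close>, its values on \<open>es\<close>
    and \<open>eu\<close> are removed.\<close>
  define b where "b = (1 / (ec \<bullet> ec)) *\<^sub>R (ec - (ec \<bullet> es) *\<^sub>R a - (ec \<bullet> eu) *\<^sub>R c)"
  have b: "b \<bullet> es = 0" "b \<bullet> ec = 1" "b \<bullet> eu = 0"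
    using nz a c by (auto simp: b_def inner_diff_left)
  have repr: "x = (a \<bullet> x) *\<^sub>R es + (b \<bullet> x) *\<^sub>R ec + (c \<bullet> x) *\<^sub>R eu" for x
  proof -
    have "x - (a \<bullet> x) *\<^sub>R es - (c \<bullet> x) *\<^sub>R eu \<in> span {ec}"
      by (rule dec) (simp_all add: inner_diff_right a c)
    then obtain k where k: "x - (a \<bullet> x) *\<^sub>R es - (c \<bullet> x) *\<^sub>R eu = k *\<^sub>R ec" by (auto simp: span_singleton)
    then have x: "x = (a \<bullet> x) *\<^sub>R es + k *\<^sub>R ec + (c \<bullet> x) *\<^sub>R eu" by (simp add: algebra_simps)
    have "b \<bullet> x = b \<bullet> ((a \<bullet> x) *\<^sub>R es + k *\<^sub>R ec + (c \<bullet> x) *\<^sub>R eu)" using x by simp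
    then have "b \<bullet> x = k" by (simp add: inner_add_right b)
    then show ?thesis using x by simp
  qed
  define G :: "torus \<Rightarrow> real^3^3" where "G p = (\<chi> i j. a$i * a$j + b$i * b$j + c$i * c$j)" for p
  have quad: "x \<bullet> (G p *v x) = (a \<bullet> x)\<^sup>2 + (b \<bullet> x)\<^sup>2 + (c \<bullet> x)\<^sup>2" for p x
    by (simp add: G_def inner_vec_def matrix_vector_mult_def sum_3 power2_eq_square algebra_simps)
  have riem: "riem_metric G"
    unfolding riem_metric_def
  proof (intro conjI allI impI)
    have "G \<circ> tproj = (\<lambda>_. G undefined)" by (auto simp: G_def)
    then show "continuous_on UNIV (G \<circ> tproj)" by simp
    show "transpose (G p) = G p" for p by (simp add: G_def transpose_def vec_eq_iff mult.commute)
    show "0 < v \<bullet> (G p *v v)" if v: "v \<noteq> 0" for p v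
    proof (rule ccontr)
      assume "\<not> 0 < v \<bullet> (G p *v v)"
      then have "(a \<bullet> v)\<^sup>2 + (b \<bullet> v)\<^sup>2 + (c \<bullet> v)\<^sup>2 \<le> 0" using quad by simp
      then have "(a \<bullet> v)\<^sup>2 = 0 \<and> (b \<bullet> v)\<^sup>2 = 0 \<and> (c \<bullet> v)\<^sup>2 = 0"
        using zero_le_power2[of "a \<bullet> v"] zero_le_power2[of "b \<bullet> v"] zero_le_power2[of "c \<bullet> v"] by linarith
      then show False using repr[of v] v by simp
    qed
  qed
  have gn: "gnorm G p (t *\<^sub>R es) = \<bar>t\<bar>" "gnorm G p (t *\<^sub>R ec) = \<bar>t\<bar>" "gnorm G p (t *\<^sub>R eu) = \<bar>t\<bar>" for p t
    unfolding gnorm_def quad by (simp_all add: a b c)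
  have td: "tderiv A p = (*v) M" for p
  proof -
    obtain x where x: "tproj x = p" using tproj_surj by blast
    have "tderiv A (tproj x) = (*v) M"
    proof (rule tderiv_eq)
      show "continuous_on UNIV ((*v) M)" by (intro linear_continuous_on) (simp add: linear_conv_bounded_linear[symmetric])
      show "is_lift ((*v) M) A" by (simp add: is_lift_def A)
      show "((*v) M has_derivative (*v) M) (at x)" by (intro linear_imp_has_derivative) simp
    qed
    then show ?thesis by (simp add: x)
  qed
  have img: "(*v) M ` span {v} = span {v}" if "M *v v = l *\<^sub>R v" "l \<noteq> 0" for v l
  proof
    show "(*v) M ` span {v} \<subseteq> span {v}"
      using that(1) by (auto simp: span_singleton matrix_vector_mult_scaleR)
    show "span {v} \<subseteq> (*v) M ` span {v}"
    proof
      fix y assume "y \<in> span {v}"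
      then obtain k where "y = k *\<^sub>R v" by (auto simp: span_singleton)
      then have "y = M *v ((k / l) *\<^sub>R v)" using that by (simp add: matrix_vector_mult_scaleR)
      then show "y \<in> (*v) M ` span {v}" by (auto simp: span_singleton)
    qed
  qed
  have dims: "dim (span {v}) = 1" if "v \<noteq> 0" for v :: "real^3" using that by (simp add: dim_singleton)
  have sp: "ssum (ssum (span {es}) (span {ec})) (span {eu}) = UNIV"
  proof -
    have "x \<in> ssum (ssum (span {es}) (span {ec})) (span {eu})" for x
    proof -
      have "(a \<bullet> x) *\<^sub>R es + (b \<bullet> x) *\<^sub>R ec \<in> ssum (span {es}) (span {ec})"
        unfolding ssum_def by (intro CollectI exI conjI) (auto simp: span_singleton)
      then show ?thesis unfolding ssum_def[of _ "span {eu}"]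
        by (intro CollectI exI[of _ "(a \<bullet> x) *\<^sub>R es + (b \<bullet> x) *\<^sub>R ec"] exI[of _ "(c \<bullet> x) *\<^sub>R eu"] conjI)
          (auto simp: span_singleton repr[symmetric])
    qed
    then show ?thesis by blast
  qed
  \<comment> \<open>The modulus of \<open>lc\<close> may lie on either side of 1, hence the minimum
    here and the maximum for \<open>\<mu>\<close>.\<close>
  obtain \<sigma> where \<sigma>: "\<bar>ls\<bar> < \<sigma>" "\<sigma> < min 1 \<bar>lc\<bar>" using dense[of "\<bar>ls\<bar>" "min 1 \<bar>lc\<bar>"] mod by auto
  obtain \<mu> where \<mu>: "max 1 \<bar>lc\<bar> < \<mu>" "\<mu> < \<bar>lu\<bar>" using dense[of "max 1 \<bar>lc\<bar>" "\<bar>lu\<bar>"] mod by auto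
  have lcu: "lc \<noteq> 0" "lu \<noteq> 0" using mod by auto
  have rate: "\<forall>p vs vc vu. vs \<in> span {es} \<longrightarrow> vc \<in> span {ec} \<longrightarrow> vu \<in> span {eu} \<longrightarrow>
          gnorm G p vs = 1 \<longrightarrow> gnorm G p vc = 1 \<longrightarrow> gnorm G p vu = 1 \<longrightarrow>
          gnorm G (A p) (tderiv A p vs) < \<sigma> \<and> \<sigma> < gnorm G (A p) (tderiv A p vc) \<and>
          gnorm G (A p) (tderiv A p vc) < \<mu> \<and> \<mu> < gnorm G (A p) (tderiv A p vu)"
  proof (intro allI impI)
    fix p vs vc vu assume v: "vs \<in> span {es}" "vc \<in> span {ec}" "vu \<in> span {eu}"
      "gnorm G p vs = 1" "gnorm G p vc = 1" "gnorm G p vu = 1"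
    obtain s k u where s: "vs = s *\<^sub>R es" "vc = k *\<^sub>R ec" "vu = u *\<^sub>R eu" using v(1-3) by (auto simp: span_singleton)
    have 1: "\<bar>s\<bar> = 1" "\<bar>k\<bar> = 1" "\<bar>u\<bar> = 1" using v(4-6) by (simp_all add: s gn)
    have m: "tderiv A p vs = (s * ls) *\<^sub>R es" "tderiv A p vc = (k * lc) *\<^sub>R ec" "tderiv A p vu = (u * lu) *\<^sub>R eu"
      by (simp_all add: td s matrix_vector_mult_scaleR eig)
    show "gnorm G (A p) (tderiv A p vs) < \<sigma> \<and> \<sigma> < gnorm G (A p) (tderiv A p vc) \<and>
          gnorm G (A p) (tderiv A p vc) < \<mu> \<and> \<mu> < gnorm G (A p) (tderiv A p vu)"
      unfolding m gn using \<sigma> \<mu> by (simp add: abs_mult 1)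
  qed
  show ?thesis
    unfolding abs_PH_def
  proof (intro exI[of _ G] exI conjI)
    show "riem_metric G" by (rule riem)
    show "\<sigma> < 1" "1 < \<mu>" using \<sigma> \<mu> by auto
    show "\<forall>p. subspace (span {es}) \<and> subspace (span {ec}) \<and> subspace (span {eu}) \<and>
           dim (span {es}) = 1 \<and> dim (span {ec}) = 1 \<and> dim (span {eu}) = 1 \<and>
           ssum (ssum (span {es}) (span {ec})) (span {eu}) = UNIV \<and>
           tderiv A p ` span {es} = span {es} \<and> tderiv A p ` span {ec} = span {ec} \<and>
           tderiv A p ` span {eu} = span {eu}"
      using sp dims[OF nz(1)] dims[OF nz(2)] dims[OF nz(3)] img[OF eig(1) nz(4)] img[OF eig(2) lcu(1)] img[OF eig(3) lcu(2)]
      by (simp add: td subspace_span)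
  qed (rule rate)
qed

section \<open>Lifting the partially hyperbolic diffeomorphism\<close>

context ph
begin

lemma line_proj_ps_pu: "line_proj ps" "line_proj pu"
proof -
  have u: "\<exists>w\<in>E x. norm w = 1 \<and> (\<forall>v\<in>E x. \<exists>t. v = t *\<^sub>R w)" if E: "line E" for E x
  proof -
    define w where "w = (1 / norm (dir E x)) *\<^sub>R dir E x"
    have w: "w \<in> E x" "norm w = 1" using dir[OF E, of x] lineD(1)[OF E] subspace_scale by (auto simp: w_def)
    then have "w \<noteq> 0" by auto
    then show ?thesis using w line_multiple[OF E w(1)] by blast
  qed
  have fix_s: "ps x w = w" if "w \<in> Es x" for x w
    using proj_eq(1)[OF that subspace_0[OF sub(2)] subspace_0[OF sub(3)]] by simp
  have fix_u: "pu x w = w" if "w \<in> Eu x" for x w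
    using proj_eq(3)[OF subspace_0[OF sub(1)] subspace_0[OF sub(2)] that] by simp
  show "line_proj ps" unfolding line_proj_def
  proof (intro conjI allI proj_lfield)
    fix x
    obtain w where "w \<in> Es x" "norm w = 1" "\<forall>v\<in>Es x. \<exists>t. v = t *\<^sub>R w" using u[OF line_cases(1)] by blast
    then show "\<exists>w. norm w = 1 \<and> ps x w = w \<and> (\<forall>v. \<exists>t. ps x v = t *\<^sub>R w)" using fix_s proj(1) by blast
  qed
  show "line_proj pu" unfolding line_proj_def
  proof (intro conjI allI proj_lfield)
    fix x
    obtain w where "w \<in> Eu x" "norm w = 1" "\<forall>v\<in>Eu x. \<exists>t. v = t *\<^sub>R w" using u[OF line_cases(3)] by blast
    then show "\<exists>w. norm w = 1 \<and> pu x w = w \<and> (\<forall>v. \<exists>t. pu x v = t *\<^sub>R w)" using fix_u proj(3) by blast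
  qed
qed

lemma contracting_lines:
  assumes "\<sigma> < 1" "1 < \<mu>"
  shows "contracting_line F A \<sigma> ps" "contracting_line Fi Ai (1 / \<mu>) pu"
proof -
  obtain K where K: "0 < K" "\<And>x v n. v \<in> Es x \<Longrightarrow> norm (D n x v) \<le> K * \<sigma> ^ n * norm v"
    "\<And>x v n. v \<in> Eu x \<Longrightarrow> norm (Di n x v) \<le> K * (1 / \<mu>) ^ n * norm v"
    using bundle_growth by blast
  have "\<forall>x v n. norm (D n x (ps x v)) \<le> K * \<sigma> ^ n * norm (ps x v)" "\<forall>x v n. norm (Di n x (pu x v)) \<le> K * (1 / \<mu>) ^ n * norm (pu x v)"
    using K(2,3) proj(1,3) by blast+
  then have "\<exists>Kc\<ge>0. \<forall>x v n. norm (D n x (ps x v)) \<le> Kc * \<sigma> ^ n * norm (ps x v)"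
    "\<exists>Kc\<ge>0. \<forall>x v n. norm (Di n x (pu x v)) \<le> Kc * (1 / \<mu>) ^ n * norm (pu x v)"
    using less_imp_le[OF K(1)] by blast+
  then show "contracting_line F A \<sigma> ps" "contracting_line Fi Ai (1 / \<mu>) pu"
    unfolding contracting_line_def using assms \<sigma>\<mu> F_der Fi_der line_proj_ps_pu stable_cone unstable_cone
    by simp_all
qed

end

text \<open>From the condition on the unit circle the points 1 and -1 are extracted, at which the
  complex determinant is the real one.\<close>

lemma hyp_toral_autE:
  assumes "hyp_toral_aut A"
  obtains M :: "real^3^3" where "\<And>x. A (tproj x) = tproj (M *v x)" "\<bar>det M\<bar> = 1" "det (mat 1 - M) \<noteq> 0"
    "det (mat (-1) - M) \<noteq> 0" "\<And>n. ivec n \<Longrightarrow> ivec (M *v n)"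
proof -
  obtain M :: "real^3^3" where M: "\<And>i j. M$i$j \<in> \<int>" "\<bar>det M\<bar> = 1" "\<And>x. A (tproj x) = tproj (M *v x)"
    and z: "\<And>z::complex. cmod z = 1 \<Longrightarrow> det (mat z - (\<chi> i j. complex_of_real (M$i$j)) :: complex^3^3) \<noteq> 0"
    using assms unfolding hyp_toral_aut_def by blast
  have "det (mat (complex_of_real s) - (\<chi> i j. complex_of_real (M$i$j)) :: complex^3^3) = of_real (det (mat s - M))" for s
    by (simp add: det_3 mat_def)
  then have "det (mat s - M) \<noteq> 0" if "\<bar>s\<bar> = 1" for s
    using z[of "of_real s"] that by (metis norm_of_real of_real_0)
  then have "det (mat 1 - M) \<noteq> 0" "det (mat (-1) - M) \<noteq> 0" by simp_all
  moreover have "ivec (M *v n)" if "ivec n" for n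
    using that M(1) by (auto simp: ivec_def matrix_vector_mult_def intro!: Ints_sum Ints_mult)
  ultimately show thesis using that M by blast
qed

lemma gnorm_scaleR: "gnorm G p (t *\<^sub>R v) = \<bar>t\<bar> * gnorm G p v"
proof -
  have "(t *\<^sub>R v) \<bullet> (G p *v (t *\<^sub>R v)) = t\<^sup>2 * (v \<bullet> (G p *v v))"
    by (simp add: matrix_vector_mult_scaleR power2_eq_square)
  then show ?thesis by (simp add: gnorm_def real_sqrt_mult)
qed

lemma gnorm_pos: "riem_metric G \<Longrightarrow> v \<noteq> 0 \<Longrightarrow> 0 < gnorm G p v"
  by (simp add: gnorm_def riem_metric_def)

lemma gnorm_continuous:
  assumes "riem_metric G"
  shows "continuous_on UNIV (\<lambda>z. gnorm G (tproj (fst z)) (snd z))"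
proof -
  have "continuous_on UNIV (\<lambda>x. G (tproj x))" using assms by (simp add: riem_metric_def o_def)
  then have c: "continuous_on UNIV (\<lambda>z::(real^3)\<times>(real^3). G (tproj (fst z)))"
    by (rule continuous_on_compose2) (auto intro: continuous_intros)
  show ?thesis unfolding gnorm_def inner_vec_def matrix_vector_mult_def
    by (simp, intro continuous_intros c)
qed

text \<open>On the torus the inequalities are stated for three unit vectors at once.
  One-dimensionality supplies vectors for the places not under consideration, and homogeneity
  removes the normalisation.\<close>

lemma abs_PH_rates:
  assumes riem: "riem_metric G"
    and lin: "linear T"
    and E: "subspace Es" "subspace Ec" "subspace Eu" "dim Es = 1" "dim Ec = 1" "dim Eu = 1"
    and rate: "\<And>vs vc vu. vs \<in> Es \<Longrightarrow> vc \<in> Ec \<Longrightarrow> vu \<in> Eu \<Longrightarrow>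
      gnorm G p vs = 1 \<Longrightarrow> gnorm G p vc = 1 \<Longrightarrow> gnorm G p vu = 1 \<Longrightarrow>
      gnorm G q (T vs) < \<sigma> \<and> \<sigma> < gnorm G q (T vc) \<and> gnorm G q (T vc) < \<mu> \<and> \<mu> < gnorm G q (T vu)"
  shows "0 < \<sigma>"
    and "v \<in> Es \<Longrightarrow> v \<noteq> 0 \<Longrightarrow> gnorm G q (T v) < \<sigma> * gnorm G p v"
    and "v \<in> Ec \<Longrightarrow> v \<noteq> 0 \<Longrightarrow> \<sigma> * gnorm G p v < gnorm G q (T v)"
    and "v \<in> Ec \<Longrightarrow> v \<noteq> 0 \<Longrightarrow> gnorm G q (T v) < \<mu> * gnorm G p v"
    and "v \<in> Eu \<Longrightarrow> v \<noteq> 0 \<Longrightarrow> \<mu> * gnorm G p v < gnorm G q (T v)"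
proof -
  define nv where "nv v = (1 / gnorm G p v) *\<^sub>R v" for v
  have nv: "nv v \<in> E" "gnorm G p (nv v) = 1" "gnorm G q (T (nv v)) = gnorm G q (T v) / gnorm G p v"
    if "subspace E" "v \<in> E" "v \<noteq> 0" for E v
    using that gnorm_pos[OF riem that(3), of p]
    by (simp_all add: nv_def subspace_scale gnorm_scaleR linear_cmul[OF lin])
  have nz: "\<exists>v\<in>E. v \<noteq> 0" if "dim E = 1" for E :: "(real^3) set"
    using that dim_eq_0[of E] by (metis subsetI singletonI zero_neq_one)
  obtain s c u where scu: "s \<in> Es" "s \<noteq> 0" "c \<in> Ec" "c \<noteq> 0" "u \<in> Eu" "u \<noteq> 0" using nz E(4-6) by meson
  have r: "gnorm G q (T a) / gnorm G p a < \<sigma> \<and> \<sigma> < gnorm G q (T b) / gnorm G p b \<and>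
      gnorm G q (T b) / gnorm G p b < \<mu> \<and> \<mu> < gnorm G q (T d) / gnorm G p d"
    if "a \<in> Es" "a \<noteq> 0" "b \<in> Ec" "b \<noteq> 0" "d \<in> Eu" "d \<noteq> 0" for a b d
    using rate[OF nv(1)[OF E(1) that(1,2)] nv(1)[OF E(2) that(3,4)] nv(1)[OF E(3) that(5,6)]
        nv(2)[OF E(1) that(1,2)] nv(2)[OF E(2) that(3,4)] nv(2)[OF E(3) that(5,6)]]
    unfolding nv(3)[OF E(1) that(1,2)] nv(3)[OF E(2) that(3,4)] nv(3)[OF E(3) that(5,6)] .
  have ge: "0 \<le> gnorm G q w" for w
    using gnorm_pos[OF riem, of w q] gnorm_scaleR[of G q 0 0] by (cases "w = 0") auto
  show "0 < \<sigma>" using r[OF scu] ge[of "T s"] gnorm_pos[OF riem scu(2), of p]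
    by (meson divide_nonneg_pos le_less_trans)
  show "gnorm G q (T v) < \<sigma> * gnorm G p v" if "v \<in> Es" "v \<noteq> 0"
    using r[OF that scu(3-6)] gnorm_pos[OF riem that(2), of p] by (simp add: field_simps)
  show "\<sigma> * gnorm G p v < gnorm G q (T v)" if "v \<in> Ec" "v \<noteq> 0"
    using r[OF scu(1,2) that scu(5,6)] gnorm_pos[OF riem that(2), of p] by (simp add: field_simps)
  show "gnorm G q (T v) < \<mu> * gnorm G p v" if "v \<in> Ec" "v \<noteq> 0"
    using r[OF scu(1,2) that scu(5,6)] gnorm_pos[OF riem that(2), of p] by (simp add: field_simps)
  show "\<mu> * gnorm G p v < gnorm G q (T v)" if "v \<in> Eu" "v \<noteq> 0"
    using r[OF scu(1-4) that] gnorm_pos[OF riem that(2), of p] by (simp add: field_simps)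
qed

text \<open>The given lift differs by a constant from the differentiable one and inherits its
  derivative. Continuity of \<open>Fi\<close> makes the inverse differentiable, and its derivative
  is continuous as the solution of linear equations.\<close>

lemma lifted_ph:
  assumes diffeo: "tC1_diffeo f" and PH: "abs_PH f Es Ec Eu"
    and fol: "fol1 Es Ws" "fol1 Ec Wc" "fol1 Eu Wu"
    and F: "continuous_on UNIV F" "is_lift F f" and Fi: "continuous_on UNIV Fi"
    and FFi: "\<And>x. F (Fi x) = x" and FiF: "\<And>x. Fi (F x) = x"
  shows "\<exists>A Ai N \<sigma> \<mu>. ph F Fi A Ai N (\<lambda>x. Es (tproj x)) (\<lambda>x. Ec (tproj x)) (\<lambda>x. Eu (tproj x)) \<sigma> \<mu> \<and> \<sigma> < 1 \<and> 1 < \<mu>"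
proof -
  obtain F0 F0' where F0: "is_lift F0 f" "\<And>x. (F0 has_derivative blinfun_apply (F0' x)) (at x)"
    "continuous_on UNIV F0'" "\<And>x. bij (blinfun_apply (F0' x))"
    using diffeo unfolding tC1_diffeo_def by blast
  have bijf: "bij f" using diffeo by (simp add: tC1_diffeo_def)
  have F0c: "continuous_on UNIV F0"
    by (intro continuous_at_imp_continuous_on ballI has_derivative_continuous[OF F0(2)])
  obtain m where m: "\<And>x. F x = F0 x + m" using lifts_differ_by_ivec[OF F0c F0(1) F] by blast
  define A where "A x = blinfun_apply (F0' x)" for x
  have der: "(F has_derivative A x) (at x)" for x
  proof -
    have "((\<lambda>x. F0 x + m) has_derivative A x) (at x)"
      unfolding A_def using F0(2)[of x] by (auto intro!: derivative_eq_intros)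
    moreover have "F = (\<lambda>x. F0 x + m)" using m by auto
    ultimately show ?thesis by simp
  qed
  have Fe: "int_equivariant F" by (rule lift_int_equivariant[OF F])
  have Fil: "is_lift Fi (inv f)" unfolding is_lift_def
  proof
    fix x
    have "f (tproj (Fi x)) = tproj x" using F(2) FFi by (metis is_lift_def)
    then show "tproj (Fi x) = inv f (tproj x)" using bijf by (metis bij_is_inj inv_f_f)
  qed
  have Fie: "int_equivariant Fi" by (rule lift_int_equivariant[OF Fi Fil])
  have Alin: "linear (A x)" for x using has_derivative_linear[OF der] .
  have Aper: "A (x + n) = A x" if "ivec n" for x n
    using has_derivative_unique[OF der[of "x + n"] has_derivative_lift_shift[OF Fe der that]] .
  have Alf: "lfield A" unfolding lfield_def
  proof (intro conjI allI Alin)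
    have "continuous_on UNIV (\<lambda>z::(real^3)\<times>(real^3). F0' (fst z))"
      by (rule continuous_on_compose2[OF F0(3)]) (auto intro: continuous_intros)
    then show "continuous_on UNIV (\<lambda>z. A (fst z) (snd z))"
      unfolding A_def by (intro blinfun.continuous_on continuous_intros)
    show "periodic A" using Aper by (simp add: periodic_def)
  qed
  have Abij: "bij (A x)" for x using F0(4) by (simp add: A_def)
  define Ai where "Ai y = inv (A (Fi y))" for y
  have AiA: "Ai (F x) (A x v) = v" for x v
    using Abij by (simp add: Ai_def FiF bij_is_inj)
  have AAi: "A x (Ai (F x) v) = v" for x v
    using Abij by (simp add: Ai_def FiF bij_is_surj surj_f_inv_f)
  have Ailin: "linear (Ai x)" for x
    unfolding Ai_def using Alin Abij by (intro inj_linear_imp_inv_linear) (auto simp: bij_is_inj)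
  have Ailf: "lfield Ai" unfolding lfield_def
  proof (intro conjI allI Ailin)
    show "continuous_on UNIV (\<lambda>z. Ai (fst z) (snd z))"
    proof (rule continuous_solution_of_linear_equations[where g' = "\<lambda>z. F0' (Fi (fst z))" and f = snd])
      have "continuous_on UNIV (\<lambda>z::(real^3)\<times>(real^3). Fi (fst z))"
        by (rule continuous_on_compose2[OF Fi]) (auto intro: continuous_intros)
      then show "continuous_on UNIV (\<lambda>z::(real^3)\<times>(real^3). F0' (Fi (fst z)))"
        by (rule continuous_on_compose2[OF F0(3)]) auto
      show "continuous_on UNIV (snd :: (real^3)\<times>(real^3) \<Rightarrow> real^3)" by (intro continuous_intros)
      show "inj (blinfun_apply (F0' (Fi (fst z))))" for z :: "(real^3)\<times>(real^3)"
        using F0(4) bij_is_inj by blast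
      show "blinfun_apply (F0' (Fi (fst z))) (Ai (fst z) (snd z)) = snd z" for z
        using AAi[of "Fi (fst z)" "snd z"] by (simp add: FFi A_def)
    qed
    show "periodic Ai" unfolding periodic_def
    proof (intro allI impI)
      fix x n :: "real^3" assume n: "ivec n"
      obtain k where "ivec k" "\<And>x. Fi (x + n) = Fi x + k" using int_equivariantD[OF Fie n] by blast
      then show "Ai (x + n) = Ai x" by (simp add: Ai_def Aper)
    qed
  qed
  have Fider: "(Fi has_derivative Ai y) (at y)" for y
  proof (rule has_derivative_inverse_basic[where f = F and f' = "A (Fi y)" and T = UNIV])
    show "bounded_linear (Ai y)" using Ailin linear_conv_bounded_linear by blast
    show "Ai y \<circ> A (Fi y) = id" using AiA[of "Fi y"] by (auto simp: FFi)
    show "continuous (at y) Fi" using Fi by (simp add: continuous_on_eq_continuous_at)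
  qed (auto simp: FFi der)
  obtain G \<sigma> \<mu> where G: "riem_metric G" "\<sigma> < 1" "1 < \<mu>"
    and bd: "\<forall>p. subspace (Es p) \<and> subspace (Ec p) \<and> subspace (Eu p) \<and>
           dim (Es p) = 1 \<and> dim (Ec p) = 1 \<and> dim (Eu p) = 1 \<and>
           ssum (ssum (Es p) (Ec p)) (Eu p) = UNIV \<and>
           tderiv f p ` Es p = Es (f p) \<and> tderiv f p ` Ec p = Ec (f p) \<and> tderiv f p ` Eu p = Eu (f p)"
    and rate: "\<forall>p vs vc vu. vs \<in> Es p \<longrightarrow> vc \<in> Ec p \<longrightarrow> vu \<in> Eu p \<longrightarrow>
          gnorm G p vs = 1 \<longrightarrow> gnorm G p vc = 1 \<longrightarrow> gnorm G p vu = 1 \<longrightarrow>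
          gnorm G (f p) (tderiv f p vs) < \<sigma> \<and> \<sigma> < gnorm G (f p) (tderiv f p vc) \<and>
          gnorm G (f p) (tderiv f p vc) < \<mu> \<and> \<mu> < gnorm G (f p) (tderiv f p vu)"
    using PH unfolding abs_PH_def by (elim exE conjE) (rule that)
  have td: "tderiv f (tproj x) = A x" for x by (rule tderiv_eq[OF F der])
  have Fl: "f (tproj x) = tproj (F x)" for x using F(2) by (simp add: is_lift_def)
  have rate': "gnorm G (tproj (F x)) (A x vs) < \<sigma> \<and> \<sigma> < gnorm G (tproj (F x)) (A x vc) \<and>
          gnorm G (tproj (F x)) (A x vc) < \<mu> \<and> \<mu> < gnorm G (tproj (F x)) (A x vu)"
    if "vs \<in> Es (tproj x)" "vc \<in> Ec (tproj x)" "vu \<in> Eu (tproj x)"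
      "gnorm G (tproj x) vs = 1" "gnorm G (tproj x) vc = 1" "gnorm G (tproj x) vu = 1" for x vs vc vu
    using rate[rule_format, OF that] by (simp only: td Fl)
  define N where "N x v = gnorm G (tproj x) v" for x v
  have b: "subspace (Es p)" "subspace (Ec p)" "subspace (Eu p)" "dim (Es p) = 1" "dim (Ec p) = 1" "dim (Eu p) = 1" for p
    using bd by simp_all
  note R = abs_PH_rates[where G = G and T = "A x" and Es = "Es (tproj x)" and Ec = "Ec (tproj x)" and Eu = "Eu (tproj x)"
      and \<sigma> = \<sigma> and \<mu> = \<mu> and p = "tproj x" and q = "tproj (F x)" for x, OF G(1) Alin b]
  have "ph F Fi A Ai N (\<lambda>x. Es (tproj x)) (\<lambda>x. Ec (tproj x)) (\<lambda>x. Eu (tproj x)) \<sigma> \<mu>"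
  proof
    show "continuous_on UNIV (\<lambda>z. N (fst z) (snd z))" unfolding N_def by (rule gnorm_continuous[OF G(1)])
    show "periodic N" "periodic (\<lambda>x. Es (tproj x))" "periodic (\<lambda>x. Ec (tproj x))" "periodic (\<lambda>x. Eu (tproj x))"
      by (auto simp: periodic_def N_def)
    show "\<exists>a\<in>Es (tproj x). \<exists>b\<in>Ec (tproj x). \<exists>c\<in>Eu (tproj x). v = a + b + c" for x v
    proof -
      have "v \<in> ssum (ssum (Es (tproj x)) (Ec (tproj x))) (Eu (tproj x))" using bd by simp
      then show ?thesis unfolding ssum_def by blast
    qed
    show "A x ` Es (tproj x) = Es (tproj (F x))" "A x ` Ec (tproj x) = Ec (tproj (F x))"
      "A x ` Eu (tproj x) = Eu (tproj (F x))" for x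
      using bd[rule_format, of "tproj x"] by (simp_all add: td Fl)
    show "N (F x) (A x v) < \<sigma> * N x v" if "v \<in> Es (tproj x)" "v \<noteq> 0" for x v
      unfolding N_def by (rule R(2)[OF rate' that])
    show "\<sigma> * N x v < N (F x) (A x v)" if "v \<in> Ec (tproj x)" "v \<noteq> 0" for x v
      unfolding N_def by (rule R(3)[OF rate' that])
    show "N (F x) (A x v) < \<mu> * N x v" if "v \<in> Ec (tproj x)" "v \<noteq> 0" for x v
      unfolding N_def by (rule R(4)[OF rate' that])
    show "\<mu> * N x v < N (F x) (A x v)" if "v \<in> Eu (tproj x)" "v \<noteq> 0" for x v
      unfolding N_def by (rule R(5)[OF rate' that])
    show "0 < \<sigma>" by (rule R(1)[OF rate'])
    show "\<sigma> < \<mu>" using G by simp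
    show "line_approx (\<lambda>x. Es (tproj x))" "line_approx (\<lambda>x. Ec (tproj x))" "line_approx (\<lambda>x. Eu (tproj x))"
      using fol line_approx_of_fol1 by blast+
  qed (auto simp: FFi FiF Fe Fie Alf Ailf der Fider AiA AAi b N_def gnorm_scaleR gnorm_pos[OF G(1)])
  then show ?thesis using G(2,3) by blast
qed

section \<open>Eigenfunctionals and the growth of displacements\<close>

text \<open>The constant \<open>C1\<close> is the additive part of the coarse estimate for
  \<open>H\<close>; because of it, growth is compared below only with eigenvalues of modulus greater
  than 1.\<close>

lemma semiconjugate_growth:
  assumes H: "continuous_on UNIV H" "int_equivariant H" and G: "\<And>n. norm ((G ^^ n) x - (G ^^ n) y) \<le> C * r ^ n"
  shows "\<exists>C1 C2. \<forall>n. norm (H ((G ^^ n) x) - H ((G ^^ n) y)) \<le> C1 + C2 * r ^ n"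
proof -
  obtain B where B: "B \<ge> 0" "\<And>x y. norm (H x - H y) \<le> B * (1 + norm (x - y))" using coarse_lipschitz[OF H] by blast
  have "norm (H ((G ^^ n) x) - H ((G ^^ n) y)) \<le> B + (B * C) * r ^ n" for n
  proof -
    have "norm (H ((G ^^ n) x) - H ((G ^^ n) y)) \<le> B * (1 + norm ((G ^^ n) x - (G ^^ n) y))" by (rule B)
    also have "\<dots> \<le> B * (1 + C * r ^ n)" using G[of n] B(1) by (intro mult_left_mono) auto
    finally show ?thesis by (simp add: algebra_simps)
  qed
  then show ?thesis by blast
qed

text \<open>The value of the eigenfunctional is multiplied by \<open>\<theta>\<close> at each step,
  while the displacement grows more slowly than the powers of \<open>\<theta>\<close>.\<close>

lemma functional_vanishes:
  assumes H: "continuous_on UNIV H" "int_equivariant H" and G: "\<And>n. norm ((G ^^ n) x - (G ^^ n) y) \<le> C * r ^ n"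
    and conj: "\<And>x. H (G x) = T (H x)" and \<phi>: "\<And>w. \<phi> \<bullet> T w = \<theta> * (\<phi> \<bullet> w)"
    and r: "1 < \<bar>\<theta>\<bar>" "0 \<le> r" "r < \<bar>\<theta>\<bar>"
  shows "\<phi> \<bullet> (H x - H y) = 0"
proof -
  obtain C1 C2 where C: "\<And>n. norm (H ((G ^^ n) x) - H ((G ^^ n) y)) \<le> C1 + C2 * r ^ n"
    using semiconjugate_growth[OF H G] by blast
  have p: "\<phi> \<bullet> H ((G ^^ n) z) = \<theta> ^ n * (\<phi> \<bullet> H z)" for n z
    by (induction n) (simp_all add: conj \<phi>)
  have "\<bar>\<phi> \<bullet> (H x - H y)\<bar> * \<bar>\<theta>\<bar> ^ n \<le> (norm \<phi> * C1) * 1 ^ n + (norm \<phi> * C2) * r ^ n + 0 * 0 ^ n" for n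
  proof -
    have "\<phi> \<bullet> (H ((G ^^ n) x) - H ((G ^^ n) y)) = (\<phi> \<bullet> (H x - H y)) * \<theta> ^ n"
      by (simp add: inner_diff_right p algebra_simps)
    then have "\<bar>\<phi> \<bullet> (H x - H y)\<bar> * \<bar>\<theta>\<bar> ^ n = \<bar>\<phi> \<bullet> (H ((G ^^ n) x) - H ((G ^^ n) y))\<bar>"
      by (simp add: power_abs abs_mult)
    also have "\<dots> \<le> norm \<phi> * norm (H ((G ^^ n) x) - H ((G ^^ n) y))" by (rule Cauchy_Schwarz_ineq2)
    also have "\<dots> \<le> norm \<phi> * (C1 + C2 * r ^ n)" by (intro mult_left_mono C) simp
    finally show ?thesis by (simp add: algebra_simps)
  qed
  then have "\<bar>\<phi> \<bullet> (H x - H y)\<bar> \<le> 0" by (rule exp_sum_dominates) (use r in auto)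
  then show ?thesis by simp
qed

lemma eigenvalue_le_growth:
  assumes H: "continuous_on UNIV H" "int_equivariant H" and G: "\<And>n. norm ((G ^^ n) x - (G ^^ n) y) \<le> C * r ^ n"
    and conj: "\<And>x. H (G x) = T (H x)" and T: "linear T" "T (H x - H y) = \<theta> *\<^sub>R (H x - H y)"
    and r: "0 \<le> r" and ne: "H x \<noteq> H y"
  shows "\<bar>\<theta>\<bar> \<le> max 1 r"
proof (rule ccontr)
  assume "\<not> \<bar>\<theta>\<bar> \<le> max 1 r"
  then have \<theta>: "1 < \<bar>\<theta>\<bar>" "r < \<bar>\<theta>\<bar>" by auto
  obtain C1 C2 where C: "\<And>n. norm (H ((G ^^ n) x) - H ((G ^^ n) y)) \<le> C1 + C2 * r ^ n"
    using semiconjugate_growth[OF H G] by blast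
  have p: "H ((G ^^ n) x) - H ((G ^^ n) y) = \<theta> ^ n *\<^sub>R (H x - H y)" for n
  proof (induction n)
    case (Suc n)
    have "H ((G ^^ Suc n) x) - H ((G ^^ Suc n) y) = T (H ((G ^^ n) x) - H ((G ^^ n) y))"
      by (simp add: conj linear_diff[OF T(1)])
    also have "\<dots> = \<theta> ^ n *\<^sub>R T (H x - H y)" unfolding Suc by (rule linear_cmul[OF T(1)])
    also have "\<dots> = \<theta> ^ Suc n *\<^sub>R (H x - H y)" unfolding T(2) by simp
    finally show ?case .
  qed simp
  have "norm (H x - H y) * \<bar>\<theta>\<bar> ^ n \<le> C1 * 1 ^ n + C2 * r ^ n + 0 * 0 ^ n" for n
    using C[of n] unfolding p by (simp add: power_abs mult.commute)
  then have "norm (H x - H y) \<le> 0" by (rule exp_sum_dominates) (use r \<theta> in auto)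
  then show False using ne by simp
qed

text \<open>The image under \<open>H\<close> of the chosen representative of \<open>p\<close> and
  the chosen representative of \<open>h p\<close> differ by a lattice vector, which the projection
  forgets.\<close>

lemma leaf_projection:
  assumes "is_lift H h" "\<And>x. H ` W x = linfol V (H x)"
  shows "h ` tleaf W p = tleaf (linfol V) (h p)"
proof -
  have l: "h (tproj x) = tproj (H x)" for x using assms(1) by (simp add: is_lift_def)
  have "tproj (H (rep_torus p)) = tproj (rep_torus (h p))" unfolding l[symmetric] by simp
  then have n: "ivec (H (rep_torus p) - rep_torus (h p))" unfolding tproj_eq_iff .
  have e: "tproj (H (rep_torus p) + v) = tproj (rep_torus (h p) + v)" for v
    unfolding tproj_eq_iff using n by (simp add: algebra_simps)
  have "h ` tleaf W p = tproj ` H ` W (rep_torus p)" by (simp add: tleaf_def image_image l)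
  also have "\<dots> = (\<lambda>v. tproj (H (rep_torus p) + v)) ` V" unfolding assms(2) linfol_def by auto
  also have "\<dots> = (\<lambda>v. tproj (rep_torus (h p) + v)) ` V" by (simp add: e)
  also have "\<dots> = tleaf (linfol V) (h p)" unfolding tleaf_def linfol_def by auto
  finally show ?thesis .
qed

text \<open>Nonzero eigenfunctionals with different eigenvalues are independent, so their common
  kernel is a line, spanned by \<open>w\<close>.\<close>

lemma common_kernel_of_eigenfunctionals:
  fixes M :: "real^3^3"
  assumes s: "\<And>x. \<phi>s \<bullet> (M *v x) = ls * (\<phi>s \<bullet> x)" "\<phi>s \<noteq> 0" and u: "\<And>x. \<phi>u \<bullet> (M *v x) = lu * (\<phi>u \<bullet> x)" "\<phi>u \<noteq> 0"
    and ne: "ls \<noteq> lu" and w: "w \<noteq> 0" "\<phi>s \<bullet> w = 0" "\<phi>u \<bullet> w = 0" and x: "\<phi>s \<bullet> x = 0" "\<phi>u \<bullet> x = 0"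
  shows "x \<in> span {w}"
proof -
  define S where "S = span {\<phi>s, \<phi>u}"
  define Z where "Z = {y \<in> UNIV. \<forall>x \<in> S. orthogonal x y}"
  have "\<phi>s \<notin> span {\<phi>u}"
  proof
    assume "\<phi>s \<in> span {\<phi>u}"
    then obtain k where k: "\<phi>s = k *\<^sub>R \<phi>u" by (auto simp: span_singleton)
    have "ls * (\<phi>s \<bullet> x) = lu * (\<phi>s \<bullet> x)" for x
      using s(1)[of x] u(1)[of x] by (auto simp: k)
    then have "\<phi>s \<bullet> x = 0" for x using ne by (metis mult_right_cancel)
    from this[of \<phi>s] show False using s(2) by simp
  qed
  then have "independent {\<phi>s, \<phi>u}" "\<phi>s \<noteq> \<phi>u" using u(2) span_base[of \<phi>u "{\<phi>u}"]
    by (auto simp: independent_insert)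
  then have "dim S = 2" unfolding S_def dim_span by (subst dim_eq_card_independent) auto
  moreover have "dim Z + dim S = dim (UNIV :: (real^3) set)"
    unfolding Z_def by (rule dim_subspace_orthogonal_to_vectors) (auto simp: S_def)
  ultimately have dZ: "dim Z = 1" by simp
  have mem: "y \<in> Z" if "\<phi>s \<bullet> y = 0" "\<phi>u \<bullet> y = 0" for y
  proof -
    have "S \<subseteq> {z. z \<bullet> y = 0}"
      unfolding S_def by (rule span_minimal) (auto simp: that subspace_def inner_add_left)
    then show ?thesis by (auto simp: Z_def orthogonal_def)
  qed
  have "span {w} = Z"
  proof (rule subspace_dim_equal)
    show sub: "subspace Z" unfolding Z_def by (auto simp: subspace_def orthogonal_def inner_add_right)
    show "span {w} \<subseteq> Z" using mem[OF w(2,3)] sub by (intro span_minimal) auto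
    show "dim Z \<le> dim (span {w})" using w(1) dZ by (simp add: dim_singleton)
  qed simp
  then show ?thesis using mem[OF x] by simp
qed

section \<open>The conjugacy and the three eigenlines\<close>

text \<open>Both \<open>M\<close> and \<open>Mi\<close> preserve the lattice and the charts serve
  both strong lines, so that \<open>us_conj\<close> can be interpreted in either time
  direction.\<close>

locale ph_conj = ph F Fi A Ai N Es Ec Eu \<sigma> \<mu>
  for F Fi :: "real^3 \<Rightarrow> real^3" and A Ai :: "real^3 \<Rightarrow> real^3 \<Rightarrow> real^3" and N :: "real^3 \<Rightarrow> real^3 \<Rightarrow> real"
    and Es Ec Eu :: "real^3 \<Rightarrow> (real^3) set" and \<sigma> \<mu> :: real +
  fixes H K Mi :: "real^3 \<Rightarrow> real^3" and M :: "real^3^3"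
  assumes \<sigma>1: "\<sigma> < 1" and \<mu>1: "1 < \<mu>"
    and HK: "\<And>x. H (K x) = x" and KH: "\<And>x. K (H x) = x"
    and H_cont: "continuous_on UNIV H" and K_cont: "continuous_on UNIV K"
    and H_eq: "int_equivariant H" and K_eq: "int_equivariant K"
    and HF: "\<And>x. H (F x) = M *v H x" and Mi_lin: "linear Mi"
    and MMi: "\<And>w. M *v Mi w = w" and MiM: "\<And>w. Mi (M *v w) = w"
    and M_int: "\<And>n. ivec n \<Longrightarrow> ivec (M *v n)" and Mi_int: "\<And>n. ivec n \<Longrightarrow> ivec (Mi n)"
    and det: "\<bar>det M\<bar> = 1" "det (mat 1 - M) \<noteq> 0" "det (mat (-1) - M) \<noteq> 0"
    and charts: "\<And>q. \<exists>\<psi>. plaque_chart \<psi> ps \<and> plaque_chart \<psi> pu \<and> q \<in> \<psi> ` chart_dom"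
begin

lemma HFi: "H (Fi x) = Mi (H x)"
  by (metis FFi HF MiM)

text \<open>\<open>us_conj\<close> is interpreted forwards or backwards, according to which of
  \<open>M\<close> and its inverse has the isolated contracted eigenline. Backwards,
  \<open>e\<close> spans the unstable line and \<open>\<omega>\<close> the stable one, and
  eigenvalues become reciprocals.\<close>

lemma us_lines:
  "\<exists>es eu ls lu. es \<noteq> 0 \<and> eu \<noteq> 0 \<and> M *v es = ls *\<^sub>R es \<and> M *v eu = lu *\<^sub>R eu \<and> ls \<noteq> 0 \<and> \<bar>ls\<bar> \<le> \<sigma> \<and> \<mu> \<le> \<bar>lu\<bar> \<and>
    (\<forall>x y. exp_close F \<sigma> x y \<longrightarrow> H x - H y \<in> span {es}) \<and>
    (\<forall>x y. exp_close Fi (1 / \<mu>) x y \<longrightarrow> H x - H y \<in> span {eu}) \<and>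
    (\<forall>\<psi> t u1 u2. plaque_chart \<psi> ps \<longrightarrow> plaque_chart \<psi> pu \<longrightarrow> t \<in> ball 0 1 \<longrightarrow> u1 \<in> ball 0 1 \<longrightarrow> u2 \<in> ball 0 1 \<longrightarrow>
       H (\<psi> (u1, t)) - H (\<psi> (u2, t)) \<in> ssum (span {eu}) (span {es}))"
proof -
  note lines = contracting_lines[OF \<sigma>1 \<mu>1]
  obtain e \<kappa> \<phi> where "hyp_split ((*v) M) Mi e \<kappa> \<phi> \<or> hyp_split Mi ((*v) M) e \<kappa> \<phi>"
    using hyperbolic_matrix_split[OF det MMi MiM Mi_lin] by blast
  then show ?thesis
  proof
    assume sp: "hyp_split ((*v) M) Mi e \<kappa> \<phi>"
    interpret us_conj F Fi A Ai H K "(*v) M" Mi ps pu \<sigma> "1 / \<mu>" e \<kappa> \<phi>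
      by unfold_locales (auto simp: lines FFi FiF F_eq Fi_eq HK KH H_cont K_cont H_eq K_eq HF MMi MiM Mi_int sp charts
        linear_add[OF Mi_lin] linear_cmul[OF Mi_lin] matrix_vector_right_distrib matrix_vector_mult_scaleR)
    obtain \<omega> \<theta> where w: "\<omega> \<noteq> 0" "M *v \<omega> = \<theta> *\<^sub>R \<omega>" "1 / (1 / \<mu>) \<le> \<bar>\<theta>\<bar>" "\<bar>\<kappa>\<bar> \<le> \<sigma>"
      "\<forall>x y. exp_close F \<sigma> x y \<longrightarrow> (\<exists>t. H x - H y = t *\<^sub>R e)" "\<forall>x y. exp_close Fi (1 / \<mu>) x y \<longrightarrow> (\<exists>t. H x - H y = t *\<^sub>R \<omega>)"
      "\<forall>\<psi> t u1 u2. plaque_chart \<psi> ps \<longrightarrow> plaque_chart \<psi> pu \<longrightarrow> t \<in> ball 0 1 \<longrightarrow> u1 \<in> ball 0 1 \<longrightarrow> u2 \<in> ball 0 1 \<longrightarrow>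
       (\<exists>a b. H (\<psi> (u1, t)) - H (\<psi> (u2, t)) = a *\<^sub>R e + b *\<^sub>R \<omega>)"
      using us_conj_main by (elim exE conjE) (rule that)
    show ?thesis
    proof (rule exI[of _ e], rule exI[of _ \<omega>], rule exI[of _ \<kappa>], rule exI[of _ \<theta>], intro conjI allI impI)
      fix \<psi> :: "(real^2) \<times> real \<Rightarrow> real^3" and t :: real and u1 u2 :: "real^2"
      assume a: "plaque_chart \<psi> ps" "plaque_chart \<psi> pu" "t \<in> ball 0 1" "u1 \<in> ball 0 1" "u2 \<in> ball (0::real^2) 1"
      obtain a b where ab: "H (\<psi> (u1, t)) - H (\<psi> (u2, t)) = a *\<^sub>R e + b *\<^sub>R \<omega>" using w(7)[rule_format, OF a] by blast
      show "H (\<psi> (u1, t)) - H (\<psi> (u2, t)) \<in> ssum (span {\<omega>}) (span {e})"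
        unfolding ab ssum_def by (intro CollectI exI[of _ "b *\<^sub>R \<omega>"] exI[of _ "a *\<^sub>R e"]) (auto simp: span_singleton)
    next
      show "H x - H y \<in> span {e}" if "exp_close F \<sigma> x y" for x y
        using w(5)[rule_format, OF that] by (auto simp: span_singleton)
      show "H x - H y \<in> span {\<omega>}" if "exp_close Fi (1 / \<mu>) x y" for x y
        using w(6)[rule_format, OF that] by (auto simp: span_singleton)
    qed (use w(1-4) e0 Me \<kappa>0 in auto)
  next
    assume sp: "hyp_split Mi ((*v) M) e \<kappa> \<phi>"
    have inv: "M *v v = (1 / l) *\<^sub>R v" if "Mi v = l *\<^sub>R v" "l \<noteq> 0" for v l
    proof -
      have "v = l *\<^sub>R (M *v v)" using MMi[of v] that(1) by (simp add: matrix_vector_mult_scaleR)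
      then have "(1 / l) *\<^sub>R v = (1 / l) *\<^sub>R (l *\<^sub>R (M *v v))" by simp
      then show ?thesis using that(2) by simp
    qed
    have charts': "\<exists>\<psi>. plaque_chart \<psi> pu \<and> plaque_chart \<psi> ps \<and> q \<in> \<psi> ` chart_dom" for q
      using charts[of q] by (elim exE conjE) (intro exI conjI)
    interpret us_conj Fi F Ai A H K Mi "(*v) M" pu ps "1 / \<mu>" \<sigma> e \<kappa> \<phi>
      by unfold_locales (auto simp: charts' lines FFi FiF F_eq Fi_eq HK KH H_cont K_cont H_eq K_eq HFi MMi MiM M_int sp
        linear_add[OF Mi_lin] linear_cmul[OF Mi_lin] matrix_vector_right_distrib matrix_vector_mult_scaleR)
    obtain \<omega> \<theta> where w: "\<omega> \<noteq> 0" "Mi \<omega> = \<theta> *\<^sub>R \<omega>" "1 / \<sigma> \<le> \<bar>\<theta>\<bar>" "\<bar>\<kappa>\<bar> \<le> 1 / \<mu>"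
      "\<forall>x y. exp_close Fi (1 / \<mu>) x y \<longrightarrow> (\<exists>t. H x - H y = t *\<^sub>R e)" "\<forall>x y. exp_close F \<sigma> x y \<longrightarrow> (\<exists>t. H x - H y = t *\<^sub>R \<omega>)"
      "\<forall>\<psi> t u1 u2. plaque_chart \<psi> pu \<longrightarrow> plaque_chart \<psi> ps \<longrightarrow> t \<in> ball 0 1 \<longrightarrow> u1 \<in> ball 0 1 \<longrightarrow> u2 \<in> ball 0 1 \<longrightarrow>
       (\<exists>a b. H (\<psi> (u1, t)) - H (\<psi> (u2, t)) = a *\<^sub>R e + b *\<^sub>R \<omega>)"
      using us_conj_main by (elim exE conjE) (rule that)
    have \<theta>: "0 < \<bar>\<theta>\<bar>" using w(3) \<sigma>\<mu>(1) by (meson less_le_trans zero_less_divide_1_iff)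
    have b: "\<bar>1 / \<theta>\<bar> \<le> \<sigma>" using w(3) \<theta> \<sigma>\<mu>(1) by (simp add: field_simps)
    have b': "\<mu> \<le> \<bar>1 / \<kappa>\<bar>" using w(4) \<kappa>0 \<mu>1 by (simp add: field_simps)
    show ?thesis
    proof (rule exI[of _ \<omega>], rule exI[of _ e], rule exI[of _ "1 / \<theta>"], rule exI[of _ "1 / \<kappa>"], intro conjI allI impI)
      fix \<psi> :: "(real^2) \<times> real \<Rightarrow> real^3" and t :: real and u1 u2 :: "real^2"
      assume a: "plaque_chart \<psi> ps" "plaque_chart \<psi> pu" "t \<in> ball 0 1" "u1 \<in> ball 0 1" "u2 \<in> ball (0::real^2) 1"
      obtain a b where ab: "H (\<psi> (u1, t)) - H (\<psi> (u2, t)) = a *\<^sub>R e + b *\<^sub>R \<omega>" using w(7)[rule_format, OF a(2,1,3-5)] by blast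
      show "H (\<psi> (u1, t)) - H (\<psi> (u2, t)) \<in> ssum (span {e}) (span {\<omega>})"
        unfolding ab ssum_def by (intro CollectI exI[of _ "a *\<^sub>R e"] exI[of _ "b *\<^sub>R \<omega>"]) (auto simp: span_singleton)
    next
      show "M *v \<omega> = (1 / \<theta>) *\<^sub>R \<omega>" by (rule inv[OF w(2)]) (use \<theta> in auto)
      show "M *v e = (1 / \<kappa>) *\<^sub>R e" by (rule inv[OF Me \<kappa>0])
      show "H x - H y \<in> span {e}" if "exp_close Fi (1 / \<mu>) x y" for x y
        using w(5)[rule_format, OF that] by (auto simp: span_singleton)
      show "H x - H y \<in> span {\<omega>}" if "exp_close F \<sigma> x y" for x y
        using w(6)[rule_format, OF that] by (auto simp: span_singleton)
    qed (use w(1) e0 \<theta> b b' in auto)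
  qed
qed

text \<open>\<open>x0\<close> and \<open>y0\<close> stand for two points of a centre leaf. Slow
  growth in both time directions puts the difference of their images into the common kernel of the
  left eigenvectors for \<open>ls\<close> and \<open>lu\<close>, a line preserved by
  \<open>M\<close>: this is the origin of the third eigenvector.\<close>

lemma splitting:
  assumes ne: "x0 \<noteq> y0" and fw: "\<And>n. norm ((F ^^ n) x0 - (F ^^ n) y0) \<le> C1 * c ^ n" "0 \<le> c" "c < \<mu>"
    and bw: "\<And>n. norm ((Fi ^^ n) x0 - (Fi ^^ n) y0) \<le> C2 * r ^ n" "0 \<le> r" "r < 1 / \<sigma>"
  shows "\<exists>es ec eu ls lc lu a d. M *v es = ls *\<^sub>R es \<and> M *v ec = lc *\<^sub>R ec \<and> M *v eu = lu *\<^sub>R eu \<and>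
    es \<noteq> 0 \<and> ec \<noteq> 0 \<and> eu \<noteq> 0 \<and> ls \<noteq> 0 \<and> \<bar>ls\<bar> < \<bar>lc\<bar> \<and> \<bar>lc\<bar> < \<bar>lu\<bar> \<and> \<bar>ls\<bar> < 1 \<and> 1 < \<bar>lu\<bar> \<and>
    a \<bullet> es = 1 \<and> a \<bullet> ec = 0 \<and> a \<bullet> eu = 0 \<and> d \<bullet> es = 0 \<and> d \<bullet> ec = 0 \<and> d \<bullet> eu = 1 \<and>
    (\<forall>x. a \<bullet> x = 0 \<longrightarrow> d \<bullet> x = 0 \<longrightarrow> x \<in> span {ec}) \<and>
    (\<forall>x y. exp_close F \<sigma> x y \<longrightarrow> H x - H y \<in> span {es}) \<and>
    (\<forall>x y. exp_close Fi (1 / \<mu>) x y \<longrightarrow> H x - H y \<in> span {eu}) \<and>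
    (\<forall>x y C r. (\<forall>n. norm ((F ^^ n) x - (F ^^ n) y) \<le> C * r ^ n) \<longrightarrow> 0 \<le> r \<longrightarrow> r < \<mu> \<longrightarrow> d \<bullet> (H x - H y) = 0) \<and>
    (\<forall>x y C r. (\<forall>n. norm ((Fi ^^ n) x - (Fi ^^ n) y) \<le> C * r ^ n) \<longrightarrow> 0 \<le> r \<longrightarrow> r < 1 / \<sigma> \<longrightarrow> a \<bullet> (H x - H y) = 0) \<and>
    (\<forall>\<psi> t u1 u2. plaque_chart \<psi> ps \<longrightarrow> plaque_chart \<psi> pu \<longrightarrow> t \<in> ball 0 1 \<longrightarrow> u1 \<in> ball 0 1 \<longrightarrow> u2 \<in> ball 0 1 \<longrightarrow>
       H (\<psi> (u1, t)) - H (\<psi> (u2, t)) \<in> ssum (span {eu}) (span {es}))"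
proof -
  obtain es eu ls lu where us: "es \<noteq> 0" "eu \<noteq> 0" "M *v es = ls *\<^sub>R es" "M *v eu = lu *\<^sub>R eu" "ls \<noteq> 0" "\<bar>ls\<bar> \<le> \<sigma>" "\<mu> \<le> \<bar>lu\<bar>"
    "\<forall>x y. exp_close F \<sigma> x y \<longrightarrow> H x - H y \<in> span {es}"
    "\<forall>x y. exp_close Fi (1 / \<mu>) x y \<longrightarrow> H x - H y \<in> span {eu}"
    "\<forall>\<psi> t u1 u2. plaque_chart \<psi> ps \<longrightarrow> plaque_chart \<psi> pu \<longrightarrow> t \<in> ball 0 1 \<longrightarrow> u1 \<in> ball 0 1 \<longrightarrow> u2 \<in> ball 0 1 \<longrightarrow>
       H (\<psi> (u1, t)) - H (\<psi> (u2, t)) \<in> ssum (span {eu}) (span {es})"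
    using us_lines by (elim exE conjE) (rule that)
  have Ml: "linear ((*v) M)" by simp
  obtain \<phi>s where \<phi>s: "\<phi>s \<noteq> 0" "\<And>x. \<phi>s \<bullet> (M *v x) = ls * (\<phi>s \<bullet> x)" using left_eigenvector[OF Ml us(3,1)] by blast
  obtain \<phi>u where \<phi>u: "\<phi>u \<noteq> 0" "\<And>x. \<phi>u \<bullet> (M *v x) = lu * (\<phi>u \<bullet> x)" using left_eigenvector[OF Ml us(4,2)] by blast
  have \<phi>s': "\<phi>s \<bullet> Mi x = (1 / ls) * (\<phi>s \<bullet> x)" for x using \<phi>s(2)[of "Mi x"] us(5) by (simp add: MMi)
  have l: "\<bar>ls\<bar> < 1" "1 < \<bar>lu\<bar>" "\<bar>ls\<bar> < \<bar>lu\<bar>" using us(6,7) \<sigma>1 \<mu>1 by auto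
  have li: "1 / \<sigma> \<le> \<bar>1 / ls\<bar>" "1 < \<bar>1 / ls\<bar>" using us(5,6) \<sigma>\<mu>(1) l(1) by (simp_all add: field_simps)
  have FW: "\<phi>u \<bullet> (H x - H y) = 0" if "\<And>n. norm ((F ^^ n) x - (F ^^ n) y) \<le> C * r ^ n" "0 \<le> r" "r < \<mu>" for x y C r
    by (rule functional_vanishes[OF H_cont H_eq that(1) HF \<phi>u(2) l(2) that(2)]) (use that(3) us(7) in auto)
  have BW: "\<phi>s \<bullet> (H x - H y) = 0" if "\<And>n. norm ((Fi ^^ n) x - (Fi ^^ n) y) \<le> C * r ^ n" "0 \<le> r" "r < 1 / \<sigma>" for x y C r
    by (rule functional_vanishes[OF H_cont H_eq that(1) HFi \<phi>s' li(2) that(2)]) (use that(3) li(1) in auto)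
  define w where "w = H x0 - H y0"
  have Hne: "H x0 \<noteq> H y0" using ne KH by metis
  then have w: "w \<noteq> 0" by (simp add: w_def)
  have wk: "\<phi>s \<bullet> w = 0" "\<phi>u \<bullet> w = 0" unfolding w_def by (rule BW[OF bw], rule FW[OF fw])
  have ker: "x \<in> span {w}" if "\<phi>s \<bullet> x = 0" "\<phi>u \<bullet> x = 0" for x
    by (rule common_kernel_of_eigenfunctionals[OF \<phi>s(2,1) \<phi>u(2,1) _ w wk that]) (use l in auto)
  have "M *v w \<in> span {w}" by (rule ker) (simp_all add: \<phi>s \<phi>u wk)
  then obtain lc where lc: "M *v w = lc *\<^sub>R w" by (auto simp: span_singleton)
  have lc0: "lc \<noteq> 0" using MiM[of w] lc w linear_0[OF Mi_lin] by auto
  have Miw: "Mi w = (1 / lc) *\<^sub>R w"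
  proof -
    have "lc *\<^sub>R Mi w = w" using MiM[of w] lc by (simp add: linear_cmul[OF Mi_lin])
    then have "(1 / lc) *\<^sub>R (lc *\<^sub>R Mi w) = (1 / lc) *\<^sub>R w" by simp
    then show ?thesis using lc0 by simp
  qed
  \<comment> \<open>Forward growth bounds \<open>lc\<close>, backward growth its inverse. The
    maximum with 1 comes from the additive constant for \<open>H\<close> and is harmless, as
    \<open>\<sigma> < 1 < \<mu>\<close>.\<close>
  have "\<bar>lc\<bar> \<le> max 1 c"
    by (rule eigenvalue_le_growth[OF H_cont H_eq fw(1) HF Ml lc[unfolded w_def] fw(2) Hne])
  then have lcu: "\<bar>lc\<bar> < \<bar>lu\<bar>" using fw(3) us(7) \<mu>1 by auto
  have "\<bar>1 / lc\<bar> \<le> max 1 r"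
    by (rule eigenvalue_le_growth[OF H_cont H_eq bw(1) HFi Mi_lin Miw[unfolded w_def] bw(2) Hne])
  moreover have "1 < 1 / \<sigma>" using \<sigma>1 \<sigma>\<mu>(1) by simp
  ultimately have "\<bar>1 / lc\<bar> < 1 / \<sigma>" using bw(3) by auto
  then have "\<sigma> < \<bar>lc\<bar>" using lc0 \<sigma>\<mu>(1) by (simp add: field_simps)
  then have lsc: "\<bar>ls\<bar> < \<bar>lc\<bar>" using us(6) by simp
  \<comment> \<open>A left eigenvector annihilates the right eigenvectors of every other
    eigenvalue.\<close>
  have orth: "\<phi>s \<bullet> eu = 0" "\<phi>u \<bullet> es = 0"
    using \<phi>s(2)[of eu] \<phi>u(2)[of es] us(3,4) l(3) by auto
  have off: "v \<notin> span {w}" if v: "M *v v = k *\<^sub>R v" "v \<noteq> 0" "k \<noteq> lc" for v k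
  proof
    assume "v \<in> span {w}"
    then obtain t where t: "v = t *\<^sub>R w" by (auto simp: span_singleton)
    then have "M *v v = lc *\<^sub>R v" by (simp add: matrix_vector_mult_scaleR lc)
    then show False using v by simp
  qed
  \<comment> \<open>Otherwise \<open>es\<close> would lie in the common kernel, on which
    \<open>M\<close> has the eigenvalue \<open>lc\<close>, different from \<open>ls\<close>;
    likewise for \<open>eu\<close>.\<close>
  have "\<phi>s \<bullet> es \<noteq> 0" using ker[of es] off[OF us(3,1)] orth lsc by auto
  moreover have "\<phi>u \<bullet> eu \<noteq> 0" using ker[of eu] off[OF us(4,2)] orth lcu by auto
  ultimately have nz: "\<phi>s \<bullet> es \<noteq> 0" "\<phi>u \<bullet> eu \<noteq> 0" .
  define a where "a = (1 / (\<phi>s \<bullet> es)) *\<^sub>R \<phi>s"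
  define d where "d = (1 / (\<phi>u \<bullet> eu)) *\<^sub>R \<phi>u"
  have az: "a \<bullet> x = 0 \<longleftrightarrow> \<phi>s \<bullet> x = 0" "d \<bullet> x = 0 \<longleftrightarrow> \<phi>u \<bullet> x = 0" for x using nz by (simp_all add: a_def d_def)
  have one: "a \<bullet> es = 1" "d \<bullet> eu = 1" using nz by (simp_all add: a_def d_def)
  have aux: "a \<bullet> w = 0" "a \<bullet> eu = 0" "d \<bullet> es = 0" "d \<bullet> w = 0"
    "\<forall>x. a \<bullet> x = 0 \<longrightarrow> d \<bullet> x = 0 \<longrightarrow> x \<in> span {w}"
    "\<forall>x y C r. (\<forall>n. norm ((F ^^ n) x - (F ^^ n) y) \<le> C * r ^ n) \<longrightarrow> 0 \<le> r \<longrightarrow> r < \<mu> \<longrightarrow> d \<bullet> (H x - H y) = 0"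
    "\<forall>x y C r. (\<forall>n. norm ((Fi ^^ n) x - (Fi ^^ n) y) \<le> C * r ^ n) \<longrightarrow> 0 \<le> r \<longrightarrow> r < 1 / \<sigma> \<longrightarrow> a \<bullet> (H x - H y) = 0"
    unfolding az using orth wk ker FW BW by blast+
  show ?thesis
    by (rule exI[of _ es], rule exI[of _ w], rule exI[of _ eu], rule exI[of _ ls], rule exI[of _ lc], rule exI[of _ lu],
        rule exI[of _ a], rule exI[of _ d]) (intro conjI us w lc lcu lsc l one aux)
qed

end

lemma fol_chart_plaque_chart:
  assumes "fol_chart TYPE(real^2) TYPE(real) E W \<psi>" "\<And>x v. p x v \<in> E (tproj x)"
  shows "plaque_chart \<psi> p"
proof -
  have c: "inj_on \<psi> chart_dom" "continuous_on chart_dom \<psi>" "open (\<psi> ` chart_dom)"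
    "continuous_on (\<psi> ` chart_dom) (inv_into chart_dom \<psi>)" "\<forall>t\<in>ball 0 1. tangent_disc E (\<lambda>u. \<psi> (u, t))"
    using assms(1) unfolding fol_chart_def Let_def by blast+
  show ?thesis unfolding plaque_chart_def
  proof (intro conjI c(1-4) ballI)
    fix t :: real assume "t \<in> ball 0 1"
    with c(5) have "tangent_disc E (\<lambda>u. \<psi> (u, t))" by blast
    then obtain g' where g: "\<forall>u\<in>ball 0 1. ((\<lambda>u. \<psi> (u, t)) has_derivative blinfun_apply (g' u)) (at u)"
      "continuous_on (ball 0 1) g'"
      "\<forall>u\<in>ball 0 1. inj (blinfun_apply (g' u)) \<and> range (blinfun_apply (g' u)) = E (tproj (\<psi> (u, t)))"
      unfolding tangent_disc_def by blast
    show "\<exists>g'. (\<forall>u\<in>ball 0 1. ((\<lambda>u. \<psi> (u, t)) has_derivative blinfun_apply (g' u)) (at u)) \<and>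
        continuous_on (ball 0 1) g' \<and>
        (\<forall>u\<in>ball 0 1. inj (blinfun_apply (g' u)) \<and> range (p (\<psi> (u, t))) \<subseteq> range (blinfun_apply (g' u)))"
      using g assms(2) by (intro exI[of _ g']) auto
  qed
qed

theorem theorem6p1:
  fixes f h A :: "torus \<Rightarrow> torus"
    and Es Ec Eu :: "torus \<Rightarrow> (real^3) set"
    and Ws Wc Wu Wcs Wcu Wus :: "real^3 \<Rightarrow> (real^3) set"
  assumes diffeo: "tC1_diffeo f"
    and PH: "abs_PH f Es Ec Eu"
    and Ws: "fol1 Es Ws" "f_invariant f Ws"
    and Wc: "fol1 Ec Wc" "f_invariant f Wc"
    and Wu: "fol1 Eu Wu" "f_invariant f Wu"
    and Wcs: "fol2 (\<lambda>p. ssum (Ec p) (Es p)) Wcs" "f_invariant f Wcs"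
    and Wcu: "fol2 (\<lambda>p. ssum (Ec p) (Eu p)) Wcu" "f_invariant f Wcu"
    and Wus: "fol2 (\<lambda>p. ssum (Eu p) (Es p)) Wus"
    and hA: "hyp_toral_aut A"
    and hhomeo: "thomeo h"
    and conj: "h \<circ> f = A \<circ> h"
  shows "\<exists>EsA EcA EuA :: (real^3) set.
           abs_PH A (\<lambda>_. EsA) (\<lambda>_. EcA) (\<lambda>_. EuA) \<and>
           (\<forall>p. h ` tleaf Ws p = tleaf (linfol EsA) (h p) \<and>
                h ` tleaf Wc p = tleaf (linfol EcA) (h p) \<and>
                h ` tleaf Wu p = tleaf (linfol EuA) (h p) \<and>
                h ` tleaf Wcs p = tleaf (linfol (ssum EcA EsA)) (h p) \<and>
                h ` tleaf Wcu p = tleaf (linfol (ssum EcA EuA)) (h p) \<and>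
                h ` tleaf Wus p = tleaf (linfol (ssum EuA EsA)) (h p))"
proof -
  obtain M :: "real^3^3" where M: "\<And>x. A (tproj x) = tproj (M *v x)" "\<bar>det M\<bar> = 1" "det (mat 1 - M) \<noteq> 0"
    "det (mat (-1) - M) \<noteq> 0" "\<And>n. ivec n \<Longrightarrow> ivec (M *v n)" using hyp_toral_autE[OF hA] by blast
  obtain B where B: "M ** B = mat 1" "B ** M = mat 1"
    using M(2) invertible_det_nz[of M] unfolding invertible_def by fastforce
  define Mi where "Mi = (*v) B"
  have MMi: "M *v Mi w = w" and MiM: "Mi (M *v w) = w" for w
    unfolding Mi_def by (simp_all add: matrix_vector_mul_assoc B)
  have Mi_lin: "linear Mi" by (simp add: Mi_def)
  obtain H K where lifts: "continuous_on UNIV H" "is_lift H h" "continuous_on UNIV K" "is_lift K (inv h)"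
    "\<And>x. K (H x) = x" "\<And>x. H (K x) = x" using thomeo_lift[OF hhomeo] by blast
  have bij: "bij h" "bij f" using hhomeo diffeo by (auto simp: thomeo_def tC1_diffeo_def)
  have hf: "h (f p) = A (h p)" for p using fun_cong[OF conj, of p] by simp
  \<comment> \<open>The conjugacy makes \<open>A\<close> injective on the torus. This forces the
    inverse matrix to preserve the lattice: a lattice vector comes from a vector that
    \<open>A\<close> cannot distinguish from 0.\<close>
  have injA: "p = q" if "A p = A q" for p q
  proof -
    obtain p' q' where "p = h p'" "q = h q'" using bij(1) by (meson bij_pointE)
    then have "h (f p') = h (f q')" using that by (simp add: hf)
    then have "p' = q'" using bij by (meson bij_is_inj injD)
    then show ?thesis using \<open>p = h p'\<close> \<open>q = h q'\<close> by simp
  qed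
  have Mi_int: "ivec (Mi n)" if "ivec n" for n
  proof -
    have "A (tproj (Mi n)) = A (tproj 0)" using that by (simp add: M(1) MMi tproj_eq_iff)
    then have "tproj (Mi n) = tproj 0" by (rule injA)
    then show ?thesis by (simp add: tproj_eq_iff)
  qed
  \<comment> \<open>The lift of \<open>f\<close> is defined through \<open>H\<close>, so that the
    conjugacy holds exactly, without a lattice vector, and the inverse lift is explicit.\<close>
  define F where "F x = K (M *v H x)" for x
  define Fi where "Fi x = K (Mi (H x))" for x
  have Fc: "continuous_on UNIV F" unfolding F_def
    by (intro continuous_on_compose2[OF lifts(3)] continuous_on_compose2[OF linear_continuous_on[of "(*v) M" UNIV]] lifts(1))
      (auto simp: linear_conv_bounded_linear[symmetric])
  have Fic: "continuous_on UNIV Fi" unfolding Fi_def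
    by (intro continuous_on_compose2[OF lifts(3)] continuous_on_compose2[OF linear_continuous_on[of Mi UNIV]] lifts(1))
      (auto simp: linear_conv_bounded_linear[symmetric] Mi_lin)
  have hl: "tproj (H x) = h (tproj x)" "tproj (K x) = inv h (tproj x)" for x using lifts(2,4) by (simp_all add: is_lift_def)
  have Fl: "is_lift F f" unfolding is_lift_def F_def
    using bij(1) by (simp add: hl M(1)[symmetric] hf[symmetric] bij_is_inj)
  have FFi: "F (Fi x) = x" and FiF: "Fi (F x) = x" for x by (simp_all add: F_def Fi_def lifts MMi MiM)
  obtain A' Ai N \<sigma> \<mu> where ph: "ph F Fi A' Ai N (\<lambda>x. Es (tproj x)) (\<lambda>x. Ec (tproj x)) (\<lambda>x. Eu (tproj x)) \<sigma> \<mu>"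
    and \<sigma>\<mu>1: "\<sigma> < 1" "1 < \<mu>"
    using lifted_ph[OF diffeo PH Ws(1) Wc(1) Wu(1) Fc Fl Fic FFi FiF] by blast
  interpret ph F Fi A' Ai N "\<lambda>x. Es (tproj x)" "\<lambda>x. Ec (tproj x)" "\<lambda>x. Eu (tproj x)" \<sigma> \<mu> by (rule ph)
  have us_charts: "plaque_chart \<psi> ps" "plaque_chart \<psi> pu"
    if "fol_chart TYPE(real^2) TYPE(real) (\<lambda>p. ssum (Eu p) (Es p)) Wus \<psi>" for \<psi>
  proof -
    have "ps x v \<in> ssum (Eu (tproj x)) (Es (tproj x))" "pu x v \<in> ssum (Eu (tproj x)) (Es (tproj x))" for x v
      unfolding ssum_def using proj(1,3)[of x v] subspace_0[OF sub(1)[of x]] subspace_0[OF sub(3)[of x]] by force+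
    then show "plaque_chart \<psi> ps" "plaque_chart \<psi> pu" using fol_chart_plaque_chart[OF that] by blast+
  qed
  interpret ph_conj F Fi A' Ai N "\<lambda>x. Es (tproj x)" "\<lambda>x. Ec (tproj x)" "\<lambda>x. Eu (tproj x)" \<sigma> \<mu> H K Mi M
  proof
    show "int_equivariant H" "int_equivariant K" using lifts lift_int_equivariant by blast+
    show "\<exists>\<psi>. plaque_chart \<psi> ps \<and> plaque_chart \<psi> pu \<and> q \<in> \<psi> ` chart_dom" for q
      using Wus us_charts unfolding tangent_foliation_def by blast
    show "H (F x) = M *v H x" for x by (simp add: F_def lifts)
  qed (use lifts M Mi_int MMi MiM \<sigma>\<mu>1 linear_add[OF Mi_lin] linear_cmul[OF Mi_lin] in auto)
  obtain Kb b c where g: "0 < Kb" "\<sigma> < b" "0 < c" "c < \<mu>"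
    "\<forall>x v n. v \<in> Es (tproj x) \<longrightarrow> norm (D n x v) \<le> Kb * \<sigma> ^ n * norm v"
    "\<forall>x v n. v \<in> Eu (tproj x) \<longrightarrow> norm (Di n x v) \<le> Kb * (1 / \<mu>) ^ n * norm v"
    "\<forall>x v n. v \<in> Ec (tproj x) \<longrightarrow> norm (D n x v) \<le> Kb * c ^ n * norm v"
    "\<forall>x v n. v \<in> Ec (tproj x) \<longrightarrow> norm (Di n x v) \<le> Kb * (1 / b) ^ n * norm v"
    "\<forall>x v n. v \<in> ssum (Ec (tproj x)) (Es (tproj x)) \<longrightarrow> norm (D n x v) \<le> Kb * c ^ n * norm v"
    "\<forall>x v n. v \<in> ssum (Ec (tproj x)) (Eu (tproj x)) \<longrightarrow> norm (Di n x v) \<le> Kb * (1 / b) ^ n * norm v"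
    using bundle_growth by (elim exE conjE) (rule that)
  have b: "0 < b" "0 < 1 / b" "1 / b < 1 / \<sigma>" "0 < 1 / \<mu>" using g(2) \<sigma>\<mu>1 ph.\<sigma>\<mu>(1)[OF ph] by (auto simp: field_simps)
  note K0 = less_imp_le[OF g(1)]
  note dF = disc_growth[where G = F and A = A', OF _ F_der K0] and dFi = disc_growth[where G = Fi and A = Ai, OF _ Fi_der K0]
  have s_growth: "\<exists>C. \<forall>n. norm ((F ^^ n) (\<gamma> u1) - (F ^^ n) (\<gamma> u2)) \<le> C * \<sigma> ^ n"
    if "tangent_disc Es \<gamma>" "u1 \<in> ball 0 1" "u2 \<in> ball 0 1" for \<gamma> :: "real \<Rightarrow> real^3" and u1 u2
    by (rule dF[OF that(1) ph.\<sigma>\<mu>(1)[OF ph] _ that(2,3)]) (use g(5) in blast)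
  have u_growth: "\<exists>C. \<forall>n. norm ((Fi ^^ n) (\<gamma> u1) - (Fi ^^ n) (\<gamma> u2)) \<le> C * (1 / \<mu>) ^ n"
    if "tangent_disc Eu \<gamma>" "u1 \<in> ball 0 1" "u2 \<in> ball 0 1" for \<gamma> :: "real \<Rightarrow> real^3" and u1 u2
    by (rule dFi[OF that(1) b(4) _ that(2,3)]) (use g(6) in blast)
  have c_growth: "\<exists>C. \<forall>n. norm ((F ^^ n) (\<gamma> u1) - (F ^^ n) (\<gamma> u2)) \<le> C * c ^ n"
    "\<exists>C. \<forall>n. norm ((Fi ^^ n) (\<gamma> u1) - (Fi ^^ n) (\<gamma> u2)) \<le> C * (1 / b) ^ n"
    if "tangent_disc Ec \<gamma>" "u1 \<in> ball 0 1" "u2 \<in> ball 0 1" for \<gamma> :: "real \<Rightarrow> real^3" and u1 u2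
  proof -
    show "\<exists>C. \<forall>n. norm ((F ^^ n) (\<gamma> u1) - (F ^^ n) (\<gamma> u2)) \<le> C * c ^ n"
      by (rule dF[OF that(1) g(3) _ that(2,3)]) (use g(7) in blast)
    show "\<exists>C. \<forall>n. norm ((Fi ^^ n) (\<gamma> u1) - (Fi ^^ n) (\<gamma> u2)) \<le> C * (1 / b) ^ n"
      by (rule dFi[OF that(1) b(2) _ that(2,3)]) (use g(8) in blast)
  qed
  have cs_growth: "\<exists>C. \<forall>n. norm ((F ^^ n) (\<gamma> u1) - (F ^^ n) (\<gamma> u2)) \<le> C * c ^ n"
    if "tangent_disc (\<lambda>p. ssum (Ec p) (Es p)) \<gamma>" "u1 \<in> ball 0 1" "u2 \<in> ball 0 1" for \<gamma> :: "real^2 \<Rightarrow> real^3" and u1 u2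
    by (rule dF[OF that(1) g(3) _ that(2,3)]) (use g(9) in blast)
  have cu_growth: "\<exists>C. \<forall>n. norm ((Fi ^^ n) (\<gamma> u1) - (Fi ^^ n) (\<gamma> u2)) \<le> C * (1 / b) ^ n"
    if "tangent_disc (\<lambda>p. ssum (Ec p) (Eu p)) \<gamma>" "u1 \<in> ball 0 1" "u2 \<in> ball 0 1" for \<gamma> :: "real^2 \<Rightarrow> real^3" and u1 u2
    by (rule dFi[OF that(1) b(2) _ that(2,3)]) (use g(10) in blast)
  have disc1: "tangent_disc E (\<lambda>u. \<psi> (u, t))" if "fol_chart TYPE(real) TYPE(real^2) E W \<psi>" "t \<in> ball 0 1" for E W \<psi> t
    using that unfolding fol_chart_def Let_def by blast
  have disc2: "tangent_disc E (\<lambda>u. \<psi> (u, t))" if "fol_chart TYPE(real^2) TYPE(real) E W \<psi>" "t \<in> ball 0 1" for E W \<psi> t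
    using that unfolding fol_chart_def Let_def by blast
  \<comment> \<open>Two distinct points of any one centre plaque are all that
    \<open>splitting\<close> requires.\<close>
  obtain \<psi>c where \<psi>c: "fol_chart TYPE(real) TYPE(real^2) Ec Wc \<psi>c" using Wc(1) unfolding tangent_foliation_def by blast
  define x0 where "x0 = \<psi>c (0, 0)"
  define y0 where "y0 = \<psi>c (1 / 2, 0)"
  have ne: "x0 \<noteq> y0"
  proof
    assume "x0 = y0"
    moreover have inj: "inj_on \<psi>c (ball 0 1 \<times> ball 0 1)" using \<psi>c unfolding fol_chart_def Let_def by blast
    ultimately have "(0 :: real, 0 :: real^2) = (1 / 2, 0)"
      unfolding x0_def y0_def by (intro inj_onD[OF inj]) auto
    then show False by simp
  qed
  have dc: "tangent_disc Ec (\<lambda>u. \<psi>c (u, 0))" by (rule disc1[OF \<psi>c]) simp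
  obtain C1 where C1: "\<And>n. norm ((F ^^ n) x0 - (F ^^ n) y0) \<le> C1 * c ^ n"
    using c_growth(1)[OF dc, of 0 "1/2"] unfolding x0_def y0_def by auto
  obtain C2 where C2: "\<And>n. norm ((Fi ^^ n) x0 - (Fi ^^ n) y0) \<le> C2 * (1 / b) ^ n"
    using c_growth(2)[OF dc, of 0 "1/2"] unfolding x0_def y0_def by auto
  obtain es ec eu ls lc lu a d where e: "M *v es = ls *\<^sub>R es" "M *v ec = lc *\<^sub>R ec" "M *v eu = lu *\<^sub>R eu"
    "es \<noteq> 0" "ec \<noteq> 0" "eu \<noteq> 0" "ls \<noteq> 0" "\<bar>ls\<bar> < \<bar>lc\<bar>" "\<bar>lc\<bar> < \<bar>lu\<bar>" "\<bar>ls\<bar> < 1" "1 < \<bar>lu\<bar>"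
    "a \<bullet> es = 1" "a \<bullet> ec = 0" "a \<bullet> eu = 0" "d \<bullet> es = 0" "d \<bullet> ec = 0" "d \<bullet> eu = 1"
    and ker: "\<forall>x. a \<bullet> x = 0 \<longrightarrow> d \<bullet> x = 0 \<longrightarrow> x \<in> span {ec}"
    and S: "\<forall>x y. exp_close F \<sigma> x y \<longrightarrow> H x - H y \<in> span {es}"
    and U: "\<forall>x y. exp_close Fi (1 / \<mu>) x y \<longrightarrow> H x - H y \<in> span {eu}"
    and FW: "\<forall>x y C r. (\<forall>n. norm ((F ^^ n) x - (F ^^ n) y) \<le> C * r ^ n) \<longrightarrow> 0 \<le> r \<longrightarrow> r < \<mu> \<longrightarrow> d \<bullet> (H x - H y) = 0"
    and BW: "\<forall>x y C r. (\<forall>n. norm ((Fi ^^ n) x - (Fi ^^ n) y) \<le> C * r ^ n) \<longrightarrow> 0 \<le> r \<longrightarrow> r < 1 / \<sigma> \<longrightarrow> a \<bullet> (H x - H y) = 0"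
    and US: "\<forall>\<psi> t u1 u2. plaque_chart \<psi> ps \<longrightarrow> plaque_chart \<psi> pu \<longrightarrow> t \<in> ball 0 1 \<longrightarrow> u1 \<in> ball 0 1 \<longrightarrow> u2 \<in> ball 0 1 \<longrightarrow>
       H (\<psi> (u1, t)) - H (\<psi> (u2, t)) \<in> ssum (span {eu}) (span {es})"
    using splitting[OF ne C1 less_imp_le[OF g(3)] g(4) C2 less_imp_le[OF b(2)] b(3)] by (elim exE conjE) (rule that)
  \<comment> \<open>The kernel of \<open>d\<close> is the linear centre-stable plane, and that of
    \<open>a\<close> the linear centre-unstable plane. So each plane leaf needs a single functional
    to vanish.\<close>
  have ker_d: "x \<in> ssum (span {ec}) (span {es})" if "d \<bullet> x = 0" for x
  proof -
    have "x - (a \<bullet> x) *\<^sub>R es \<in> span {ec}" by (rule ker[rule_format]) (simp_all add: inner_diff_right that e)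
    then show ?thesis unfolding ssum_def
      by (intro CollectI exI[of _ "x - (a \<bullet> x) *\<^sub>R es"] exI[of _ "(a \<bullet> x) *\<^sub>R es"]) (auto simp: span_singleton)
  qed
  have ker_a: "x \<in> ssum (span {ec}) (span {eu})" if "a \<bullet> x = 0" for x
  proof -
    have "x - (d \<bullet> x) *\<^sub>R eu \<in> span {ec}" by (rule ker[rule_format]) (simp_all add: inner_diff_right that e)
    then show ?thesis unfolding ssum_def
      by (intro CollectI exI[of _ "x - (d \<bullet> x) *\<^sub>R eu"] exI[of _ "(d \<bullet> x) *\<^sub>R eu"]) (auto simp: span_singleton)
  qed
  note FW' = FW[rule_format, OF _ less_imp_le[OF g(3)] g(4)] and BW' = BW[rule_format, OF _ less_imp_le[OF b(2)] b(3)]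
  have dim1: "dim (span {v :: real^3}) \<le> DIM(real)" for v by (simp add: dim_singleton)
  have dim2: "dim (ssum (span {v}) (span {w :: real^3})) \<le> DIM(real^2)" for v w
    using dim_le_card'[of "{v, w}"] card_insert_le_m1[of 2 "{w}" v] by (simp add: ssum_span)
  have ss: "subspace (ssum (span {v}) (span {w}))" for v w :: "real^3" by (simp add: ssum_span)
  have leaves: "H ` Ws x = linfol (span {es}) (H x)" "H ` Wc x = linfol (span {ec}) (H x)"
    "H ` Wu x = linfol (span {eu}) (H x)" "H ` Wcs x = linfol (ssum (span {ec}) (span {es})) (H x)"
    "H ` Wcu x = linfol (ssum (span {ec}) (span {eu})) (H x)" "H ` Wus x = linfol (ssum (span {eu}) (span {es})) (H x)" for x
  proof -
    show "H ` Ws x = linfol (span {es}) (H x)"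
    proof (rule leaf_image[OF Ws(1) subspace_span dim1 lifts(6,5,1)])
      fix \<psi> :: "real \<times> (real^2) \<Rightarrow> real^3" and t :: "real^2" and u1 u2 :: real
      assume "fol_chart TYPE(real) TYPE(real^2) Es Ws \<psi>" "t \<in> ball 0 1" "u1 \<in> ball 0 1" "u2 \<in> ball 0 1"
      then have "exp_close F \<sigma> (\<psi> (u1, t)) (\<psi> (u2, t))" unfolding exp_close_def using s_growth disc1 by blast
      then show "H (\<psi> (u1, t)) - H (\<psi> (u2, t)) \<in> span {es}" using S by blast
    qed
    show "H ` Wu x = linfol (span {eu}) (H x)"
    proof (rule leaf_image[OF Wu(1) subspace_span dim1 lifts(6,5,1)])
      fix \<psi> :: "real \<times> (real^2) \<Rightarrow> real^3" and t :: "real^2" and u1 u2 :: real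
      assume "fol_chart TYPE(real) TYPE(real^2) Eu Wu \<psi>" "t \<in> ball 0 1" "u1 \<in> ball 0 1" "u2 \<in> ball 0 1"
      then have "exp_close Fi (1 / \<mu>) (\<psi> (u1, t)) (\<psi> (u2, t))" unfolding exp_close_def using u_growth disc1 by blast
      then show "H (\<psi> (u1, t)) - H (\<psi> (u2, t)) \<in> span {eu}" using U by blast
    qed
    show "H ` Wc x = linfol (span {ec}) (H x)"
    proof (rule leaf_image[OF Wc(1) subspace_span dim1 lifts(6,5,1)])
      fix \<psi> :: "real \<times> (real^2) \<Rightarrow> real^3" and t :: "real^2" and u1 u2 :: real
      assume u: "fol_chart TYPE(real) TYPE(real^2) Ec Wc \<psi>" "t \<in> ball 0 1" "u1 \<in> ball 0 1" "u2 \<in> ball 0 1"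
      obtain C C' where "\<And>n. norm ((F ^^ n) (\<psi> (u1, t)) - (F ^^ n) (\<psi> (u2, t))) \<le> C * c ^ n"
        "\<And>n. norm ((Fi ^^ n) (\<psi> (u1, t)) - (Fi ^^ n) (\<psi> (u2, t))) \<le> C' * (1 / b) ^ n"
        using c_growth[OF disc1[OF u(1,2)] u(3,4)] by blast
      \<comment> \<open>Slow growth in both time directions annihilates both functionals, whose
        common kernel is the centre line.\<close>
      then show "H (\<psi> (u1, t)) - H (\<psi> (u2, t)) \<in> span {ec}" using ker FW' BW' by blast
    qed
    show "H ` Wcs x = linfol (ssum (span {ec}) (span {es})) (H x)"
    proof (rule leaf_image[OF Wcs(1) ss dim2 lifts(6,5,1)])
      fix \<psi> :: "(real^2) \<times> real \<Rightarrow> real^3" and t :: real and u1 u2 :: "real^2"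
      assume u: "fol_chart TYPE(real^2) TYPE(real) (\<lambda>p. ssum (Ec p) (Es p)) Wcs \<psi>" "t \<in> ball 0 1" "u1 \<in> ball 0 1" "u2 \<in> ball 0 1"
      obtain C where "\<And>n. norm ((F ^^ n) (\<psi> (u1, t)) - (F ^^ n) (\<psi> (u2, t))) \<le> C * c ^ n"
        using cs_growth[OF disc2[OF u(1,2)] u(3,4)] by blast
      then show "H (\<psi> (u1, t)) - H (\<psi> (u2, t)) \<in> ssum (span {ec}) (span {es})" using ker_d FW' by blast
    qed
    show "H ` Wcu x = linfol (ssum (span {ec}) (span {eu})) (H x)"
    proof (rule leaf_image[OF Wcu(1) ss dim2 lifts(6,5,1)])
      fix \<psi> :: "(real^2) \<times> real \<Rightarrow> real^3" and t :: real and u1 u2 :: "real^2"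
      assume u: "fol_chart TYPE(real^2) TYPE(real) (\<lambda>p. ssum (Ec p) (Eu p)) Wcu \<psi>" "t \<in> ball 0 1" "u1 \<in> ball 0 1" "u2 \<in> ball 0 1"
      obtain C where "\<And>n. norm ((Fi ^^ n) (\<psi> (u1, t)) - (Fi ^^ n) (\<psi> (u2, t))) \<le> C * (1 / b) ^ n"
        using cu_growth[OF disc2[OF u(1,2)] u(3,4)] by blast
      then show "H (\<psi> (u1, t)) - H (\<psi> (u2, t)) \<in> ssum (span {ec}) (span {eu})" using ker_a BW' by blast
    qed
    show "H ` Wus x = linfol (ssum (span {eu}) (span {es})) (H x)"
    proof (rule leaf_image[OF Wus ss dim2 lifts(6,5,1)])
      fix \<psi> :: "(real^2) \<times> real \<Rightarrow> real^3" and t :: real and u1 u2 :: "real^2"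
      assume u: "fol_chart TYPE(real^2) TYPE(real) (\<lambda>p. ssum (Eu p) (Es p)) Wus \<psi>" "t \<in> ball 0 1" "u1 \<in> ball 0 1" "u2 \<in> ball 0 1"
      show "H (\<psi> (u1, t)) - H (\<psi> (u2, t)) \<in> ssum (span {eu}) (span {es})"
        by (rule US[rule_format, OF us_charts[OF u(1)] u(2-4)])
    qed
  qed
  have PHA: "abs_PH A (\<lambda>_. span {es}) (\<lambda>_. span {ec}) (\<lambda>_. span {eu})"
    by (rule abs_PH_linear[OF M(1) e]) (use ker in blast)
  show ?thesis
    by (rule exI[of _ "span {es}"], rule exI[of _ "span {ec}"], rule exI[of _ "span {eu}"])
      (intro conjI allI PHA leaf_projection[OF lifts(2)] leaves)
qed

end
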